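(* Let $\Gamma$ be a finitely generated word hyperbolic group and let $\rho:\Gamma\to\mathsf{G}=\mathsf{SO}_0(n,n)$ be an injective homomorphism which is Anosov with respect to $\mathsf{P}^\pm$ (the stabilizers in $\mathsf{G}$ of the oriented $(n-1)$-dimensional isotropic subspaces $\overrightarrow{W}_\pm$ of $\mathbb{R}^{n,n}$). Then the action of $\rho(\Gamma)$ on $\mathbb{H}^{n,n-1}$ is proper if and only if $\rho$, viewed as a representation into $\mathsf{SL}(2n,\mathbb{R})$, is Anosov with respect to the stabilizer of an $n$-dimensional subspace of $\mathbb{R}^{2n}$.
   Context: Linear setting. Let $n\ge 2$. On $\mathbb{R}^{2n}$ with standard basis $e_1,\dots,e_{2n}$ put $\langle v\mid w\rangle=v^tI_{n,n}w$, $I_{n,n}=\mathrm{diag}(I_n,-I_n)$; this space is denoted $\mathbb{R}^{n,n}$. $\mathsf{G}=\mathsf{SO}_0(n,n)$ is the identity component of $\mathsf{SO}(n,n)$, and $\mathbb{H}^{n,n-1}:=\mathsf{G}e_{2n}\subset\mathbb{R}^{2n}$. Let $W_\pm=\mathrm{span}\{e_j\pm e_{n+j}: 1\le j\le n-1\}$ and let $\overrightarrow{W}_\pm$ be $W_\pm$ oriented by the ordered basis $(e_1\pm e_{n+1},\dots,e_{n-1}\pm e_{2n-1})$. Put $\mathsf{P}^\pm=\mathrm{Stab}_{\mathsf{G}}(\overrightarrow{W}_\pm)$. Gromov flow. $\partial_\infty\Gamma$ is the Gromov boundary, $\partial_\infty\Gamma^{(2)}=\{(p_+,p_-): p_\pm\in\partial_\infty\Gamma,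 p_+\ne p_-\}$, and $\widetilde{\mathsf{U}\Gamma}=\partial_\infty\Gamma^{(2)}\times\mathbb{R}$ with flow $\phi_t(p_+,p_-,p_0)=(p_+,p_-,p_0+t)$. It carries Gromov's proper cocompact $\Gamma$-action, commuting with $\phi$ and inducing the diagonal action on $\partial_\infty\Gamma^{(2)}$, together with a metric (well defined up to H\"older equivalence) for which $\Gamma$ acts by isometries, $\phi_t$ acts by Lipschitz homeomorphisms and flow orbits are quasi-isometric embeddings. For each infinite order $\gamma\in\Gamma$ with attracting and repelling fixed points $\gamma^+,\gamma^-\in\partial_\infty\Gamma$ there is $l(\gamma)>0$ with $\gamma(\gamma^+,\gamma^-,t)=\phi_{l(\gamma)}(\gamma^+,\gamma^-,t)$ for all $t$. Anosov representations. Let $\mathsf{H}$ be a connected semisimple Lie group and $\mathsf{P}_\pm$ a pair of opposite virtually parabolic subgroups: each is a finite index subgroup of a parabolic subgroup, the two parabolic overgroups are opposite, and $\mathsf{P}_+\cap\mathsf{P}_-$ has finite index in the intersection of the overgroups. Let $\mathcal{X}=\{(h\mathsf{P}_+,h\mathsf{P}_-):h\in\mathsf{H}\}\cong\mathsf{H}/(\mathsf{P}_+\cap\mathsf{P}_-)$, which is open in $\mathsf{H}/\mathsf{P}_+\times\mathsf{H}/\mathsf{P}_-$, so its tangent spaces split as direct sums. A homomorphism $\rho:\Gamma\to\mathsf{H}$ is $\mathsf{P}_\pm$-Anosov if: (1) there are continuous, injective, $\rho(\Gamma)$-equivariant maps $\xi^\pm:\partial_\infty\Gamma\to\mathsf{H}/\mathsf{P}_\pm$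 with $\xi(p):=(\xi^+(p_+),\xi^-(p_-))\in\mathcal{X}$ for every $p=(p_+,p_-,t)\in\widetilde{\mathsf{U}\Gamma}$; (2) there are constants $C,c>0$ and a continuous $\rho(\Gamma)$-equivariant family of Euclidean norms $\|\cdot\|_p$ on $T_{\xi(p)}\mathcal{X}$ with $\|v^\pm\|_{\phi_{\mp t}p}\le Ce^{-ct}\|v^\pm\|_p$ for all $v^\pm\in T_{\xi^\pm(p_\pm)}\mathsf{H}/\mathsf{P}_\pm$ and $t\ge 0$. "Anosov in $\mathsf{SL}(2n,\mathbb{R})$ with respect to the stabilizer of an $n$-dimensional subspace" means Anosov with respect to the pair of stabilizers in $\mathsf{SL}(2n,\mathbb{R})$ of two complementary $n$-dimensional subspaces of $\mathbb{R}^{2n}$. *)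

theory Defs
  imports "HOL-Analysis.Analysis" "HOL-Algebra.Group_Action"
    "HOL-Algebra.Multiplicative_Group" "HOL-Algebra.Left_Coset"
begin

section \<open>Word hyperbolic groups and the Gromov boundary\<close>

definition word_length :: "'g monoid \<Rightarrow> 'g set \<Rightarrow> 'g \<Rightarrow> nat" where
  "word_length \<Gamma> S g = (LEAST k. \<exists>ws. length ws = k \<and>
     set ws \<subseteq> S \<union> m_inv \<Gamma> ` S \<and> foldr (mult \<Gamma>) ws \<one>\<^bsub>\<Gamma>\<^esub> = g)"

definition word_dist :: "'g monoid \<Rightarrow> 'g set \<Rightarrow> 'g \<Rightarrow> 'g \<Rightarrow> real" where
  "word_dist \<Gamma> S x y = real (word_length \<Gamma> S (inv\<^bsub>\<Gamma>\<^esub> x \<otimes>\<^bsub>\<Gamma>\<^esub> y))"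

definition gromov_prod :: "'g monoid \<Rightarrow> 'g set \<Rightarrow> 'g \<Rightarrow> 'g \<Rightarrow> 'g \<Rightarrow> real" where
  "gromov_prod \<Gamma> S w x y =
     (word_dist \<Gamma> S x w + word_dist \<Gamma> S y w - word_dist \<Gamma> S x y) / 2"

text \<open>\<open>S\<close> is a finite generating set of \<open>\<Gamma>\<close> whose word metric is Gromov hyperbolic, expressed by
  Gromov's four-point condition. A group is finitely generated and word hyperbolic iff such an
  \<open>S\<close> exists; then every finite generating set qualifies, and the boundary below does not
  depend on the choice.\<close>

definition word_hyperbolic :: "'g monoid \<Rightarrow> 'g set \<Rightarrow> bool" where
  "word_hyperbolic \<Gamma> S \<longleftrightarrow>
     group \<Gamma> \<and> finite S \<and> S \<subseteq> carrier \<Gamma> \<and> generate \<Gamma> S = carrier \<Gamma> \<and>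
     (\<exists>\<delta>. \<forall>w\<in>carrier \<Gamma>. \<forall>x\<in>carrier \<Gamma>. \<forall>y\<in>carrier \<Gamma>. \<forall>z\<in>carrier \<Gamma>.
        min (gromov_prod \<Gamma> S w x y) (gromov_prod \<Gamma> S w y z) - \<delta> \<le> gromov_prod \<Gamma> S w x z)"

text \<open>Boundary points are classes of sequences converging to infinity.\<close>

type_synonym 'g boundary_point = "(nat \<Rightarrow> 'g) set"

definition gromov_asymptotic :: "'g monoid \<Rightarrow> 'g set \<Rightarrow> (nat \<Rightarrow> 'g) \<Rightarrow> (nat \<Rightarrow> 'g) \<Rightarrow> bool" where
  "gromov_asymptotic \<Gamma> S a b \<longleftrightarrow>
     filterlim (\<lambda>(i, j). gromov_prod \<Gamma> S \<one>\<^bsub>\<Gamma>\<^esub> (a i) (b j)) at_top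
       (sequentially \<times>\<^sub>F sequentially)"

definition gromov_seqs :: "'g monoid \<Rightarrow> 'g set \<Rightarrow> (nat \<Rightarrow> 'g) set" where
  "gromov_seqs \<Gamma> S = {a. range a \<subseteq> carrier \<Gamma> \<and> gromov_asymptotic \<Gamma> S a a}"

definition boundary_rel :: "'g monoid \<Rightarrow> 'g set \<Rightarrow> ((nat \<Rightarrow> 'g) \<times> (nat \<Rightarrow> 'g)) set" where
  "boundary_rel \<Gamma> S =
     {(a, b). a \<in> gromov_seqs \<Gamma> S \<and> b \<in> gromov_seqs \<Gamma> S \<and> gromov_asymptotic \<Gamma> S a b}"

definition boundary :: "'g monoid \<Rightarrow> 'g set \<Rightarrow> 'g boundary_point set" where
  "boundary \<Gamma> S = gromov_seqs \<Gamma> S // boundary_rel \<Gamma> S"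

definition boundary_prod :: "'g monoid \<Rightarrow> 'g set \<Rightarrow> 'g boundary_point \<Rightarrow> 'g boundary_point \<Rightarrow> ereal"
  where "boundary_prod \<Gamma> S p q =
     (SUP (a, b) \<in> p \<times> q. Liminf (sequentially \<times>\<^sub>F sequentially)
        (\<lambda>(i, j). ereal (gromov_prod \<Gamma> S \<one>\<^bsub>\<Gamma>\<^esub> (a i) (b j))))"

text \<open>The usual topology: the sets of all \<open>q\<close> with \<open>(p|q) \<ge> r\<close> form a basis of
  (not necessarily open) neighbourhoods of \<open>p\<close>.\<close>

definition boundary_topology :: "'g monoid \<Rightarrow> 'g set \<Rightarrow> 'g boundary_point topology" where
  "boundary_topology \<Gamma> S = topology (\<lambda>U. U \<subseteq> boundary \<Gamma> S \<and>
     (\<forall>p\<in>U. \<exists>r::real. \<forall>q\<in>boundary \<Gamma> S. ereal r \<le> boundary_prod \<Gamma> S p q \<longrightarrow> q \<in> U))"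

lemma openin_boundary_topology:
  "openin (boundary_topology \<Gamma> S) U \<longleftrightarrow> U \<subseteq> boundary \<Gamma> S \<and>
     (\<forall>p\<in>U. \<exists>r::real. \<forall>q\<in>boundary \<Gamma> S. ereal r \<le> boundary_prod \<Gamma> S p q \<longrightarrow> q \<in> U)"
proof -
  have "istopology (\<lambda>U. U \<subseteq> boundary \<Gamma> S \<and>
     (\<forall>p\<in>U. \<exists>r::real. \<forall>q\<in>boundary \<Gamma> S. ereal r \<le> boundary_prod \<Gamma> S p q \<longrightarrow> q \<in> U))"
    (is "istopology ?P")
    unfolding istopology_def
  proof (intro conjI allI impI)
    fix A B assume A: "?P A" and B: "?P B"
    show "A \<inter> B \<subseteq> boundary \<Gamma> S" using A by blast
    show "\<forall>p\<in>A \<inter> B. \<exists>r::real. \<forall>q\<in>boundary \<Gamma> S.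
            ereal r \<le> boundary_prod \<Gamma> S p q \<longrightarrow> q \<in> A \<inter> B"
    proof
      fix p assume "p \<in> A \<inter> B"
      then obtain r s :: real
        where r: "\<forall>q\<in>boundary \<Gamma> S. ereal r \<le> boundary_prod \<Gamma> S p q \<longrightarrow> q \<in> A"
          and s: "\<forall>q\<in>boundary \<Gamma> S. ereal s \<le> boundary_prod \<Gamma> S p q \<longrightarrow> q \<in> B"
        using A B by (meson IntE)
      have "\<forall>q\<in>boundary \<Gamma> S. ereal (max r s) \<le> boundary_prod \<Gamma> S p q \<longrightarrow> q \<in> A \<inter> B"
        using r s by (meson IntI ereal_less_eq(3) max.cobounded1 max.cobounded2 order_trans)
      then show "\<exists>r::real. \<forall>q\<in>boundary \<Gamma> S. ereal r \<le> boundary_prod \<Gamma> S p q \<longrightarrow> q \<in> A \<inter> B"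
        by blast
    qed
  next
    fix \<K> assume K: "\<forall>U\<in>\<K>. ?P U"
    show "\<Union>\<K> \<subseteq> boundary \<Gamma> S" using K by blast
    show "\<forall>p\<in>\<Union>\<K>. \<exists>r::real. \<forall>q\<in>boundary \<Gamma> S.
            ereal r \<le> boundary_prod \<Gamma> S p q \<longrightarrow> q \<in> \<Union>\<K>"
      using K by (meson UnionE UnionI)
  qed
  then show ?thesis
    unfolding boundary_topology_def by (simp add: topology_inverse')
qed

definition boundary_act :: "'g monoid \<Rightarrow> 'g \<Rightarrow> 'g boundary_point \<Rightarrow> 'g boundary_point" where
  "boundary_act \<Gamma> g p = (\<lambda>a i. g \<otimes>\<^bsub>\<Gamma>\<^esub> a i) ` p"

text \<open>The attracting fixed point of an element of infinite order is the limit in the boundary of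
  its positive powers; the repelling one is that of its inverse.\<close>

definition attracting_point :: "'g monoid \<Rightarrow> 'g set \<Rightarrow> 'g \<Rightarrow> 'g boundary_point" where
  "attracting_point \<Gamma> S g = boundary_rel \<Gamma> S `` {\<lambda>k. g [^]\<^bsub>\<Gamma>\<^esub> k}"

definition repelling_point :: "'g monoid \<Rightarrow> 'g set \<Rightarrow> 'g \<Rightarrow> 'g boundary_point" where
  "repelling_point \<Gamma> S g = attracting_point \<Gamma> S (inv\<^bsub>\<Gamma>\<^esub> g)"


section \<open>The Gromov flow\<close>

text \<open>Properness of an action of a discrete group (or set of transformations) \<open>A\<close> on \<open>X\<close>.\<close>

definition proper_action :: "'a set \<Rightarrow> 'x topology \<Rightarrow> ('a \<Rightarrow> 'x \<Rightarrow> 'x) \<Rightarrow> bool" where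
  "proper_action A X act \<longleftrightarrow> (\<forall>K. compactin X K \<longrightarrow> finite {g \<in> A. act g ` K \<inter> K \<noteq> {}})"

type_synonym 'g flow_point = "'g boundary_point \<times> 'g boundary_point \<times> real"

definition flow_space :: "'g monoid \<Rightarrow> 'g set \<Rightarrow> 'g flow_point set" where
  "flow_space \<Gamma> S = {(p, q, t). p \<in> boundary \<Gamma> S \<and> q \<in> boundary \<Gamma> S \<and> p \<noteq> q}"

definition flow_topology :: "'g monoid \<Rightarrow> 'g set \<Rightarrow> 'g flow_point topology" where
  "flow_topology \<Gamma> S =
     subtopology
       (prod_topology (boundary_topology \<Gamma> S) (prod_topology (boundary_topology \<Gamma> S) euclideanreal))
       (flow_space \<Gamma> S)"

fun flow :: "real \<Rightarrow> 'g flow_point \<Rightarrow> 'g flow_point" where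
  "flow t (p, q, s) = (p, q, s + t)"

text \<open>Gromov's action \<open>act\<close> and metric \<open>d\<close> are only determined up to equivalence, so they enter
  as parameters constrained by their characteristic properties.\<close>

locale gromov_flow =
  fixes \<Gamma> :: "'g monoid" and S :: "'g set"
    and act :: "'g \<Rightarrow> 'g flow_point \<Rightarrow> 'g flow_point"
    and d :: "'g flow_point \<Rightarrow> 'g flow_point \<Rightarrow> real"
  assumes act_closed: "\<lbrakk>g \<in> carrier \<Gamma>; x \<in> flow_space \<Gamma> S\<rbrakk> \<Longrightarrow> act g x \<in> flow_space \<Gamma> S"
    and act_one: "x \<in> flow_space \<Gamma> S \<Longrightarrow> act \<one>\<^bsub>\<Gamma>\<^esub> x = x"
    and act_mult: "\<lbrakk>g \<in> carrier \<Gamma>; h \<in> carrier \<Gamma>; x \<in> flow_space \<Gamma> S\<rbrakk>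
          \<Longrightarrow> act (g \<otimes>\<^bsub>\<Gamma>\<^esub> h) x = act g (act h x)"
    and act_flow: "\<lbrakk>g \<in> carrier \<Gamma>; x \<in> flow_space \<Gamma> S\<rbrakk> \<Longrightarrow> act g (flow t x) = flow t (act g x)"
    and act_diagonal: "\<lbrakk>g \<in> carrier \<Gamma>; (p, q, t) \<in> flow_space \<Gamma> S\<rbrakk>
          \<Longrightarrow> \<exists>s. act g (p, q, t) = (boundary_act \<Gamma> g p, boundary_act \<Gamma> g q, s)"
    and act_proper: "proper_action (carrier \<Gamma>) (flow_topology \<Gamma> S) act"
    and act_cocompact: "\<exists>K. compactin (flow_topology \<Gamma> S) K \<and>
          (\<Union>g\<in>carrier \<Gamma>. act g ` K) = flow_space \<Gamma> S"
    and metric: "Metric_space (flow_space \<Gamma> S) d"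
    and metric_topology: "Metric_space.mtopology (flow_space \<Gamma> S) d = flow_topology \<Gamma> S"
    and act_isometry: "\<lbrakk>g \<in> carrier \<Gamma>; x \<in> flow_space \<Gamma> S; y \<in> flow_space \<Gamma> S\<rbrakk>
          \<Longrightarrow> d (act g x) (act g y) = d x y"
    and flow_Lipschitz: "\<exists>L. \<forall>x\<in>flow_space \<Gamma> S. \<forall>y\<in>flow_space \<Gamma> S.
          d (flow t x) (flow t y) \<le> L * d x y"
    and orbit_quasi_isometric: "x \<in> flow_space \<Gamma> S \<Longrightarrow> \<exists>A>0. \<exists>B. \<forall>s t.
          \<bar>s - t\<bar> / A - B \<le> d (flow s x) (flow t x) \<and> d (flow s x) (flow t x) \<le> A * \<bar>s - t\<bar> + B"
    and period: "\<lbrakk>g \<in> carrier \<Gamma>; group.ord \<Gamma> g = 0\<rbrakk> \<Longrightarrow> \<exists>l>0. \<forall>t.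
          act g (attracting_point \<Gamma> S g, repelling_point \<Gamma> S g, t) =
          flow l (attracting_point \<Gamma> S g, repelling_point \<Gamma> S g, t)"


section \<open>Homogeneous spaces of linear groups\<close>

type_synonym 'k matrix = "real^'k^'k"

definition matrix_group :: "'k::finite matrix set \<Rightarrow> 'k matrix monoid" where
  "matrix_group H = \<lparr>carrier = H, mult = (**), one = mat 1\<rparr>"

definition translate :: "'k::finite matrix \<Rightarrow> 'k matrix set \<Rightarrow> 'k matrix set" where
  "translate g x = (\<lambda>m. g ** m) ` x"

text \<open>Quotient topology: the preimage in \<open>H\<close> of a set \<open>U\<close> of cosets is their union.\<close>

definition quotient_space_topology ::
    "'k::finite matrix set \<Rightarrow> 'k matrix set \<Rightarrow> 'k matrix set topology" where
  "quotient_space_topology H P =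
     topology (\<lambda>U. U \<subseteq> lcosets\<^bsub>matrix_group H\<^esub> P \<and> openin (top_of_set H) {h \<in> H. translate h P \<in> U})"

lemma openin_quotient_space_topology:
  "openin (quotient_space_topology H P) U \<longleftrightarrow>
     U \<subseteq> lcosets\<^bsub>matrix_group H\<^esub> P \<and> openin (top_of_set H) {h \<in> H. translate h P \<in> U}"
proof -
  have "istopology (\<lambda>U. U \<subseteq> lcosets\<^bsub>matrix_group H\<^esub> P \<and> openin (top_of_set H) {h \<in> H. translate h P \<in> U})"
    (is "istopology ?P")
    unfolding istopology_def
  proof (intro conjI allI impI)
    fix A B assume A: "?P A" and B: "?P B"
    show "A \<inter> B \<subseteq> lcosets\<^bsub>matrix_group H\<^esub> P" using A by blast
    have "{h \<in> H. translate h P \<in> A \<inter> B} =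
        {h \<in> H. translate h P \<in> A} \<inter> {h \<in> H. translate h P \<in> B}" by auto
    then show "openin (top_of_set H) {h \<in> H. translate h P \<in> A \<inter> B}"
      using A B by (simp add: openin_Int)
  next
    fix \<K> assume K: "\<forall>U\<in>\<K>. ?P U"
    show "\<Union>\<K> \<subseteq> lcosets\<^bsub>matrix_group H\<^esub> P" using K by blast
    have "{h \<in> H. translate h P \<in> \<Union>\<K>} = (\<Union>U\<in>\<K>. {h \<in> H. translate h P \<in> U})" by auto
    then show "openin (top_of_set H) {h \<in> H. translate h P \<in> \<Union>\<K>}"
      using K by (simp add: openin_clauses)
  qed
  then show ?thesis
    unfolding quotient_space_topology_def by (simp add: topology_inverse')
qed

text \<open>The Lie algebra of a closed matrix group, as its tangent space at the identity.\<close>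

definition lie_algebra :: "'k::finite matrix set \<Rightarrow> 'k matrix set" where
  "lie_algebra H = {X. \<exists>c. (\<forall>t. c t \<in> H) \<and> c 0 = mat 1 \<and> (c has_vector_derivative X) (at (0::real))}"

definition Ad :: "'k::finite matrix \<Rightarrow> 'k matrix \<Rightarrow> 'k matrix" where
  "Ad g X = g ** X ** matrix_inv g"

text \<open>The infinitesimal action identifies the tangent space of \<open>H/P\<close> at \<open>x\<close> with the quotient
  of \<open>lie_algebra H\<close> by \<open>isotropy_algebra H x\<close> (for \<open>x = hP\<close> this is \<open>Ad h\<close> of the Lie algebra
  of \<open>P\<close>); the differential of the translation by \<open>g\<close> is then induced by \<open>Ad g\<close>.\<close>

definition isotropy_algebra :: "'k::finite matrix set \<Rightarrow> 'k matrix set \<Rightarrow> 'k matrix set" where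
  "isotropy_algebra H x = lie_algebra (stabilizer (matrix_group H) translate x)"

text \<open>A Euclidean norm on a quotient \<open>V/K\<close> of vector spaces, viewed as a seminorm on \<open>V\<close>
  with null space \<open>K\<close>.\<close>

definition euclidean_norm_mod :: "'v::real_vector set \<Rightarrow> 'v set \<Rightarrow> ('v \<Rightarrow> real) \<Rightarrow> bool" where
  "euclidean_norm_mod V K q \<longleftrightarrow> (\<exists>B::'v \<Rightarrow> 'v \<Rightarrow> real. bilinear B \<and> (\<forall>v w. B v w = B w v) \<and>
     (\<forall>v\<in>V. 0 \<le> B v v \<and> (B v v = 0 \<longleftrightarrow> v \<in> K) \<and> q v = sqrt (B v v)))"


section \<open>Anosov representations\<close>

text \<open>The pair of stabilizers \<open>P\<close>, \<open>Q\<close> plays the role of the pair (P+, P-). The open orbit of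
  \<open>H\<close> in \<open>H/P \<times> H/Q\<close> has tangent space \<open>T H/P \<oplus> T H/Q\<close>, so its norms are seminorms on
  \<open>lie_algebra H \<times> lie_algebra H\<close> vanishing exactly on the product of the isotropy algebras, and
  the two summands consist of the classes of \<open>(X, 0)\<close> and \<open>(0, X)\<close>.

  The definition is used only for closed connected semisimple \<open>H\<close> and opposite virtually
  parabolic \<open>P\<close>, \<open>Q\<close>; these standing assumptions are not repeated in it.\<close>

definition transverse_pairs ::
    "'k::finite matrix set \<Rightarrow> 'k matrix set \<Rightarrow> 'k matrix set \<Rightarrow> ('k matrix set \<times> 'k matrix set) set"
  where "transverse_pairs H P Q = (\<lambda>h. (translate h P, translate h Q)) ` H"

definition equivariant_boundary_map ::
    "'g monoid \<Rightarrow> 'g set \<Rightarrow> 'k::finite matrix set \<Rightarrow> 'k matrix set \<Rightarrow> ('g \<Rightarrow> 'k matrix) \<Rightarrow>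
     ('g boundary_point \<Rightarrow> 'k matrix set) \<Rightarrow> bool" where
  "equivariant_boundary_map \<Gamma> S H P \<rho> \<xi> \<longleftrightarrow>
     continuous_map (boundary_topology \<Gamma> S) (quotient_space_topology H P) \<xi> \<and>
     inj_on \<xi> (boundary \<Gamma> S) \<and>
     (\<forall>g\<in>carrier \<Gamma>. \<forall>p\<in>boundary \<Gamma> S. \<xi> (boundary_act \<Gamma> g p) = translate (\<rho> g) (\<xi> p))"

definition anosov ::
    "'g monoid \<Rightarrow> 'g set \<Rightarrow> ('g \<Rightarrow> 'g flow_point \<Rightarrow> 'g flow_point) \<Rightarrow>
     'k::finite matrix set \<Rightarrow> 'k matrix set \<Rightarrow> 'k matrix set \<Rightarrow> ('g \<Rightarrow> 'k matrix) \<Rightarrow> bool" where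
  "anosov \<Gamma> S act H P Q \<rho> \<longleftrightarrow>
     \<rho> \<in> hom \<Gamma> (matrix_group H) \<and>
     (\<exists>\<xi> \<eta>. equivariant_boundary_map \<Gamma> S H P \<rho> \<xi> \<and> equivariant_boundary_map \<Gamma> S H Q \<rho> \<eta> \<and>
       (\<forall>(p, q, t)\<in>flow_space \<Gamma> S. (\<xi> p, \<eta> q) \<in> transverse_pairs H P Q) \<and>
       (\<exists>C>0. \<exists>c>0. \<exists>N :: 'g flow_point \<Rightarrow> 'k matrix \<times> 'k matrix \<Rightarrow> real.
         (\<forall>(p, q, t)\<in>flow_space \<Gamma> S.
            euclidean_norm_mod (lie_algebra H \<times> lie_algebra H)
              (isotropy_algebra H (\<xi> p) \<times> isotropy_algebra H (\<eta> q)) (N (p, q, t))) \<and>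
         continuous_map
           (prod_topology (flow_topology \<Gamma> S) (top_of_set (lie_algebra H \<times> lie_algebra H)))
           euclideanreal (\<lambda>(x, v). N x v) \<and>
         (\<forall>g\<in>carrier \<Gamma>. \<forall>x\<in>flow_space \<Gamma> S. \<forall>X\<in>lie_algebra H. \<forall>Y\<in>lie_algebra H.
            N (act g x) (Ad (\<rho> g) X, Ad (\<rho> g) Y) = N x (X, Y)) \<and>
         (\<forall>x\<in>flow_space \<Gamma> S. \<forall>t\<ge>0. \<forall>X\<in>lie_algebra H.
            N (flow (- t) x) (X, 0) \<le> C * exp (- c * t) * N x (X, 0) \<and>
            N (flow t x) (0, X) \<le> C * exp (- c * t) * N x (0, X))))"


section \<open>The space \<open>\<real>\<^sup>n\<^sup>,\<^sup>n\<close>\<close>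

text \<open>The coordinates of \<open>\<real>\<^sup>n\<^sup>,\<^sup>n\<close> are indexed by a sum type \<open>'n + 'n\<close> with \<open>n = CARD('n)\<close>, where
  \<open>Inl\<close> gives the positive and \<open>Inr\<close> the negative directions.\<close>

definition I_nn :: "('n::finite + 'n) matrix" where
  "I_nn = (\<chi> i j. if i = j then (case i of Inl _ \<Rightarrow> 1 | Inr _ \<Rightarrow> -1) else 0)"

definition SO_nn :: "('n::finite + 'n) matrix set" where
  "SO_nn = {A. transpose A ** I_nn ** A = I_nn \<and> det A = 1}"

definition SO0_nn :: "('n::finite + 'n) matrix set" where
  "SO0_nn = connected_component_set SO_nn (mat 1)"

definition SL :: "'k::finite matrix set" where
  "SL = {A. det A = 1}"

text \<open>To single out the last index \<open>n\<close>, take \<open>'n = 'm option\<close>: \<open>None\<close> stands for \<open>n\<close> and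
  \<open>Some j\<close> runs over \<open>1, \<dots>, n - 1\<close>. As \<open>'m\<close> is nonempty, \<open>n \<ge> 2\<close> is automatic, and every
  \<open>n \<ge> 2\<close> occurs.\<close>

lemma two_le_card_option: "2 \<le> CARD('m::finite option)"
  using zero_less_card_finite[where 'a='m] by (simp add: Suc_le_eq)

definition pseudo_hyperbolic :: "(real^('m::finite option + 'm option)) set" where
  "pseudo_hyperbolic = (\<lambda>g. g *v axis (Inr None) 1) ` SO0_nn"

definition isotropic_basis :: "real \<Rightarrow> 'm::finite \<Rightarrow> real^('m option + 'm option)" where
  "isotropic_basis s j = axis (Inl (Some j)) 1 + s *\<^sub>R axis (Inr (Some j)) 1"

text \<open>The oriented subspace spanned by an ordered basis, represented by the set of all its
  positively oriented bases.\<close>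

definition oriented_span :: "('i::finite \<Rightarrow> real^'k) \<Rightarrow> ('i \<Rightarrow> real^'k) set" where
  "oriented_span b = {\<lambda>i. \<Sum>j\<in>UNIV. (A $ i $ j) *\<^sub>R b j | A :: real^'i^'i. 0 < det A}"

definition stabilizer_oriented ::
    "'k::finite matrix set \<Rightarrow> ('i \<Rightarrow> real^'k) set \<Rightarrow> 'k matrix set" where
  "stabilizer_oriented H W = stabilizer (matrix_group H) (\<lambda>g W. (\<lambda>b i. g *v b i) ` W) W"

definition stabilizer_subspace :: "'k::finite matrix set \<Rightarrow> (real^'k) set \<Rightarrow> 'k matrix set" where
  "stabilizer_subspace H V = stabilizer (matrix_group H) (\<lambda>g V. (\<lambda>v. g *v v) ` V) V"

definition P_plus :: "('m::finite option + 'm option) matrix set" where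
  "P_plus = stabilizer_oriented SO0_nn (oriented_span (isotropic_basis 1))"

definition P_minus :: "('m::finite option + 'm option) matrix set" where
  "P_minus = stabilizer_oriented SO0_nn (oriented_span (isotropic_basis (- 1)))"

end

(* Summing over the group against a bump function turns the Euclidean norms into an equivariant
   family of norms on the bundle over the flow space. Comparing N on the rank one operators
   e (x) b with the product of the norms of e and b converts the contraction in the definition of
   an Anosov representation into domination of the bundles under the flow; for SO_0(n,n) the same
   works with the operators v (x) w - w (x) v.

   If rho is Anosov in SL(2n) and infinitely many elements return to a compact subset of H^{n,n-1},
   domination yields an n-dimensional subspace contracted along a recurrent sequence. The form is
   preserved, so this subspace is a Lagrangian and it is orthogonal to the limit of the returning
   vectors; hence the limit is isotropic, although vectors of H^{n,n-1} have norm -1.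

   Conversely, the fibre over a point of the flow space splits into two transverse isotropic
   (n-1)-spaces W and Wm and two null lines. Sums of suitable vectors of the two lines lie in H^{n,n-1},
   so properness prevents both lines from keeping bounded size along the flow, and one of them
   is uniformly contracted, the other expanded. W plus the contracted line is a Lagrangian which
   depends only on the forward end point p, continuously, since the sign of the line is locally
   constant. Lagrangians E(p), E(q) of distinct points are transverse: following a recurrent
   orbit, a common vector would be contracted both in forward and in backward time. The pairs
   (E(p), E(q)) give the boundary maps into SL(2n), and Hom(E(p), E(q)) is contracted. *)
theory Submission
  imports Defs "HOL-Library.Diagonal_Subsequence"
begin

section \<open>Word hyperbolic groups and their boundary\<close>

text \<open>The flow is known only through its axioms, so dynamical statements are phrased with
  sequences of group elements and flow times. Distinct elements h of the group yield, after passing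
  to a subsequence, fixed ends p, q such that the flow points over (h p, q) and (p, h^-1 q) both
  converge; h relates the two flow lines up to a time shift, which properness forces to be
  unbounded. The Anosov condition for the oriented flags controls a null line only through products
  with vectors of W. The contracted line is at first attached to a pair (p, q). That its sign
  depends on p alone, and that E(p) and E(q) are transverse, comes from letting the same group
  elements act on several flow lines at once and comparing the times through the norm of one common
  vector. In these arguments a limit of values of eta is found as a subspace only; its orientation
  is recovered from the sign of a Gram determinant. Transversality needs a third boundary point; if
  there is none, p and q are the ends of a periodic orbit.\<close>

locale hyp_group = group \<Gamma> for \<Gamma> :: "'g monoid" (structure) +
  fixes S :: "'g set" and \<delta> :: real
  assumes fin_S: "finite S" and S_sub: "S \<subseteq> carrier \<Gamma>" and gen_S: "generate \<Gamma> S = carrier \<Gamma>"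
    and delta_nonneg: "0 \<le> \<delta>"
    and four_point: "\<lbrakk>w \<in> carrier \<Gamma>; x \<in> carrier \<Gamma>; y \<in> carrier \<Gamma>; z \<in> carrier \<Gamma>\<rbrakk>
      \<Longrightarrow> min (gromov_prod \<Gamma> S w x y) (gromov_prod \<Gamma> S w y z) - \<delta> \<le> gromov_prod \<Gamma> S w x z"

lemma word_hyperbolic_hyp_group:
  assumes "word_hyperbolic \<Gamma> S" obtains \<delta> where "hyp_group \<Gamma> S \<delta>"
proof -
  from assms obtain \<delta> where d: "\<forall>w\<in>carrier \<Gamma>. \<forall>x\<in>carrier \<Gamma>. \<forall>y\<in>carrier \<Gamma>. \<forall>z\<in>carrier \<Gamma>.
        min (gromov_prod \<Gamma> S w x y) (gromov_prod \<Gamma> S w y z) - \<delta> \<le> gromov_prod \<Gamma> S w x z"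
    and g: "group \<Gamma>" and r: "finite S" "S \<subseteq> carrier \<Gamma>" "generate \<Gamma> S = carrier \<Gamma>"
    unfolding word_hyperbolic_def by blast
  interpret group \<Gamma> by (rule g)
  \<comment> \<open>Raising a negative constant to 0 weakens the inequality, and later bounds add
    multiples of \<open>\<delta>\<close>.\<close>
  have "hyp_group \<Gamma> S (max \<delta> 0)"
  proof
    fix w x y z assume "w \<in> carrier \<Gamma>" "x \<in> carrier \<Gamma>" "y \<in> carrier \<Gamma>" "z \<in> carrier \<Gamma>"
    then have "min (gromov_prod \<Gamma> S w x y) (gromov_prod \<Gamma> S w y z) - \<delta> \<le> gromov_prod \<Gamma> S w x z"
      using d by blast
    then show "min (gromov_prod \<Gamma> S w x y) (gromov_prod \<Gamma> S w y z) - max \<delta> 0 \<le> gromov_prod \<Gamma> S w x z"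
      by linarith
  qed (use r in auto)
  then show ?thesis by (rule that)
qed

context hyp_group
begin

abbreviation "G \<equiv> carrier \<Gamma>"
abbreviation "seqs \<equiv> gromov_seqs \<Gamma> S"
abbreviation "asympt \<equiv> gromov_asymptotic \<Gamma> S"
abbreviation "brel \<equiv> boundary_rel \<Gamma> S"
abbreviation "bdry \<equiv> boundary \<Gamma> S"
abbreviation "bdry_top \<equiv> boundary_topology \<Gamma> S"
abbreviation "blim p l \<equiv> limitin bdry_top p l sequentially"
abbreviation "bprod \<equiv> boundary_prod \<Gamma> S"
abbreviation "bact \<equiv> boundary_act \<Gamma>"
abbreviation "att \<equiv> attracting_point \<Gamma> S"
abbreviation "rep \<equiv> repelling_point \<Gamma> S"

section \<open>Words, lengths and geodesics\<close>

abbreviation letters :: "'g set" where "letters \<equiv> S \<union> m_inv \<Gamma> ` S"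
abbreviation eval_word :: "'g list \<Rightarrow> 'g" where "eval_word ws \<equiv> foldr (mult \<Gamma>) ws \<one>"
abbreviation len :: "'g \<Rightarrow> nat" where "len \<equiv> word_length \<Gamma> S"
abbreviation gp :: "'g \<Rightarrow> 'g \<Rightarrow> real" where "gp \<equiv> gromov_prod \<Gamma> S \<one>"

lemma letters_closed: "letters \<subseteq> G"
  using S_sub by auto

lemma eval_closed [simp]: "set ws \<subseteq> letters \<Longrightarrow> eval_word ws \<in> G"
proof (induction ws)
  case (Cons a ws)
  then have "a \<in> G" "eval_word ws \<in> G" using letters_closed by auto
  then show ?case by simp
qed simp

lemma eval_append: "\<lbrakk>set ws \<subseteq> letters; set vs \<subseteq> letters\<rbrakk> \<Longrightarrow>
    eval_word (ws @ vs) = eval_word ws \<otimes> eval_word vs"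
proof (induction ws)
  case Nil
  then show ?case using eval_closed[of vs] by simp
next
  case (Cons a ws)
  then have "a \<in> G" using letters_closed by auto
  moreover have "eval_word ws \<in> G" "eval_word vs \<in> G"
    using Cons.prems eval_closed[of ws] eval_closed[of vs] by auto
  moreover have "eval_word (ws @ vs) = eval_word ws \<otimes> eval_word vs" using Cons by auto
  ultimately show ?case by (simp add: m_assoc)
qed

lemma word_exists: "x \<in> G \<Longrightarrow> \<exists>ws. set ws \<subseteq> letters \<and> eval_word ws = x"
proof -
  assume "x \<in> G"
  then have "x \<in> generate \<Gamma> S" using gen_S by simp
  then show ?thesis
  proof (induction rule: generate.induct)
    case one
    show ?case by (rule exI[of _ "[]"]) simp
  next
    case (incl h)
    then show ?case using S_sub by (intro exI[of _ "[h]"]) auto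
  next
    case (inv h)
    then show ?case using S_sub by (intro exI[of _ "[m_inv \<Gamma> h]"]) auto
  next
    case (eng h1 h2)
    then obtain ws vs where "set ws \<subseteq> letters" "eval_word ws = h1" "set vs \<subseteq> letters" "eval_word vs = h2"
      by blast
    then show ?case using eval_append[of ws vs] by (intro exI[of _ "ws @ vs"]) auto
  qed
qed

lemma geodesic_word:
  assumes "x \<in> G"
  obtains ws where "set ws \<subseteq> letters" "eval_word ws = x" "length ws = len x"
proof -
  have "\<exists>k ws. length ws = k \<and> set ws \<subseteq> letters \<and> eval_word ws = x"
    using word_exists[OF assms] by blast
  from LeastI_ex[OF this] that show ?thesis unfolding word_length_def by blast
qed

lemma len_le: "set ws \<subseteq> letters \<Longrightarrow> len (eval_word ws) \<le> length ws"
  unfolding word_length_def by (rule Least_le) blast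

lemma len_one [simp]: "len \<one> = 0"
  using len_le[of "[]"] by simp

lemma len_mult: "\<lbrakk>x \<in> G; y \<in> G\<rbrakk> \<Longrightarrow> len (x \<otimes> y) \<le> len x + len y"
  by (metis eval_append geodesic_word len_le length_append set_append Un_subset_iff)

lemma letters_inv: "a \<in> letters \<Longrightarrow> inv a \<in> letters"
  using S_sub by auto

lemma len_inv_le: "x \<in> G \<Longrightarrow> len (inv x) \<le> len x"
proof -
  assume "x \<in> G"
  then obtain ws where ws: "set ws \<subseteq> letters" "eval_word ws = x" "length ws = len x"
    by (rule geodesic_word)
  have "set vs \<subseteq> letters \<Longrightarrow> eval_word (rev (map (m_inv \<Gamma>) vs)) = inv (eval_word vs)" for vs
  proof (induction vs)
    case (Cons a vs)
    have a: "a \<in> G" "inv a \<in> letters" using Cons.prems letters_closed letters_inv by auto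
    have "eval_word (rev (map (m_inv \<Gamma>) (a # vs))) = eval_word (rev (map (m_inv \<Gamma>) vs)) \<otimes> eval_word [inv a]"
    proof (unfold list.map rev.simps, rule eval_append)
      have "\<And>b. b \<in> set vs \<Longrightarrow> inv b \<in> letters" using Cons.prems letters_inv by (metis insert_subset list.set(2) subsetD)
      then show "set (rev (map (m_inv \<Gamma>) vs)) \<subseteq> letters" by auto
    qed (use a in simp)
    also have "\<dots> = inv (eval_word vs) \<otimes> inv a" using Cons a by simp
    also have "\<dots> = inv (a \<otimes> eval_word vs)" using a Cons.prems eval_closed[of vs] by (simp add: inv_mult_group)
    finally show ?case by simp
  qed simp
  moreover have "set (rev (map (m_inv \<Gamma>) ws)) \<subseteq> letters" using ws(1) letters_inv by auto
  ultimately show ?thesis using len_le[of "rev (map (m_inv \<Gamma>) ws)"] ws by simp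
qed

lemma len_inv [simp]: "x \<in> G \<Longrightarrow> len (inv x) = len x"
  using len_inv_le[of x] len_inv_le[of "inv x"] by simp

lemma finite_ball: "finite {x \<in> G. len x \<le> n}"
proof -
  have "{x \<in> G. len x \<le> n} \<subseteq> eval_word ` {ws. set ws \<subseteq> letters \<and> length ws \<le> n}"
  proof
    fix x assume "x \<in> {x \<in> G. len x \<le> n}"
    then have "x \<in> G" "len x \<le> n" by auto
    then show "x \<in> eval_word ` {ws. set ws \<subseteq> letters \<and> length ws \<le> n}"
      by (elim geodesic_word) force
  qed
  moreover have "finite (eval_word ` {ws. set ws \<subseteq> letters \<and> length ws \<le> n})"
    using fin_S by (intro finite_imageI finite_lists_length_le) auto
  ultimately show ?thesis by (rule finite_subset)
qed

lemma cancel_left: "\<lbrakk>x \<in> G; y \<in> G\<rbrakk> \<Longrightarrow> x \<otimes> (inv x \<otimes> y) = y"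
  by (simp add: m_assoc[symmetric])

lemma cancel_left': "\<lbrakk>x \<in> G; y \<in> G\<rbrakk> \<Longrightarrow> inv x \<otimes> (x \<otimes> y) = y"
  by (simp add: m_assoc[symmetric])

lemma gp_eq: "\<lbrakk>x \<in> G; y \<in> G\<rbrakk> \<Longrightarrow> gp x y = (real (len x) + len y - len (inv x \<otimes> y)) / 2"
  unfolding gromov_prod_def word_dist_def by simp

lemma inv_mult_inv: "\<lbrakk>x \<in> G; y \<in> G\<rbrakk> \<Longrightarrow> inv (inv x \<otimes> y) = inv y \<otimes> x"
  by (simp add: inv_mult_group)

lemma gp_sym: "\<lbrakk>x \<in> G; y \<in> G\<rbrakk> \<Longrightarrow> gp x y = gp y x"
  using inv_mult_inv[of x y] len_inv[of "inv x \<otimes> y"] by (simp add: gp_eq)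

lemma gp_hyp: "\<lbrakk>x \<in> G; y \<in> G; z \<in> G; a \<le> gp x y; a \<le> gp y z\<rbrakk> \<Longrightarrow> a - \<delta> \<le> gp x z"
  using four_point[of \<one> x y z] by simp

text \<open>Left translation preserves the distance of the two points and lowers each length by at
  most \<open>len z\<close>.\<close>

lemma gp_shift:
  assumes "z \<in> G" "x \<in> G" "y \<in> G"
  shows "gp x y - len z \<le> gp (z \<otimes> x) (z \<otimes> y)"
proof -
  have "inv z \<otimes> (z \<otimes> x) = x" "inv z \<otimes> (z \<otimes> y) = y" using assms by (simp_all add: m_assoc[symmetric])
  then have "len x \<le> len z + len (z \<otimes> x)" "len y \<le> len z + len (z \<otimes> y)"
    using assms len_mult[of "inv z" "z \<otimes> x"] len_mult[of "inv z" "z \<otimes> y"] by auto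
  moreover have "inv (z \<otimes> x) \<otimes> (z \<otimes> y) = inv x \<otimes> y"
    using assms by (simp add: inv_mult_group m_assoc cancel_left')
  moreover have "gp (z \<otimes> x) (z \<otimes> y) = (real (len (z \<otimes> x)) + len (z \<otimes> y) - len (inv (z \<otimes> x) \<otimes> (z \<otimes> y))) / 2"
    using assms by (intro gp_eq) auto
  moreover note gp_eq[OF assms(2,3)]
  ultimately show ?thesis by (simp add: field_simps)
qed

text \<open>In the triangle \<open>\<one>\<close>, \<open>g\<close>, \<open>x\<close> the Gromov
  products at the two ends of the side from \<open>\<one>\<close> to \<open>g\<close> add up to the
  length of that side; translation by \<open>inv g\<close> turns the base point \<open>g\<close>
  into \<open>\<one>\<close>.\<close>

lemma gp_rev:
  assumes "g \<in> G" "x \<in> G"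
  shows "gp (inv g \<otimes> x) (inv g) = len g - gp x g"
proof -
  have "inv (inv g \<otimes> x) \<otimes> inv g = inv x" using assms by (simp add: inv_mult_group m_assoc)
  moreover have "len (inv g \<otimes> x) = len (inv x \<otimes> g)"
    using assms inv_mult_inv[of g x] len_inv[of "inv g \<otimes> x"] by simp
  ultimately show ?thesis using assms by (simp add: gp_eq field_simps)
qed

text \<open>The points are the prefixes of a shortest word. Two prefixes cut the word into three
  pieces, none longer than expected; since the lengths must add up to at least \<open>len g\<close>,
  none is shorter.\<close>

lemma geodesic_segment:
  assumes "g \<in> G"
  obtains c where "\<And>i. c i \<in> G" "c 0 = \<one>" "c (len g) = g"
    "\<And>i j. i \<le> j \<Longrightarrow> j \<le> len g \<Longrightarrow> len (inv (c i) \<otimes> c j) = j - i"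
proof -
  obtain ws where ws: "set ws \<subseteq> letters" "eval_word ws = g" "length ws = len g"
    using assms(1) by (rule geodesic_word)
  define c where "c i = eval_word (take i ws)" for i
  have sub: "set (take n ws) \<subseteq> letters" "set (drop n ws) \<subseteq> letters" "set (take m (drop n ws)) \<subseteq> letters" for n m
    using ws(1) set_take_subset[of n ws] set_drop_subset[of n ws] set_take_subset[of m "drop n ws"] by auto
  have cc: "c i \<in> G" for i unfolding c_def using sub by simp
  have "len (inv (c i) \<otimes> c j) = j - i" if ij: "i \<le> j" "j \<le> len g" for i j
  proof -
    define m z where "m = eval_word (take (j - i) (drop i ws))" and "z = eval_word (drop j ws)"
    have mz: "m \<in> G" "z \<in> G" using sub unfolding m_def z_def by simp_all
    have cj: "c j = c i \<otimes> m" unfolding c_def m_def using eval_append[OF sub(1,3)] ij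
      by (metis le_add_diff_inverse take_add)
    have g: "g = c j \<otimes> z" using eval_append[OF sub(1,2), of j j] ws(2) unfolding c_def z_def by simp
    have "len (c i) \<le> i" "len m \<le> j - i" "len z \<le> len g - j"
      using len_le[OF sub(1)] len_le[OF sub(2)] len_le[OF sub(3)] ws(3) ij
      unfolding c_def z_def m_def by (fastforce intro: order_trans)+
    moreover have "len g \<le> len (c i) + len m + len z"
      using len_mult[OF cc mz(2), of j] len_mult[OF cc mz(1), of i] g cj by simp
    ultimately have "len m = j - i" using ij by simp
    moreover have "inv (c i) \<otimes> c j = m" using cc mz unfolding cj by (simp add: m_assoc[symmetric])
    ultimately show ?thesis by simp
  qed
  moreover have "c 0 = \<one>" "c (len g) = g" unfolding c_def using ws by simp_all
  ultimately show ?thesis using cc that by blast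
qed

text \<open>\<open>gp y g = n\<close> together with \<open>len y = n\<close> says that
  \<open>y\<close> lies on a geodesic from \<open>\<one>\<close> to \<open>g\<close>. Such points
  are the finite approximations of boundary points.\<close>

lemma geodesic_prefix:
  assumes g: "g \<in> G" "n \<le> len g"
  obtains y where "y \<in> G" "len y = n" "gp y g = n"
proof -
  obtain c where c: "\<And>i. c i \<in> G" "c 0 = \<one>" "c (len g) = g" "\<And>i j. i \<le> j \<Longrightarrow> j \<le> len g \<Longrightarrow> len (inv (c i) \<otimes> c j) = j - i"
    by (rule geodesic_segment[OF g(1)]) (rule that)
  have "len (c n) = n" "len (inv (c n) \<otimes> g) = len g - n" using c(1)[of n] c(2,3) c(4)[of 0 n] c(4)[of n "len g"] g by auto
  then show ?thesis using that[of "c n"] c(1) g by (simp add: gp_eq of_nat_diff)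
qed


section \<open>Sequences converging to infinity, the boundary product and the boundary
  topology\<close>

lemma gromov_asymptotic_iff:
  "asympt a b \<longleftrightarrow> (\<forall>N::real. \<exists>n. \<forall>i\<ge>n. \<forall>j\<ge>n. N \<le> gp (a i) (b j))"
  unfolding gromov_asymptotic_def filterlim_at_top
  by (simp add: case_prod_unfold eventually_prod_sequentially) metis

lemma asymptoticD: "asympt a b \<Longrightarrow> \<exists>n. \<forall>i\<ge>n. \<forall>j\<ge>n. N \<le> gp (a i) (b j)"
  unfolding gromov_asymptotic_iff by blast

lemma gp_self [simp]: "x \<in> G \<Longrightarrow> gp x x = len x"
  by (simp add: gp_eq)

lemma gp_one [simp]: "x \<in> G \<Longrightarrow> gp \<one> x = 0"
  by (simp add: gp_eq)

lemma gromov_seqs_closed: "a \<in> seqs \<Longrightarrow> a i \<in> G"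
  unfolding gromov_seqs_def by auto

lemma gromov_seqsD: "a \<in> seqs \<Longrightarrow> \<exists>n. \<forall>i\<ge>n. \<forall>j\<ge>n. N \<le> gp (a i) (a j)"
  unfolding gromov_seqs_def gromov_asymptotic_iff by auto

lemma asymptotic_sym:
  assumes "a \<in> seqs" "b \<in> seqs" "asympt a b"
  shows "asympt b a"
  using assms gp_sym gromov_seqs_closed unfolding gromov_asymptotic_iff by metis

lemma asymptotic_trans:
  assumes abc: "a \<in> seqs" "b \<in> seqs" "c \<in> seqs"
    and ab: "asympt a b" and bc: "asympt b c"
  shows "asympt a c"
  unfolding gromov_asymptotic_iff
proof
  fix N :: real
  obtain n m where n: "\<forall>i\<ge>n. \<forall>j\<ge>n. N + \<delta> \<le> gp (a i) (b j)" and m: "\<forall>i\<ge>m. \<forall>j\<ge>m. N + \<delta> \<le> gp (b i) (c j)"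
    using asymptoticD[OF ab, of "N + \<delta>"] asymptoticD[OF bc, of "N + \<delta>"] by blast
  have "N \<le> gp (a i) (c j)" if "i \<ge> max n m" "j \<ge> max n m" for i j
    using gp_hyp[of "a i" "b (max n m)" "c j" "N + \<delta>"] n m that abc gromov_seqs_closed by auto
  then show "\<exists>n. \<forall>i\<ge>n. \<forall>j\<ge>n. N \<le> gp (a i) (c j)" by blast
qed

lemma equiv_boundary_rel: "equiv seqs brel"
proof (rule equivI)
  show "brel \<subseteq> seqs \<times> seqs" by (auto simp: boundary_rel_def)
  show "refl_on seqs brel"
    by (rule refl_onI) (simp add: boundary_rel_def gromov_seqs_def)
  show "sym brel" by (auto simp: sym_def boundary_rel_def intro: asymptotic_sym)
  show "trans brel" by (auto simp: trans_def boundary_rel_def intro: asymptotic_trans)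
qed

lemma boundary_rep:
  assumes "p \<in> bdry"
  obtains a where "a \<in> p" "a \<in> seqs"
  using assms unfolding boundary_def
  by (metis equiv_boundary_rel equiv_class_self quotientE)

lemma boundary_mem_seqs: "\<lbrakk>p \<in> bdry; a \<in> p\<rbrakk> \<Longrightarrow> a \<in> seqs"
  unfolding boundary_def using equiv_boundary_rel by (meson in_quotient_imp_subset subsetD)

lemma boundary_mem_asymptotic: "\<lbrakk>p \<in> bdry; a \<in> p; b \<in> p\<rbrakk> \<Longrightarrow> asympt a b"
  using in_quotient_imp_in_rel[OF equiv_boundary_rel, of p a b] unfolding boundary_def boundary_rel_def by auto

lemma boundary_class: "a \<in> seqs \<Longrightarrow> brel `` {a} \<in> bdry"
  unfolding boundary_def by (rule quotientI)

lemma boundary_class_self: "a \<in> seqs \<Longrightarrow> a \<in> brel `` {a}"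
  using equiv_boundary_rel by (rule equiv_class_self)

lemma boundary_eqI:
  assumes "p \<in> bdry" "q \<in> bdry" "a \<in> p" "b \<in> q" "asympt a b"
  shows "p = q"
proof (rule quotient_eqI[OF equiv_boundary_rel])
  show "p \<in> seqs // brel" "q \<in> seqs // brel"
    using assms(1,2) unfolding boundary_def .
  show "(a, b) \<in> brel"
    using assms boundary_mem_seqs unfolding boundary_rel_def by blast
qed (use assms in simp_all)

lemma boundary_prod_lower:
  assumes "a \<in> p" "b \<in> q" "\<forall>i\<ge>n. \<forall>j\<ge>n. N \<le> gp (a i) (b j)"
  shows "ereal N \<le> bprod p q"
  unfolding boundary_prod_def
proof (rule SUP_upper2[of "(a, b)"])
  show "(a, b) \<in> p \<times> q" using assms by simp
  show "ereal N \<le> (case (a, b) of (a, b) \<Rightarrow>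
    Liminf (sequentially \<times>\<^sub>F sequentially) (\<lambda>(i, j). ereal (gp (a i) (b j))))"
    unfolding prod.case
  proof (rule Liminf_bounded)
    show "\<forall>\<^sub>F x in sequentially \<times>\<^sub>F sequentially. ereal N \<le> (case x of (i, j) \<Rightarrow> ereal (gp (a i) (b j)))"
      unfolding eventually_prod_sequentially using assms(3) by (intro exI[of _ n]) simp
  qed
qed

lemma gp_chain3:
  assumes "x \<in> G" "y \<in> G" "z \<in> G" "w \<in> G"
    "N \<le> gp x y" "N \<le> gp y z" "N \<le> gp z w"
  shows "N - 2 * \<delta> \<le> gp x w"
  using gp_hyp[OF assms(1-3,5,6)] gp_hyp[of x z w "N - \<delta>"] assms delta_nonneg by auto

text \<open>The supremum runs over all representatives, but any other pair is asymptotic to the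
  given one, and two uses of hyperbolicity carry the bound over at the cost of
  \<open>2 * \<delta>\<close>.\<close>

lemma boundary_prod_upper:
  assumes pq: "p \<in> bdry" "q \<in> bdry" and ab: "a \<in> p" "b \<in> q"
    and bd: "\<forall>i\<ge>n. \<forall>j\<ge>n. gp (a i) (b j) \<le> R"
  shows "bprod p q \<le> ereal (R + 2 * \<delta>)"
  unfolding boundary_prod_def
proof (rule SUP_least, clarify)
  fix a' b' assume "a' \<in> p" "b' \<in> q"
  then have seqs: "a \<in> seqs" "b \<in> seqs" "a' \<in> seqs" "b' \<in> seqs"
    and as: "asympt a a'" "asympt b' b"
    using boundary_mem_seqs boundary_mem_asymptotic pq ab by auto
  define L where "L = Liminf (sequentially \<times>\<^sub>F sequentially) (\<lambda>(i, j). ereal (gp (a' i) (b' j)))"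
  have "\<not> ereal (R + 2 * \<delta>) < L"
  proof
    assume "ereal (R + 2 * \<delta>) < L"
    then obtain N where N: "ereal (R + 2 * \<delta>) < ereal N" "ereal N < L"
      using ereal_dense2 by blast
    have "eventually (\<lambda>x. ereal N < (case x of (i, j) \<Rightarrow> ereal (gp (a' i) (b' j)))) (sequentially \<times>\<^sub>F sequentially)"
      using N(2) unfolding L_def by (rule less_LiminfD)
    then obtain m1 where m1: "\<forall>i\<ge>m1. \<forall>j\<ge>m1. N < gp (a' i) (b' j)"
      unfolding eventually_prod_sequentially by auto
    obtain m2 m3 where m2: "\<forall>i\<ge>m2. \<forall>j\<ge>m2. N \<le> gp (a i) (a' j)" and m3: "\<forall>i\<ge>m3. \<forall>j\<ge>m3. N \<le> gp (b' i) (b j)"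
      using asymptoticD[OF as(1), of N] asymptoticD[OF as(2), of N] by blast
    define m where "m = Max {n, m1, m2, m3}"
    have m: "m \<ge> n" "m \<ge> m1" "m \<ge> m2" "m \<ge> m3" unfolding m_def by auto
    have "N - 2 * \<delta> \<le> gp (a m) (b m)"
      using gp_chain3[of "a m" "a' m" "b' m" "b m" N] seqs gromov_seqs_closed m m1 m2 m3
      by (simp add: less_imp_le)
    then show False using N(1) bd[rule_format, of m m] m by simp
  qed
  then show "L \<le> ereal (R + 2 * \<delta>)" by simp
qed

text \<open>The negation gives only single late pairs with small product. Late terms of each
  sequence have large products with one another, so one such pair bounds all late pairs up to
  \<open>2 * \<delta>\<close>.\<close>

lemma not_asymptotic_bounded:
  assumes seqs: "a \<in> seqs" "b \<in> seqs" and "\<not> asympt a b"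
  shows "\<exists>R n. \<forall>i\<ge>n. \<forall>j\<ge>n. gp (a i) (b j) \<le> R"
proof -
  obtain N where N: "\<And>n. \<exists>i\<ge>n. \<exists>j\<ge>n. gp (a i) (b j) < N"
    using assms(3) unfolding gromov_asymptotic_iff by (simp add: not_le) blast
  obtain n m where n: "\<forall>i\<ge>n. \<forall>j\<ge>n. N + 2 * \<delta> \<le> gp (a i) (a j)" and m: "\<forall>i\<ge>m. \<forall>j\<ge>m. N + 2 * \<delta> \<le> gp (b i) (b j)"
    using gromov_seqsD[OF seqs(1), of "N + 2 * \<delta>"] gromov_seqsD[OF seqs(2), of "N + 2 * \<delta>"] by blast
  obtain i' j' where ij': "i' \<ge> max n m" "j' \<ge> max n m" "gp (a i') (b j') < N" using N by blast
  have "gp (a i) (b j) \<le> N + 2 * \<delta>" if "i \<ge> max n m" "j \<ge> max n m" for i j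
  proof (rule ccontr)
    assume "\<not> gp (a i) (b j) \<le> N + 2 * \<delta>"
    moreover have "N + 2 * \<delta> \<le> gp (a i') (a i)" "N + 2 * \<delta> \<le> gp (b j) (b j')" using n m ij' that by auto
    ultimately have "N + 2 * \<delta> - 2 * \<delta> \<le> gp (a i') (b j')"
      using seqs gromov_seqs_closed by (intro gp_chain3[of "a i'" "a i" "b j" "b j'"]) auto
    then show False using ij' by simp
  qed
  then show ?thesis by blast
qed

lemma boundary_prod_finite:
  assumes "p \<in> bdry" "q \<in> bdry" "p \<noteq> q"
  obtains R where "bprod p q \<le> ereal R"
proof -
  obtain a b where ab: "a \<in> p" "b \<in> q" using assms boundary_rep by metis
  then have "\<not> asympt a b" using boundary_eqI assms by blast
  then obtain R n where "\<forall>i\<ge>n. \<forall>j\<ge>n. gp (a i) (b j) \<le> R"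
    using not_asymptotic_bounded ab assms boundary_mem_seqs by metis
  from boundary_prod_upper[OF assms(1,2) ab this] that show ?thesis by blast
qed

lemma topspace_boundary [simp]: "topspace bdry_top = bdry"
proof
  show "topspace bdry_top \<subseteq> bdry"
    using openin_topspace[of "bdry_top"] unfolding openin_boundary_topology by blast
  have "openin bdry_top bdry" unfolding openin_boundary_topology by auto
  then show "bdry \<subseteq> topspace bdry_top" by (rule openin_subset)
qed

text \<open>Serves to keep pairs of ends distinct in limits: a sequence converging to a point other
  than \<open>q\<close> eventually avoids \<open>q\<close>.\<close>

lemma openin_boundary_minus_point:
  assumes "q \<in> bdry"
  shows "openin bdry_top (bdry - {q})"
  unfolding openin_boundary_topology
proof (intro conjI ballI)
  fix p assume p: "p \<in> bdry - {q}"
  then obtain R where R: "bprod p q \<le> ereal R" using boundary_prod_finite assms by blast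
  then have "\<forall>q'\<in>bdry. ereal (R + 1) \<le> bprod p q' \<longrightarrow> q' \<in> bdry - {q}"
    by (auto dest: order_trans[of "ereal (R + 1)" _ "ereal R"])
  then show "\<exists>r::real. \<forall>q'\<in>bdry. ereal r \<le> bprod p q' \<longrightarrow> q' \<in> bdry - {q}" by blast
qed auto

lemma limitin_boundary:
  assumes "c \<in> bdry" "\<And>k. P k \<in> bdry" "\<And>N::nat. \<exists>k0. \<forall>k\<ge>k0. ereal N \<le> bprod c (P k)"
  shows "blim P c"
  unfolding limitin_sequentially
proof (intro conjI allI impI)
  show "c \<in> topspace bdry_top" using assms(1) by simp
  fix U assume "openin bdry_top U \<and> c \<in> U"
  then obtain r :: real where r: "\<forall>q\<in>bdry. ereal r \<le> bprod c q \<longrightarrow> q \<in> U"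
    unfolding openin_boundary_topology by blast
  obtain N :: nat where "r \<le> N" using real_arch_simple by blast
  moreover obtain k0 where "\<forall>k\<ge>k0. ereal N \<le> bprod c (P k)" using assms(3) by blast
  ultimately have "\<forall>k\<ge>k0. P k \<in> U" using r assms(2) by (meson ereal_less_eq(3) order_trans)
  then show "\<exists>k0. \<forall>k\<ge>k0. P k \<in> U" by blast
qed


text \<open>Each \<open>P k\<close> is approximated by group elements of every length
  \<open>n\<close>. There are finitely many of each length, so along a diagonal subsequence all
  approximations become eventually constant, and these constants form a sequence converging to the
  limit point.\<close>

lemma boundary_seq_compact:
  assumes P: "\<And>k. P k \<in> bdry"
  obtains c r where "c \<in> bdry" "strict_mono (r :: nat \<Rightarrow> nat)"
    "\<And>N::nat. \<exists>k0. \<forall>k\<ge>k0. ereal N \<le> bprod c (P (r k))"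
proof -
  have "\<exists>s. s \<in> P k \<and> s \<in> seqs" for k using boundary_rep[OF P] by metis
  then obtain s where s: "\<And>k. s k \<in> P k" "\<And>k. s k \<in> seqs" by metis
  have sc: "s k i \<in> G" for k i using s gromov_seqs_closed by blast
  \<comment> \<open>\<open>y\<close> is the prefix of length \<open>n\<close> of one late term of
    the representative; all later terms agree with it up to \<open>\<delta>\<close>.\<close>
  have "\<exists>y. y \<in> G \<and> len y = n \<and> (\<exists>m. \<forall>j\<ge>m. real n - \<delta> \<le> gp y (s k j))" for k n
  proof -
    obtain m where m: "\<forall>i\<ge>m. \<forall>j\<ge>m. real n \<le> gp (s k i) (s k j)" using gromov_seqsD[OF s(2)] by blast
    then have "real n \<le> gp (s k m) (s k m)" by blast
    then have "n \<le> len (s k m)" using sc by simp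
    then obtain y where y: "y \<in> G" "len y = n" "gp y (s k m) = n"
      using geodesic_prefix sc by blast
    have "real n - \<delta> \<le> gp y (s k j)" if "j \<ge> m" for j
      by (rule gp_hyp[of y "s k m"]) (use y m that sc in auto)
    then show ?thesis using y by blast
  qed
  then have "\<forall>k n. \<exists>y. y \<in> G \<and> len y = n \<and> (\<exists>m. \<forall>j\<ge>m. real n - \<delta> \<le> gp y (s k j))" by blast
  then have "\<exists>y. \<forall>k n. y k n \<in> G \<and> len (y k n) = n \<and> (\<exists>m. \<forall>j\<ge>m. real n - \<delta> \<le> gp (y k n) (s k j))"
    unfolding choice_iff .
  then obtain y where y: "\<And>k n. y k n \<in> G" "\<And>k n. len (y k n) = n"
    "\<And>k n. \<exists>m. \<forall>j\<ge>m. real n - \<delta> \<le> gp (y k n) (s k j)" by blast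
  define Q where "Q n r = (\<exists>z. \<forall>k. y (r k) n = z)" for n and r :: "nat \<Rightarrow> nat"
  interpret subseqs Q
  proof
    fix n and r :: "nat \<Rightarrow> nat"
    have "finite ((\<lambda>k. y (r k) n) ` UNIV)"
      by (rule finite_subset[OF _ finite_ball[of n]]) (use y in auto)
    from pigeonhole_infinite[OF infinite_UNIV_nat this]
    obtain k0 where inf: "infinite {k. y (r k) n = y (r k0) n}" by auto
    define f where "f = enumerate {k. y (r k) n = y (r k0) n}"
    have "strict_mono f" unfolding f_def using inf by (rule strict_mono_enumerate)
    moreover have "y (r (f k)) n = y (r k0) n" for k
      using enumerate_in_set[OF inf, of k] unfolding f_def by simp
    ultimately show "\<exists>f. strict_mono f \<and> Q n (r \<circ> f)" unfolding Q_def by auto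
  qed
  have "Q n (diagseq \<circ> ((+) (Suc n)))" for n
    by (rule diagseq_holds) (auto simp: Q_def)
  then obtain z where z: "\<And>n k. y (diagseq (Suc n + k)) n = z n"
    unfolding Q_def by (metis comp_apply)
  have z': "y (diagseq k) n = z n" if "n < k" for n k
    using z[of n "k - Suc n"] that by simp
  have zc: "z n \<in> G" for n using y(1) z[of n 0] by metis
  have zs: "\<exists>m. \<forall>j\<ge>m. real n - \<delta> \<le> gp (z n) (s (diagseq k) j)" if "n < k" for n k
    using y(3)[of n "diagseq k"] z'[OF that] by simp
  have zz: "real (min n m) - 2 * \<delta> \<le> gp (z n) (z m)" for n m
  proof -
    define k where "k = Suc (max n m)"
    have nk: "n < k" "m < k" unfolding k_def by auto
    obtain a b where a: "\<forall>j\<ge>a. real n - \<delta> \<le> gp (z n) (s (diagseq k) j)"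
      and b: "\<forall>j\<ge>b. real m - \<delta> \<le> gp (z m) (s (diagseq k) j)"
      using zs[OF nk(1)] zs[OF nk(2)] by blast
    have "real (min n m) - \<delta> - \<delta> \<le> gp (z n) (z m)"
    proof (rule gp_hyp)
      show "real (min n m) - \<delta> \<le> gp (z n) (s (diagseq k) (max a b))" using a[rule_format, of "max a b"] by auto
      show "real (min n m) - \<delta> \<le> gp (s (diagseq k) (max a b)) (z m)"
        using b[rule_format, of "max a b"] gp_sym[OF zc sc] by auto
    qed (use zc sc in auto)
    then show ?thesis by simp
  qed
  have zseq: "z \<in> seqs"
    unfolding gromov_seqs_def
  proof (intro CollectI conjI)
    show "range z \<subseteq> G" using zc by auto
    show "asympt z z"
      unfolding gromov_asymptotic_iff
    proof
      fix N :: real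
      obtain n :: nat where n: "N + 2 * \<delta> \<le> n" using real_arch_simple by blast
      have "N \<le> gp (z i) (z j)" if "i \<ge> n" "j \<ge> n" for i j
      proof -
        have "n \<le> min i j" using that by simp
        then have "real n \<le> real (min i j)" by (rule of_nat_mono)
        then show ?thesis using n zz[of i j] by linarith
      qed
      then show "\<exists>n. \<forall>i\<ge>n. \<forall>j\<ge>n. N \<le> gp (z i) (z j)" by blast
    qed
  qed
  define c where "c = brel `` {z}"
  have c: "c \<in> bdry" "z \<in> c" unfolding c_def using zseq boundary_class boundary_class_self by auto
  have "\<exists>k0. \<forall>k\<ge>k0. ereal N \<le> bprod c (P (diagseq k))" for N :: nat
  proof -
    \<comment> \<open>Going from \<open>z i\<close> to \<open>z n\<close> costs
      \<open>2 * \<delta>\<close>, and joining this with the representative of the boundary point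
      costs one more \<open>\<delta>\<close>.\<close>
    obtain n :: nat where n: "real N + 3 * \<delta> \<le> n" using real_arch_simple by blast
    have "ereal N \<le> bprod c (P (diagseq k))" if k: "k > n" for k
    proof -
      obtain m where m: "\<forall>j\<ge>m. real n - \<delta> \<le> gp (z n) (s (diagseq k) j)" using zs[OF k] by blast
      have "real N \<le> gp (z i) (s (diagseq k) j)" if "i \<ge> max n m" "j \<ge> max n m" for i j
      proof -
        have "real N + \<delta> \<le> gp (z i) (z n)" using zz[of i n] n that by (simp add: min_def split: if_splits)
        moreover have "real N + \<delta> \<le> gp (z n) (s (diagseq k) j)" using m[rule_format, of j] n that delta_nonneg by auto
        ultimately show ?thesis using gp_hyp[of "z i" "z n" "s (diagseq k) j" "real N + \<delta>"] zc sc by auto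
      qed
      then show ?thesis using boundary_prod_lower[OF c(2) s(1)] by blast
    qed
    then show ?thesis by (intro exI[of _ "Suc n"]) simp
  qed
  with c(1) subseq_diagseq show ?thesis by (rule that)
qed

lemma asymptotic_shift:
  assumes "g \<in> G" "\<And>i. a i \<in> G" "\<And>i. b i \<in> G" "asympt a b"
  shows "asympt (\<lambda>i. g \<otimes> a i) (\<lambda>i. g \<otimes> b i)"
  unfolding gromov_asymptotic_iff
proof
  fix N :: real
  obtain n where n: "\<forall>i\<ge>n. \<forall>j\<ge>n. N + len g \<le> gp (a i) (b j)" using asymptoticD[OF assms(4)] by blast
  have "N \<le> gp (g \<otimes> a i) (g \<otimes> b j)" if "i \<ge> n" "j \<ge> n" for i j
    using gp_shift[OF assms(1) assms(2)[of i] assms(3)[of j]] n[rule_format, OF that] by simp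
  then show "\<exists>n. \<forall>i\<ge>n. \<forall>j\<ge>n. N \<le> gp (g \<otimes> a i) (g \<otimes> b j)" by blast
qed

lemma seqs_shift: "\<lbrakk>g \<in> G; a \<in> seqs\<rbrakk> \<Longrightarrow> (\<lambda>i. g \<otimes> a i) \<in> seqs"
  using asymptotic_shift[of g a a] gromov_seqs_closed unfolding gromov_seqs_def by auto

lemma boundary_act_class:
  assumes g: "g \<in> G" and a: "a \<in> seqs"
  shows "bact g (brel `` {a}) = brel `` {\<lambda>i. g \<otimes> a i}"
proof (rule Set.set_eqI, rule iffI)
  fix x assume "x \<in> bact g (brel `` {a})"
  then obtain b where b: "x = (\<lambda>i. g \<otimes> b i)" "b \<in> seqs" "asympt a b"
    unfolding boundary_act_def boundary_rel_def by auto
  then show "x \<in> brel `` {\<lambda>i. g \<otimes> a i}"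
    using seqs_shift[OF g a] seqs_shift[OF g b(2)] asymptotic_shift[OF g gromov_seqs_closed[OF a] gromov_seqs_closed[OF b(2)] b(3)]
    unfolding boundary_rel_def by auto
next
  fix x assume "x \<in> brel `` {\<lambda>i. g \<otimes> a i}"
  then have x: "x \<in> seqs" "asympt (\<lambda>i. g \<otimes> a i) x"
    unfolding boundary_rel_def by auto
  have xc: "x i \<in> G" and ac: "a i \<in> G" for i using x(1) a gromov_seqs_closed by auto
  define b where "b i = inv g \<otimes> x i" for i
  have "b \<in> seqs" unfolding b_def using seqs_shift[of "inv g" x] g x by simp
  moreover have "asympt a b"
    using asymptotic_shift[of "inv g" "\<lambda>i. g \<otimes> a i" x] g ac xc x(2) unfolding b_def by (simp add: cancel_left')
  moreover have "x = (\<lambda>i. g \<otimes> b i)" unfolding b_def using g xc by (simp add: cancel_left)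
  ultimately show "x \<in> bact g (brel `` {a})"
    using a unfolding boundary_act_def boundary_rel_def by auto
qed

lemma boundary_act_closed: "\<lbrakk>g \<in> G; p \<in> bdry\<rbrakk> \<Longrightarrow> bact g p \<in> bdry"
  by (metis boundary_act_class boundary_class boundary_def quotientE seqs_shift)

lemma boundary_act_mem: "a \<in> p \<Longrightarrow> (\<lambda>i. g \<otimes> a i) \<in> bact g p"
  unfolding boundary_act_def by auto

lemma boundary_act_inv:
  assumes "g \<in> G" "p \<in> bdry"
  shows "bact (inv g) (bact g p) = p"
proof -
  have "(\<lambda>i. inv g \<otimes> (g \<otimes> a i)) = a" if "a \<in> p" for a
    using that assms boundary_mem_seqs gromov_seqs_closed by (simp add: cancel_left')
  then show ?thesis unfolding boundary_act_def image_image by simp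
qed


section \<open>Loxodromic elements and their fixed points\<close>

lemma inv_nat_pow: "g \<in> G \<Longrightarrow> inv (g [^] (n::nat)) = inv g [^] n"
  by (simp add: nat_pow_inv)

text \<open>A local criterion for translation along a quasi-geodesic: the path through
  \<open>inv g\<close>, \<open>\<one>\<close>, \<open>g\<close> backtracks little compared with its
  step length. The margin \<open>8 * \<delta> + 1\<close> covers the later demands
  \<open>len g - 3 * \<delta> > 4 * \<delta>\<close> and
  \<open>len g - 6 * \<delta> \<ge> 1\<close>.\<close>

definition loxodromic :: "'g \<Rightarrow> bool" where
  "loxodromic g \<longleftrightarrow> g \<in> G \<and> gp (inv g) g \<le> 2 * \<delta> \<and> 8 * \<delta> + 1 \<le> len g"

lemma loxodromic_inv: "loxodromic g \<Longrightarrow> loxodromic (inv g)"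
  unfolding loxodromic_def using gp_sym[of g "inv g"] by simp

text \<open>Induction along the orbit: by \<open>gp_rev\<close> the next negative power follows
  \<open>inv g\<close> for length \<open>len g - 3 * \<delta>\<close>. If it also followed
  \<open>g\<close> beyond \<open>3 * \<delta>\<close>, hyperbolicity would push
  \<open>gp (inv g) g\<close> above \<open>2 * \<delta>\<close>.\<close>

lemma loxodromic_chain:
  assumes "loxodromic g"
  shows "gp (inv g [^] Suc n) g \<le> 3 * \<delta>"
proof (induction n)
  case 0
  then show ?case using assms delta_nonneg unfolding loxodromic_def by simp
next
  case (Suc n)
  have g: "g \<in> G" "gp (inv g) g \<le> 2 * \<delta>" "8 * \<delta> + 1 \<le> len g"
    using assms unfolding loxodromic_def by auto
  define a where "a = inv g [^] Suc n"
  have a: "a \<in> G" unfolding a_def using g by simp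
  have eq: "inv g [^] Suc (Suc n) = inv g \<otimes> a"
    unfolding a_def using g nat_pow_Suc2[of "inv g" "Suc n"] by simp
  have "gp (inv g \<otimes> a) (inv g) = len g - gp a g" by (rule gp_rev[OF g(1) a])
  then have far: "len g - 3 * \<delta> \<le> gp (inv g \<otimes> a) (inv g)" using Suc unfolding a_def by linarith
  show ?case
  proof (rule ccontr)
    assume "\<not> gp (inv g [^] Suc (Suc n)) g \<le> 3 * \<delta>"
    then have gt: "3 * \<delta> < gp (inv g \<otimes> a) g" unfolding eq by simp
    define m where "m = min (gp (inv g \<otimes> a) g) (len g - 3 * \<delta>)"
    have "m - \<delta> \<le> gp (inv g) g"
      by (rule gp_hyp[of "inv g" "inv g \<otimes> a" g])
        (use g a far gp_sym[of "inv g" "inv g \<otimes> a"] in \<open>auto simp: m_def\<close>)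
    moreover have "m > 3 * \<delta>" using gt g delta_nonneg unfolding m_def by auto
    ultimately show False using g by linarith
  qed
qed

lemma loxodromic_chain': 
  assumes "loxodromic g"
  shows "gp (g [^] (n::nat)) (inv g) \<le> 3 * \<delta>"
proof (cases n)
  case 0
  then show ?thesis using assms delta_nonneg unfolding loxodromic_def by simp
next
  case (Suc m)
  then show ?thesis using loxodromic_chain[OF loxodromic_inv[OF assms], of m] assms unfolding loxodromic_def by simp
qed

text \<open>Each further factor adds \<open>len g\<close> and loses at most
  \<open>6 * \<delta>\<close> to backtracking.\<close>

lemma loxodromic_len:
  assumes "loxodromic g"
  shows "n \<le> len (g [^] n)"
proof (induction n)
  case (Suc n)
  have g: "g \<in> G" "8 * \<delta> + 1 \<le> len g" using assms unfolding loxodromic_def by auto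
  have "gp (inv g [^] n) g \<le> 3 * \<delta>"
    using loxodromic_chain'[OF loxodromic_inv[OF assms], of n] g by simp
  moreover have "inv (inv g [^] n) = g [^] n" using g inv_nat_pow[of "inv g" n] by simp
  moreover have "len (inv g [^] n) = len (g [^] n)" using g inv_nat_pow[of g n] len_inv[of "g [^] n"] by simp
  ultimately have "real (len (g [^] n)) + len g - 6 * \<delta> \<le> len (g [^] Suc n)"
    using g gp_eq[of "inv g [^] n" g] by (simp add: field_simps)
  then have "real (Suc n) \<le> len (g [^] Suc n)" using Suc g delta_nonneg by simp
  then show ?case by simp
qed simp

text \<open>A positive power follows \<open>g\<close> for length
  \<open>len g - 3 * \<delta>\<close>, whereas a negative power leaves \<open>g\<close> after at
  most \<open>3 * \<delta>\<close>.\<close>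

lemma loxodromic_opposite:
  assumes "loxodromic g"
  shows "gp (inv g [^] (m::nat)) (g [^] (k::nat)) \<le> 4 * \<delta>"
proof (cases m)
  case 0
  then show ?thesis using assms delta_nonneg unfolding loxodromic_def by simp
next
  case m: (Suc m')
  have g: "g \<in> G" "gp (inv g) g \<le> 2 * \<delta>" "8 * \<delta> + 1 \<le> len g"
    using assms unfolding loxodromic_def by auto
  show ?thesis
  proof (cases k)
    case 0
    then show ?thesis using g delta_nonneg gp_sym[of "inv g [^] m" \<one>] by simp
  next
    case (Suc k')
    have "gp (g \<otimes> g [^] k') g = len g - gp (g [^] k') (inv g)"
      using gp_rev[of "inv g" "g [^] k'"] g by simp
    moreover have "g \<otimes> g [^] k' = g [^] k" using Suc g nat_pow_Suc2[of g k'] by simp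
    ultimately have far: "len g - 3 * \<delta> \<le> gp (g [^] k) g"
      using loxodromic_chain'[OF assms, of k'] by simp
    show ?thesis
    proof (rule ccontr)
      assume gt: "\<not> gp (inv g [^] m) (g [^] k) \<le> 4 * \<delta>"
      define a where "a = min (gp (inv g [^] m) (g [^] k)) (len g - 3 * \<delta>)"
      have "a - \<delta> \<le> gp (inv g [^] m) g"
        by (rule gp_hyp[of "inv g [^] m" "g [^] k" g]) (use g far in \<open>auto simp: a_def\<close>)
      moreover have "a > 4 * \<delta>" using gt g delta_nonneg unfolding a_def by auto
      moreover have "gp (inv g [^] m) g \<le> 3 * \<delta>" using loxodromic_chain[OF assms, of m'] m by simp
      ultimately show False by linarith
    qed
  qed
qed

text \<open>Translating \<open>g [^] m\<close> to \<open>\<one>\<close> turns \<open>\<one>\<close>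
  and \<open>g [^] n\<close> into \<open>inv g [^] m\<close> and \<open>g [^] (n - m)\<close>, which
  are nearly opposite; so \<open>g [^] n\<close> follows almost all of
  \<open>g [^] m\<close>.\<close>

lemma loxodromic_gp:
  assumes "loxodromic g" "m \<le> n"
  shows "real m - 4 * \<delta> \<le> gp (g [^] m) (g [^] n)"
proof -
  have g: "g \<in> G" using assms unfolding loxodromic_def by auto
  have split: "g [^] n = g [^] m \<otimes> g [^] (n - m)" using g assms(2) nat_pow_mult[of g m "n - m"] by simp
  have "gp (inv (g [^] m) \<otimes> g [^] n) (inv (g [^] m)) = len (g [^] m) - gp (g [^] n) (g [^] m)"
    using gp_rev[of "g [^] m" "g [^] n"] g by simp
  moreover have "inv (g [^] m) \<otimes> g [^] n = g [^] (n - m)"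
    unfolding split using g by (simp add: cancel_left')
  moreover have "gp (g [^] (n - m)) (inv g [^] m) \<le> 4 * \<delta>"
    using loxodromic_opposite[OF assms(1), of m "n - m"] g gp_sym by simp
  ultimately show ?thesis
    using loxodromic_len[OF assms(1), of m] g gp_sym[of "g [^] n" "g [^] m"] inv_nat_pow[of g m] by simp
qed

lemma loxodromic_seq: 
  assumes "loxodromic g"
  shows "(\<lambda>k::nat. g [^] k) \<in> seqs"
  unfolding gromov_seqs_def
proof (intro CollectI conjI)
  have g: "g \<in> G" using assms unfolding loxodromic_def by auto
  then show "range (\<lambda>k::nat. g [^] k) \<subseteq> G" by auto
  show "asympt (\<lambda>k::nat. g [^] k) (\<lambda>k::nat. g [^] k)"
    unfolding gromov_asymptotic_iff
  proof
    fix N :: real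
    obtain n :: nat where n: "N + 4 * \<delta> \<le> n" using real_arch_simple by blast
    have "N \<le> gp (g [^] i) (g [^] j)" if "i \<ge> n" "j \<ge> n" for i j
    proof (cases "i \<le> j")
      case True
      then show ?thesis using loxodromic_gp[OF assms True] n that by simp
    next
      case False
      then show ?thesis using loxodromic_gp[OF assms, of j i] n that gp_sym[of "g [^] i" "g [^] j"] g by simp
    qed
    then show "\<exists>n. \<forall>i\<ge>n. \<forall>j\<ge>n. N \<le> gp (g [^] (i::nat)) (g [^] (j::nat))" by blast
  qed
qed

lemma loxodromic_boundary:
  assumes "loxodromic g"
  shows "group.ord \<Gamma> g = 0" "att g \<in> bdry" "rep g \<in> bdry"
    "att g \<noteq> rep g"
    "(\<lambda>k::nat. g [^] k) \<in> att g" "(\<lambda>k::nat. inv g [^] k) \<in> rep g"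
proof -
  have g: "g \<in> G" using assms unfolding loxodromic_def by auto
  show "group.ord \<Gamma> g = 0"
  proof (rule ccontr)
    assume "ord g \<noteq> 0"
    then have "0 < ord g" by simp
    moreover have "g [^] ord g = \<one>" using pow_eq_id[OF g] by simp
    ultimately show False using loxodromic_len[OF assms, of "ord g"] by simp
  qed
  note s = loxodromic_seq[OF assms] loxodromic_seq[OF loxodromic_inv[OF assms]]
  show b: "att g \<in> bdry" "rep g \<in> bdry"
    unfolding attracting_point_def repelling_point_def using s boundary_class by auto
  show m: "(\<lambda>k::nat. g [^] k) \<in> att g" "(\<lambda>k::nat. inv g [^] k) \<in> rep g"
    unfolding attracting_point_def repelling_point_def using s boundary_class_self by auto
  show "att g \<noteq> rep g"
  proof
    assume "att g = rep g"
    then have "asympt (\<lambda>k::nat. inv g [^] k) (\<lambda>k::nat. g [^] k)"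
      using boundary_mem_asymptotic[OF b(2)] m by auto
    then obtain n where "\<forall>i\<ge>n. \<forall>j\<ge>n. 4 * \<delta> + 1 \<le> gp (inv g [^] (i::nat)) (g [^] (j::nat))"
      using asymptoticD by blast
    then have "4 * \<delta> + 1 \<le> gp (inv g [^] n) (g [^] n)" by blast
    then show False using loxodromic_opposite[OF assms, of n n] by simp
  qed
qed

text \<open>By pigeonhole a long geodesic passes two well separated points with the same germ of radius
  larger than \<open>2\<delta>\<close>; the element translating one to the other is then a local geodesic translation.\<close>

lemma loxodromic_exists:
  assumes inf: "infinite G"
  obtains g where "loxodromic g"
proof -
  \<comment> \<open>\<open>R\<close> exceeds \<open>2 * \<delta>\<close>, so that equal germs of
    radius \<open>R\<close> exclude backtracking. The spacing \<open>D\<close> makes the translation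
    long enough and keeps the inner germs within the segment between two base points.\<close>
  define R :: nat where "R = nat \<lceil>2 * \<delta>\<rceil> + 1"
  define D :: nat where "D = nat \<lceil>8 * \<delta>\<rceil> + 1 + R"
  have R: "2 * \<delta> < R" and D: "8 * \<delta> + 1 \<le> D" "R \<le> D" unfolding R_def D_def using delta_nonneg by linarith+
  define B where "B = {x \<in> G. len x \<le> R}"
  define M where "M = card (B \<times> B)"
  have finB: "finite (B \<times> B)" unfolding B_def using finite_ball by simp
  define L where "L = 2 * R + M * D"
  obtain h where h: "h \<in> G" "L \<le> len h"
    using inf finite_ball[of L] by (metis (mono_tags, lifting) finite_subset mem_Collect_eq nat_le_linear subsetI)
  obtain c where c: "\<And>i. c i \<in> G"
    "\<And>i j. i \<le> j \<Longrightarrow> j \<le> len h \<Longrightarrow> len (inv (c i) \<otimes> c j) = j - i"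
    by (rule geodesic_segment[OF h(1)]) (rule that)
  have c': "len (inv (c j) \<otimes> c i) = j - i" if "i \<le> j" "j \<le> len h" for i j
    using c(2)[OF that] inv_mult_inv[OF c(1) c(1), of i j] len_inv[of "inv (c i) \<otimes> c j"] c(1) by simp
  define pos where "pos m = R + m * D" for m
  define germ where "germ m = (inv (c (pos m)) \<otimes> c (pos m - R), inv (c (pos m)) \<otimes> c (pos m + R))" for m
  have pos_le: "pos m + R \<le> len h" if "m \<le> M" for m
  proof -
    have "m * D \<le> M * D" using that by simp
    then show ?thesis using h(2) unfolding pos_def L_def by linarith
  qed
  have "germ ` {..M} \<subseteq> B \<times> B"
  proof
    fix x assume "x \<in> germ ` {..M}"
    then obtain m where m: "m \<le> M" "x = germ m" by auto
    have "len (inv (c (pos m)) \<otimes> c (pos m - R)) \<le> R" "len (inv (c (pos m)) \<otimes> c (pos m + R)) \<le> R"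
      using c'[of "pos m - R" "pos m"] c(2)[of "pos m" "pos m + R"] pos_le[OF m(1)] by auto
    then show "x \<in> B \<times> B" unfolding m germ_def B_def using c(1) by simp
  qed
  \<comment> \<open>\<open>{..M}\<close> has \<open>M + 1\<close> elements, one more than there are
    possible germs.\<close>
  then have "\<not> inj_on germ {..M}"
    using card_inj_on_le[of germ "{..M}" "B \<times> B"] finB unfolding M_def by auto
  then obtain m1 m2 where m12: "m1 \<le> M" "m2 \<le> M" "m1 \<noteq> m2" "germ m1 = germ m2" unfolding inj_on_def by auto
  then obtain m n where mn: "m < n" "n \<le> M" "germ m = germ n" by (metis linorder_neqE_nat)
  define i j where "i = pos m" and "j = pos n"
  have "Suc m * D \<le> n * D" using mn(1) by (intro mult_right_mono) auto
  then have ij: "i + D \<le> j" "R \<le> i" "j + R \<le> len h"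
    using pos_le[OF mn(2)] unfolding i_def j_def pos_def by auto
  define g where "g = inv (c i) \<otimes> c j"
  define u where "u = inv (c j) \<otimes> c (j - R)"
  define v where "v = inv (c j) \<otimes> c (j + R)"
  \<comment> \<open>Equality of the germs: \<open>u\<close> points backwards and \<open>v\<close>
    forwards, both as seen from \<open>c i\<close> and as seen from \<open>c j\<close>.\<close>
  have u': "u = inv (c i) \<otimes> c (i - R)" and v': "v = inv (c i) \<otimes> c (i + R)"
    using mn(3) unfolding u_def v_def germ_def i_def j_def by auto
  have carr: "g \<in> G" "u \<in> G" "v \<in> G" unfolding g_def u_def v_def using c(1) by auto
  have quot: "inv (inv (c a) \<otimes> c b) \<otimes> (inv (c a) \<otimes> c d) = inv (c b) \<otimes> c d" for a b d
    using c(1) by (simp add: inv_mult_group m_assoc cancel_left)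
  have lens: "len g = j - i" "len u = R" "len v = R"
    unfolding g_def u_def v_def using c c' ij by auto
  have ginv: "inv g = inv (c j) \<otimes> c i" unfolding g_def using inv_mult_inv[OF c(1) c(1)] .
  have uv: "gp u v = 0"
  proof -
    have "inv u \<otimes> v = inv (c (j - R)) \<otimes> c (j + R)" unfolding u_def v_def by (rule quot)
    then have "len (inv u \<otimes> v) = 2 * R" using c(2)[of "j - R" "j + R"] ij by simp
    then show ?thesis using gp_eq[OF carr(2,3)] lens by simp
  qed
  have ug: "gp (inv g) u = R"
  proof -
    have "inv (inv g) \<otimes> u = inv (c i) \<otimes> c (j - R)" unfolding ginv u_def by (rule quot)
    then have "len (inv (inv g) \<otimes> u) = j - R - i" using c(2)[of i "j - R"] ij D by simp
    then show ?thesis using gp_eq[of "inv g" u] carr lens ij D by (simp add: of_nat_diff)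
  qed
  have gv: "gp g v = R"
  proof -
    have "inv g \<otimes> v = inv (c j) \<otimes> c (i + R)" unfolding g_def v' by (rule quot)
    then have "len (inv g \<otimes> v) = j - (i + R)" using c'[of "i + R" j] ij D by simp
    then show ?thesis using gp_eq[of g v] carr lens ij D by (simp add: of_nat_diff)
  qed
  \<comment> \<open>\<open>inv g\<close> starts along \<open>u\<close> and \<open>g\<close> along
    \<open>v\<close>, each for length \<open>R\<close>. As \<open>u\<close> and \<open>v\<close> lie
    on opposite sides of \<open>\<one>\<close> on a geodesic, \<open>inv g\<close> and
    \<open>g\<close> share at most \<open>2 * \<delta>\<close>.\<close>
  have "gp (inv g) g \<le> 2 * \<delta>"
  proof (rule ccontr)
    assume gt: "\<not> gp (inv g) g \<le> 2 * \<delta>"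
    have "min (real R) (gp (inv g) g) - 2 * \<delta> \<le> gp u v"
      by (rule gp_chain3[of u "inv g" g v]) (use carr ug gv gp_sym[of u "inv g"] in auto)
    then show False using gt R uv by simp
  qed
  then have "loxodromic g" unfolding loxodromic_def using carr lens ij D by auto
  then show ?thesis by (rule that)
qed

text \<open>The two ends are too far apart to lie both in direction \<open>h\<close>. The constants
  6, 5, 4 lose one \<open>\<delta>\<close> in passing to all late powers and another in comparing
  the two ends.\<close>

lemma loxodromic_side:
  assumes g: "loxodromic g" and h: "h \<in> G"
  shows "\<exists>X\<in>{g, inv g}. \<exists>n. \<forall>i\<ge>n. gp (X [^] (i::nat)) h \<le> 6 * \<delta>"
proof (rule ccontr)
  assume neg: "\<not> ?thesis"
  have gc: "g \<in> G" using g unfolding loxodromic_def by auto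
  have stab: "\<exists>m. \<forall>i\<ge>m. 5 * \<delta> < gp (X [^] (i::nat)) h" if X: "X \<in> {g, inv g}" for X
  proof -
    have lx: "loxodromic X" and Xc: "X \<in> G" using X g loxodromic_inv gc by auto
    obtain n where n: "\<forall>i\<ge>n. \<forall>j\<ge>n. 6 * \<delta> + 1 \<le> gp (X [^] (i::nat)) (X [^] (j::nat))"
      using gromov_seqsD[OF loxodromic_seq[OF lx]] by blast
    obtain j where j: "j \<ge> n" "6 * \<delta> < gp (X [^] (j::nat)) h" using neg X by (auto simp: not_le)
    have "5 * \<delta> < gp (X [^] (i::nat)) h" if "i \<ge> n" for i
    proof -
      have "min (6 * \<delta> + 1) (gp (X [^] j) h) - \<delta> \<le> gp (X [^] i) h"
        by (rule gp_hyp[of _ "X [^] j"]) (use n[rule_format, OF that j(1)] Xc h in auto)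
      then show ?thesis using j(2) by linarith
    qed
    then show ?thesis by blast
  qed
  obtain m1 m2 where m1: "\<forall>i\<ge>m1. 5 * \<delta> < gp (g [^] (i::nat)) h" and m2: "\<forall>i\<ge>m2. 5 * \<delta> < gp (inv g [^] (i::nat)) h"
    using stab[of g] stab[of "inv g"] by auto
  define k where "k = max m1 m2"
  have k: "5 * \<delta> < gp (g [^] k) h" "5 * \<delta> < gp (inv g [^] k) h" using m1 m2 unfolding k_def by auto
  have "min (gp (inv g [^] k) h) (gp (g [^] k) h) - \<delta> \<le> gp (inv g [^] k) (g [^] k)"
    by (rule gp_hyp[of _ h]) (use gc h gp_sym[of h "g [^] k"] in auto)
  then show False using k loxodromic_opposite[OF g, of k k] by linarith
qed

text \<open>Since \<open>p\<close> avoids the direction of \<open>inv g\<close>, its image lies in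
  the direction of \<open>g\<close>, which \<open>q\<close> avoids. The bound is
  \<open>8 * \<delta>\<close> for the representatives plus the \<open>2 * \<delta>\<close> of
  \<open>boundary_prod_upper\<close>.\<close>

lemma boundary_prod_shift_bound:
  assumes g: "g \<in> G" "15 * \<delta> < len g" and pq: "p \<in> bdry" "q \<in> bdry"
    and ab: "a \<in> p" "b \<in> q"
    and a: "\<forall>i\<ge>n. gp (a i) (inv g) \<le> 6 * \<delta>" and b: "\<forall>i\<ge>m. gp (b i) g \<le> 6 * \<delta>"
  shows "bprod q (bact g p) \<le> ereal (10 * \<delta>)"
proof -
  have ac: "a i \<in> G" and bc: "b i \<in> G" for i
    using pq ab boundary_mem_seqs gromov_seqs_closed by auto
  have "gp (b i) (g \<otimes> a j) \<le> 8 * \<delta>" if "i \<ge> max n m" "j \<ge> max n m" for i j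
  proof (rule ccontr)
    assume gt: "\<not> gp (b i) (g \<otimes> a j) \<le> 8 * \<delta>"
    have "gp (g \<otimes> a j) g = len g - gp (a j) (inv g)" using gp_rev[of "inv g" "a j"] g ac by simp
    then have far: "len g - 6 * \<delta> \<le> gp (g \<otimes> a j) g" using a that by simp
    have "min (gp (b i) (g \<otimes> a j)) (len g - 6 * \<delta>) - \<delta> \<le> gp (b i) g"
      by (rule gp_hyp[of _ "g \<otimes> a j"]) (use g ac bc far in auto)
    moreover have "gp (b i) g \<le> 6 * \<delta>" using b that by simp
    ultimately show False using gt g(2) delta_nonneg by linarith
  qed
  then have "bprod q (bact g p) \<le> ereal (8 * \<delta> + 2 * \<delta>)"
    using pq ab g boundary_act_closed boundary_act_mem
    by (intro boundary_prod_upper[of _ _ b "\<lambda>i. g \<otimes> a i" "max n m"]) blast+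
  then show ?thesis by simp
qed

text \<open>For a sequence leaving every finite set, one of the two ends of a loxodromic element avoids the
  repelling point of the sequence and one avoids the attracting point.\<close>

lemma separated_pair:
  assumes inf: "infinite G" and h: "\<And>k. h k \<in> G" "inj h"
  obtains p q c c' and r :: "nat \<Rightarrow> nat" where "p \<in> bdry" "q \<in> bdry" "c \<in> bdry" "c' \<in> bdry"
    "c \<noteq> q" "c' \<noteq> p" "strict_mono r"
    "blim (\<lambda>k. bact (h (r k)) p) c"
    "blim (\<lambda>k. bact (inv (h (r k))) q) c'"
proof -
  obtain g where g: "loxodromic g" using loxodromic_exists[OF inf] .
  have gc: "g \<in> G" using g unfolding loxodromic_def by auto
  \<comment> \<open>\<open>X\<close> is an end away from \<open>inv (h k)\<close> and
    \<open>Y\<close> an end away from \<open>h k\<close>. There are four choices in all, so one pair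
    serves for infinitely many \<open>k\<close>.\<close>
  define good where "good k X Y \<longleftrightarrow> (\<exists>n. \<forall>i\<ge>n. gp (X [^] (i::nat)) (inv (h k)) \<le> 6 * \<delta>) \<and> (\<exists>n. \<forall>i\<ge>n. gp (Y [^] (i::nat)) (h k) \<le> 6 * \<delta>)" for k X Y
  have "\<exists>X\<in>{g, inv g}. \<exists>Y\<in>{g, inv g}. good k X Y" for k
    using loxodromic_side[OF g, of "inv (h k)"] loxodromic_side[OF g, of "h k"] h(1)[of k] inv_closed[OF h(1)[of k]]
    unfolding good_def by blast
  then obtain A B where AB: "\<And>k. A k \<in> {g, inv g}" "\<And>k. B k \<in> {g, inv g}" "\<And>k. good k (A k) (B k)" by metis
  define XY where "XY k = (A k, B k)" for k
  have XY: "XY k \<in> {g, inv g} \<times> {g, inv g}" "good k (fst (XY k)) (snd (XY k))" for k unfolding XY_def using AB by auto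
  have "finite (XY ` {k. 15 * \<delta> < len (h k)})"
    by (rule finite_subset[of _ "{g, inv g} \<times> {g, inv g}"], rule image_subsetI, rule XY(1), simp)
  moreover have "finite {k. \<not> 15 * \<delta> < len (h k)}"
    by (rule finite_subset[OF _ finite_vimageI[OF finite_ball[of "nat \<lceil>15 * \<delta>\<rceil>"] h(2)]]) (auto simp: h(1), linarith)
  then have "infinite {k. 15 * \<delta> < len (h k)}" using finite_Collect_not[of "\<lambda>k. 15 * \<delta> < len (h k)"] by auto
  ultimately obtain k0 where k0: "infinite {k \<in> {k. 15 * \<delta> < len (h k)}. XY k = XY k0}"
    using pigeonhole_infinite by blast
  define s where "s = enumerate {k \<in> {k. 15 * \<delta> < len (h k)}. XY k = XY k0}"
  have s: "strict_mono s" "\<And>k. 15 * \<delta> < len (h (s k))" "\<And>k. XY (s k) = XY k0"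
    unfolding s_def using strict_mono_enumerate[OF k0] enumerate_in_set[OF k0] by auto
  obtain X Y where XYk: "XY k0 = (X, Y)" by (cases "XY k0") auto
  have lx: "loxodromic X" "loxodromic Y" using XY(1)[of k0] XYk g loxodromic_inv by auto
  define p q where "p = att X" and "q = att Y"
  have pq: "p \<in> bdry" "q \<in> bdry" "(\<lambda>k::nat. X [^] k) \<in> p" "(\<lambda>k::nat. Y [^] k) \<in> q"
    unfolding p_def q_def using loxodromic_boundary lx by auto
  have bd1: "bprod q (bact (h (s k)) p) \<le> ereal (10 * \<delta>)" for k
  proof -
    have "good (s k) X Y" using XY(2)[of "s k"] s(3) XYk by simp
    then show ?thesis unfolding good_def
      using boundary_prod_shift_bound[OF h(1) s(2) pq] by blast
  qed
  have bd2: "bprod p (bact (inv (h (s k))) q) \<le> ereal (10 * \<delta>)" for k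
  proof -
    have "good (s k) X Y" using XY(2)[of "s k"] s(3) XYk by simp
    then obtain n m where "\<forall>i\<ge>n. gp (X [^] (i::nat)) (inv (h (s k))) \<le> 6 * \<delta>" "\<forall>i\<ge>m. gp (Y [^] (i::nat)) (h (s k)) \<le> 6 * \<delta>"
      unfolding good_def by blast
    then show ?thesis
      using boundary_prod_shift_bound[of "inv (h (s k))" q p "\<lambda>k. Y [^] k" "\<lambda>k. X [^] k" m n] h(1) s(2) pq by simp
  qed
  obtain c r1 where c: "c \<in> bdry" "strict_mono (r1 :: nat \<Rightarrow> nat)"
    "\<And>N::nat. \<exists>k0. \<forall>k\<ge>k0. ereal N \<le> bprod c (bact (h (s (r1 k))) p)"
    using boundary_seq_compact[of "\<lambda>k. bact (h (s k)) p"] boundary_act_closed h(1) pq by blast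
  obtain c' r2 where c': "c' \<in> bdry" "strict_mono (r2 :: nat \<Rightarrow> nat)"
    "\<And>N::nat. \<exists>k0. \<forall>k\<ge>k0. ereal N \<le> bprod c' (bact (inv (h (s (r1 (r2 k))))) q)"
    using boundary_seq_compact[of "\<lambda>k. bact (inv (h (s (r1 k)))) q"] boundary_act_closed h(1) pq inv_closed by blast
  obtain N :: nat where N: "10 * \<delta> < N" using reals_Archimedean2 by blast
  have far: False if "ereal N \<le> x" "x \<le> ereal (10 * \<delta>)" for x
    using order_trans[OF that] N by simp
  \<comment> \<open>The products of the images with \<open>q\<close> stay below
    \<open>10 * \<delta>\<close>, while those with their limit \<open>c\<close> are
    unbounded.\<close>
  have "c \<noteq> q" using c(3)[of N] bd1 far by blast
  moreover have "c' \<noteq> p" using c'(3)[of N] bd2 far by blast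
  moreover have "blim (\<lambda>k. bact (h (s (r1 k))) p) c"
    using c boundary_act_closed h(1) pq by (intro limitin_boundary) auto
  then have "blim ((\<lambda>k. bact (h (s (r1 k))) p) \<circ> r2) c"
    by (rule limitin_subsequence[OF c'(2)])
  then have "blim (\<lambda>k. bact (h ((s \<circ> r1 \<circ> r2) k)) p) c"
    by (simp add: comp_def)
  moreover have "blim (\<lambda>k. bact (inv (h ((s \<circ> r1 \<circ> r2) k))) q) c'"
    using c' boundary_act_closed h(1) pq by (intro limitin_boundary) auto
  moreover have "strict_mono (s \<circ> r1 \<circ> r2)" using s(1) c(2) c'(2) by (intro strict_mono_o)
  ultimately show ?thesis using pq(1,2) c(1) c'(1) that by blast
qed

end

section \<open>Matrix groups and their quotients\<close>

lemma bounded_bilinear_matrix_vector: "bounded_bilinear ((*v) :: real^'n::finite^'m::finite \<Rightarrow> _)"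
  unfolding bilinear_conv_bounded_bilinear[symmetric] bilinear_def
  by (auto intro!: linearI simp: matrix_vector_mult_add_rdistrib matrix_vector_right_distrib
      matrix_vector_mult_scaleR scaleR_matrix_vector_assoc)

lemma bounded_bilinear_matrix_matrix: "bounded_bilinear ((**) :: real^'n::finite^'m::finite \<Rightarrow> real^'k::finite^'n \<Rightarrow> _)"
  unfolding bilinear_conv_bounded_bilinear[symmetric] bilinear_def
  by (auto intro!: linearI simp: matrix_add_ldistrib matrix_matrix_mult_def vec_eq_iff sum.distrib algebra_simps sum_distrib_left)

lemma bounded_linear_transpose: "bounded_linear (transpose :: real^'n::finite^'m::finite \<Rightarrow> _)"
  unfolding linear_conv_bounded_linear[symmetric]
  by (rule linearI) (auto simp: transpose_def vec_eq_iff)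

lemmas tendsto_matrix_vector [tendsto_intros] = bounded_bilinear.tendsto[OF bounded_bilinear_matrix_vector]
lemmas tendsto_matrix_matrix [tendsto_intros] = bounded_bilinear.tendsto[OF bounded_bilinear_matrix_matrix]
lemmas continuous_on_matrix_vector [continuous_intros] = bounded_bilinear.continuous_on[OF bounded_bilinear_matrix_vector]
lemmas continuous_on_matrix_matrix [continuous_intros] = bounded_bilinear.continuous_on[OF bounded_bilinear_matrix_matrix]
lemmas continuous_on_transpose [continuous_intros] = bounded_linear.continuous_on[OF bounded_linear_transpose]
lemmas tendsto_transpose [tendsto_intros] = bounded_linear.tendsto[OF bounded_linear_transpose]

lemma matrix_vector_norm_bound:
  obtains K where "0 < K" "\<And>(A :: real^'n::finite^'m::finite) v. norm (A *v v) \<le> K * norm A * norm v"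
proof -
  obtain K where "0 < K" "\<And>(A :: real^'n::finite^'m::finite) v. norm (A *v v) \<le> norm A * norm v * K"
    using bounded_bilinear.pos_bounded[OF bounded_bilinear_matrix_vector] by blast
  then show ?thesis using that[of K] by (simp add: mult_ac)
qed

lemma continuous_on_det [continuous_intros]:
  fixes f :: "'a::topological_space \<Rightarrow> real^'n::finite^'n"
  assumes "continuous_on S f" shows "continuous_on S (\<lambda>x. det (f x))"
  unfolding det_def by (intro continuous_intros assms)

lemma tendsto_det [tendsto_intros]:
  fixes f :: "'a \<Rightarrow> real^'n::finite^'n"
  assumes "(f \<longlongrightarrow> l) F" shows "((\<lambda>x. det (f x)) \<longlongrightarrow> det l) F"
  unfolding det_def by (intro tendsto_intros assms)

lemma matrix_inv_mult:
  fixes A :: "real^'n::finite^'n"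
  assumes "invertible A"
  shows "A ** matrix_inv A = mat 1" "matrix_inv A ** A = mat 1"
    "A *v (matrix_inv A *v v) = v" "matrix_inv A *v (A *v v) = v"
proof -
  have "A ** matrix_inv A = mat 1 \<and> matrix_inv A ** A = mat 1"
    unfolding matrix_inv_def using assms unfolding invertible_def by (rule someI_ex)
  then show e: "A ** matrix_inv A = mat 1" "matrix_inv A ** A = mat 1" by auto
  show "A *v (matrix_inv A *v v) = v" "matrix_inv A *v (A *v v) = v"
    by (simp_all add: matrix_vector_mul_assoc e)
qed

lemma matrix_inv_unique:
  fixes A B :: "real^'n::finite^'n"
  assumes "A ** B = mat 1"
  shows "invertible A" "matrix_inv A = B"
proof -
  have BA: "B ** A = mat 1" using assms matrix_left_right_inverse by blast
  show inv: "invertible A" unfolding invertible_def using assms BA by blast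
  have "matrix_inv A = matrix_inv A ** (A ** B)" using assms by simp
  also have "\<dots> = B" unfolding matrix_mul_assoc matrix_inv_mult(2)[OF inv] by simp
  finally show "matrix_inv A = B" .
qed

lemma tendsto_matrix_inv:
  fixes A :: "nat \<Rightarrow> real^'n::finite^'n"
  assumes lim: "A \<longlonglongrightarrow> B" and inv: "\<And>k. invertible (A k)" "invertible B"
  shows "(\<lambda>k. matrix_inv (A k)) \<longlonglongrightarrow> matrix_inv B"
proof -
  \<comment> \<open>\<open>matrix_inv\<close> is a choice term; Cramer's rule expresses its entries
    as quotients of determinants, which are continuous.\<close>
  have entry: "matrix_inv M $ i $ j = det (\<chi> a b. if b = i then axis j 1 $ a else M $ a $ b) / det M" if M: "invertible M" for M :: "real^'n^'n" and i j
  proof -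
    have "M *v (matrix_inv M *v axis j 1) = axis j 1" by (rule matrix_inv_mult(3)[OF M])
    then have "(matrix_inv M *v axis j 1) $ i = det (\<chi> a b. if b = i then axis j 1 $ a else M $ a $ b) / det M"
      using cramer[of M] M by (simp add: invertible_det_nz)
    then show ?thesis by (simp add: matrix_vector_mult_basis column_def)
  qed
  show ?thesis
  proof (intro vec_tendstoI, unfold entry[OF inv(1)] entry[OF inv(2)], intro tendsto_divide tendsto_det lim vec_tendstoI)
    show "(\<lambda>k. (\<chi> a b. if b = i then axis j 1 $ a else A k $ a $ b) $ m $ n) \<longlonglongrightarrow> (\<chi> a b. if b = i then axis j 1 $ a else B $ a $ b) $ m $ n" for i j m n
      using tendsto_vec_nth[OF tendsto_vec_nth[OF lim]] by simp
  qed (use inv in \<open>simp add: invertible_det_nz\<close>)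
qed

definition matrix_subgroup :: "'k::finite matrix set \<Rightarrow> bool" where
  "matrix_subgroup H \<longleftrightarrow> mat 1 \<in> H \<and> (\<forall>A\<in>H. \<forall>B\<in>H. A ** B \<in> H) \<and> (\<forall>A\<in>H. invertible A \<and> matrix_inv A \<in> H)"

lemma matrix_subgroupD:
  assumes "matrix_subgroup H"
  shows "mat 1 \<in> H" "\<And>A B. \<lbrakk>A \<in> H; B \<in> H\<rbrakk> \<Longrightarrow> A ** B \<in> H" "\<And>A. A \<in> H \<Longrightarrow> invertible A"
    "\<And>A. A \<in> H \<Longrightarrow> matrix_inv A \<in> H"
  using assms unfolding matrix_subgroup_def by auto

lemma matrix_group_simps [simp]:
  "carrier (matrix_group H) = H" "mult (matrix_group H) = (**)" "one (matrix_group H) = mat 1"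
  unfolding matrix_group_def by simp_all

lemma stabilizer_matrix_group: "stabilizer (matrix_group H) \<phi> x = {g \<in> H. \<phi> g x = x}"
  unfolding stabilizer_def by simp

lemma translate_mult: "translate (A ** B) x = translate A (translate B x)"
  unfolding translate_def image_image by (simp add: matrix_mul_assoc)

lemma mem_translate: "invertible A \<Longrightarrow> B \<in> translate A P \<longleftrightarrow> matrix_inv A ** B \<in> P"
proof -
  assume A: "invertible A"
  have "B = A ** C \<longleftrightarrow> matrix_inv A ** B = C" for C
    by (metis A matrix_inv_mult(1,2) matrix_mul_assoc matrix_mul_lid)
  from this[of "matrix_inv A ** B"] this show ?thesis unfolding translate_def by (metis image_iff)
qed

lemma lcosets_matrix_group: "lcosets\<^bsub>matrix_group H\<^esub> P = (\<lambda>h. translate h P) ` H"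
  unfolding LCOSETS_def l_coset_def translate_def by auto

lemma translate_eq_iff:
  assumes P: "matrix_subgroup P" and gh: "invertible g" "invertible h"
  shows "translate g P = translate h P \<longleftrightarrow> matrix_inv g ** h \<in> P"
proof
  assume "translate g P = translate h P"
  moreover have "h \<in> translate h P" unfolding translate_def using matrix_subgroupD(1)[OF P] by force
  ultimately show "matrix_inv g ** h \<in> P" using mem_translate[OF gh(1)] by blast
next
  assume u: "matrix_inv g ** h \<in> P"
  define u where "u = matrix_inv g ** h"
  have h: "h = g ** u" unfolding u_def by (simp add: matrix_mul_assoc matrix_inv_mult gh)
  have "translate u P = P"
  proof
    show "translate u P \<subseteq> P" unfolding translate_def using matrix_subgroupD(2)[OF P] u u_def by auto
    show "P \<subseteq> translate u P"
    proof
      fix p assume p: "p \<in> P"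
      have "invertible u" "matrix_inv u \<in> P" using matrix_subgroupD(3,4)[OF P] u u_def by auto
      then show "p \<in> translate u P" using mem_translate matrix_subgroupD(2)[OF P] p by blast
    qed
  qed
  then show "translate g P = translate h P" unfolding h translate_mult by simp
qed

text \<open>The projection onto cosets is open, because the preimage of the image of
  \<open>U\<close> is the union of the right translates of \<open>U\<close> by elements of
  \<open>P\<close>.\<close>

lemma openin_translate_ball:
  assumes H: "matrix_subgroup H" and P: "matrix_subgroup P" "P \<subseteq> H" and U: "open U"
  shows "openin (quotient_space_topology H P) ((\<lambda>h. translate h P) ` (H \<inter> U))"
  unfolding openin_quotient_space_topology
proof
  show "(\<lambda>h. translate h P) ` (H \<inter> U) \<subseteq> lcosets\<^bsub>matrix_group H\<^esub> P"
    unfolding lcosets_matrix_group by auto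
  have "{h \<in> H. translate h P \<in> (\<lambda>h. translate h P) ` (H \<inter> U)} = H \<inter> (\<Union>p\<in>P. (\<lambda>h. h ** p) -` U)"
  proof (intro Set.set_eqI iffI)
    fix h assume "h \<in> {h \<in> H. translate h P \<in> (\<lambda>h. translate h P) ` (H \<inter> U)}"
    then obtain g where h: "h \<in> H" and g: "g \<in> H" "g \<in> U" "translate h P = translate g P" by auto
    then have p: "matrix_inv h ** g \<in> P" using translate_eq_iff[OF P(1)] matrix_subgroupD(3)[OF H] by blast
    moreover have "h ** (matrix_inv h ** g) = g"
      by (simp add: matrix_mul_assoc matrix_inv_mult matrix_subgroupD(3)[OF H h])
    ultimately show "h \<in> H \<inter> (\<Union>p\<in>P. (\<lambda>h. h ** p) -` U)" using h g by force
  next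
    fix h assume "h \<in> H \<inter> (\<Union>p\<in>P. (\<lambda>h. h ** p) -` U)"
    then obtain p where h: "h \<in> H" "p \<in> P" "h ** p \<in> U" by auto
    have hp: "h ** p \<in> H" using h matrix_subgroupD(2)[OF H] P(2) by blast
    have inv: "invertible h" using matrix_subgroupD(3)[OF H h(1)] .
    have "matrix_inv h ** (h ** p) = p" by (simp add: matrix_mul_assoc matrix_inv_mult inv)
    then have "translate h P = translate (h ** p) P"
      using translate_eq_iff[OF P(1) inv matrix_subgroupD(3)[OF H hp]] h by simp
    then show "h \<in> {h \<in> H. translate h P \<in> (\<lambda>h. translate h P) ` (H \<inter> U)}" using h hp by auto
  qed
  moreover have "open (\<Union>p\<in>P. (\<lambda>h. h ** p) -` U)"
    by (intro open_UN ballI open_vimage U continuous_intros)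
  ultimately show "openin (top_of_set H) {h \<in> H. translate h P \<in> (\<lambda>h. translate h P) ` (H \<inter> U)}"
    by (simp add: openin_open_Int)
qed

text \<open>Because the projection is open, cosets near that of \<open>h\<close> have
  representatives near \<open>h\<close>; representatives almost nearest to \<open>h\<close>
  therefore converge.\<close>

lemma quotient_lift:
  assumes H: "matrix_subgroup H" and P: "matrix_subgroup P" "P \<subseteq> H" and h: "h \<in> H"
    and lim: "limitin (quotient_space_topology H P) x (translate h P) sequentially"
    and x: "\<And>k. x k \<in> (\<lambda>h. translate h P) ` H"
  obtains g where "g \<longlonglongrightarrow> h" "\<And>k. g k \<in> H" "\<And>k. x k = translate (g k) P"
proof -
  \<comment> \<open>The infimum of these distances need not be attained, hence the slack
    \<open>1 / Suc k\<close> below.\<close>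
  define D where "D k = {dist f h | f. f \<in> H \<and> x k = translate f P}" for k
  have "\<exists>f. f \<in> H \<and> x k = translate f P \<and> dist f h < Inf (D k) + 1 / Suc k" for k
  proof -
    have "D k \<noteq> {}" using x[of k] unfolding D_def by auto
    then obtain d where "d \<in> D k" "d < Inf (D k) + 1 / Suc k" using cInf_lessD[of "D k" "Inf (D k) + 1 / Suc k"] by auto
    then show ?thesis unfolding D_def by auto
  qed
  then obtain g where g: "\<And>k. g k \<in> H" "\<And>k. x k = translate (g k) P" "\<And>k. dist (g k) h < Inf (D k) + 1 / Suc k" by metis
  have "g \<longlonglongrightarrow> h"
  proof (rule tendstoI)
    fix e :: real assume e: "0 < e"
    have "openin (quotient_space_topology H P) ((\<lambda>h. translate h P) ` (H \<inter> ball h (e / 2)))"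
      by (rule openin_translate_ball[OF H P open_ball])
    moreover have "translate h P \<in> (\<lambda>h. translate h P) ` (H \<inter> ball h (e / 2))" using h e by auto
    ultimately have "\<forall>\<^sub>F k in sequentially. x k \<in> (\<lambda>h. translate h P) ` (H \<inter> ball h (e / 2))"
      using lim unfolding limitin_def by blast
    moreover have "\<forall>\<^sub>F k in sequentially. 1 / real (Suc k) < e / 2"
      using LIMSEQ_inverse_real_of_nat e by (intro order_tendstoD(2)[of _ 0]) (auto simp: inverse_eq_divide)
    ultimately show "\<forall>\<^sub>F k in sequentially. dist (g k) h < e"
    proof eventually_elim
      case (elim k)
      then obtain f where f: "f \<in> H" "dist f h < e / 2" "x k = translate f P" by (auto simp: dist_commute)
      have "Inf (D k) \<le> dist f h" by (rule cInf_lower) (use f in \<open>auto simp: D_def intro: bdd_belowI[of _ 0]\<close>)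
      then show ?case using g(3)[of k] f(2) elim(2) by linarith
    qed
  qed
  then show ?thesis using g(1,2) by (rule that)
qed

section \<open>The group SO(n,n) and isotropic subspaces\<close>

definition hf :: "real^('n::finite + 'n) \<Rightarrow> real^('n + 'n) \<Rightarrow> real" where
  "hf v w = v \<bullet> (I_nn *v w)"

lemma I_nn_vec: "I_nn *v v = (\<chi> i. case i of Inl _ \<Rightarrow> v $ i | Inr _ \<Rightarrow> - v $ i)"
  unfolding I_nn_def matrix_vector_mult_def
  by (auto simp: vec_eq_iff if_distrib if_distribR cong: if_cong split: sum.split)

lemma I_nn_involution [simp]: "I_nn *v (I_nn *v v) = v"
  unfolding I_nn_vec by (auto simp: vec_eq_iff split: sum.split)

lemma I_nn_square [simp]: "I_nn ** I_nn = mat 1"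
  by (simp add: matrix_eq flip: matrix_vector_mul_assoc)

lemma transpose_I_nn [simp]: "transpose I_nn = I_nn"
  unfolding I_nn_def transpose_def by (auto simp: vec_eq_iff)

lemma norm_I_nn [simp]: "norm (I_nn *v v) = norm v"
  unfolding I_nn_vec norm_vec_def L2_set_def
  by (intro arg_cong[of _ _ sqrt] sum.cong) (auto split: sum.split)

lemma sum_UNIV_sum: "(\<Sum>i\<in>(UNIV :: ('a::finite + 'b::finite) set). f i) = (\<Sum>i\<in>UNIV. f (Inl i)) + (\<Sum>i\<in>UNIV. f (Inr i))"
  by (simp add: UNIV_Plus_UNIV[symmetric] sum.Plus comp_def del: UNIV_Plus_UNIV)

lemma hf_sum: "hf v w = (\<Sum>i\<in>UNIV. v $ Inl i * w $ Inl i) - (\<Sum>i\<in>UNIV. v $ Inr i * w $ Inr i)"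
  unfolding hf_def I_nn_vec inner_vec_def by (simp add: sum_UNIV_sum sum_negf)

lemma bounded_bilinear_hf: "bounded_bilinear hf"
  unfolding hf_def
  by (rule bounded_bilinear.comp[OF bounded_bilinear_inner bounded_linear_ident matrix_vector_mul_bounded_linear])

lemmas hf_simps = bounded_bilinear.add_left[OF bounded_bilinear_hf] bounded_bilinear.add_right[OF bounded_bilinear_hf]
  bounded_bilinear.diff_left[OF bounded_bilinear_hf] bounded_bilinear.diff_right[OF bounded_bilinear_hf]
  bounded_bilinear.scaleR_left[OF bounded_bilinear_hf] bounded_bilinear.scaleR_right[OF bounded_bilinear_hf]
  bounded_bilinear.minus_left[OF bounded_bilinear_hf] bounded_bilinear.minus_right[OF bounded_bilinear_hf]
  bounded_bilinear.zero_left[OF bounded_bilinear_hf] bounded_bilinear.zero_right[OF bounded_bilinear_hf]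
lemmas tendsto_hf [tendsto_intros] = bounded_bilinear.tendsto[OF bounded_bilinear_hf]
lemmas continuous_on_hf [continuous_intros] = bounded_bilinear.continuous_on[OF bounded_bilinear_hf]

lemma hf_sym: "hf v w = hf w v"
  unfolding hf_sum by (simp add: mult.commute)

lemma hf_I_nn [simp]: "hf v (I_nn *v w) = v \<bullet> w"
  unfolding hf_def by simp

lemma hf_norm_le: "\<bar>hf v w\<bar> \<le> norm v * norm w"
  unfolding hf_def using Cauchy_Schwarz_ineq2[of v "I_nn *v w"] by simp

definition isometry :: "('n::finite + 'n) matrix \<Rightarrow> bool" where
  "isometry A \<longleftrightarrow> (\<forall>v w. hf (A *v v) (A *v w) = hf v w)"

lemma isometry_iff: "isometry A \<longleftrightarrow> transpose A ** I_nn ** A = I_nn"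
proof -
  have "hf (A *v v) (A *v w) = v \<bullet> ((transpose A ** I_nn ** A) *v w)" for v w
    unfolding hf_def by (simp add: dot_lmul_matrix[symmetric] transpose_matrix_vector flip: matrix_vector_mul_assoc)
      (metis dot_lmul_matrix inner_commute)
  then have "isometry A \<longleftrightarrow> (\<forall>v w. v \<bullet> ((transpose A ** I_nn ** A) *v w) = v \<bullet> (I_nn *v w))"
    unfolding isometry_def hf_def by simp
  also have "\<dots> \<longleftrightarrow> (\<forall>w. (transpose A ** I_nn ** A) *v w = I_nn *v w)"
    by (metis vector_eq_ldot)
  also have "\<dots> \<longleftrightarrow> transpose A ** I_nn ** A = I_nn" by (simp add: matrix_eq)
  finally show ?thesis .
qed

lemma SO_nn_iff: "A \<in> SO_nn \<longleftrightarrow> isometry A \<and> det A = 1"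
  unfolding SO_nn_def isometry_iff by simp

lemma isometry_inverse:
  assumes "isometry A"
  shows "invertible A" "matrix_inv A = I_nn ** transpose A ** I_nn"
proof -
  have "I_nn ** (transpose A ** I_nn ** A) = I_nn ** I_nn" using assms by (simp add: isometry_iff)
  then have "(I_nn ** transpose A ** I_nn) ** A = mat 1" by (simp add: matrix_mul_assoc)
  then have "A ** (I_nn ** transpose A ** I_nn) = mat 1" using matrix_left_right_inverse by blast
  then show "invertible A" "matrix_inv A = I_nn ** transpose A ** I_nn" using matrix_inv_unique by auto
qed

lemma isometry_mult: "isometry A \<Longrightarrow> isometry B \<Longrightarrow> isometry (A ** B)"
  unfolding isometry_def by (simp flip: matrix_vector_mul_assoc)

lemma isometry_one [simp]: "isometry (mat 1)"
  unfolding isometry_def by simp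

lemma isometry_inv: "isometry A \<Longrightarrow> isometry (matrix_inv A)"
  unfolding isometry_def using isometry_inverse[of A] matrix_inv_mult[of A] by (metis isometry_def)

lemma isometry_adjoint: "isometry A \<Longrightarrow> hf v (matrix_inv A *v w) = hf (A *v v) w"
  using isometry_inverse[of A] matrix_inv_mult[of A] by (metis isometry_def)

lemma matrix_subgroup_SO_nn: "matrix_subgroup SO_nn"
  unfolding matrix_subgroup_def
proof (intro conjI ballI)
  fix A :: "('a + 'a) matrix" assume "A \<in> SO_nn"
  then have A: "isometry A" "det A = 1" by (auto simp: SO_nn_iff)
  show "invertible A" using isometry_inverse[OF A(1)] by simp
  then have "det A * det (matrix_inv A) = 1" by (metis det_I det_mul matrix_inv_mult(1))
  then show "matrix_inv A \<in> SO_nn" using A isometry_inv by (simp add: SO_nn_iff)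
qed (auto simp: isometry_mult det_mul SO_nn_iff)

lemma SO0_subset: "SO0_nn \<subseteq> SO_nn"
  unfolding SO0_nn_def by (rule connected_component_subset)

lemma SO0_I:
  assumes "connected T" "T \<subseteq> SO_nn" "mat 1 \<in> T" "A \<in> T"
  shows "A \<in> SO0_nn"
  unfolding SO0_nn_def connected_component_def using assms by blast

lemma SO0_E:
  assumes "A \<in> SO0_nn"
  obtains T where "connected T" "T \<subseteq> SO_nn" "mat 1 \<in> T" "A \<in> T"
  using assms unfolding SO0_nn_def connected_component_def by blast

lemma matrix_subgroup_SO0: "matrix_subgroup (SO0_nn :: ('a::finite + 'a) matrix set)"
  unfolding matrix_subgroup_def
proof (intro conjI ballI)
  have G0: "matrix_subgroup (SO_nn :: ('a + 'a) matrix set)" by (rule matrix_subgroup_SO_nn)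
  note G = matrix_subgroupD[OF G0]
  show "(mat 1 :: ('a + 'a) matrix) \<in> SO0_nn" by (rule SO0_I[of "{mat 1}"]) (use G in auto)
  fix A :: "('a + 'a) matrix" assume A: "A \<in> SO0_nn"
  then obtain T where T: "connected T" "T \<subseteq> SO_nn" "mat 1 \<in> T" "A \<in> T" by (rule SO0_E)
  show "invertible A" using A SO0_subset G by blast
  have eq: "matrix_inv B = I_nn ** transpose B ** I_nn" if "B \<in> T" for B
    using isometry_inverse(2) that T(2) SO_nn_iff by blast
  show "matrix_inv A \<in> SO0_nn"
  proof (rule SO0_I)
    have "connected ((\<lambda>B. I_nn ** transpose B ** I_nn) ` T)"
      by (intro connected_continuous_image T continuous_intros)
    then show "connected (matrix_inv ` T)" using eq by (metis (no_types, lifting) image_cong)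
    show "matrix_inv ` T \<subseteq> SO_nn" using T(2) G by auto
    have "matrix_inv (mat 1) = (mat 1 :: ('a + 'a) matrix)" by (rule matrix_inv_unique) simp
    then show "mat 1 \<in> matrix_inv ` T" using T(3) by (metis imageI)
    show "matrix_inv A \<in> matrix_inv ` T" using T(4) by simp
  qed
  fix B :: "('a + 'a) matrix" assume "B \<in> SO0_nn"
  then obtain U where U: "connected U" "U \<subseteq> SO_nn" "mat 1 \<in> U" "B \<in> U" by (rule SO0_E)
  show "A ** B \<in> SO0_nn"
  proof (rule SO0_I)
    show "connected ((\<lambda>(A, B). A ** B) ` (T \<times> U))"
      unfolding case_prod_unfold by (intro connected_continuous_image connected_Times T U continuous_intros)
    show "(\<lambda>(A, B). A ** B) ` (T \<times> U) \<subseteq> SO_nn" using T(2) U(2) G by auto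
    have "(mat 1, mat 1) \<in> T \<times> U" "(A, B) \<in> T \<times> U" using T U by auto
    then show "mat 1 \<in> (\<lambda>(A, B). A ** B) ` (T \<times> U)" "A ** B \<in> (\<lambda>(A, B). A ** B) ` (T \<times> U)" by force+
  qed
qed

lemma SO0_isometry: "A \<in> SO0_nn \<Longrightarrow> isometry A"
  using SO0_subset SO_nn_iff by blast

lemma SO0_invertible: "A \<in> SO0_nn \<Longrightarrow> invertible A"
  using SO0_isometry isometry_inverse by blast

lemma SO0_subset_SL: "SO0_nn \<subseteq> SL"
  using SO0_subset SO_nn_iff unfolding SL_def by blast

lemma isometry_det_square: "isometry A \<Longrightarrow> det A * det A = 1"
proof -
  assume "isometry A"
  then have "det (transpose A ** I_nn ** A) = det (I_nn :: ('a + 'a) matrix)" by (simp add: isometry_iff)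
  then have "det A * det A * det (I_nn :: ('a + 'a) matrix) = det (I_nn :: ('a + 'a) matrix)"
    by (simp add: det_mul det_transpose mult_ac)
  moreover have "det (I_nn :: ('a + 'a) matrix) * det (I_nn :: ('a + 'a) matrix) = 1"
    using det_mul[of I_nn I_nn] by simp
  ultimately show ?thesis by (metis mult.right_neutral mult_eq_0_iff mult_right_cancel zero_neq_one mult_1)
qed

text \<open>Isometries have determinant 1 or -1, so the determinant is constant along a path
  starting at the identity.\<close>

lemma SO0_path:
  assumes cont: "continuous_on {0..1} c" and c0: "c 0 = mat 1" and iso: "\<And>t. t \<in> {0..1::real} \<Longrightarrow> isometry (c t)"
  shows "c 1 \<in> SO0_nn"
proof (rule SO0_I[of "c ` {0..1}"])
  show "connected (c ` {0..1})" by (intro connected_continuous_image cont) simp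
  have "det (c t) \<in> {1, -1}" if "t \<in> {0..1}" for t
    using isometry_det_square[OF iso[OF that]] by (simp add: square_eq_1_iff)
  then have "finite ((\<lambda>t. det (c t)) ` {0..1})" by (intro finite_subset[OF _ finite.insertI[OF finite.insertI[OF finite.emptyI]], of _ 1 "-1"] image_subsetI)
  then have "(\<lambda>t. det (c t)) constant_on {0..1}"
    by (intro continuous_finite_range_constant continuous_intros cont) auto
  moreover have "det (c 0) = 1" using c0 by simp
  ultimately have "det (c t) = 1" if "t \<in> {0..1}" for t
    using that unfolding constant_on_def by (metis atLeastAtMost_iff order_refl zero_le_one)
  then show "c ` {0..1} \<subseteq> SO_nn" using iso by (auto simp: SO_nn_iff)
qed (use c0 in \<open>auto intro: image_eqI[of _ _ 0]\<close>)

definition outer :: "real^'n::finite \<Rightarrow> real^'m::finite \<Rightarrow> real^'m^'n" where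
  "outer u w = (\<chi> i j. u $ i * w $ j)"

lemma outer_vec [simp]: "outer u w *v z = (w \<bullet> z) *\<^sub>R u"
  unfolding outer_def matrix_vector_mult_def inner_vec_def
  by (simp add: vec_eq_iff sum_distrib_left mult_ac)

lemma bounded_bilinear_outer: "bounded_bilinear outer"
  unfolding bilinear_conv_bounded_bilinear[symmetric] bilinear_def outer_def
  by (auto intro!: linearI simp: vec_eq_iff algebra_simps)

lemmas tendsto_outer [tendsto_intros] = bounded_bilinear.tendsto[OF bounded_bilinear_outer]
lemmas continuous_on_outer [continuous_intros] = bounded_bilinear.continuous_on[OF bounded_bilinear_outer]

text \<open>The bivector of \<open>u\<close> and \<open>v\<close>, acting as an infinitesimal
  isometry of the form \<open>hf\<close>.\<close>

definition skew :: "real^('n::finite + 'n) \<Rightarrow> real^('n + 'n) \<Rightarrow> ('n + 'n) matrix" where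
  "skew u v = outer u (I_nn *v v) - outer v (I_nn *v u)"

lemma skew_vec: "skew u v *v z = hf v z *\<^sub>R u - hf u z *\<^sub>R v"
  unfolding skew_def by (simp add: matrix_vector_mult_diff_rdistrib hf_def) (metis hf_def hf_sym inner_commute)

lemma bounded_bilinear_skew: "bounded_bilinear skew"
  unfolding bilinear_conv_bounded_bilinear[symmetric] bilinear_def
  by (auto intro!: linearI simp: matrix_eq skew_vec hf_simps algebra_simps matrix_vector_mult_add_rdistrib
      scaleR_matrix_vector_assoc[symmetric])

lemmas tendsto_skew [tendsto_intros] = bounded_bilinear.tendsto[OF bounded_bilinear_skew]

lemma scaleR_matrix_vector: "(c *\<^sub>R A) *v (x :: real^'n::finite) = c *\<^sub>R (A *v x)"
  by (simp add: scaleR_matrix_vector_assoc)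

text \<open>For an isotropic pair \<open>skew u v\<close> has square zero, so this affine path is
  its one-parameter group.\<close>

lemma skew_SO0:
  assumes "hf u u = 0" "hf v v = 0" "hf u v = 0"
  shows "mat 1 + t *\<^sub>R skew u v \<in> SO0_nn"
proof -
  have iso: "isometry (mat 1 + s *\<^sub>R skew u v)" for s
    unfolding isometry_def
    by (simp add: matrix_vector_mult_add_rdistrib scaleR_matrix_vector skew_vec hf_simps assms hf_sym[of v u])
      (simp add: hf_sym[of _ u] hf_sym[of _ v] algebra_simps)
  have "mat 1 + (1 * t) *\<^sub>R skew u v \<in> SO0_nn"
    by (rule SO0_path[where c = "\<lambda>s. mat 1 + (s * t) *\<^sub>R skew u v"]) (auto intro!: continuous_intros iso)
  then show ?thesis by simp
qed

lemma skew_lie_algebra: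
  assumes "hf u u = 0" "hf v v = 0" "hf u v = 0"
  shows "skew u v \<in> lie_algebra SO0_nn"
  unfolding lie_algebra_def
proof (intro CollectI exI[of _ "\<lambda>t. mat 1 + t *\<^sub>R skew u v"] conjI allI)
  show "((\<lambda>t. mat 1 + t *\<^sub>R skew u v) has_vector_derivative skew u v) (at 0)"
    by (auto intro!: derivative_eq_intros)
qed (use skew_SO0[OF assms] in auto)

lemma Ad_skew: "isometry A \<Longrightarrow> Ad A (skew u v) = skew (A *v u) (A *v v)"
  unfolding Ad_def
  by (simp add: matrix_eq skew_vec matrix_vector_mult_diff_distrib matrix_vector_mult_scaleR isometry_adjoint
      flip: matrix_vector_mul_assoc)

definition reflection :: "real^('n::finite + 'n) \<Rightarrow> ('n + 'n) matrix" where
  "reflection u = mat 1 - (2 / hf u u) *\<^sub>R outer u (I_nn *v u)"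

lemma reflection_vec: "reflection u *v z = z - (2 * hf u z / hf u u) *\<^sub>R u"
  unfolding reflection_def by (simp add: matrix_vector_mult_diff_rdistrib scaleR_matrix_vector)
    (metis hf_def hf_sym inner_commute)

lemma isometry_reflection: "hf u u \<noteq> 0 \<Longrightarrow> isometry (reflection u)"
  unfolding isometry_def
proof (intro allI)
  fix v w assume "hf u u \<noteq> 0"
  then show "hf (reflection u *v v) (reflection u *v w) = hf v w"
    by (simp add: reflection_vec hf_simps hf_sym[of v u] field_simps)
qed

text \<open>The product of the reflections in \<open>w + w'\<close> and \<open>w'\<close> maps \<open>w\<close> to \<open>w'\<close>; moving \<open>w'\<close> to \<open>w\<close>
  along the segment connects it to the identity.\<close>

lemma SO0_transitive:
  assumes w: "hf w w = -1" "hf w' w' = -1" and neg: "hf w w' < 0"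
  obtains g where "g \<in> SO0_nn" "g *v w = w'"
proof -
  define p where "p t = (1 - t) *\<^sub>R w + t *\<^sub>R w'" for t :: real
  define c where "c t = reflection (p t) ** reflection (w + p t)" for t
  have pp: "hf (p t) (p t) = - ((1 - t)\<^sup>2 + t\<^sup>2) + 2 * t * (1 - t) * hf w w'" for t
    unfolding p_def by (simp add: hf_simps w hf_sym[of w' w] power2_eq_square algebra_simps)
  have wp: "hf w (p t) = - (1 - t) + t * hf w w'" for t
    unfolding p_def by (simp add: hf_simps w)
  \<comment> \<open>\<open>hf w w' < 0\<close> keeps \<open>p t\<close> and \<open>w + p t\<close>
    of negative norm, so that both reflections are defined and continuous.\<close>
  have n1: "hf (p t) (p t) < 0" if "t \<in> {0..1}" for t
  proof -
    have "2 * t * (1 - t) * hf w w' \<le> 0" using that neg by (intro mult_nonneg_nonpos) auto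
    moreover have "0 < (1 - t)\<^sup>2 + t\<^sup>2" using sum_power2_gt_zero_iff[of "1 - t" t] by auto
    ultimately show ?thesis unfolding pp by linarith
  qed
  have n2: "hf (w + p t) (w + p t) < 0" if "t \<in> {0..1}" for t
  proof -
    have "hf w (p t) \<le> 0" 
      unfolding wp using mult_nonneg_nonpos[of t "hf w w'"] that neg by auto
    then show ?thesis using n1[OF that] by (simp add: hf_simps w hf_sym[of "p t" w])
  qed
  have "c 1 \<in> SO0_nn"
  proof (rule SO0_path)
    show "continuous_on {0..1} c" unfolding c_def reflection_def
      using n1 n2 by (intro continuous_intros) (fastforce simp: p_def intro!: continuous_intros)+
    \<comment> \<open>At \<open>t = 0\<close> the vectors are \<open>w\<close> and twice
      \<open>w\<close>, so the same reflection is applied twice.\<close>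
    show "c 0 = mat 1"
      unfolding c_def by (simp add: matrix_eq p_def reflection_vec hf_simps w scaleR_2[symmetric] flip: matrix_vector_mul_assoc)
    show "isometry (c t)" if "t \<in> {0..1}" for t
      unfolding c_def using n1[OF that] n2[OF that] by (intro isometry_mult isometry_reflection) auto
  qed
  moreover have "c 1 *v w = w'"
  proof -
    have "reflection (w + w') *v w = - w'"
      using neg by (simp add: reflection_vec hf_simps w hf_sym[of w' w] field_simps)
    then show ?thesis unfolding c_def p_def
      by (simp add: reflection_vec[of w'] hf_simps w flip: matrix_vector_mul_assoc) (simp add: scaleR_2)
  qed
  ultimately show ?thesis by (rule that)
qed

text \<open>For a sign vector \<open>s\<close> the graph of \<open>diag s\<close> is a maximal isotropic subspace, and
  \<open>\<Prod>s\<close> is its type: \<open>SO\<^sub>0(n,n)\<close> preserves types.\<close>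

definition sign_graph :: "('n::finite \<Rightarrow> real) \<Rightarrow> (real^('n + 'n)) set" where
  "sign_graph s = {z. \<forall>j. z $ Inr j = s j * z $ Inl j}"

definition graph_vec :: "('n::finite \<Rightarrow> real) \<Rightarrow> real^'n \<Rightarrow> real^('n + 'n)" where
  "graph_vec s v = (\<chi> k. case k of Inl j \<Rightarrow> v $ j | Inr j \<Rightarrow> s j * v $ j)"

definition upper_block :: "('n::finite \<Rightarrow> real) \<Rightarrow> ('n + 'n) matrix \<Rightarrow> real^'n^'n" where
  "upper_block s g = (\<chi> i j. g $ Inl i $ Inl j + s j * g $ Inl i $ Inr j)"

definition lower_block :: "('n::finite \<Rightarrow> real) \<Rightarrow> ('n + 'n) matrix \<Rightarrow> real^'n^'n" where
  "lower_block s g = (\<chi> i j. g $ Inr i $ Inl j + s j * g $ Inr i $ Inr j)"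

lemma upper_block_vec: "(g *v graph_vec s v) $ Inl i = (upper_block s g *v v) $ i"
  unfolding matrix_vector_mult_def graph_vec_def upper_block_def
  by (simp add: sum_UNIV_sum sum.distrib[symmetric] algebra_simps)

lemma lower_block_vec: "(g *v graph_vec s v) $ Inr i = (lower_block s g *v v) $ i"
  unfolding matrix_vector_mult_def graph_vec_def lower_block_def
  by (simp add: sum_UNIV_sum sum.distrib[symmetric] algebra_simps)

lemma hf_self: "hf z z = (\<Sum>i\<in>UNIV. (z $ Inl i)\<^sup>2) - (\<Sum>i\<in>UNIV. (z $ Inr i)\<^sup>2)"
  unfolding hf_sum by (simp add: power2_eq_square)

text \<open>The image of an isotropic graph under \<open>g\<close> is isotropic, so the positive and
  negative parts of a vector in it have equal length: if one vanishes, so does the other.\<close>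

lemma block_nonsingular:
  assumes g: "g \<in> SO_nn" and s: "\<And>j. s j * s j = 1"
  shows "det (upper_block s g) \<noteq> 0" "det (lower_block s g) \<noteq> 0"
proof -
  have iso: "isometry g" using g SO_nn_iff by blast
  have s2: "(s j)\<^sup>2 = 1" for j using s by (simp add: power2_eq_square)
  have null: "v = 0" if "(\<forall>i. (upper_block s g *v v) $ i = 0) \<or> (\<forall>i. (lower_block s g *v v) $ i = 0)" for v
  proof -
    define z where "z = g *v graph_vec s v"
    have "hf z z = hf (graph_vec s v) (graph_vec s v)" using iso unfolding isometry_def z_def by simp
    also have "\<dots> = 0" unfolding hf_self graph_vec_def by (simp add: power_mult_distrib s2)
    finally have eq: "(\<Sum>i\<in>UNIV. (z $ Inl i)\<^sup>2) = (\<Sum>i\<in>UNIV. (z $ Inr i)\<^sup>2)" unfolding hf_self by simp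
    have "(\<forall>i. z $ Inl i = 0) \<or> (\<forall>i. z $ Inr i = 0)"
      using that unfolding z_def upper_block_vec lower_block_vec .
    then have "(\<Sum>i\<in>UNIV. (z $ Inl i)\<^sup>2) = 0 \<and> (\<Sum>i\<in>UNIV. (z $ Inr i)\<^sup>2) = 0"
    proof
      assume "\<forall>i. z $ Inl i = 0"
      then have "(\<Sum>i\<in>UNIV. (z $ Inl i)\<^sup>2) = 0" by simp
      then show ?thesis using eq by simp
    next
      assume "\<forall>i. z $ Inr i = 0"
      then have "(\<Sum>i\<in>UNIV. (z $ Inr i)\<^sup>2) = 0" by simp
      then show ?thesis using eq by simp
    qed
    then have "z $ Inl i = 0" "z $ Inr i = 0" for i
      using sum_nonneg_eq_0_iff[of UNIV "\<lambda>i. (z $ Inl i)\<^sup>2"] sum_nonneg_eq_0_iff[of UNIV "\<lambda>i. (z $ Inr i)\<^sup>2"] by auto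
    then have "z = 0" by (simp add: vec_eq_iff) (metis sumE)
    then have "matrix_inv g *v z = 0" by simp
    then have "graph_vec s v = 0" unfolding z_def using matrix_inv_mult(4) isometry_inverse(1)[OF iso] by metis
    then show "v = 0" unfolding graph_vec_def vec_eq_iff by (metis (mono_tags, lifting) sum.case(1) vec_lambda_beta zero_index)
  qed
  then have "upper_block s g *v v = 0 \<Longrightarrow> v = 0" "lower_block s g *v v = 0 \<Longrightarrow> v = 0" for v by auto
  then have "invertible (upper_block s g)" "invertible (lower_block s g)"
    unfolding invertible_left_inverse matrix_left_invertible_ker by blast+
  then show "det (upper_block s g) \<noteq> 0" "det (lower_block s g) \<noteq> 0" by (simp_all add: invertible_det_nz)
qed

lemma continuous_on_upper_block: "continuous_on T (upper_block s)"
  unfolding upper_block_def by (intro continuous_intros)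

lemma continuous_on_lower_block: "continuous_on T (lower_block s)"
  unfolding lower_block_def by (intro continuous_intros)

lemma connected_pos:
  fixes f :: "'a::topological_space \<Rightarrow> real"
  assumes "connected T" "continuous_on T f" "\<And>x. x \<in> T \<Longrightarrow> f x \<noteq> 0" "a \<in> T" "b \<in> T" "f a > 0"
  shows "f b > 0"
proof (rule ccontr)
  assume "\<not> f b > 0"
  moreover have "connected (f ` T)" using assms by (intro connected_continuous_image)
  ultimately have "0 \<in> f ` T" using connectedD_interval[of "f ` T" "f b" "f a" 0] assms by auto
  then show False using assms(3) by auto
qed

text \<open>A nonvanishing determinant keeps its sign on a connected set, and at the identity the
  two blocks are \<open>mat 1\<close> and the diagonal matrix of \<open>s\<close>.\<close>

lemma block_sign:
  assumes g: "g \<in> SO0_nn" and s: "\<And>j. s j * s j = 1"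
  shows "det (upper_block s g) > 0" "det (lower_block s g) * (\<Prod>j\<in>UNIV. s j) > 0"
proof -
  obtain T where T: "connected T" "T \<subseteq> SO_nn" "mat 1 \<in> T" "g \<in> T" using g by (rule SO0_E)
  have "(\<Prod>j\<in>UNIV. s j) * (\<Prod>j\<in>UNIV. s j) = 1" by (simp add: prod.distrib[symmetric] s)
  then have p: "(\<Prod>j\<in>UNIV. s j) \<noteq> 0" "(\<Prod>j\<in>UNIV. s j) * (\<Prod>j\<in>UNIV. s j) > 0"
    by (metis mult_zero_left zero_neq_one, metis zero_less_one)
  have "upper_block s (mat 1) = mat 1" unfolding upper_block_def mat_def by (simp add: vec_eq_iff)
  moreover have "det (upper_block s A) \<noteq> 0" if "A \<in> T" for A using block_nonsingular(1) T that s by blast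
  ultimately show "det (upper_block s g) > 0"
    by (intro connected_pos[OF T(1) _ _ T(3,4), of "\<lambda>g. det (upper_block s g)"] continuous_intros continuous_on_upper_block) auto
  have "det (lower_block s (mat 1)) = (\<Prod>j\<in>UNIV. lower_block s (mat 1) $ j $ j)"
    by (rule det_diagonal) (simp add: lower_block_def mat_def)
  also have "\<dots> = (\<Prod>j\<in>UNIV. s j)" by (simp add: lower_block_def mat_def)
  finally have "det (lower_block s (mat 1)) * (\<Prod>j\<in>UNIV. s j) > 0" using p by simp
  moreover have "det (lower_block s A) * (\<Prod>j\<in>UNIV. s j) \<noteq> 0" if "A \<in> T" for A using block_nonsingular(2) T that s p by auto
  ultimately show "det (lower_block s g) * (\<Prod>j\<in>UNIV. s j) > 0"
    by (intro connected_pos[OF T(1) _ _ T(3,4), of "\<lambda>g. det (lower_block s g) * (\<Prod>j\<in>UNIV. s j)"] continuous_intros continuous_on_lower_block) auto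
qed

text \<open>Landing in the graph of \<open>s'\<close> makes the lower block equal to the diagonal
  matrix of \<open>s'\<close> times the upper block; the signs from \<open>block_sign\<close> then
  compare the two products.\<close>

lemma sign_graph_type:
  assumes g: "g \<in> SO0_nn" and s: "\<And>j. s j * s j = 1" "\<And>j. s' j * s' j = 1"
    and sub: "(*v) g ` sign_graph s \<subseteq> sign_graph s'"
  shows "(\<Prod>j\<in>UNIV. s j) * (\<Prod>j\<in>UNIV. s' j) > 0"
proof -
  define D :: "real^'a^'a" where "D = (\<chi> i j. if i = j then s' i else 0)"
  have "lower_block s g *v v = D *v (upper_block s g *v v)" for v
  proof -
    have "graph_vec s v \<in> sign_graph s" unfolding sign_graph_def graph_vec_def by simp
    then have "g *v graph_vec s v \<in> sign_graph s'" using sub by auto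
    then have "\<forall>j. (lower_block s g *v v) $ j = s' j * (upper_block s g *v v) $ j"
      unfolding sign_graph_def by (simp add: upper_block_vec lower_block_vec)
    moreover have "(D *v w) $ j = s' j * w $ j" for w j
      unfolding D_def matrix_vector_mult_def by (simp add: if_distrib if_distribR cong: if_cong)
    ultimately show ?thesis by (simp add: vec_eq_iff)
  qed
  then have "lower_block s g = D ** upper_block s g" by (simp add: matrix_eq flip: matrix_vector_mul_assoc)
  moreover have "det D = (\<Prod>j\<in>UNIV. s' j)" unfolding D_def by (subst det_diagonal) auto
  ultimately have "(\<Prod>j\<in>UNIV. s' j) * det (upper_block s g) * (\<Prod>j\<in>UNIV. s j) > 0"
    using block_sign(2)[of g s, OF g s(1)] by (simp add: det_mul)
  then have "det (upper_block s g) * ((\<Prod>j\<in>UNIV. s j) * (\<Prod>j\<in>UNIV. s' j)) > 0" by (simp add: mult_ac)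
  then show ?thesis using block_sign(1)[of g s, OF g s(1)] by (simp add: zero_less_mult_iff)
qed

section \<open>The model flags and their stabilizers\<close>

type_synonym 'm nvec = "real^('m option + 'm option)"
type_synonym 'm nmat = "('m option + 'm option) matrix"

definition W_model :: "real \<Rightarrow> 'm::finite nvec set" where
  "W_model \<sigma> = {z. z $ Inl None = 0 \<and> z $ Inr None = 0 \<and> (\<forall>j. z $ Inr (Some j) = \<sigma> * z $ Inl (Some j))}"

text \<open>For \<open>eps\<close> equal to 1 and -1 these are the two maximal isotropic subspaces
  containing \<open>W_model 1\<close>; each adds the null line of
  \<open>null_vec eps\<close>.\<close>

definition V_model :: "real \<Rightarrow> 'm::finite nvec set" where
  "V_model eps = {z. z $ Inr None = eps * z $ Inl None \<and> (\<forall>j. z $ Inr (Some j) = z $ Inl (Some j))}"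

definition null_vec :: "real \<Rightarrow> 'm::finite nvec" where
  "null_vec eps = axis (Inl None) 1 + eps *\<^sub>R axis (Inr None) 1"

lemma UNIV_option_sum: "(\<Sum>i\<in>(UNIV :: 'a::finite option set). f i) = f None + (\<Sum>i\<in>UNIV. f (Some i))"
  unfolding UNIV_option_conv by (subst sum.insert) (auto simp: sum.reindex)

lemma UNIV_option_prod: "(\<Prod>i\<in>(UNIV :: 'a::finite option set). f i) = f None * (\<Prod>i\<in>UNIV. f (Some i))"
  unfolding UNIV_option_conv by (subst prod.insert) (auto simp: prod.reindex)

lemma hf_option: "hf v w = v $ Inl None * w $ Inl None - v $ Inr None * w $ Inr None
    + (\<Sum>i\<in>UNIV. v $ Inl (Some i) * w $ Inl (Some i) - v $ Inr (Some i) * w $ Inr (Some i))"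
  unfolding hf_sum UNIV_option_sum by (simp add: sum_subtractf)

lemma isotropic_basis_nth:
  "isotropic_basis \<sigma> j $ Inl None = 0" "isotropic_basis \<sigma> j $ Inr None = 0"
  "isotropic_basis \<sigma> j $ Inl (Some i) = (if i = j then 1 else 0)"
  "isotropic_basis \<sigma> j $ Inr (Some i) = (if i = j then \<sigma> else 0)"
  unfolding isotropic_basis_def by (auto simp: axis_def)

lemma null_vec_nth:
  "null_vec eps $ Inl None = 1" "null_vec eps $ Inr None = eps" "null_vec eps $ Inl (Some i) = 0" "null_vec eps $ Inr (Some i) = 0"
  unfolding null_vec_def by (auto simp: axis_def)

lemma vec_eq_option: "(v :: 'm::finite nvec) = w \<longleftrightarrow> v $ Inl None = w $ Inl None \<and> v $ Inr None = w $ Inr None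
    \<and> (\<forall>i. v $ Inl (Some i) = w $ Inl (Some i)) \<and> (\<forall>i. v $ Inr (Some i) = w $ Inr (Some i))"
  unfolding vec_eq_iff by (metis not_Some_eq sumE)

lemma subspace_W_model: "subspace (W_model \<sigma>)"
  unfolding W_model_def subspace_def by (auto simp: algebra_simps)

lemma subspace_V_model: "subspace (V_model eps)"
  unfolding V_model_def subspace_def by (auto simp: algebra_simps)

lemma isotropic_basis_expand: "(\<Sum>j\<in>UNIV. c j *\<^sub>R isotropic_basis \<sigma> j) $ Inl None = 0"
  "(\<Sum>j\<in>UNIV. c j *\<^sub>R isotropic_basis \<sigma> j) $ Inr None = 0"
  "(\<Sum>j\<in>UNIV. c j *\<^sub>R isotropic_basis \<sigma> j) $ Inl (Some i) = c i"
  "(\<Sum>j\<in>UNIV. c j *\<^sub>R isotropic_basis \<sigma> j) $ Inr (Some i) = \<sigma> * c i"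
  by (simp_all add: isotropic_basis_nth if_distrib cong: if_cong)

lemma W_model_expand: "w \<in> W_model \<sigma> \<Longrightarrow> w = (\<Sum>j\<in>UNIV. (w $ Inl (Some j)) *\<^sub>R isotropic_basis \<sigma> j)"
  unfolding vec_eq_option isotropic_basis_expand W_model_def by auto

lemma isotropic_basis_W: "isotropic_basis \<sigma> j \<in> W_model \<sigma>"
  unfolding W_model_def by (auto simp: isotropic_basis_nth)

lemma span_isotropic_basis: "span (range (isotropic_basis \<sigma>)) = W_model \<sigma>"
proof
  show "span (range (isotropic_basis \<sigma>)) \<subseteq> W_model \<sigma>"
    by (rule span_minimal) (auto simp: isotropic_basis_W subspace_W_model)
  show "W_model \<sigma> \<subseteq> span (range (isotropic_basis \<sigma>))"
  proof
    fix w assume "w \<in> W_model \<sigma>"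
    show "w \<in> span (range (isotropic_basis \<sigma>))"
      by (subst W_model_expand[OF \<open>w \<in> W_model \<sigma>\<close>]) (intro span_sum span_scale span_base rangeI)
  qed
qed

lemma V_model_decomp: "z \<in> V_model eps \<longleftrightarrow> (\<exists>w\<in>W_model 1. \<exists>c. z = w + c *\<^sub>R null_vec eps)"
proof
  assume z: "z \<in> V_model eps"
  define w where "w = z - (z $ Inl None) *\<^sub>R null_vec eps"
  have "w \<in> W_model 1" using z unfolding w_def W_model_def V_model_def by (auto simp: null_vec_nth)
  then show "\<exists>w\<in>W_model 1. \<exists>c. z = w + c *\<^sub>R null_vec eps" unfolding w_def by (metis diff_add_cancel)
qed (auto simp: W_model_def V_model_def null_vec_nth)

definition type_sign :: "real \<Rightarrow> 'm option \<Rightarrow> real" where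
  "type_sign eps j = (case j of None \<Rightarrow> eps | Some _ \<Rightarrow> 1)"

lemma V_model_sign_graph: "V_model eps = sign_graph (type_sign eps)"
  unfolding V_model_def sign_graph_def type_sign_def by (auto split: option.split)

lemma oriented_span_self: "b \<in> oriented_span b"
proof -
  have "b = (\<lambda>i. \<Sum>j\<in>UNIV. ((mat 1 :: real^'a^'a) $ i $ j) *\<^sub>R b j)"
    unfolding mat_def by (auto simp: fun_eq_iff if_distrib[of "\<lambda>x. x *\<^sub>R _"] cong: if_cong)
  moreover have "0 < det (mat 1 :: real^'a^'a)" by simp
  ultimately show ?thesis unfolding oriented_span_def by blast
qed

lemma matrix_subgroup_stabilizer:
  assumes H: "matrix_subgroup H" and one: "\<phi> (mat 1) x = x" and mult: "\<And>A B. \<phi> (A ** B) x = \<phi> A (\<phi> B x)"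
  shows "matrix_subgroup (stabilizer (matrix_group H) \<phi> x)"
  unfolding matrix_subgroup_def stabilizer_matrix_group
proof (intro conjI ballI)
  fix A assume A: "A \<in> {g \<in> H. \<phi> g x = x}"
  then show inv: "invertible A" using matrix_subgroupD(3)[OF H] by blast
  have "\<phi> (matrix_inv A) x = \<phi> (matrix_inv A ** A) x" using A mult by simp
  also have "\<dots> = x" using matrix_inv_mult(2)[OF inv] one by simp
  finally show "matrix_inv A \<in> {g \<in> H. \<phi> g x = x}" using A matrix_subgroupD(4)[OF H] by blast
qed (use matrix_subgroupD[OF H] one mult in auto)

lemma matrix_subgroup_stabilizer_oriented:
  "matrix_subgroup H \<Longrightarrow> matrix_subgroup (stabilizer_oriented H W)"
  unfolding stabilizer_oriented_def
  by (rule matrix_subgroup_stabilizer) (auto simp: image_image matrix_vector_mul_assoc)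

lemma matrix_subgroup_stabilizer_subspace:
  "matrix_subgroup H \<Longrightarrow> matrix_subgroup (stabilizer_subspace H V)"
  unfolding stabilizer_subspace_def
  by (rule matrix_subgroup_stabilizer) (auto simp: image_image matrix_vector_mul_assoc)

lemma matrix_subgroup_SL: "matrix_subgroup SL"
  unfolding matrix_subgroup_def SL_def
proof (intro conjI ballI)
  fix A :: "real^'a^'a" assume A: "A \<in> {A. det A = 1}"
  then show inv: "invertible A" by (simp add: invertible_det_nz)
  have "det A * det (matrix_inv A) = 1" by (metis det_I det_mul matrix_inv_mult(1)[OF inv])
  then show "matrix_inv A \<in> {A. det A = 1}" using A by simp
qed (auto simp: det_mul)

lemma subgroup_image_eq:
  assumes P: "matrix_subgroup P" and sub: "\<And>u. u \<in> P \<Longrightarrow> (*v) u ` U \<subseteq> U" and u: "u \<in> P"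
  shows "(*v) u ` U = U"
proof
  show "U \<subseteq> (*v) u ` U"
  proof
    fix z assume "z \<in> U"
    then have "matrix_inv u *v z \<in> U" using sub[OF matrix_subgroupD(4)[OF P u]] by auto
    then show "z \<in> (*v) u ` U" using matrix_inv_mult(3)[OF matrix_subgroupD(3)[OF P u], of z] by (metis imageI)
  qed
qed (rule sub[OF u])

lemma stabilizer_oriented_span:
  assumes "u \<in> stabilizer_oriented H (oriented_span b)"
  shows "u \<in> H" "\<exists>M. 0 < det M \<and> (\<forall>i. u *v b i = (\<Sum>j\<in>UNIV. (M $ i $ j) *\<^sub>R b j))"
proof -
  have u: "u \<in> H" "(\<lambda>b i. u *v b i) ` oriented_span b = oriented_span b"
    using assms unfolding stabilizer_oriented_def stabilizer_matrix_group by auto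
  then show "u \<in> H" by blast
  have "(\<lambda>i. u *v b i) \<in> oriented_span b" using u(2) oriented_span_self by blast
  then show "\<exists>M. 0 < det M \<and> (\<forall>i. u *v b i = (\<Sum>j\<in>UNIV. (M $ i $ j) *\<^sub>R b j))"
    unfolding oriented_span_def by (auto simp: fun_eq_iff)
qed

text \<open>Applying \<open>u\<close> multiplies the coefficient matrix of a basis by
  \<open>M\<close> on the right, which permutes the matrices of positive determinant.\<close>

lemma stabilizer_oriented_I:
  fixes b :: "'i::finite \<Rightarrow> real^'k::finite"
  assumes u: "u \<in> H" and M: "0 < det M" "\<And>i. u *v b i = (\<Sum>j\<in>UNIV. (M $ i $ j) *\<^sub>R b j)"
  shows "u \<in> stabilizer_oriented H (oriented_span b)"
proof -
  have mv: "u *v (\<Sum>j\<in>UNIV. (A $ i $ j) *\<^sub>R b j) = (\<Sum>j\<in>UNIV. ((A ** M) $ i $ j) *\<^sub>R b j)" for A :: "real^'i^'i" and i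
  proof -
    have "u *v (\<Sum>j\<in>UNIV. (A $ i $ j) *\<^sub>R b j) = (\<Sum>j\<in>UNIV. (A $ i $ j) *\<^sub>R (u *v b j))"
      by (simp add: linear_sum[OF matrix_vector_mul_linear] comp_def matrix_vector_mult_scaleR)
    also have "\<dots> = (\<Sum>j\<in>UNIV. \<Sum>l\<in>UNIV. (A $ i $ j * M $ j $ l) *\<^sub>R b l)"
      unfolding M(2) by (simp add: scaleR_sum_right)
    also have "\<dots> = (\<Sum>l\<in>UNIV. \<Sum>j\<in>UNIV. (A $ i $ j * M $ j $ l) *\<^sub>R b l)" by (rule sum.swap)
    also have "\<dots> = (\<Sum>j\<in>UNIV. ((A ** M) $ i $ j) *\<^sub>R b j)"
      by (simp add: matrix_matrix_mult_def scaleR_sum_left)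
    finally show ?thesis .
  qed
  have inv: "invertible M" using M(1) by (simp add: invertible_det_nz)
  have "(\<lambda>b i. u *v b i) ` oriented_span b = oriented_span b"
  proof
    show "(\<lambda>b i. u *v b i) ` oriented_span b \<subseteq> oriented_span b"
    proof
      fix x assume "x \<in> (\<lambda>b i. u *v b i) ` oriented_span b"
      then obtain A :: "real^'i^'i" where A: "0 < det A" "x = (\<lambda>i. u *v (\<Sum>j\<in>UNIV. (A $ i $ j) *\<^sub>R b j))"
        unfolding oriented_span_def by auto
      have "0 < det (A ** M)" using A(1) M(1) by (simp add: det_mul)
      then show "x \<in> oriented_span b" unfolding A(2) mv oriented_span_def by blast
    qed
    show "oriented_span b \<subseteq> (\<lambda>b i. u *v b i) ` oriented_span b"
    proof
      fix x assume "x \<in> oriented_span b"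
      then obtain A :: "real^'i^'i" where A: "0 < det A" "x = (\<lambda>i. \<Sum>j\<in>UNIV. (A $ i $ j) *\<^sub>R b j)"
        unfolding oriented_span_def by auto
      define B where "B = A ** matrix_inv M"
      have BM: "B ** M = A" unfolding B_def by (simp add: matrix_inv_mult(2)[OF inv] flip: matrix_mul_assoc)
      have "det B * det M = det A" using BM det_mul by metis
      then have "0 < det B" using A(1) M(1) by (metis zero_less_mult_pos2)
      then have y: "(\<lambda>i. \<Sum>j\<in>UNIV. (B $ i $ j) *\<^sub>R b j) \<in> oriented_span b" unfolding oriented_span_def by blast
      have x: "x = (\<lambda>i. u *v (\<Sum>j\<in>UNIV. (B $ i $ j) *\<^sub>R b j))" unfolding mv BM A(2) ..
      show "x \<in> (\<lambda>b i. u *v b i) ` oriented_span b"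
        by (rule image_eqI[where f = "\<lambda>b i. u *v b i", OF _ y]) (rule x)
    qed
  qed
  then show ?thesis using u unfolding stabilizer_oriented_def stabilizer_matrix_group by simp
qed

lemma matrix_subgroup_P_plus: "matrix_subgroup P_plus"
  unfolding P_plus_def by (rule matrix_subgroup_stabilizer_oriented[OF matrix_subgroup_SO0])

lemma matrix_subgroup_P_minus: "matrix_subgroup P_minus"
  unfolding P_minus_def by (rule matrix_subgroup_stabilizer_oriented[OF matrix_subgroup_SO0])

lemma P_plus_SO0: "P_plus \<subseteq> SO0_nn"
  unfolding P_plus_def using stabilizer_oriented_span(1) by blast

lemma P_minus_SO0: "P_minus \<subseteq> SO0_nn"
  unfolding P_minus_def using stabilizer_oriented_span(1) by blast

lemma stabilizer_oriented_W_model: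
  assumes "u \<in> stabilizer_oriented H (oriented_span (isotropic_basis \<sigma>))"
  shows "(*v) u ` W_model \<sigma> \<subseteq> W_model \<sigma>"
proof
  obtain M where M: "\<And>i. u *v isotropic_basis \<sigma> i = (\<Sum>j\<in>UNIV. (M $ i $ j) *\<^sub>R isotropic_basis \<sigma> j)"
    using stabilizer_oriented_span(2)[OF assms] by blast
  have "u *v isotropic_basis \<sigma> i \<in> W_model \<sigma>" for i
    unfolding M by (intro subspace_sum subspace_scale subspace_W_model isotropic_basis_W)
  then have "(*v) u ` range (isotropic_basis \<sigma>) \<subseteq> W_model \<sigma>" by auto
  then have "span ((*v) u ` range (isotropic_basis \<sigma>)) \<subseteq> W_model \<sigma>"
    by (rule span_minimal) (rule subspace_W_model)
  moreover have "span ((*v) u ` range (isotropic_basis \<sigma>)) = (*v) u ` span (range (isotropic_basis \<sigma>))"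
    by (rule linear_span_image) simp
  ultimately show "z \<in> (*v) u ` W_model \<sigma> \<Longrightarrow> z \<in> W_model \<sigma>" for z
    unfolding span_isotropic_basis by blast
qed

lemma P_plus_W: "u \<in> P_plus \<Longrightarrow> (*v) u ` W_model 1 = W_model 1"
  by (rule subgroup_image_eq[OF matrix_subgroup_P_plus]) (auto simp: P_plus_def dest: stabilizer_oriented_W_model)

lemma P_minus_W: "u \<in> P_minus \<Longrightarrow> (*v) u ` W_model (-1) = W_model (-1)"
  by (rule subgroup_image_eq[OF matrix_subgroup_P_minus]) (auto simp: P_minus_def dest: stabilizer_oriented_W_model)

lemma hf_isotropic_basis: "hf z (isotropic_basis \<sigma> j) = z $ Inl (Some j) - \<sigma> * z $ Inr (Some j)"
proof -
  have "(\<Sum>i\<in>UNIV. z $ Inl (Some i) * (if i = j then 1 else 0) - z $ Inr (Some i) * (if i = j then \<sigma> else 0))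
      = (\<Sum>i\<in>UNIV. if i = j then z $ Inl (Some j) - \<sigma> * z $ Inr (Some j) else 0)"
    by (intro sum.cong) auto
  then show ?thesis by (simp add: hf_option isotropic_basis_nth)
qed

lemma hf_null_vec: "hf z (null_vec eps) = z $ Inl None - eps * z $ Inr None"
  by (simp add: hf_option null_vec_nth)

lemma W_model_subset_V: "W_model 1 \<subseteq> V_model eps"
  unfolding W_model_def V_model_def by auto

text \<open>The image of the added null vector is isotropic and orthogonal to
  \<open>W_model 1\<close>, so the two maximal isotropic subspaces are either kept or exchanged. An
  exchange would change the type, against \<open>sign_graph_type\<close>.\<close>

lemma P_plus_V:
  assumes u: "u \<in> P_plus" and eps: "eps = 1 \<or> eps = -1"
  shows "(*v) u ` V_model eps = V_model eps"
proof (rule subgroup_image_eq[OF matrix_subgroup_P_plus _ u])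
  fix u :: "'a nmat" assume u: "u \<in> P_plus"
  have iso: "isometry u" and SO0: "u \<in> SO0_nn" using u P_plus_SO0 SO0_isometry by auto
  have e2: "eps * eps = 1" using eps by auto
  define y where "y = u *v null_vec eps"
  have "hf y y = hf (null_vec eps :: 'a nvec) (null_vec eps)" using iso unfolding isometry_def y_def by simp
  then have yy: "hf y y = 0" by (simp add: hf_null_vec null_vec_nth e2)
  have Some: "y $ Inr (Some j) = y $ Inl (Some j)" for j
  proof -
    have "isotropic_basis 1 j \<in> (*v) u ` W_model 1" using P_plus_W[OF u] isotropic_basis_W by blast
    then obtain w where w: "w \<in> W_model 1" "isotropic_basis 1 j = u *v w" by auto
    have "hf y (isotropic_basis 1 j) = hf w (null_vec eps)"
      unfolding w(2) y_def using iso hf_sym unfolding isometry_def by metis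
    also have "\<dots> = 0" using w(1) unfolding W_model_def hf_null_vec by simp
    finally show ?thesis by (simp add: hf_isotropic_basis)
  qed
  have "y $ Inl None * y $ Inl None = y $ Inr None * y $ Inr None"
    using yy unfolding hf_option by (simp add: Some)
  then have "y $ Inr None = eps * y $ Inl None \<or> y $ Inr None = - eps * y $ Inl None"
    using eps square_eq_iff[of "y $ Inr None" "y $ Inl None"] by auto
  then have y: "y \<in> V_model eps \<or> y \<in> V_model (- eps)" using Some unfolding V_model_def by auto
  have sub: "(*v) u ` V_model eps \<subseteq> V_model eps'" if "y \<in> V_model eps'" for eps'
  proof
    fix z assume "z \<in> (*v) u ` V_model eps"
    then obtain z' where z': "z' \<in> V_model eps" "z = u *v z'" by auto
    then obtain w c where w: "w \<in> W_model 1" "z = u *v (w + c *\<^sub>R null_vec eps)"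
      using V_model_decomp[of z' eps] by auto
    have "u *v w \<in> V_model eps'" using w(1) P_plus_W[OF u] W_model_subset_V by blast
    then show "z \<in> V_model eps'" unfolding w(2) using that
      by (auto simp: matrix_vector_right_distrib matrix_vector_mult_scaleR y_def intro!: subspace_add[OF subspace_V_model] subspace_scale[OF subspace_V_model])
  qed
  have "y \<notin> V_model (- eps)"
  proof
    assume "y \<in> V_model (- eps)"
    then have s: "(*v) u ` sign_graph (type_sign eps) \<subseteq> sign_graph (type_sign (- eps))"
      using sub unfolding V_model_sign_graph by blast
    have "(\<Prod>j\<in>UNIV. type_sign eps (j :: 'a option)) * (\<Prod>j\<in>UNIV. type_sign (- eps) (j :: 'a option)) > 0"
      by (rule sign_graph_type[OF SO0 _ _ s]) (auto simp: type_sign_def e2 split: option.split)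
    then show False by (simp add: UNIV_option_prod type_sign_def e2)
  qed
  then show "(*v) u ` V_model eps \<subseteq> V_model eps" using y sub by blast
qed

text \<open>Attaches a subspace to a coset without choosing a representative; this is sound when the
  subgroup preserves \<open>U\<close>, since then all representatives give the same image.\<close>

definition orbit_sp :: "'k::finite matrix set \<Rightarrow> (real^'k) set \<Rightarrow> (real^'k) set" where
  "orbit_sp x U = (\<Union>g\<in>x. (*v) g ` U)"

lemma orbit_sp_translate: 
  assumes "matrix_subgroup P" "\<And>u. u \<in> P \<Longrightarrow> (*v) u ` U = U"
  shows "orbit_sp (translate h P) U = (*v) h ` U"
proof -
  have "(*v) (h ** u) ` U = (*v) h ` U" if "u \<in> P" for u
  proof -
    have "(*v) (h ** u) ` U = (*v) h ` ((*v) u ` U)" by (simp add: image_image matrix_vector_mul_assoc)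
    then show ?thesis using assms(2)[OF that] by simp
  qed
  moreover have "orbit_sp (translate h P) U = (\<Union>u\<in>P. (*v) (h ** u) ` U)"
    unfolding orbit_sp_def translate_def by blast
  moreover have "P \<noteq> {}" using matrix_subgroupD(1)[OF assms(1)] by blast
  ultimately show ?thesis by simp
qed

lemma orbit_sp_equivariant: "orbit_sp (translate A x) U = (*v) A ` orbit_sp x U"
  unfolding orbit_sp_def translate_def by (simp add: image_UN image_image matrix_vector_mul_assoc)

lemma derivative_in_subspace:
  fixes f :: "real \<Rightarrow> 'a::euclidean_space"
  assumes S: "subspace S" and f: "(f has_vector_derivative D) (at 0)" "\<And>t. f t \<in> S"
  shows "D \<in> S"
proof -
  have "y \<bullet> D = 0" if y: "y \<in> orthogonal_comp S" for y
  proof -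
    have "((\<lambda>t. y \<bullet> f t) has_vector_derivative y \<bullet> D) (at 0)"
      by (rule bounded_linear.has_vector_derivative[OF bounded_linear_inner_right f(1)])
    moreover have "y \<bullet> f t = 0" for t using y f(2)[of t] unfolding orthogonal_comp_def orthogonal_def by (metis (mono_tags) inner_commute mem_Collect_eq)
    ultimately show ?thesis using vector_derivative_unique_at[OF _ has_vector_derivative_const] by simp
  qed
  then have "D \<in> orthogonal_comp (orthogonal_comp S)" by (simp add: orthogonal_comp_def orthogonal_def inner_commute)
  then show ?thesis by (simp add: orthogonal_comp_self S)
qed

lemma has_vector_derivative_matrix_vector:
  fixes c :: "real \<Rightarrow> real^'n::finite^'m::finite"
  assumes "(c has_vector_derivative X) (at t)"
  shows "((\<lambda>t. c t *v z) has_vector_derivative X *v z) (at t)"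
  using bounded_linear.has_vector_derivative[OF bounded_bilinear.bounded_linear_left[OF bounded_bilinear_matrix_vector] assms] .

lemma isotropy_algebra_preserves:
  assumes X: "X \<in> isotropy_algebra H x" and U: "subspace (orbit_sp x U)" and z: "z \<in> orbit_sp x U"
  shows "X *v z \<in> orbit_sp x U"
proof -
  obtain c where c: "\<And>t. c t \<in> stabilizer (matrix_group H) translate x" "(c has_vector_derivative X) (at 0)"
    using X unfolding isotropy_algebra_def lie_algebra_def by blast
  show ?thesis
  proof (rule derivative_in_subspace[OF U has_vector_derivative_matrix_vector[OF c(2)]])
    fix t
    have "translate (c t) x = x" using c(1) unfolding stabilizer_matrix_group by blast
    then have "(*v) (c t) ` orbit_sp x U = orbit_sp x U" using orbit_sp_equivariant by metis
    then show "c t *v z \<in> orbit_sp x U" using z by blast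
  qed
qed

text \<open>Pulled back by the convergent representatives, the vectors lie in one fixed closed
  subspace.\<close>

lemma orbit_sp_closed:
  assumes P: "matrix_subgroup P" "\<And>u. u \<in> P \<Longrightarrow> (*v) u ` U = U" and U: "subspace U"
    and g: "g \<longlonglongrightarrow> h" "\<And>k. invertible (g k)" "invertible h"
    and v: "v \<longlonglongrightarrow> w" "\<forall>\<^sub>F k in sequentially. v k \<in> orbit_sp (x k) U"
    and x: "\<forall>\<^sub>F k in sequentially. x k = translate (g k) P"
  shows "w \<in> orbit_sp (translate h P) U"
proof -
  have "(\<lambda>k. matrix_inv (g k) *v v k) \<longlonglongrightarrow> matrix_inv h *v w"
    by (intro tendsto_intros tendsto_matrix_inv g v)
  moreover have "\<forall>\<^sub>F k in sequentially. matrix_inv (g k) *v v k \<in> U"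
    using v(2) x
  proof eventually_elim
    case (elim k)
    then obtain u where "u \<in> U" "v k = g k *v u" using orbit_sp_translate[OF P] by auto
    then show ?case using matrix_inv_mult(4)[OF g(2)] by simp
  qed
  ultimately have "matrix_inv h *v w \<in> U"
    using Lim_in_closed_set[OF closed_subspace[OF U]] by (metis sequentially_bot)
  then have "h *v (matrix_inv h *v w) \<in> (*v) h ` U" by (rule imageI)
  then show ?thesis using orbit_sp_translate[OF P, of h] matrix_inv_mult(3)[OF g(3), of w] by simp
qed

text \<open>The orthogonal space of \<open>U\<close> has dimension 2n - n = n and contains
  \<open>U\<close>, hence equals it.\<close>

lemma lagrangian_orthogonal:
  fixes U :: "(real^('n::finite + 'n)) set"
  assumes U: "subspace U" "dim U = CARD('n)" and iso: "\<And>u v. u \<in> U \<Longrightarrow> v \<in> U \<Longrightarrow> hf u v = 0"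
    and w: "\<And>u. u \<in> U \<Longrightarrow> hf w u = 0"
  shows "w \<in> U"
proof -
  define Orth where "Orth = {y \<in> UNIV. \<forall>x\<in>(*v) I_nn ` U. orthogonal x y}"
  have inj: "inj ((*v) (I_nn :: ('n + 'n) matrix))" by (rule inj_on_inverseI[of _ "(*v) I_nn"]) simp
  have "dim ((*v) I_nn ` U) = dim U"
    by (rule dim_image_eq) (use inj in \<open>auto intro: inj_on_subset\<close>)
  moreover have "dim Orth + dim ((*v) I_nn ` U) = dim (UNIV :: (real^('n + 'n)) set)"
    unfolding Orth_def by (rule dim_subspace_orthogonal_to_vectors) (auto intro: linear_subspace_image U)
  ultimately have "dim Orth = dim U" using U(2) by (simp add: card_sum)
  moreover have mem: "y \<in> Orth \<longleftrightarrow> (\<forall>u\<in>U. hf y u = 0)" for y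
    unfolding Orth_def hf_def orthogonal_def by (auto simp: inner_commute)
  then have "U \<subseteq> Orth" using iso by auto
  moreover have "subspace Orth" unfolding subspace_def by (auto simp: mem hf_simps)
  ultimately have "U = Orth" using subspace_dim_equal U(1) by (metis order_refl)
  then show ?thesis using mem w by blast
qed

abbreviation "W_plus x \<equiv> orbit_sp x (W_model 1)"
abbreviation "W_minus y \<equiv> orbit_sp y (W_model (-1))"
abbreviation "V_plus eps x \<equiv> orbit_sp x (V_model eps)"

text \<open>Over a transverse pair, \<open>V_plus eps\<close> is \<open>W_plus\<close> plus a null
  line, and orthogonality to \<open>W_minus\<close> selects a canonical such line.\<close>

definition null_line :: "real \<Rightarrow> 'm::finite nmat set \<Rightarrow> 'm nmat set
    \<Rightarrow> 'm nvec set" where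
  "null_line eps x y = V_plus eps x \<inter> {z. \<forall>w\<in>W_minus y. hf z w = 0}"

lemma frame_W_plus: "W_plus (translate h P_plus) = (*v) h ` W_model 1"
  by (rule orbit_sp_translate[OF matrix_subgroup_P_plus P_plus_W])

lemma frame_W_minus: "W_minus (translate h P_minus) = (*v) h ` W_model (-1)"
  by (rule orbit_sp_translate[OF matrix_subgroup_P_minus P_minus_W])

lemma frame_V_plus: "eps = 1 \<or> eps = -1 \<Longrightarrow> V_plus eps (translate h P_plus) = (*v) h ` V_model eps"
  by (rule orbit_sp_translate[OF matrix_subgroup_P_plus P_plus_V])

lemma hf_W_W: "\<lbrakk>v \<in> W_model 1; w \<in> W_model 1\<rbrakk> \<Longrightarrow> hf v w = 0"
  unfolding W_model_def hf_option by simp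

lemma hf_V_V: "\<lbrakk>eps = 1 \<or> eps = -1; v \<in> V_model eps; w \<in> V_model eps\<rbrakk> \<Longrightarrow> hf v w = 0"
  unfolding V_model_def hf_option by auto

lemma frame_null_line:
  fixes h :: "'a::finite nmat"
  assumes h: "h \<in> SO0_nn" and eps: "eps = 1 \<or> eps = -1"
  shows "null_line eps (translate h P_plus) (translate h P_minus) = {c *\<^sub>R (h *v null_vec eps) | c. True}"
proof -
  have iso: "hf (h *v v) (h *v w) = hf v w" for v w using SO0_isometry[OF h] unfolding isometry_def by blast
  have "null_line eps (translate h P_plus) (translate h P_minus) = (*v) h ` {z \<in> V_model eps. \<forall>w\<in>W_model (-1). hf z w = 0}"
    unfolding null_line_def frame_V_plus[OF eps] frame_W_minus by (auto simp: iso)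
  also have "{z \<in> V_model eps. \<forall>w\<in>W_model (-1). hf z w = 0} = {c *\<^sub>R (null_vec eps :: 'a nvec) | c. True}"
  proof (intro Set.set_eqI iffI)
    fix z :: "'a nvec" assume "z \<in> {z \<in> V_model eps. \<forall>w\<in>W_model (-1). hf z w = 0}"
    then have z: "z \<in> V_model eps" "\<And>w. w \<in> W_model (-1) \<Longrightarrow> hf z w = 0" by auto
    have "z $ Inl (Some j) = 0" "z $ Inr (Some j) = 0" for j
      using z(2)[OF isotropic_basis_W[of "-1" j]] z(1) unfolding hf_isotropic_basis V_model_def by auto
    then have "z = (z $ Inl None) *\<^sub>R null_vec eps"
      using z(1) unfolding vec_eq_option V_model_def by (simp add: null_vec_nth)
    then show "z \<in> {c *\<^sub>R null_vec eps | c. True}" by blast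
  next
    fix z :: "'a nvec" assume "z \<in> {c *\<^sub>R null_vec eps | c. True}"
    then show "z \<in> {z \<in> V_model eps. \<forall>w\<in>W_model (-1). hf z w = 0}"
      by (auto simp: V_model_def W_model_def hf_option null_vec_nth)
  qed
  also have "(*v) h ` {c *\<^sub>R null_vec eps | c. True} = {c *\<^sub>R (h *v null_vec eps) | c. True}"
    by (auto simp: matrix_vector_mult_scaleR image_iff) (metis matrix_vector_mult_scaleR)
  finally show ?thesis .
qed

lemma transverse_pairs_frame:
  assumes "(x, y) \<in> transverse_pairs H P Q"
  obtains h where "h \<in> H" "x = translate h P" "y = translate h Q"
  using assms unfolding transverse_pairs_def by auto

text \<open>The sign of its determinant is the relative orientation of the two isotropic subspaces.
  It distinguishes a coset of \<open>P_minus\<close> from the one with the same subspace and the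
  opposite orientation.\<close>

definition gram :: "'m::finite nmat \<Rightarrow> 'm nmat \<Rightarrow> real^'m^'m" where
  "gram g g' = (\<chi> i j. hf (g *v isotropic_basis 1 i) (g' *v isotropic_basis (-1) j))"

lemma hf_sum_left: "hf (\<Sum>i\<in>I. f i) w = (\<Sum>i\<in>I. hf (f i) w)"
  by (rule bounded_bilinear.sum_left[OF bounded_bilinear_hf])

lemma hf_sum_right: "hf w (\<Sum>i\<in>I. f i) = (\<Sum>i\<in>I. hf w (f i))"
  by (rule bounded_bilinear.sum_right[OF bounded_bilinear_hf])

lemma gram_left:
  assumes "\<And>i. g *v isotropic_basis 1 i = (\<Sum>l\<in>UNIV. (M $ i $ l) *\<^sub>R (h *v isotropic_basis 1 l))"
  shows "gram g g' = M ** gram h g'"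
  unfolding gram_def assms matrix_matrix_mult_def by (simp add: hf_sum_left hf_simps vec_eq_iff)

lemma gram_right:
  assumes "\<And>i. g' *v isotropic_basis (-1) i = (\<Sum>l\<in>UNIV. (M $ i $ l) *\<^sub>R (h *v isotropic_basis (-1) l))"
  shows "gram g g' = gram g h ** transpose M"
  unfolding gram_def assms matrix_matrix_mult_def transpose_def by (simp add: hf_sum_right hf_simps vec_eq_iff mult.commute)

lemma gram_self:
  assumes "h \<in> SO0_nn" shows "det (gram h h :: real^'m::finite^'m) > 0"
proof -
  have "(gram h h :: real^'m^'m) = (\<chi> i j. if i = j then 2 else 0)"
    using SO0_isometry[OF assms] unfolding gram_def isometry_def hf_isotropic_basis
    by (auto simp: vec_eq_iff hf_isotropic_basis isotropic_basis_nth)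
  also have "det (\<chi> i j. if i = j then 2 else 0 :: real^'m^'m) = 2 ^ CARD('m)" by (subst det_diagonal) auto
  finally show ?thesis by simp
qed

lemma mult_expand:
  fixes h u :: "real^'k::finite^'k" and M :: "real^'i::finite^'i"
  assumes "\<And>i. u *v b i = (\<Sum>j\<in>UNIV. (M $ i $ j) *\<^sub>R b j)"
  shows "(h ** u) *v b i = (\<Sum>l\<in>UNIV. (M $ i $ l) *\<^sub>R (h *v b l))"
  unfolding matrix_vector_mul_assoc[symmetric] assms
  by (simp add: linear_sum[OF matrix_vector_mul_linear] comp_def matrix_vector_mult_scaleR)

lemma translate_eq_mult:
  assumes P: "matrix_subgroup P" and gh: "invertible g" "invertible h" and eq: "translate g P = translate h P"
  obtains u where "u \<in> P" "g = h ** u"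
proof
  show "matrix_inv h ** g \<in> P" using translate_eq_iff[OF P gh(2,1)] eq by simp
  show "g = h ** (matrix_inv h ** g)" by (simp add: matrix_mul_assoc matrix_inv_mult(1)[OF gh(2)])
qed

text \<open>Changes of oriented bases contribute factors of positive determinant, and in a common
  frame the matrix is twice the identity.\<close>

lemma gram_positive:
  assumes g: "g \<in> SO0_nn" "g' \<in> SO0_nn"
    and tr: "(translate g P_plus, translate g' P_minus) \<in> transverse_pairs SO0_nn P_plus P_minus"
  shows "det (gram g g') > 0"
proof -
  obtain h where h: "h \<in> SO0_nn" "translate g P_plus = translate h P_plus" "translate g' P_minus = translate h P_minus"
    using tr by (rule transverse_pairs_frame)
  obtain u where u: "u \<in> P_plus" "g = h ** u"
    using translate_eq_mult[OF matrix_subgroup_P_plus SO0_invertible[OF g(1)] SO0_invertible[OF h(1)] h(2)] .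
  obtain u' where u': "u' \<in> P_minus" "g' = h ** u'"
    using translate_eq_mult[OF matrix_subgroup_P_minus SO0_invertible[OF g(2)] SO0_invertible[OF h(1)] h(3)] .
  obtain M where M: "det M > 0" "\<And>i. u *v isotropic_basis 1 i = (\<Sum>j\<in>UNIV. (M $ i $ j) *\<^sub>R isotropic_basis 1 j)"
    using stabilizer_oriented_span(2) u(1) unfolding P_plus_def by blast
  obtain M' where M': "det M' > 0" "\<And>i. u' *v isotropic_basis (-1) i = (\<Sum>j\<in>UNIV. (M' $ i $ j) *\<^sub>R isotropic_basis (-1) j)"
    using stabilizer_oriented_span(2) u'(1) unfolding P_minus_def by blast
  have "gram g g' = M ** (gram h h ** transpose M')"
    unfolding u(2) u'(2) gram_left[OF mult_expand[OF M(2)]] gram_right[OF mult_expand[OF M'(2)]] by (simp add: matrix_mul_assoc)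
  then show ?thesis using M(1) M'(1) gram_self[OF h(1)] by (simp add: det_mul det_transpose)
qed

text \<open>The weak inequality is what survives a limit. It suffices, because the change of basis
  within the common subspace is invertible and so its determinant cannot vanish.\<close>

lemma gram_determines_orientation:
  assumes g: "g \<in> SO0_nn" "h \<in> SO0_nn" "g' \<in> SO0_nn"
    and tr: "(translate g P_plus, translate h P_minus) \<in> transverse_pairs SO0_nn P_plus P_minus"
    and W: "(*v) g' ` W_model (-1) = (*v) h ` W_model (-1)" and pos: "det (gram g g') \<ge> 0"
  shows "translate g' P_minus = translate h P_minus"
proof -
  define u where "u = matrix_inv h ** g'"
  have inv: "invertible h" "invertible g'" using g SO0_invertible by auto
  have g': "g' = h ** u" unfolding u_def by (simp add: matrix_mul_assoc matrix_inv_mult(1)[OF inv(1)])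
  have u0: "u \<in> SO0_nn" unfolding u_def using matrix_subgroupD[OF matrix_subgroup_SO0] g by blast
  have uW: "u *v z \<in> W_model (-1)" if "z \<in> W_model (-1)" for z
  proof -
    have "g' *v z \<in> (*v) h ` W_model (-1)" using W that by blast
    then obtain w where "w \<in> W_model (-1)" "g' *v z = h *v w" by auto
    then show ?thesis unfolding u_def using matrix_inv_mult(4)[OF inv(1)] by (simp flip: matrix_vector_mul_assoc)
  qed
  define M :: "real^'a^'a" where "M = (\<chi> i j. (u *v isotropic_basis (-1) i) $ Inl (Some j))"
  have M: "u *v isotropic_basis (-1) i = (\<Sum>j\<in>UNIV. (M $ i $ j) *\<^sub>R isotropic_basis (-1) j)" for i
    unfolding M_def using W_model_expand[OF uW[OF isotropic_basis_W]] by simp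
  have eq: "gram g g' = gram g h ** transpose M" unfolding g' gram_right[OF mult_expand[OF M]] ..
  have gh: "det (gram g h) > 0" by (rule gram_positive[OF g(1,2) tr])
  have "det M \<ge> 0" using pos gh unfolding eq by (simp add: det_mul det_transpose zero_le_mult_iff)
  moreover have "det M \<noteq> 0"
  proof
    assume "det M = 0"
    then have "\<not> invertible (transpose M)" by (simp add: invertible_det_nz det_transpose)
    then obtain c where c: "transpose M *v c = 0" "c \<noteq> 0"
      using matrix_left_invertible_ker[of "transpose M"] unfolding invertible_left_inverse by auto
    define z :: "'a nvec" where "z = (\<Sum>i\<in>UNIV. (c $ i) *\<^sub>R isotropic_basis (-1) i)"
    have "u *v z = (\<Sum>i\<in>UNIV. (c $ i) *\<^sub>R (\<Sum>j\<in>UNIV. (M $ i $ j) *\<^sub>R isotropic_basis (-1) j))"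
      unfolding z_def M[symmetric] by (simp add: linear_sum[OF matrix_vector_mul_linear] comp_def matrix_vector_mult_scaleR)
    also have "\<dots> = (\<Sum>i\<in>UNIV. \<Sum>j\<in>UNIV. (M $ i $ j * c $ i) *\<^sub>R isotropic_basis (-1) j)"
      by (simp add: scaleR_sum_right mult.commute)
    also have "\<dots> = (\<Sum>j\<in>UNIV. \<Sum>i\<in>UNIV. (M $ i $ j * c $ i) *\<^sub>R isotropic_basis (-1) j)" by (rule sum.swap)
    also have "\<dots> = (\<Sum>j\<in>UNIV. ((transpose M *v c) $ j) *\<^sub>R isotropic_basis (-1) j)"
      by (simp add: matrix_vector_mult_def transpose_def scaleR_sum_left del: transpose_matrix_vector)
    also have "\<dots> = 0" unfolding c(1) by simp
    finally have "matrix_inv u *v (u *v z) = 0" by simp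
    then have "z = 0" using matrix_inv_mult(4)[OF SO0_invertible[OF u0]] by simp
    then have "c $ i = 0" for i using isotropic_basis_expand(3)[of "\<lambda>i. c $ i" "-1" i] unfolding z_def by simp
    then show False using c(2) by (simp add: vec_eq_iff)
  qed
  ultimately have "u \<in> P_minus" unfolding P_minus_def
    using stabilizer_oriented_I[OF u0 _ M] by simp
  then show ?thesis using translate_eq_iff[OF matrix_subgroup_P_minus inv] unfolding u_def by simp
qed

lemma continuous_gram: 
  assumes "g \<longlonglongrightarrow> h" "g' \<longlonglongrightarrow> h'" shows "(\<lambda>k. gram (g k) (g' k)) \<longlonglongrightarrow> gram h h'"
  unfolding gram_def by (intro vec_tendstoI) (auto intro!: tendsto_intros assms)

section \<open>The Gromov flow and averaged norms\<close>

lemma bounded_by_subsequences: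
  fixes f :: "'s \<Rightarrow> real"
  assumes "\<And>s :: nat \<Rightarrow> 's. (\<And>k. s k \<in> D) \<Longrightarrow> \<exists>r l. strict_mono (r :: nat \<Rightarrow> nat) \<and> (\<lambda>k. f (s (r k))) \<longlonglongrightarrow> l"
  shows "\<exists>K>0. \<forall>z\<in>D. f z \<le> K"
proof (rule ccontr)
  assume neg: "\<not> ?thesis"
  have "\<exists>z. z \<in> D \<and> f z > real k + 1" for k :: nat
    using neg by (metis not_le of_nat_0_le_iff add_nonneg_pos zero_less_one)
  then obtain s where s: "\<And>k. s k \<in> D" "\<And>k. f (s k) > real k + 1" by metis
  obtain r l where r: "strict_mono (r :: nat \<Rightarrow> nat)" "(\<lambda>k. f (s (r k))) \<longlonglongrightarrow> l" using assms[of s] s(1) by blast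
  have "Bseq (\<lambda>k. f (s (r k)))" using convergent_imp_Bseq convergentI[OF r(2)] by blast
  then obtain K where K: "\<And>k. norm (f (s (r k))) \<le> K" unfolding Bseq_def by blast
  obtain n :: nat where n: "K < n" using reals_Archimedean2 by blast
  have "real n \<le> real (r n)" using seq_suble[OF r(1)] by simp
  then show False using s(2)[of "r n"] K[of n] n by simp
qed

locale cocompact_flow = hyp_group \<Gamma> S \<delta> + gromov_flow \<Gamma> S act d
  for \<Gamma> :: "'g monoid" (structure) and S \<delta> act d
begin

abbreviation X where "X \<equiv> flow_space \<Gamma> S"
abbreviation "flow_top \<equiv> flow_topology \<Gamma> S"

sublocale M: Metric_space X d by (rule metric)

definition flim :: "(nat \<Rightarrow> 'g flow_point) \<Rightarrow> 'g flow_point \<Rightarrow> bool" where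
  "flim x l \<longleftrightarrow> limitin flow_top x l sequentially"

lemma mem_X: "(p, q, t) \<in> X \<longleftrightarrow> p \<in> bdry \<and> q \<in> bdry \<and> p \<noteq> q"
  unfolding flow_space_def by auto

lemma topspace_flow [simp]: "topspace flow_top = X"
  unfolding flow_topology_def by (auto simp: mem_X)

lemma flim_mem: "flim x l \<Longrightarrow> l \<in> X"
  unfolding flim_def using limitin_topspace by force

lemma flim_iff:
  assumes "\<And>k. x k \<in> X" "(p, q, s) \<in> X"
  shows "flim x (p, q, s) \<longleftrightarrow> blim (\<lambda>k. fst (x k)) p \<and>
    blim (\<lambda>k. fst (snd (x k))) q \<and> (\<lambda>k. snd (snd (x k))) \<longlonglongrightarrow> s"
  unfolding flim_def flow_topology_def limitin_subtopology limitin_pairwise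
  using assms by (simp add: comp_def)

lemma flim_metric:
  assumes "\<And>k. x k \<in> X"
  shows "flim x l \<longleftrightarrow> l \<in> X \<and> (\<forall>e>0. \<forall>\<^sub>F k in sequentially. d (x k) l < e)"
  unfolding flim_def metric_topology[symmetric] M.limitin_metric using assms by auto

lemma flim_dist:
  assumes "\<And>k. x k \<in> X"
  shows "flim x l \<longleftrightarrow> l \<in> X \<and> (\<lambda>k. d (x k) l) \<longlonglongrightarrow> 0"
  unfolding flim_metric[of x, OF assms] tendsto_iff by (simp add: dist_real_def)

lemma flim_subseq: "flim x l \<Longrightarrow> strict_mono r \<Longrightarrow> flim (\<lambda>k. x (r k)) l"
  unfolding flim_def using limitin_subsequence[of r "flow_top" x l] by (simp add: comp_def)

lemma flim_const: "l \<in> X \<Longrightarrow> flim (\<lambda>k. l) l"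
  unfolding flim_def by (simp add: limitin_const_iff)

lemma flim_act:
  assumes "\<And>k. x k \<in> X" "flim x l" "g \<in> G"
  shows "flim (\<lambda>k. act g (x k)) (act g l)"
proof -
  have l: "l \<in> X" using assms flim_mem by blast
  then have "d (act g (x k)) (act g l) = d (x k) l" for k using act_isometry assms by blast
  then show ?thesis using assms l act_closed by (simp add: flim_dist)
qed

lemma flow_mem [simp]: "flow t x \<in> X \<longleftrightarrow> x \<in> X"
  by (cases x) (simp add: mem_X)

lemma flow_flow [simp]: "flow s (flow t x) = flow (s + t) x"
  by (cases x) (simp add: algebra_simps)

lemma flow_zero [simp]: "flow 0 x = x"
  by (cases x) simp

lemma flim_flow:
  assumes x: "\<And>k. x k \<in> X" "flim x l" and t: "t \<longlonglongrightarrow> s"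
  shows "flim (\<lambda>k. flow (t k) (x k)) (flow s l)"
proof -
  obtain p q u where l: "l = (p, q, u)" by (cases l)
  have lX: "(p, q, u) \<in> X" using flim_mem x l by blast
  have lX': "(p, q, u + s) \<in> X" using lX by (simp add: mem_X)
  have eq: "flow (t k) (x k) = (fst (x k), fst (snd (x k)), snd (snd (x k)) + t k)" for k
    by (cases "x k") simp
  have fX: "(fst (x k), fst (snd (x k)), snd (snd (x k)) + t k) \<in> X" for k
    unfolding eq[symmetric] using x by simp
  have "flim x (p, q, u)" using x(2) l by simp
  then show ?thesis
    unfolding l eq flow.simps flim_iff[OF x(1) lX] flim_iff[OF fX lX'] using t by (auto intro: tendsto_add)
qed

lemma act_inv [simp]:
  assumes "g \<in> G" "x \<in> X"
  shows "act (inv g) (act g x) = x" "act g (act (inv g) x) = x"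
  using act_mult[of "inv g" g x] act_mult[of g "inv g" x] act_one assms by simp_all

lemma compact_subseq:
  assumes "compactin flow_top K" "\<And>k. x k \<in> K"
  obtains l r where "l \<in> K" "strict_mono (r :: nat \<Rightarrow> nat)" "flim (\<lambda>k. x (r k)) l"
proof -
  have "range x \<subseteq> K" using assms(2) by auto
  then obtain l r where "l \<in> K" "strict_mono (r :: nat \<Rightarrow> nat)" "limitin M.mtopology (x \<circ> r) l sequentially"
    using assms(1) unfolding metric_topology[symmetric] M.compactin_sequentially by blast
  then show ?thesis using that[of l r] unfolding flim_def metric_topology by (simp add: comp_def)
qed

text \<open>A convergent sequence together with its limit is compact, so properness applies to the
  union of the two sequences and their limits.\<close>

lemma proper_seq:
  assumes g: "\<And>k. g k \<in> G" and x: "\<And>k. x k \<in> X" "flim x l" "flim (\<lambda>k. act (g k) (x k)) l'"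
  shows "finite (range g)"
proof -
  define K where "K = insert l (range x) \<union> insert l' (range (\<lambda>k. act (g k) (x k)))"
  have "compactin flow_top (insert l (range x))"
    using x unfolding flim_def by (intro compactin_sequence_with_limit) auto
  moreover have "compactin flow_top (insert l' (range (\<lambda>k. act (g k) (x k))))"
    using x(3) act_closed[OF g x(1)] unfolding flim_def by (intro compactin_sequence_with_limit) auto
  ultimately have "compactin flow_top K" unfolding K_def by (rule compactin_Un)
  then have "finite {h \<in> G. act h ` K \<inter> K \<noteq> {}}" using act_proper unfolding proper_action_def by blast
  moreover have "range g \<subseteq> {h \<in> G. act h ` K \<inter> K \<noteq> {}}"
  proof
    fix h assume "h \<in> range g"
    then obtain k where h: "h = g k" by auto
    have "act h (x k) \<in> act h ` K" "act h (x k) \<in> K" unfolding K_def h by auto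
    then show "h \<in> {h \<in> G. act h ` K \<inter> K \<noteq> {}}" using g h by blast
  qed
  ultimately show ?thesis by (rule rev_finite_subset)
qed

definition core :: "'g flow_point set" where
  "core = (SOME K. compactin flow_top K \<and> (\<Union>g\<in>G. act g ` K) = X)"

lemma core: "compactin flow_top core" "(\<Union>g\<in>G. act g ` core) = X"
  unfolding core_def using someI_ex[OF act_cocompact] by auto

lemma core_X: "core \<subseteq> X"
  using compactin_subset_topspace[OF core(1)] by simp

lemma to_core:
  assumes "x \<in> X" obtains g where "g \<in> G" "act (inv g) x \<in> core"
proof -
  obtain g y where g: "g \<in> G" "y \<in> core" "x = act g y" using assms core(2) by blast
  then have "act (inv g) x = y" using core_X by auto
  then show ?thesis using that g by blast
qed

lemma cocompact_subseq:
  assumes "\<And>k. x k \<in> X"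
  obtains g l r where "\<And>k. g k \<in> G" "strict_mono (r :: nat \<Rightarrow> nat)" "l \<in> core"
    "flim (\<lambda>k. act (inv (g (r k))) (x (r k))) l"
proof -
  have "\<forall>k. \<exists>g. g \<in> G \<and> act (inv g) (x k) \<in> core" using to_core assms by metis
  then obtain g where g: "\<And>k. g k \<in> G" "\<And>k. act (inv (g k)) (x k) \<in> core" by metis
  obtain l r where "l \<in> core" "strict_mono (r :: nat \<Rightarrow> nat)" "flim (\<lambda>k. act (inv (g (r k))) (x (r k))) l"
    by (rule compact_subseq[OF core(1), of "\<lambda>k. act (inv (g k)) (x k)", OF g(2)])
  with g(1) show ?thesis using that by blast
qed

definition close_to_core :: "real \<Rightarrow> 'g flow_point set" where
  "close_to_core r = {x \<in> X. \<exists>y\<in>core. d x y < r}"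

lemma core_close: "0 < r \<Longrightarrow> core \<subseteq> close_to_core r"
  unfolding close_to_core_def using core_X by force

lemma close_seq:
  assumes "\<And>k. x k \<in> close_to_core (1 / Suc k)"
  obtains l r where "l \<in> core" "strict_mono (r :: nat \<Rightarrow> nat)" "flim (\<lambda>k. x (r k)) l"
proof -
  have "\<forall>k. \<exists>y. y \<in> core \<and> d (x k) y < 1 / Suc k" using assms unfolding close_to_core_def by blast
  then obtain y where y: "\<And>k. y k \<in> core" "\<And>k. d (x k) (y k) < 1 / Suc k" by metis
  have xX: "x k \<in> X" for k using assms unfolding close_to_core_def by blast
  obtain l r where l: "l \<in> core" "strict_mono (r :: nat \<Rightarrow> nat)" "flim (\<lambda>k. y (r k)) l"
    by (rule compact_subseq[OF core(1), of y, OF y(1)])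
  have yX: "y k \<in> X" for k using y core_X by blast
  have lX: "l \<in> X" using l core_X by blast
  have "(\<lambda>k. 1 / real (Suc (r k))) \<longlonglongrightarrow> 0"
    using LIMSEQ_subseq_LIMSEQ[OF LIMSEQ_inverse_real_of_nat l(2)] by (simp add: comp_def inverse_eq_divide)
  moreover have "(\<lambda>k. d (y (r k)) l) \<longlonglongrightarrow> 0" using l(3) yX by (simp add: flim_dist)
  ultimately have "(\<lambda>k. 1 / real (Suc (r k)) + d (y (r k)) l) \<longlonglongrightarrow> 0" using tendsto_add by fastforce
  moreover have "\<forall>k. norm (d (x (r k)) l) \<le> 1 / real (Suc (r k)) + d (y (r k)) l"
  proof
    fix k show "norm (d (x (r k)) l) \<le> 1 / real (Suc (r k)) + d (y (r k)) l"
    using M.triangle[OF xX yX lX, of "r k" "r k"] y(2)[of "r k"] by simp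
  qed
  ultimately have "(\<lambda>k. d (x (r k)) l) \<longlonglongrightarrow> 0"
    by (rule Lim_null_comparison[OF always_eventually, rotated])
  then have "flim (\<lambda>k. x (r k)) l" using xX lX by (simp add: flim_dist)
  with l that show ?thesis by blast
qed

lemma close_to_core_mono: "r \<le> s \<Longrightarrow> close_to_core r \<subseteq> close_to_core s"
  unfolding close_to_core_def by force

text \<open>Neighbourhoods of \<open>core\<close> are not known to be compact, so properness does
  not apply to them directly. Elements returning ever smaller neighbourhoods form a sequence
  instead: properness leaves finitely many, and one repeated infinitely often maps a point of
  \<open>core\<close> into \<open>core\<close>, although those elements were excluded.\<close>

lemma radius_exists:
  "\<exists>r>0. finite {g \<in> G. \<exists>x\<in>close_to_core r. act (inv g) x \<in> close_to_core r}"
proof (rule ccontr)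
  define F where "F r = {g \<in> G. \<exists>x\<in>close_to_core r. act (inv g) x \<in> close_to_core r}" for r
  assume "\<not> ?thesis"
  then have inf: "infinite (F (1 / real (Suc k)))" for k unfolding F_def by auto
  define A where "A = {g \<in> G. act g ` core \<inter> core \<noteq> {}}"
  have "finite A" unfolding A_def using act_proper core(1) unfolding proper_action_def by blast
  then have "\<exists>g. g \<in> F (1 / real (Suc k)) - m_inv \<Gamma> ` A" for k
    using infinite_imp_nonempty[OF Diff_infinite_finite[OF _ inf[of k], of "m_inv \<Gamma> ` A"]] by blast
  then obtain g where g: "\<And>k. g k \<in> F (1 / real (Suc k))" "\<And>k. g k \<notin> m_inv \<Gamma> ` A" by (metis DiffD1 DiffD2)
  have "\<forall>k. \<exists>x. x \<in> close_to_core (1 / real (Suc k)) \<and> act (inv (g k)) x \<in> close_to_core (1 / real (Suc k))"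
    using g(1) unfolding F_def by blast
  then obtain x where x: "\<And>k. x k \<in> close_to_core (1 / real (Suc k))" "\<And>k. act (inv (g k)) (x k) \<in> close_to_core (1 / real (Suc k))"
    by metis
  have gc: "g k \<in> G" for k using g(1) unfolding F_def by blast
  have xX: "x k \<in> X" for k using x unfolding close_to_core_def by blast
  obtain l r where l: "strict_mono (r :: nat \<Rightarrow> nat)" "flim (\<lambda>k. x (r k)) l" "l \<in> core"
    by (rule close_seq[of x, OF x(1)])
  have "act (inv (g (r k))) (x (r k)) \<in> close_to_core (1 / real (Suc k))" for k
  proof -
    have "k \<le> r k" by (rule seq_suble[OF l(1)])
    then have "1 / real (Suc (r k)) \<le> 1 / real (Suc k)" by (simp add: frac_le)
    then show ?thesis using x(2)[of "r k"] close_to_core_mono by blast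
  qed
  from close_seq[OF this] obtain l' r' where l': "strict_mono (r' :: nat \<Rightarrow> nat)"
    "flim (\<lambda>k. act (inv (g (r (r' k)))) (x (r (r' k)))) l'" "l' \<in> core" by blast
  define h where "h k = inv (g (r (r' k)))" for k
  have h: "h k \<in> G" "h k \<notin> A" for k
    using gc g(2)[of "r (r' k)"] image_eqI[of "g (r (r' k))" "m_inv \<Gamma>" "h k" A] unfolding h_def by auto
  have "finite (range h)" unfolding h_def
    by (rule proper_seq[OF _ _ flim_subseq[OF l(2) l'(1)] l'(2)]) (use gc xX in auto)
  then obtain k0 where "infinite {k. h k = h k0}" using pigeonhole_infinite[of "UNIV :: nat set" h] by auto
  then obtain s where s: "strict_mono (s :: nat \<Rightarrow> nat)" "\<And>k. h (s k) = h k0" by (auto dest: infinite_enumerate)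
  have "flim (\<lambda>k. act (h k0) (x (r (r' (s k))))) (act (h k0) l)"
    by (rule flim_act[OF xX flim_subseq[OF flim_subseq[OF l(2) l'(1)] s(1)] h(1)])
  moreover have "flim (\<lambda>k. act (h k0) (x (r (r' (s k))))) l'"
    using flim_subseq[OF l'(2) s(1)] unfolding h_def[symmetric] s(2) .
  ultimately have "act (h k0) l = l'"
    unfolding flim_def metric_topology[symmetric] using M.limitin_metric_unique trivial_limit_sequentially by metis
  then have "h k0 \<in> A" unfolding A_def using h(1) l(3) l'(3) by blast
  then show False using h(2) by blast
qed

lemma core_mem: "y \<in> core \<Longrightarrow> y \<in> X"
  using core_X by blast

text \<open>\<open>Q\<close> confines the second argument to a fibre or to unit vectors; a singleton
  \<open>C\<close> serves for functions of the base point alone.\<close>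

lemma core_bound:
  assumes C: "compact (C :: 'v::metric_space set)"
    and f: "\<And>x l v v'. \<lbrakk>\<And>k. x k \<in> X; flim x l; \<And>k. Q (x k) (v k); v \<longlonglongrightarrow> v'\<rbrakk> \<Longrightarrow> (\<lambda>k. f (x k) (v k)) \<longlonglongrightarrow> (f l v' :: real)"
  shows "\<exists>K>0. \<forall>x\<in>core. \<forall>v\<in>C. Q x v \<longrightarrow> f x v \<le> K"
proof -
  have "\<exists>K>0. \<forall>z\<in>{(x, v). x \<in> core \<and> v \<in> C \<and> Q x v}. (\<lambda>(x, v). f x v) z \<le> K"
  proof (rule bounded_by_subsequences)
    fix z :: "nat \<Rightarrow> 'g flow_point \<times> 'v" assume "\<And>k. z k \<in> {(x, v). x \<in> core \<and> v \<in> C \<and> Q x v}"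
    then have z: "\<And>k. fst (z k) \<in> core" "\<And>k. snd (z k) \<in> C" "\<And>k. Q (fst (z k)) (snd (z k))" by (simp_all add: case_prod_unfold)
    obtain x r where r: "x \<in> core" "strict_mono (r :: nat \<Rightarrow> nat)" "flim (\<lambda>k. fst (z (r k))) x"
      by (rule compact_subseq[OF core(1), of "\<lambda>k. fst (z k)", OF z(1)]) (rule that)
    obtain v s where s: "strict_mono (s :: nat \<Rightarrow> nat)" "((\<lambda>k. snd (z (r k))) \<circ> s) \<longlonglongrightarrow> v"
      using compact_imp_seq_compact[OF C] z(2) unfolding seq_compact_def by metis
    have "(\<lambda>k. f (fst (z (r (s k)))) (snd (z (r (s k))))) \<longlonglongrightarrow> f x v"
      by (rule f[OF core_mem[OF z(1)] flim_subseq[OF r(3) s(1)] z(3) s(2)[unfolded comp_def]])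
    then show "\<exists>r l. strict_mono (r :: nat \<Rightarrow> nat) \<and> (\<lambda>k. (\<lambda>(x, v). f x v) (z (r k))) \<longlonglongrightarrow> l"
      using strict_mono_o[OF r(2) s(1)] by (intro exI[of _ "r \<circ> s"]) (auto simp: case_prod_unfold)
  qed
  then show ?thesis by fastforce
qed

end

lemma lim_null_bound:
  fixes f :: "nat \<Rightarrow> 'a::real_normed_vector"
  assumes "\<And>k. norm (f k) \<le> g k" "g \<longlonglongrightarrow> 0" shows "f \<longlonglongrightarrow> 0"
  using Lim_null_comparison[of f g sequentially] assms by simp

section \<open>A cut-off function and averaging over the group\<close>

context cocompact_flow
begin

definition radius :: real where
  "radius = (SOME r. r > 0 \<and> finite {g \<in> G. \<exists>x\<in>close_to_core r. act (inv g) x \<in> close_to_core r})"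

definition near :: "'g set" where
  "near = {g \<in> G. \<exists>x\<in>close_to_core radius. act (inv g) x \<in> close_to_core radius}"

lemma radius: "radius > 0" "finite near"
proof -
  have "\<exists>r. r > 0 \<and> finite {g \<in> G. \<exists>x\<in>close_to_core r. act (inv g) x \<in> close_to_core r}"
    using radius_exists by blast
  from someI_ex[OF this] show "radius > 0" "finite near" unfolding near_def radius_def by auto
qed

definition core_dist :: "'g flow_point \<Rightarrow> real" where
  "core_dist x = Inf (d x ` core)"

text \<open>A continuous cut-off made from the metric alone: it equals \<open>radius\<close> on
  \<open>core\<close> and vanishes at distance \<open>radius\<close> and beyond.\<close>

definition bump :: "'g flow_point \<Rightarrow> real" where
  "bump x = max 0 (radius - core_dist x)"

lemma core_nonempty: "x \<in> X \<Longrightarrow> core \<noteq> {}"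
  using core(2) by auto

lemma core_dist_le: "y \<in> core \<Longrightarrow> core_dist x \<le> d x y"
  unfolding core_dist_def by (rule cInf_lower) (auto intro!: bdd_belowI[of _ 0])

lemma core_dist_lipschitz:
  assumes "x \<in> X" "y \<in> X" shows "core_dist x \<le> core_dist y + d x y"
proof -
  have "core_dist x - d x y \<le> Inf (d y ` core)"
  proof (rule cInf_greatest)
    show "d y ` core \<noteq> {}" using core_nonempty[OF assms(1)] by simp
    fix a assume "a \<in> d y ` core"
    then obtain z where z: "z \<in> core" "a = d y z" by auto
    then show "core_dist x - d x y \<le> a"
      using core_dist_le[OF z(1), of x] M.triangle[OF assms, of z] core_X by auto
  qed
  then show ?thesis unfolding core_dist_def by simp
qed

lemma bump_nonneg [simp]: "0 \<le> bump x"
  unfolding bump_def by simp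

lemma bump_core: "x \<in> core \<Longrightarrow> bump x = radius"
proof -
  assume x: "x \<in> core"
  have "x \<in> X" using x core_X by blast
  then have "core_dist x \<le> 0" using core_dist_le[OF x, of x] by simp
  moreover have "0 \<le> core_dist x" unfolding core_dist_def by (rule cInf_greatest) (use x in auto)
  ultimately show ?thesis unfolding bump_def using radius(1) by simp
qed

lemma bump_close: "x \<in> X \<Longrightarrow> bump x \<noteq> 0 \<Longrightarrow> x \<in> close_to_core radius"
proof -
  assume x: "x \<in> X" "bump x \<noteq> 0"
  then have "Inf (d x ` core) < radius" unfolding bump_def core_dist_def by (simp add: max_def split: if_splits)
  then obtain a where "a \<in> d x ` core" "a < radius" using cInf_lessD[of "d x ` core" radius] core_nonempty[OF x(1)] by auto
  then show ?thesis unfolding close_to_core_def using x(1) by auto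
qed

lemma bump_flim:
  assumes "\<And>k. x k \<in> X" "flim x l" shows "(\<lambda>k. bump (x k)) \<longlonglongrightarrow> bump l"
proof -
  have l: "l \<in> X" "(\<lambda>k. d (x k) l) \<longlonglongrightarrow> 0" using assms flim_dist by auto
  have "\<bar>core_dist (x k) - core_dist l\<bar> \<le> d (x k) l" for k
    using core_dist_lipschitz[OF assms(1) l(1), of k] core_dist_lipschitz[OF l(1) assms(1), of k]
      M.commute[of l "x k"] by linarith
  then have "(\<lambda>k. core_dist (x k) - core_dist l) \<longlonglongrightarrow> 0"
    using lim_null_bound[of "\<lambda>k. core_dist (x k) - core_dist l", OF _ l(2)] by simp
  then have "(\<lambda>k. core_dist (x k)) \<longlonglongrightarrow> core_dist l" by (rule LIM_zero_cancel)
  then show ?thesis unfolding bump_def by (intro tendsto_intros)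
qed

definition support :: "'g flow_point \<Rightarrow> 'g set" where
  "support x = {g \<in> G. bump (act (inv g) x) \<noteq> 0}"

text \<open>Once \<open>g\<close> brings \<open>x\<close> near \<open>core\<close>, every other
  element doing so differs from \<open>g\<close> by a member of the finite set
  \<open>near\<close>.\<close>

lemma support_bound:
  assumes x: "x \<in> X" and g: "g \<in> G" "act (inv g) x \<in> close_to_core radius"
  shows "support x \<subseteq> (\<lambda>h. g \<otimes> h) ` near"
proof
  fix k assume "k \<in> support x"
  then have k: "k \<in> G" "act (inv k) x \<in> close_to_core radius"
    using bump_close act_closed x unfolding support_def by auto
  define h where "h = inv g \<otimes> k"
  have h: "h \<in> G" "k = g \<otimes> h" unfolding h_def using g k by (auto simp: cancel_left)
  have "act (inv h) (act (inv g) x) = act (inv h \<otimes> inv g) x" using act_mult[of "inv h" "inv g" x] h g x by simp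
  also have "inv h \<otimes> inv g = inv k" using h g by (simp add: inv_mult_group)
  finally have eq: "act (inv h) (act (inv g) x) = act (inv k) x" .
  have "h \<in> near" unfolding near_def
  proof (intro CollectI conjI bexI)
    show "act (inv h) (act (inv g) x) \<in> close_to_core radius" unfolding eq by (rule k(2))
  qed (use h g in auto)
  then show "k \<in> (\<lambda>h. g \<otimes> h) ` near" using h by auto
qed

lemma support_finite: "x \<in> X \<Longrightarrow> finite (support x)"
proof -
  assume x: "x \<in> X"
  obtain g where "g \<in> G" "act (inv g) x \<in> core" using to_core[OF x] .
  then have "support x \<subseteq> (\<lambda>h. g \<otimes> h) ` near" using support_bound[OF x] core_close[OF radius(1)] by blast
  then show ?thesis using radius(2) finite_subset by blast
qed

text \<open>The group permutes the summands, which gives equivariance. Positivity comes from the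
  translate of \<open>x\<close> lying in \<open>core\<close>, where the weight is
  \<open>radius\<close>.\<close>

definition average :: "('g \<Rightarrow> 'v \<Rightarrow> 'v::euclidean_space) \<Rightarrow> 'g flow_point \<Rightarrow> 'v \<Rightarrow> 'v \<Rightarrow> real" where
  "average L x v w = (\<Sum>g\<in>support x. bump (act (inv g) x) * (L (inv g) v \<bullet> L (inv g) w))"

lemma average_superset:
  assumes "finite T" "support x \<subseteq> T" "T \<subseteq> G"
  shows "average L x v w = (\<Sum>g\<in>T. bump (act (inv g) x) * (L (inv g) v \<bullet> L (inv g) w))"
  unfolding average_def by (rule sum.mono_neutral_left) (use assms in \<open>auto simp: support_def\<close>)

lemma average_sym: "average L x v w = average L x w v"
  unfolding average_def by (simp add: inner_commute)

lemma average_nonneg: "0 \<le> average L x v v"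
  unfolding average_def by (intro sum_nonneg mult_nonneg_nonneg) auto

end

locale averaging = cocompact_flow \<Gamma> S \<delta> act d
  for \<Gamma> :: "'g monoid" (structure) and S \<delta> act d +
  fixes L :: "'g \<Rightarrow> 'v::euclidean_space \<Rightarrow> 'v"
  assumes L_linear: "g \<in> G \<Longrightarrow> linear (L g)"
    and L_mult: "\<lbrakk>g \<in> G; h \<in> G\<rbrakk> \<Longrightarrow> L (g \<otimes> h) v = L g (L h v)"
    and L_one: "L \<one> v = v"
begin

lemma L_inv: "g \<in> G \<Longrightarrow> L (inv g) (L g v) = v"
  using L_mult[of "inv g" g v] L_one by simp

lemma bilinear_average: "bilinear (average L x)"
proof -
  have lin: "linear (L (inv g))" if "g \<in> support x" for g using that L_linear unfolding support_def by auto
  have "average L x (a + b) w = average L x a w + average L x b w" for a b w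
    unfolding average_def by (simp add: linear_add[OF lin] inner_add_left sum.distrib algebra_simps)
  moreover have "average L x (c *\<^sub>R a) w = c * average L x a w" for c a w
    unfolding average_def by (simp add: linear_scale[OF lin] sum_distrib_left algebra_simps)
  ultimately have l: "linear (\<lambda>v. average L x v w)" for w by (intro linearI) auto
  then have "linear (\<lambda>w. average L x v w)" for v by (simp add: average_sym[of L x v])
  with l show ?thesis unfolding bilinear_def by blast
qed

lemma average_equivariant:
  assumes h: "h \<in> G" and x: "x \<in> X"
  shows "average L (act h x) (L h v) (L h w) = average L x v w"
proof -
  have a: "act (inv (h \<otimes> g)) (act h x) = act (inv g) x" if "g \<in> G" for g
    using act_mult[of "inv g" "inv h" "act h x"] act_closed[OF h x] h that x by (simp add: inv_mult_group)
  have l: "L (inv (h \<otimes> g)) (L h v) = L (inv g) v" if "g \<in> G" for g v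
    using L_mult[of "inv g" "inv h"] L_inv[OF h] h that by (simp add: inv_mult_group)
  have sup: "support (act h x) = (\<lambda>g. h \<otimes> g) ` support x"
  proof
    show "(\<lambda>g. h \<otimes> g) ` support x \<subseteq> support (act h x)"
      unfolding support_def using a h by auto
    show "support (act h x) \<subseteq> (\<lambda>g. h \<otimes> g) ` support x"
    proof
      fix g assume g: "g \<in> support (act h x)"
      then have gc: "g \<in> G" unfolding support_def by auto
      have eq: "h \<otimes> (inv h \<otimes> g) = g" using cancel_left h gc by simp
      then have "inv h \<otimes> g \<in> support x"
        using g a[of "inv h \<otimes> g"] h gc unfolding support_def by auto
      then show "g \<in> (\<lambda>g. h \<otimes> g) ` support x" using eq by (metis imageI)
    qed
  qed
  have inj: "inj_on (\<lambda>g. h \<otimes> g) (support x)"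
    by (rule inj_onI) (use h in \<open>auto simp: support_def\<close>)
  show ?thesis unfolding average_def sup sum.reindex[OF inj] comp_def
    by (intro sum.cong) (auto simp: support_def a l)
qed

text \<open>Near the limit point all supports lie in one finite set \<open>T\<close>, so the
  convergence is that of a finite sum.\<close>

lemma average_flim:
  assumes x: "\<And>k. x k \<in> X" "flim x l" and v: "v \<longlonglongrightarrow> v'" and w: "w \<longlonglongrightarrow> w'"
  shows "(\<lambda>k. average L (x k) (v k) (w k)) \<longlonglongrightarrow> average L l v' w'"
proof -
  have l: "l \<in> X" using x flim_mem by blast
  obtain g where g: "g \<in> G" "act (inv g) l \<in> core" using to_core[OF l] .
  define T where "T = (\<lambda>h. g \<otimes> h) ` near"
  have T: "finite T" "T \<subseteq> G" unfolding T_def near_def using radius(2) g unfolding near_def by auto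
  have supl: "support l \<subseteq> T" unfolding T_def using support_bound[OF l g(1)] g(2) core_close[OF radius(1)] by blast
  have "\<forall>\<^sub>F k in sequentially. d (x k) l < radius"
    using x(2) radius(1) flim_metric[of x, OF x(1)] by blast
  then have "\<forall>\<^sub>F k in sequentially. support (x k) \<subseteq> T"
  proof eventually_elim
    case (elim k)
    have "d (act (inv g) (x k)) (act (inv g) l) < radius" using elim act_isometry[of "inv g"] g l x(1) by simp
    then have "act (inv g) (x k) \<in> close_to_core radius"
      unfolding close_to_core_def using g act_closed[of "inv g"] x(1) by auto
    then show ?case unfolding T_def using support_bound[OF x(1) g(1)] by blast
  qed
  then have ev: "\<forall>\<^sub>F k in sequentially. (\<Sum>g\<in>T. bump (act (inv g) (x k)) * (L (inv g) (v k) \<bullet> L (inv g) (w k))) = average L (x k) (v k) (w k)"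
    by eventually_elim (simp add: average_superset[OF T(1) _ T(2)])
  have lim: "(\<lambda>k. \<Sum>g\<in>T. bump (act (inv g) (x k)) * (L (inv g) (v k) \<bullet> L (inv g) (w k))) \<longlonglongrightarrow>
      (\<Sum>g\<in>T. bump (act (inv g) l) * (L (inv g) v' \<bullet> L (inv g) w'))"
  proof (intro tendsto_sum tendsto_mult tendsto_inner)
    fix h assume "h \<in> T"
    then have h: "inv h \<in> G" using T(2) by auto
    show "(\<lambda>k. bump (act (inv h) (x k))) \<longlonglongrightarrow> bump (act (inv h) l)"
      using flim_act[OF x h] act_closed[OF h x(1)] by (intro bump_flim)
    have "bounded_linear (L (inv h))" using L_linear[OF h] linear_conv_bounded_linear by blast
    then show "(\<lambda>k. L (inv h) (v k)) \<longlonglongrightarrow> L (inv h) v'" "(\<lambda>k. L (inv h) (w k)) \<longlonglongrightarrow> L (inv h) w'"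
      using v w bounded_linear.tendsto by blast+
  qed
  show ?thesis unfolding average_superset[OF T(1) supl T(2)]
    by (rule Lim_transform_eventually[OF lim ev])
qed

definition anorm :: "'g flow_point \<Rightarrow> 'v \<Rightarrow> real" where
  "anorm x v = sqrt (average L x v v)"

lemma anorm_nonneg [simp]: "0 \<le> anorm x v"
  unfolding anorm_def by (simp add: average_nonneg)

lemma anorm_equivariant: "\<lbrakk>h \<in> G; x \<in> X\<rbrakk> \<Longrightarrow> anorm (act h x) (L h v) = anorm x v"
  unfolding anorm_def by (simp add: average_equivariant)

lemma anorm_flim: "\<lbrakk>\<And>k. x k \<in> X; flim x l; v \<longlonglongrightarrow> v'\<rbrakk> \<Longrightarrow> (\<lambda>k. anorm (x k) (v k)) \<longlonglongrightarrow> anorm l v'"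
  unfolding anorm_def by (intro tendsto_real_sqrt average_flim)

lemma anorm_scale: "anorm x (c *\<^sub>R v) = \<bar>c\<bar> * anorm x v"
proof -
  have "average L x (c *\<^sub>R v) (c *\<^sub>R v) = c\<^sup>2 * average L x v v"
    using bilinear_lmul[OF bilinear_average] bilinear_rmul[OF bilinear_average] by (simp add: power2_eq_square)
  then show ?thesis unfolding anorm_def by (simp add: real_sqrt_mult)
qed

lemma anorm_zero_iff: "x \<in> X \<Longrightarrow> anorm x v = 0 \<longleftrightarrow> v = 0"
proof
  assume x: "x \<in> X" and 0: "anorm x v = 0"
  obtain g where g: "g \<in> G" "act (inv g) x \<in> core" using to_core[OF x] .
  define y u where "y = act (inv g) x" and "u = L (inv g) v"
  have y: "y \<in> X" "y \<in> core" unfolding y_def using core_mem[OF g(2)] g(2) by auto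
  have b: "bump (act (inv \<one>) y) = radius" using act_one[OF y(1)] bump_core[OF y(2)] by simp
  have "(\<Sum>g\<in>{\<one>}. bump (act (inv g) y) * (L (inv g) u \<bullet> L (inv g) u)) \<le> average L y u u"
    unfolding average_def by (rule sum_mono2) (use support_finite[OF y(1)] b radius(1) in \<open>auto simp: support_def\<close>)
  then have "radius * (u \<bullet> u) \<le> average L y u u" using b L_one by simp
  moreover have "average L y u u = 0" using average_equivariant[of "inv g" x v v] g x 0 unfolding anorm_def y_def u_def by simp
  ultimately have "u = 0" using radius(1) inner_ge_zero[of u] by (simp add: mult_le_0_iff antisym)
  then have "L g (L (inv g) v) = 0" unfolding u_def using linear_0 L_linear[OF g(1)] by metis
  then show "v = 0" using L_inv[of "inv g" v] g by simp
qed (simp add: anorm_def bilinear_lzero[OF bilinear_average])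

text \<open>Bounding the norm plus its inverse on unit vectors over \<open>core\<close> yields both
  comparisons with the same constant.\<close>

lemma anorm_core:
  "\<exists>C>0. \<forall>x\<in>core. \<forall>v. norm v \<le> C * anorm x v \<and> anorm x v \<le> C * norm v"
proof -
  have "\<exists>K>0. \<forall>x\<in>core. \<forall>v\<in>sphere 0 1. norm v = 1 \<longrightarrow> anorm x v + inverse (anorm x v) \<le> K"
  proof (rule core_bound)
    fix x l and v :: "nat \<Rightarrow> 'v" and v'
    assume h: "\<And>k. x k \<in> X" "flim x l" "\<And>k. norm (v k) = 1" "v \<longlonglongrightarrow> v'"
    have "norm v' = 1" using tendsto_norm[OF h(4)] h(3) by (simp add: LIMSEQ_const_iff)
    then have "anorm l v' \<noteq> 0" using anorm_zero_iff[OF flim_mem[OF h(2)]] by force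
    then show "(\<lambda>k. anorm (x k) (v k) + inverse (anorm (x k) (v k))) \<longlonglongrightarrow> anorm l v' + inverse (anorm l v')"
      by (intro tendsto_intros anorm_flim[OF h(1,2,4)])
  qed simp
  then obtain K where K: "K > 0" "\<And>x v. x \<in> core \<Longrightarrow> norm v = 1 \<Longrightarrow> anorm x v + inverse (anorm x v) \<le> K" by auto
  have "norm v \<le> K * anorm x v \<and> anorm x v \<le> K * norm v" if x: "x \<in> core" for x v
  proof (cases "v = 0")
    case True then show ?thesis using anorm_scale[of x 0 0] by simp
  next
    case False
    define a where "a = anorm x ((1 / norm v) *\<^sub>R v)"
    have "0 < anorm x v" using anorm_zero_iff[OF core_mem[OF x], of v] anorm_nonneg[of x v] False by (metis order_le_less)
    then have a: "anorm x v = norm v * a" "0 < a" "a + inverse a \<le> K"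
      unfolding a_def using K(2)[OF x, of "(1 / norm v) *\<^sub>R v"] False by (simp_all add: anorm_scale)
    have "inverse a \<le> K" "a \<le> K" using a(2,3) positive_imp_inverse_positive[OF a(2)] by linarith+
    then have "1 \<le> K * a" "a \<le> K" using a(2) by (auto simp: field_simps)
    then have "norm v * 1 \<le> norm v * (K * a)" "norm v * a \<le> norm v * K" by (intro mult_left_mono; simp)+
    then show ?thesis unfolding a(1) by (simp add: mult_ac)
  qed
  then show ?thesis using K(1) by blast
qed

lemma anorm_triangle: "anorm x (v + w) \<le> anorm x v + anorm x w"
proof -
  define f where "f v g = sqrt (bump (act (inv g) x)) * norm (L (inv g) v)" for v g
  have eq: "anorm x v = L2_set (f v) (support x)" for v
    unfolding anorm_def average_def L2_set_def f_def by (simp add: power_mult_distrib power2_norm_eq_inner)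
  have "L2_set (f (v + w)) (support x) \<le> L2_set (\<lambda>g. f v g + f w g) (support x)"
  proof (rule L2_set_mono)
    fix g assume "g \<in> support x"
    then have "L (inv g) (v + w) = L (inv g) v + L (inv g) w" using linear_add[OF L_linear] unfolding support_def by auto
    then show "f (v + w) g \<le> f v g + f w g"
      unfolding f_def using mult_left_mono[OF norm_triangle_ineq, of "sqrt (bump (act (inv g) x))"] by (simp add: distrib_left)
  qed (simp add: f_def)
  then show ?thesis unfolding eq using L2_set_triangle_ineq order_trans by blast
qed

end

section \<open>Complementary subspaces\<close>

definition complementary :: "(real^'k::finite) set \<Rightarrow> (real^'k) set \<Rightarrow> bool" where
  "complementary E F \<longleftrightarrow> subspace E \<and> subspace F \<and> E \<inter> F = {0} \<and> dim E + dim F = CARD('k)"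

definition projection :: "(real^'k::finite) set \<Rightarrow> (real^'k) set \<Rightarrow> 'k matrix" where
  "projection E F = matrix (\<lambda>z. SOME e. e \<in> E \<and> z - e \<in> F)"

lemma complementary_decomp:
  assumes "complementary E F" shows "\<exists>e. e \<in> E \<and> z - e \<in> F"
proof -
  have E: "subspace E" and F: "subspace F" and i: "E \<inter> F = {0}" and d: "dim E + dim F = CARD('a)"
    using assms unfolding complementary_def by auto
  have "dim {x + y |x y. x \<in> E \<and> y \<in> F} = CARD('a)"
    using dim_sums_Int[OF E F] i d by simp
  then have "{x + y |x y. x \<in> E \<and> y \<in> F} = UNIV"
    using dim_eq_full[of "{x + y |x y. x \<in> E \<and> y \<in> F}"] span_eq_iff[THEN iffD2, OF subspace_sums[OF E F]] by simp
  then obtain x y where "z = x + y" "x \<in> E" "y \<in> F" by blast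
  then show ?thesis by (intro exI[of _ x]) simp
qed

lemma complementary_unique:
  assumes "complementary E F" "e \<in> E" "z - e \<in> F" "e' \<in> E" "z - e' \<in> F" shows "e = e'"
proof -
  have "e - e' \<in> E" using assms subspace_diff[of E e e'] unfolding complementary_def by blast
  moreover have "(z - e') - (z - e) \<in> F" using assms subspace_diff[of F "z - e'" "z - e"] unfolding complementary_def by blast
  ultimately have "e - e' \<in> E \<inter> F" by simp
  then show ?thesis using assms unfolding complementary_def by simp
qed

lemma projection:
  assumes c: "complementary E F"
  shows "projection E F *v z \<in> E" "z - projection E F *v z \<in> F"
proof -
  define f where "f z = (SOME e. e \<in> E \<and> z - e \<in> F)" for z
  have f: "f z \<in> E" "z - f z \<in> F" for z
    using someI_ex[OF complementary_decomp[OF c, of z]] unfolding f_def by auto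
  have E: "subspace E" and F: "subspace F" using c unfolding complementary_def by auto
  have "linear f"
  proof (rule linearI)
    fix a b
    have "(a + b) - (f a + f b) = (a - f a) + (b - f b)" by simp
    then have "(a + b) - (f a + f b) \<in> F" using f(2) F subspace_add by metis
    then show "f (a + b) = f a + f b"
      using complementary_unique[OF c f(1) f(2), of "f a + f b"] f(1) E subspace_add by blast
  next
    fix r :: real and a
    have "r *\<^sub>R a - r *\<^sub>R f a = r *\<^sub>R (a - f a)" by (simp add: scaleR_diff_right)
    then have "r *\<^sub>R a - r *\<^sub>R f a \<in> F" using f(2) F subspace_scale by metis
    then show "f (r *\<^sub>R a) = r *\<^sub>R f a"
      using complementary_unique[OF c f(1) f(2), of "r *\<^sub>R f a"] f(1) E subspace_scale by blast
  qed
  then have "projection E F *v z = f z" unfolding projection_def f_def[symmetric] by (simp add: matrix_works)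
  then show "projection E F *v z \<in> E" "z - projection E F *v z \<in> F" using f by auto
qed

lemma projection_eqI: "\<lbrakk>complementary E F; e \<in> E; z - e \<in> F\<rbrakk> \<Longrightarrow> projection E F *v z = e"
  using complementary_unique projection by blast

lemma projection_left [simp]: "\<lbrakk>complementary E F; e \<in> E\<rbrakk> \<Longrightarrow> projection E F *v e = e"
  by (rule projection_eqI) (auto simp: complementary_def subspace_0)

lemma projection_right [simp]: "\<lbrakk>complementary E F; f \<in> F\<rbrakk> \<Longrightarrow> projection E F *v f = 0"
  by (rule projection_eqI) (auto simp: complementary_def subspace_0)

lemma projection_sum: "complementary E F \<Longrightarrow> projection E F + projection F E = mat 1"
proof -
  assume c: "complementary E F"
  then have c': "complementary F E" unfolding complementary_def by auto
  have "projection F E *v z = z - projection E F *v z" for z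
    by (rule projection_eqI[OF c']) (use projection[OF c, of z] in auto)
  then show ?thesis by (simp add: matrix_eq matrix_vector_mult_add_rdistrib)
qed

lemma complementary_sym: "complementary E F \<Longrightarrow> complementary F E"
  unfolding complementary_def by auto

lemma dim_image_invertible: "invertible (g :: 'k::finite matrix) \<Longrightarrow> dim ((*v) g ` V) = dim V"
proof -
  assume "invertible g"
  then have "inj ((*v) g)" using inj_matrix_vector_mult by blast
  then show ?thesis by (intro dim_image_eq) (auto intro: inj_on_subset)
qed

lemma complementary_image:
  fixes g :: "'k::finite matrix"
  assumes c: "complementary E F" and g: "invertible g"
  shows "complementary ((*v) g ` E) ((*v) g ` F)"
proof -
  have inj: "inj ((*v) g)" using g inj_matrix_vector_mult by blast
  have "(*v) g ` E \<inter> (*v) g ` F = (*v) g ` (E \<inter> F)" using image_Int[OF inj] by blast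
  then show ?thesis using c g unfolding complementary_def
    by (auto simp: dim_image_invertible intro: linear_subspace_image)
qed

lemma projection_image:
  fixes g :: "'k::finite matrix"
  assumes c: "complementary E F" and g: "invertible g"
  shows "projection ((*v) g ` E) ((*v) g ` F) = g ** projection E F ** matrix_inv g"
proof -
  have "projection ((*v) g ` E) ((*v) g ` F) *v z = g *v (projection E F *v (matrix_inv g *v z))" for z
  proof (rule projection_eqI[OF complementary_image[OF c g]])
    show "g *v (projection E F *v (matrix_inv g *v z)) \<in> (*v) g ` E" using projection(1)[OF c] by blast
    have "z - g *v (projection E F *v (matrix_inv g *v z)) = g *v (matrix_inv g *v z - projection E F *v (matrix_inv g *v z))"
      using matrix_inv_mult(3)[OF g, of z] by (simp add: matrix_vector_mult_diff_distrib)
    then show "z - g *v (projection E F *v (matrix_inv g *v z)) \<in> (*v) g ` F" using projection(2)[OF c] by blast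
  qed
  then show ?thesis by (simp add: matrix_eq flip: matrix_vector_mul_assoc)
qed

text \<open>The map that is \<open>g\<close> on \<open>V\<close> and \<open>g'\<close> on
  \<open>V'\<close>: it joins two separately chosen frames into one.\<close>

definition glue :: "(real^'k::finite) set \<Rightarrow> (real^'k) set \<Rightarrow> 'k matrix \<Rightarrow> 'k matrix \<Rightarrow> 'k matrix" where
  "glue V V' g g' = g ** projection V V' + g' ** projection V' V"

lemma glue_images:
  fixes g g' :: "'k::finite matrix"
  assumes c: "complementary V V'"
  shows "(*v) (glue V V' g g') ` V = (*v) g ` V" "(*v) (glue V V' g g') ` V' = (*v) g' ` V'"
  unfolding glue_def using c complementary_sym[OF c]
  by (auto simp: matrix_vector_mult_add_rdistrib simp flip: matrix_vector_mul_assoc intro!: image_cong)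

lemma glue_invertible:
  fixes g g' :: "'k::finite matrix"
  assumes c: "complementary V V'" and g: "invertible g" "invertible g'" and i: "(*v) g ` V \<inter> (*v) g' ` V' = {0}"
  shows "invertible (glue V V' g g')"
  unfolding invertible_left_inverse matrix_left_invertible_ker
proof (intro allI impI)
  fix z assume z: "glue V V' g g' *v z = 0"
  define a b where "a = projection V V' *v z" and "b = projection V' V *v z"
  have ab: "a \<in> V" "b \<in> V'" unfolding a_def b_def using projection(1)[OF c] projection(1)[OF complementary_sym[OF c]] by auto
  have "z = (projection V V' + projection V' V) *v z" using projection_sum[OF c] by simp
  then have z_eq: "z = a + b" unfolding a_def b_def by (simp add: matrix_vector_mult_add_rdistrib)
  have eq: "g *v a = g' *v (- b)"
    using z unfolding glue_def a_def b_def
    by (simp add: matrix_vector_mult_add_rdistrib matrix_vector_mul_assoc[symmetric] eq_neg_iff_add_eq_0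
        linear_neg[OF matrix_vector_mul_linear])
  have "- b \<in> V'" using ab c unfolding complementary_def by (auto intro: subspace_neg)
  then have "g *v a \<in> (*v) g ` V \<inter> (*v) g' ` V'" using eq ab(1) by (metis IntI imageI)
  then have "g *v a = 0" using i by blast
  then have "matrix_inv g *v (g *v a) = 0" "matrix_inv g' *v (g' *v (- b)) = 0" using eq by simp_all
  then show "z = 0" using matrix_inv_mult(4)[OF g(1)] matrix_inv_mult(4)[OF g(2)] z_eq by simp
qed

text \<open>The frames of the two subspaces converge separately; glued together they conjugate the
  projection to a fixed one, and inversion is continuous.\<close>

lemma tendsto_projection:
  fixes g :: "nat \<Rightarrow> 'k::finite matrix"
  assumes c: "complementary V V'" and lim: "g \<longlonglongrightarrow> h" "g' \<longlonglongrightarrow> h'"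
    and inv: "\<And>k. invertible (g k)" "\<And>k. invertible (g' k)" "invertible h" "invertible h'"
    and i: "\<And>k. (*v) (g k) ` V \<inter> (*v) (g' k) ` V' = {0}" "(*v) h ` V \<inter> (*v) h' ` V' = {0}"
  shows "(\<lambda>k. projection ((*v) (g k) ` V) ((*v) (g' k) ` V')) \<longlonglongrightarrow> projection ((*v) h ` V) ((*v) h' ` V')"
proof -
  have eq: "projection ((*v) a ` V) ((*v) b ` V') = glue V V' a b ** projection V V' ** matrix_inv (glue V V' a b)"
    if "invertible a" "invertible b" "(*v) a ` V \<inter> (*v) b ` V' = {0}" for a b
    using projection_image[OF c glue_invertible[OF c that]] glue_images[OF c, of a b] by simp
  have l: "(\<lambda>k. glue V V' (g k) (g' k)) \<longlonglongrightarrow> glue V V' h h'"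
    unfolding glue_def by (intro tendsto_intros lim)
  show ?thesis unfolding eq[OF inv(1,2) i(1)] eq[OF inv(3,4) i(2)]
    by (intro tendsto_matrix_matrix tendsto_const l tendsto_matrix_inv glue_invertible[OF c] inv i)
qed

text \<open>The matrices \<open>N t\<close> form a one-parameter group, and the map \<open>D\<close>
  doubling the direction \<open>u\<close> conjugates \<open>N t\<close> to \<open>N (2 * t)\<close>.
  So the determinant equals its own square and, being nonzero, is 1.\<close>

lemma det_outer:
  fixes u w :: "real^'k::finite"
  assumes "w \<bullet> u = 0" shows "det (mat 1 + t *\<^sub>R outer u w) = 1"
proof (cases "u = 0")
  case True
  then have "outer u w = 0" unfolding outer_def by (simp add: vec_eq_iff)
  then show ?thesis by simp
next
  case False
  define N where "N s = mat 1 + s *\<^sub>R outer u w" for s :: real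
  have Nv: "N s *v z = z + (s * (w \<bullet> z)) *\<^sub>R u" for s z
    unfolding N_def by (simp add: matrix_vector_mult_add_rdistrib scaleR_matrix_vector)
  have NN: "N a ** N b = N (a + b)" for a b
    by (simp add: matrix_eq Nv inner_add_right assms algebra_simps flip: matrix_vector_mul_assoc)
  define D where "D = mat 1 + outer u (u /\<^sub>R (u \<bullet> u))"
  have Dv: "D *v z = z + ((u \<bullet> z) / (u \<bullet> u)) *\<^sub>R u" for z
    unfolding D_def by (simp add: matrix_vector_mult_add_rdistrib divide_inverse mult.commute)
  have uu: "u \<bullet> u \<noteq> 0" using False by simp
  have "D ** N t = N (2 * t) ** D"
  proof -
    have "D *v (N t *v z) = N (2 * t) *v (D *v z)" for z
      unfolding vec_eq_iff
      using uu assms by (simp add: Nv Dv inner_add_right add_divide_distrib) (simp add: algebra_simps)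
    then show ?thesis by (simp add: matrix_eq flip: matrix_vector_mul_assoc)
  qed
  then have "det D * det (N t) = det (N (2 * t)) * det D" by (metis det_mul)
  moreover have "det D \<noteq> 0"
  proof -
    have "z = 0" if "D *v z = 0" for z
    proof -
      have "u \<bullet> (D *v z) = 2 * (u \<bullet> z)" using uu by (simp add: Dv inner_add_right)
      then have "u \<bullet> z = 0" using that by simp
      then show ?thesis using that Dv[of z] by simp
    qed
    then have "invertible D" unfolding invertible_left_inverse matrix_left_invertible_ker by blast
    then show ?thesis by (simp add: invertible_det_nz)
  qed
  ultimately have "det (N t) = det (N (2 * t))" by simp
  moreover have "det (N (2 * t)) = det (N t) * det (N t)"
    unfolding mult_2 NN[symmetric] by (rule det_mul)
  ultimately have sq: "det (N t) * det (N t) = det (N t) * 1" by simp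
  have "N (t + - t) = mat 1" by (simp add: N_def)
  then have "det (N t) * det (N (- t)) = 1" unfolding NN[symmetric] det_mul by (metis det_I det_mul)
  then have "det (N t) \<noteq> 0" by auto
  then have "det (N t) = 1" using sq by simp
  then show ?thesis unfolding N_def .
qed

lemma outer_lie_algebra_SL:
  assumes "w \<bullet> u = 0" shows "outer u w \<in> lie_algebra SL"
  unfolding lie_algebra_def
proof (intro CollectI exI[of _ "\<lambda>t. mat 1 + t *\<^sub>R outer u w"] conjI allI)
  show "((\<lambda>t. mat 1 + t *\<^sub>R outer u w) has_vector_derivative outer u w) (at 0)"
    by (auto intro!: derivative_eq_intros)
qed (use det_outer[OF assms] in \<open>auto simp: SL_def\<close>)

lemma Ad_outer: "invertible A \<Longrightarrow> Ad A (outer u w) = outer (A *v u) (transpose (matrix_inv A) *v w)"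
  unfolding Ad_def
  by (simp add: matrix_eq matrix_vector_mult_scaleR dot_lmul_matrix flip: matrix_vector_mul_assoc)

lemma Ad_mult: "\<lbrakk>invertible A; invertible B\<rbrakk> \<Longrightarrow> Ad A (Ad B X) = Ad (A ** B) X"
proof -
  assume inv: "invertible A" "invertible B"
  have "(A ** B) ** (matrix_inv B ** matrix_inv A) = A ** (B ** matrix_inv B) ** matrix_inv A" by (simp add: matrix_mul_assoc)
  also have "\<dots> = mat 1" using inv by (simp add: matrix_inv_mult)
  finally have "matrix_inv (A ** B) = matrix_inv B ** matrix_inv A" by (rule matrix_inv_unique)
  then show ?thesis unfolding Ad_def by (simp add: matrix_mul_assoc)
qed

lemma Ad_zero [simp]: "Ad A 0 = 0"
  unfolding Ad_def by (simp add: matrix_matrix_mult_def vec_eq_iff)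

lemma Ad_one [simp]: "Ad (mat 1) X = X"
proof -
  have "matrix_inv (mat 1) = (mat 1 :: 'a matrix)" by (rule matrix_inv_unique) simp
  then show ?thesis unfolding Ad_def by simp
qed

lemma real_subseq_cases:
  fixes t :: "nat \<Rightarrow> real"
  obtains r l where "strict_mono (r :: nat \<Rightarrow> nat)" "(\<lambda>k. t (r k)) \<longlonglongrightarrow> l"
  | r where "strict_mono (r :: nat \<Rightarrow> nat)" "filterlim (\<lambda>k. t (r k)) at_top sequentially"
  | r where "strict_mono (r :: nat \<Rightarrow> nat)" "filterlim (\<lambda>k. t (r k)) at_bot sequentially"
proof -
  obtain l r where r: "strict_mono (r :: nat \<Rightarrow> nat)" "((\<lambda>k. ereal (t k)) \<circ> r) \<longlonglongrightarrow> l"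
    using compact_complete_linorder[of "\<lambda>k. ereal (t k)"] by blast
  then have lim: "(\<lambda>k. ereal (t (r k))) \<longlonglongrightarrow> l" by (simp add: comp_def)
  show thesis
  proof (cases l)
    case (real x)
    then show ?thesis using that(1)[OF r(1)] lim by simp
  next
    case PInf
    then show ?thesis using that(2)[OF r(1)] lim by (simp add: tendsto_PInfty_eq_at_top)
  next
    case MInf
    then show ?thesis using that(3)[OF r(1)] lim ereal_tendsto_simps2(3)[of "\<lambda>k. t (r k)" sequentially]
      by (simp add: comp_def)
  qed
qed

lemma unit_subseq:
  fixes v :: "nat \<Rightarrow> 'a::euclidean_space"
  assumes "\<And>k. norm (v k) = 1"
  obtains r l where "strict_mono (r :: nat \<Rightarrow> nat)" "(\<lambda>k. v (r k)) \<longlonglongrightarrow> l" "norm l = 1"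
proof -
  have "v k \<in> sphere 0 1" for k using assms by simp
  then obtain l r where "l \<in> sphere 0 1" "strict_mono (r :: nat \<Rightarrow> nat)" "(v \<circ> r) \<longlonglongrightarrow> l"
    using compact_sphere[of "0::'a" 1] unfolding compact_eq_seq_compact_metric seq_compact_def by blast
  then show ?thesis using that[of r l] by (simp add: comp_def)
qed

definition coordinates :: "'k::finite set \<Rightarrow> (real^'k) set" where
  "coordinates I = {v. \<forall>i. i \<notin> I \<longrightarrow> v $ i = 0}"

lemma complementary_coordinates:
  fixes V V' :: "(real^'k::finite) set"
  assumes c: "complementary V V'" and I: "card I = dim V"
  obtains A :: "'k matrix" where "invertible A" "(*v) A ` coordinates I = V" "(*v) A ` coordinates (- I) = V'"
proof -
  have V: "subspace V" "subspace V'" "dim V + dim V' = CARD('k)" using c unfolding complementary_def by auto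
  obtain B where B: "B \<subseteq> V" "independent B" "V \<subseteq> span B" "card B = dim V" using basis_exists by blast
  obtain B' where B': "B' \<subseteq> V'" "independent B'" "V' \<subseteq> span B'" "card B' = dim V'" using basis_exists by blast
  have "card (- I) = dim V'" using V(3) I by (simp add: Compl_eq_Diff_UNIV card_Diff_subset)
  then obtain b b' where b: "bij_betw b I B" and b': "bij_betw b' (- I) B'"
    using finite_same_card_bij[of I B] finite_same_card_bij[of "- I" B'] I B B' finiteI_independent by (metis finite_code)
  define f where "f j = (if j \<in> I then b j else b' j)" for j
  define A :: "'k matrix" where "A = (\<chi> i j. f j $ i)"
  have Av: "A *v v = (\<Sum>j\<in>UNIV. v $ j *\<^sub>R f j)" for v
    unfolding A_def matrix_mult_sum by (simp add: column_def vec_eq_iff scalar_mult_eq_scaleR)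
  have ax: "A *v axis j 1 = f j" for j
    unfolding A_def by (simp add: vec_eq_iff matrix_vector_mult_basis column_def)
  have img: "(*v) A ` coordinates J = U" if U: "subspace U" "f ` J \<subseteq> U" "U \<subseteq> span (f ` J)" for J U
  proof
    show "(*v) A ` coordinates J \<subseteq> U"
    proof
      fix z assume "z \<in> (*v) A ` coordinates J"
      then obtain v where v: "v \<in> coordinates J" "z = A *v v" by blast
      have "v $ j *\<^sub>R f j \<in> U" for j
      proof (cases "j \<in> J")
        case True then show ?thesis using U(1,2) by (auto intro: subspace_scale)
      next
        case False then show ?thesis using v(1) U(1) unfolding coordinates_def by (simp add: subspace_0)
      qed
      then show "z \<in> U" unfolding v(2) Av using U(1) by (auto intro: subspace_sum)
    qed
    have "span (f ` J) \<subseteq> (*v) A ` coordinates J"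
    proof (rule span_minimal)
      show "f ` J \<subseteq> (*v) A ` coordinates J"
      proof
        fix z assume "z \<in> f ` J"
        then obtain j where "j \<in> J" "z = A *v axis j 1" using ax by auto
        moreover have "axis j 1 \<in> coordinates J" if "j \<in> J" using that unfolding coordinates_def axis_def by auto
        ultimately show "z \<in> (*v) A ` coordinates J" by blast
      qed
      show "subspace ((*v) A ` coordinates J)"
        by (intro linear_subspace_image matrix_vector_mul_linear) (auto simp: subspace_def coordinates_def)
    qed
    then show "U \<subseteq> (*v) A ` coordinates J" using U(3) by blast
  qed
  have "f ` I = B" "f ` (- I) = B'" using b b' unfolding f_def bij_betw_def by auto
  then have im: "(*v) A ` coordinates I = V" "(*v) A ` coordinates (- I) = V'" using img V B B' by auto
  have "surj ((*v) A)"
    unfolding surj_def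
  proof
    fix z
    obtain e where e: "e \<in> V" "z - e \<in> V'" using complementary_decomp[OF c] by blast
    obtain u u' where "e = A *v u" "z - e = A *v u'" using e im by blast
    then have "z = A *v (u + u')" by (simp add: matrix_vector_right_distrib algebra_simps)
    then show "\<exists>y. z = A *v y" by blast
  qed
  then have "invertible A" unfolding matrix_right_invertible_surjective[symmetric] using invertible_right_inverse by blast
  then show ?thesis using that im by blast
qed

lemma complementary_SL:
  fixes V V' E F :: "(real^'k::finite) set"
  assumes V: "complementary V V'" and E: "complementary E F" and dim: "dim E = dim V"
  obtains h where "h \<in> SL" "(*v) h ` V = E" "(*v) h ` V' = F"
proof -
  have "dim V \<le> card (UNIV :: 'k set)" using V unfolding complementary_def by auto
  then obtain I :: "'k set" where I: "card I = dim V" by (meson obtain_subset_with_card_n)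
  obtain A where A: "invertible A" "(*v) A ` coordinates I = V" "(*v) A ` coordinates (- I) = V'"
    by (rule complementary_coordinates[OF V I])
  obtain B where B: "invertible B" "(*v) B ` coordinates I = E" "(*v) B ` coordinates (- I) = F"
    by (rule complementary_coordinates[OF E]) (use I dim in auto)
  \<comment> \<open>Rescaling one arbitrary coordinate corrects the determinant and preserves every
    coordinate subspace.\<close>
  define i0 :: 'k where "i0 = undefined"
  define r where "r = det A / det B"
  have nz: "det A \<noteq> 0" "det B \<noteq> 0" using A(1) B(1) invertible_det_nz by auto
  then have r0: "r \<noteq> 0" unfolding r_def by simp
  define \<delta> where "\<delta> s i = (if i = i0 then s else 1 :: real)" for s i
  define D :: "real \<Rightarrow> 'k matrix" where "D s = (\<chi> i j. if i = j then \<delta> s i else 0)" for s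
  have Dv: "D s *v v = (\<chi> i. \<delta> s i * v $ i)" for s v
    unfolding D_def matrix_vector_mult_def by (simp add: vec_eq_iff if_distrib[of "\<lambda>z. z * _"] cong: if_cong)
  have Dim: "(*v) (D r) ` coordinates J = coordinates J" for J
  proof (intro antisym subsetI)
    fix v assume v: "v \<in> coordinates J"
    have "v = D r *v (D (1 / r) *v v)" unfolding Dv using r0 by (simp add: vec_eq_iff \<delta>_def)
    moreover have "D (1 / r) *v v \<in> coordinates J" using v unfolding Dv coordinates_def by simp
    ultimately show "v \<in> (*v) (D r) ` coordinates J" by blast
  qed (auto simp: Dv coordinates_def)
  have detD: "det (D r) = r"
  proof -
    have "det (D r) = (\<Prod>i\<in>UNIV. D r $ i $ i)" by (rule det_diagonal) (simp add: D_def)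
    also have "\<dots> = (\<Prod>i\<in>UNIV. if i = i0 then r else 1)" by (simp add: D_def \<delta>_def)
    finally show ?thesis by simp
  qed
  define h where "h = B ** D r ** matrix_inv A"
  have "det (matrix_inv A) * det A = 1" using matrix_inv_mult(2)[OF A(1)] by (metis det_I det_mul)
  moreover have "det h = det B * r * det (matrix_inv A)" unfolding h_def by (simp add: det_mul detD)
  ultimately have "h \<in> SL" unfolding SL_def r_def using nz by (simp add: field_simps)
  moreover have im: "(*v) h ` ((*v) A ` K) = (*v) B ` ((*v) (D r) ` K)" for K
    unfolding image_image h_def by (simp add: matrix_inv_mult(4)[OF A(1)] flip: matrix_vector_mul_assoc)
  have "(*v) h ` V = E" "(*v) h ` V' = F" using im[of "coordinates I"] im[of "coordinates (- I)"] unfolding Dim A B .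
  ultimately show ?thesis using that by blast
qed

lemma det_differentiable: "(det :: 'k::finite matrix \<Rightarrow> real) differentiable (at A)"
proof -
  have entry: "(\<lambda>A :: 'k matrix. A $ i $ j) differentiable (at A)" for i j
    by (intro bounded_linear_imp_differentiable bounded_linear_compose[OF bounded_linear_vec_nth bounded_linear_vec_nth])
  have "(\<lambda>A :: 'k matrix. \<Prod>i\<in>J. A $ i $ p i) differentiable (at A)" for J :: "'k set" and p
    by (induction J rule: infinite_finite_induct) (auto intro!: differentiable_mult entry)
  then show ?thesis unfolding det_def by (intro differentiable_sum differentiable_mult ballI) auto
qed

lemma det_scaleR: "det (s *\<^sub>R A) = s ^ CARD('k) * det (A :: 'k::finite matrix)"
proof -
  have "s *\<^sub>R A = (\<chi> i. s *s (A $ i))" by (simp add: vec_eq_iff)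
  then show ?thesis using det_rows_mul[of "\<lambda>_. s" "\<lambda>i. A $ i"] by (simp add: vec_nth_inverse)
qed

text \<open>A curve in \<open>SL\<close> with velocity \<open>X\<close> need not preserve
  \<open>E\<close>. Its block from \<open>E\<close> to \<open>F\<close> can be removed without
  changing the velocity, since \<open>X\<close> has no such block; a root of the determinant then
  brings the curve back into \<open>SL\<close>.\<close>

lemma lie_algebra_preserving:
  fixes X :: "'k::finite matrix"
  assumes c: "complementary E F" and X: "X \<in> lie_algebra SL" and inv: "\<And>e. e \<in> E \<Longrightarrow> X *v e \<in> E"
  shows "X \<in> lie_algebra {h \<in> SL. (*v) h ` E = E}"
proof -
  obtain \<gamma> where g: "\<And>t. \<gamma> t \<in> SL" "\<gamma> 0 = mat 1" "(\<gamma> has_vector_derivative X) (at 0)" using X unfolding lie_algebra_def by blast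
  define \<pi>E \<pi>F where "\<pi>E = projection E F" and "\<pi>F = projection F E"
  define \<beta> where "\<beta> t = \<gamma> t - \<pi>F ** \<gamma> t ** \<pi>E" for t
  have E: "subspace E" using c unfolding complementary_def by blast
  have FXE: "\<pi>F ** M ** \<pi>E = 0" if "\<And>e. e \<in> E \<Longrightarrow> M *v e \<in> E" for M
    unfolding matrix_eq \<pi>E_def \<pi>F_def using that projection(1)[OF c] complementary_sym[OF c]
    by (simp flip: matrix_vector_mul_assoc)
  have b0: "\<beta> 0 = mat 1" unfolding \<beta>_def g(2) using FXE[of "mat 1"] by simp
  have bl: "bounded_linear (\<lambda>M. M - \<pi>F ** M ** \<pi>E)"
    by (intro bounded_linear_sub bounded_linear_ident bounded_linear_compose[OF bounded_bilinear.bounded_linear_left[OF bounded_bilinear_matrix_matrix] bounded_bilinear.bounded_linear_right[OF bounded_bilinear_matrix_matrix]])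
  have bd: "(\<beta> has_vector_derivative X) (at 0)"
    using bounded_linear.has_vector_derivative[OF bl g(3)] unfolding \<beta>_def FXE[OF inv, simplified] by simp
  have bE: "\<beta> t *v e \<in> E" if "e \<in> E" for t e
  proof -
    have "\<beta> t *v e = (mat 1 - \<pi>F) *v (\<gamma> t *v e)" using that c unfolding \<beta>_def \<pi>E_def
      by (simp add: matrix_vector_mult_diff_rdistrib flip: matrix_vector_mul_assoc)
    also have "mat 1 - \<pi>F = \<pi>E" unfolding \<pi>E_def \<pi>F_def using projection_sum[OF c] by (metis add_diff_cancel_right')
    finally show ?thesis using projection(1)[OF c] unfolding \<pi>E_def by simp
  qed
  obtain L where L: "((det :: 'k matrix \<Rightarrow> real) has_derivative L) (at (mat 1))" using det_differentiable unfolding differentiable_def by blast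
  have chain: "((\<lambda>t. det (\<alpha> t)) has_vector_derivative L X) (at 0)" if "\<alpha> 0 = mat 1" "(\<alpha> has_vector_derivative X) (at (0::real))" for \<alpha>
    using vector_derivative_diff_chain_within[of \<alpha> X 0 UNIV det L] that L by (auto simp: comp_def intro: has_derivative_at_withinI)
  have "((\<lambda>t. 1 :: real) has_vector_derivative L X) (at (0::real))"
    using chain[OF g(2,3)] g(1) unfolding SL_def by simp
  \<comment> \<open>The derivative of \<open>det\<close> along a curve through the identity depends
    on the velocity only, and \<open>det\<close> is constant along the original curve.\<close>
  then have "L X = 0" using vector_derivative_unique_at has_vector_derivative_const by metis
  then have dd: "((\<lambda>t. det (\<beta> t)) has_real_derivative 0) (at 0)"
    using chain[OF b0 bd] by (simp add: has_real_derivative_iff_has_vector_derivative)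
  define n where "n = CARD('k)"
  have n: "0 < n" unfolding n_def by simp
  define s where "s t = root n (inverse (det (\<beta> t)))" for t
  have d1: "det (\<beta> 0) = 1" unfolding b0 by simp
  have sd: "(s has_real_derivative 0) (at 0)"
  proof -
    have "((\<lambda>t. inverse (det (\<beta> t))) has_real_derivative 0) (at 0)"
      using DERIV_inverse'[OF dd] d1 by simp
    moreover have "(root n has_real_derivative inverse (real n * root n 1 ^ (n - Suc 0))) (at (inverse (det (\<beta> 0))))"
      unfolding d1 using DERIV_real_root[OF n, of 1] by simp
    ultimately show ?thesis unfolding s_def using DERIV_chain2 by fastforce
  qed
  have s0: "s 0 = 1" unfolding s_def d1 using n by simp
  \<comment> \<open>Far from 0 the determinant may fail to be positive; the value
    \<open>mat 1\<close> keeps the curve in the group there.\<close>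
  define \<alpha> where "\<alpha> t = (if 0 < det (\<beta> t) then s t *\<^sub>R \<beta> t else mat 1)" for t
  have cont: "isCont (\<lambda>t. det (\<beta> t)) 0" using dd by (rule DERIV_isCont)
  then have ev: "\<forall>\<^sub>F t in at 0. 0 < det (\<beta> t)" using order_tendstoD(1)[of "\<lambda>t. det (\<beta> t)" 1 "at 0" 0] d1 by (simp add: isCont_def)
  have "((\<lambda>t. s t *\<^sub>R \<beta> t) has_vector_derivative (s 0 *\<^sub>R X + 0 *\<^sub>R \<beta> 0)) (at 0)"
    by (rule has_vector_derivative_scaleR[OF sd bd])
  then have "((\<lambda>t. s t *\<^sub>R \<beta> t) has_vector_derivative X) (at 0)" by (simp add: s0)
  then have ad: "(\<alpha> has_vector_derivative X) (at 0)"
    unfolding has_vector_derivative_def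
    by (rule has_derivative_transform_eventually) (use ev in eventually_elim, auto simp: \<alpha>_def s0 b0)
  have "\<alpha> t \<in> {h \<in> SL. (*v) h ` E = E}" for t
  proof (cases "0 < det (\<beta> t)")
    case True
    have pos: "0 < s t" unfolding s_def using n True by simp
    have "s t ^ n = inverse (det (\<beta> t))" unfolding s_def using n True by simp
    moreover have "det (\<alpha> t) = s t ^ n * det (\<beta> t)" unfolding \<alpha>_def n_def using True by (simp add: det_scaleR)
    ultimately have dA: "det (\<alpha> t) = 1" using True by simp
    then have iA: "invertible (\<alpha> t)" by (simp add: invertible_det_nz)
    have "(*v) (\<alpha> t) ` E \<subseteq> E"
      unfolding \<alpha>_def using True bE E by (auto simp: scaleR_matrix_vector subspace_scale)
    then have "(*v) (\<alpha> t) ` E = E"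
      by (intro subspace_dim_equal) (auto simp: dim_image_invertible[OF iA] E intro: linear_subspace_image)
    then show ?thesis using dA unfolding SL_def by simp
  qed (simp add: \<alpha>_def SL_def)
  moreover have "\<alpha> 0 = mat 1" unfolding \<alpha>_def by (simp add: s0 b0)
  ultimately show ?thesis unfolding lie_algebra_def using ad by blast
qed

context cocompact_flow
begin

text \<open>Compactness of \<open>core\<close> bounds a positive continuous function of two unit
  vectors from both sides; invariance extends the bounds to \<open>X\<close> and homogeneity to all
  vectors. The function will be \<open>N\<close> on decomposable tangent vectors, or the pairing of
  two null vectors.\<close>

lemma invariant_pair_bound:
  fixes P :: "'g flow_point \<Rightarrow> 'v::euclidean_space \<Rightarrow> 'w::euclidean_space \<Rightarrow> bool"
  assumes L: "averaging \<Gamma> S \<delta> act d L" "averaging \<Gamma> S \<delta> act d L'"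
    and inv: "\<And>g x v w. \<lbrakk>g \<in> G; x \<in> X; P x v w\<rbrakk> \<Longrightarrow> P (act g x) (L g v) (L' g w) \<and> \<phi> (act g x) (L g v) (L' g w) = \<phi> x v w"
    and scale: "\<And>x v w a b. \<lbrakk>x \<in> X; P x v w\<rbrakk> \<Longrightarrow> P x (a *\<^sub>R v) (b *\<^sub>R w) \<and> \<phi> x (a *\<^sub>R v) (b *\<^sub>R w) = \<bar>a * b\<bar> * \<phi> x v w"
    and lim: "\<And>x l v v' w w'. \<lbrakk>\<And>k. x k \<in> X; flim x l; \<And>k. P (x k) (v k) (w k); v \<longlonglongrightarrow> v'; w \<longlonglongrightarrow> w'\<rbrakk> \<Longrightarrow>
      P l v' w' \<and> (\<lambda>k. \<phi> (x k) (v k) (w k)) \<longlonglongrightarrow> \<phi> l v' w'"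
    and pos: "\<And>x v w. \<lbrakk>x \<in> X; P x v w; v \<noteq> 0; w \<noteq> 0\<rbrakk> \<Longrightarrow> (0::real) < \<phi> x v w"
  shows "\<exists>K>0. \<forall>x\<in>X. \<forall>v w. P x v w \<longrightarrow>
    sqrt (average L x v v) * sqrt (average L' x w w) \<le> K * \<phi> x v w \<and> \<phi> x v w \<le> K * (sqrt (average L x v v) * sqrt (average L' x w w))"
proof -
  interpret A: averaging \<Gamma> S \<delta> act d L by (rule L(1))
  interpret B: averaging \<Gamma> S \<delta> act d L' by (rule L(2))
  let ?f = "\<lambda>x (v, w). \<phi> x v w + inverse (\<phi> x v w)"
  have "\<exists>K>0. \<forall>x\<in>core. \<forall>v\<in>sphere 0 1 \<times> sphere 0 1. (case v of (v, w) \<Rightarrow> P x v w \<and> norm v = 1 \<and> norm w = 1) \<longrightarrow> ?f x v \<le> K"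
  proof (rule core_bound)
    fix x l and v :: "nat \<Rightarrow> 'v \<times> 'w" and v'
    assume h: "\<And>k. x k \<in> X" "flim x l" "\<And>k. case v k of (v, w) \<Rightarrow> P (x k) v w \<and> norm v = 1 \<and> norm w = 1" "v \<longlonglongrightarrow> v'"
    have P: "P (x k) (fst (v k)) (snd (v k))" "norm (fst (v k)) = 1" "norm (snd (v k)) = 1" for k using h(3)[of k] by (auto simp: case_prod_unfold)
    have n: "norm (fst v') = 1" "norm (snd v') = 1"
      using tendsto_norm[OF tendsto_fst[OF h(4)]] tendsto_norm[OF tendsto_snd[OF h(4)]] by (auto simp: P(2,3) LIMSEQ_const_iff)
    have l: "P l (fst v') (snd v') \<and> (\<lambda>k. \<phi> (x k) (fst (v k)) (snd (v k))) \<longlonglongrightarrow> \<phi> l (fst v') (snd v')"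
      by (rule lim[OF h(1,2) P(1) tendsto_fst[OF h(4)] tendsto_snd[OF h(4)]])
    then have "0 < \<phi> l (fst v') (snd v')" using pos[OF flim_mem[OF h(2)]] n by (metis norm_zero zero_neq_one)
    then show "(\<lambda>k. ?f (x k) (v k)) \<longlonglongrightarrow> ?f l v'" using l by (auto simp: case_prod_unfold intro!: tendsto_intros)
  qed (auto intro: compact_Times)
  then obtain K where K: "K > 0" "\<And>x v w. \<lbrakk>x \<in> core; P x v w; norm v = 1; norm w = 1\<rbrakk> \<Longrightarrow> \<phi> x v w + inverse (\<phi> x v w) \<le> K" by fastforce
  obtain C where C: "C > 0" "\<And>y v. y \<in> core \<Longrightarrow> norm v \<le> C * A.anorm y v \<and> A.anorm y v \<le> C * norm v" using A.anorm_core by blast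
  obtain D where D: "D > 0" "\<And>y v. y \<in> core \<Longrightarrow> norm v \<le> D * B.anorm y v \<and> B.anorm y v \<le> D * norm v" using B.anorm_core by blast
  show ?thesis unfolding A.anorm_def[symmetric] B.anorm_def[symmetric]
  proof (rule exI[of _ "C * D * K"], rule conjI, use C D K in simp, intro ballI allI impI)
    fix x v w assume x: "x \<in> X" and P: "P x v w"
    obtain g where g: "g \<in> G" "act (inv g) x \<in> core" using to_core[OF x] .
    define y v' w' where "y = act (inv g) x" and "v' = L (inv g) v" and "w' = L' (inv g) w"
    have y: "y \<in> core" "y \<in> X" unfolding y_def using g core_mem by auto
    have e: "P y v' w'" "\<phi> x v w = \<phi> y v' w'" "A.anorm x v = A.anorm y v'" "B.anorm x w = B.anorm y w'"
      unfolding y_def v'_def w'_def using inv[of "inv g" x v w] A.anorm_equivariant[of "inv g" x v] B.anorm_equivariant[of "inv g" x w] g x P by auto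
    show "A.anorm x v * B.anorm x w \<le> C * D * K * \<phi> x v w \<and> \<phi> x v w \<le> C * D * K * (A.anorm x v * B.anorm x w)"
    proof (cases "v' = 0 \<or> w' = 0")
      case True
      then have n0: "A.anorm y v' * B.anorm y w' = 0" using A.anorm_zero_iff[OF y(2)] B.anorm_zero_iff[OF y(2)] by auto
      have "\<phi> y v' w' = 0" using True scale[OF y(2) e(1), of 0 1] scale[OF y(2) e(1), of 1 0] by auto
      then show ?thesis unfolding e n0 by simp
    next
      case False
      define r where "r = \<phi> y ((1 / norm v') *\<^sub>R v') ((1 / norm w') *\<^sub>R w')"
      note s = scale[OF y(2) e(1), of "1 / norm v'" "1 / norm w'"]
      have u: "0 < r" "r + inverse r \<le> K" unfolding r_def using pos[OF y(2) conjunct1[OF s]] K(2)[OF y(1) conjunct1[OF s]] False by auto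
      have \<phi>: "\<phi> y v' w' = norm v' * norm w' * r" unfolding r_def using conjunct2[OF s] False by simp
      have "inverse r \<le> K" "r \<le> K" using u positive_imp_inverse_positive[OF u(1)] by linarith+
      then have r: "1 \<le> K * r" "r \<le> K" using u(1) by (auto simp: field_simps)
      have "A.anorm y v' * B.anorm y w' \<le> (C * norm v') * (D * norm w')" using C D y(1) by (intro mult_mono) auto
      also have "\<dots> = (C * D * (norm v' * norm w')) * 1" by simp
      also have "\<dots> \<le> (C * D * (norm v' * norm w')) * (K * r)" using r C(1) D(1) by (intro mult_left_mono) auto
      finally have 1: "A.anorm y v' * B.anorm y w' \<le> C * D * K * \<phi> y v' w'" unfolding \<phi> by (simp add: mult_ac)
      have "\<phi> y v' w' \<le> norm v' * norm w' * K" unfolding \<phi> using r by (intro mult_left_mono) auto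
      also have "\<dots> \<le> (C * A.anorm y v') * (D * B.anorm y w') * K" using C D y(1) K(1) by (intro mult_right_mono mult_mono) auto
      finally show ?thesis using 1 unfolding e by (simp add: mult_ac)
    qed
  qed
qed

lemma act_fst:
  assumes "g \<in> G" "x \<in> X"
  shows "fst (act g x) = bact g (fst x)" "fst (snd (act g x)) = bact g (fst (snd x))"
proof -
  obtain p q t where x: "x = (p, q, t)" by (cases x)
  obtain s where "act g x = (bact g p, bact g q, s)" using act_diagonal assms unfolding x by blast
  then show "fst (act g x) = bact g (fst x)" "fst (snd (act g x)) = bact g (fst (snd x))"
    unfolding x by simp_all
qed

lemma flow_fst [simp]: "fst (flow t x) = fst x" "fst (snd (flow t x)) = fst (snd x)"
  by (cases x; simp)+

lemma mem_boundary: "x \<in> X \<Longrightarrow> fst x \<in> bdry" "x \<in> X \<Longrightarrow> fst (snd x) \<in> bdry" "x \<in> X \<Longrightarrow> fst (snd x) \<noteq> fst x"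
  by (cases x; auto simp: mem_X)+

lemma flim_boundary:
  assumes x: "\<And>k. x k \<in> X" "flim x l"
  shows "blim (\<lambda>k. fst (x k)) (fst l)"
    "blim (\<lambda>k. fst (snd (x k))) (fst (snd l))"
  using flim_iff[of x "fst l" "fst (snd l)" "snd (snd l)"] x flim_mem[OF x(2)] by auto

text \<open>The effect of \<open>g\<close> on the time coordinate is unknown; a preliminary flow
  step makes the image start at time 0.\<close>

lemma flow_normalize:
  assumes "g \<in> G" "(p, q, 0) \<in> X"
  obtains s where "act g (flow s (p, q, 0)) = (bact g p, bact g q, 0)"
proof -
  obtain s where s: "act g (p, q, 0) = (bact g p, bact g q, s)" using act_diagonal assms by blast
  then have "act g (flow (- s) (p, q, 0)) = (bact g p, bact g q, 0)" using act_flow[OF assms, of "- s"] by simp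
  then show ?thesis by (rule that)
qed

end

section \<open>Anosov representations\<close>

lemma zero_lie_algebra: "mat 1 \<in> H \<Longrightarrow> 0 \<in> lie_algebra H"
  unfolding lie_algebra_def by (intro CollectI exI[of _ "\<lambda>_. mat 1"]) auto

lemma exp_at_top: "\<kappa> > 0 \<Longrightarrow> filterlim t at_top sequentially \<Longrightarrow> (\<lambda>k::nat. exp (- \<kappa> * t k)) \<longlonglongrightarrow> (0::real)"
  using filterlim_compose[OF exp_at_bot filterlim_compose[OF filterlim_uminus_at_bot_at_top filterlim_tendsto_pos_mult_at_top[OF tendsto_const]]]
  by simp

lemma boundary_map_coset:
  assumes "equivariant_boundary_map \<Gamma> S H P \<rho> \<xi>" "p \<in> topspace (boundary_topology \<Gamma> S)"
  shows "\<xi> p \<in> (\<lambda>h. translate h P) ` H"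
proof -
  have "\<xi> p \<in> topspace (quotient_space_topology H P)"
    using assms continuous_map_image_subset_topspace unfolding equivariant_boundary_map_def by fastforce
  moreover have "topspace (quotient_space_topology H P) \<subseteq> (\<lambda>h. translate h P) ` H"
    using openin_topspace[of "quotient_space_topology H P"] unfolding openin_quotient_space_topology lcosets_matrix_group by blast
  ultimately show ?thesis by blast
qed

lemma boundary_map_lift:
  assumes H: "matrix_subgroup H" "matrix_subgroup P" "P \<subseteq> H" and xi: "equivariant_boundary_map \<Gamma> S H P \<rho> \<xi>"
    and p: "\<And>k. p k \<in> topspace (boundary_topology \<Gamma> S)" "limitin (boundary_topology \<Gamma> S) p l sequentially" and h: "h \<in> H" "\<xi> l = translate h P"
  obtains g where "g \<longlonglongrightarrow> h" "\<And>k. g k \<in> H" "\<And>k. \<xi> (p k) = translate (g k) P"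
proof -
  have "limitin (quotient_space_topology H P) (\<xi> \<circ> p) (\<xi> l) sequentially"
    using xi p(2) unfolding equivariant_boundary_map_def by (blast intro: continuous_map_limit)
  then show ?thesis
    using quotient_lift[OF H h(1), of "\<xi> \<circ> p"] h(2) boundary_map_coset[OF xi p(1)] that by (auto simp: comp_def)
qed

locale anosov_rep = cocompact_flow \<Gamma> S \<delta> act d
  for \<Gamma> :: "'g monoid" (structure) and S \<delta> act d +
  fixes \<rho> :: "'g \<Rightarrow> 'k::finite matrix" and H P Q :: "'k matrix set" and \<xi> \<eta> :: "'g boundary_point \<Rightarrow> 'k matrix set"
    and N :: "'g flow_point \<Rightarrow> 'k matrix \<times> 'k matrix \<Rightarrow> real" and C c :: real
  assumes H: "matrix_subgroup H" and P: "matrix_subgroup P" "P \<subseteq> H" and Q: "matrix_subgroup Q" "Q \<subseteq> H"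
    and rho_hom: "\<rho> \<in> hom \<Gamma> (matrix_group H)"
    and xi: "equivariant_boundary_map \<Gamma> S H P \<rho> \<xi>" and eta: "equivariant_boundary_map \<Gamma> S H Q \<rho> \<eta>"
    and transverse: "(p, q, t) \<in> flow_space \<Gamma> S \<Longrightarrow> (\<xi> p, \<eta> q) \<in> transverse_pairs H P Q"
    and Cc: "0 < C" "0 < c"
    and N_norm: "(p, q, t) \<in> flow_space \<Gamma> S \<Longrightarrow> euclidean_norm_mod (lie_algebra H \<times> lie_algebra H)
      (isotropy_algebra H (\<xi> p) \<times> isotropy_algebra H (\<eta> q)) (N (p, q, t))"
    and N_cont: "continuous_map (prod_topology flow_top (top_of_set (lie_algebra H \<times> lie_algebra H)))
           euclideanreal (\<lambda>(x, v). N x v)"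
    and N_equiv: "\<lbrakk>g \<in> G; x \<in> flow_space \<Gamma> S; A \<in> lie_algebra H; B \<in> lie_algebra H\<rbrakk> \<Longrightarrow>
      N (act g x) (Ad (\<rho> g) A, Ad (\<rho> g) B) = N x (A, B)"
    and N_contract: "\<lbrakk>x \<in> flow_space \<Gamma> S; 0 \<le> t; A \<in> lie_algebra H\<rbrakk> \<Longrightarrow>
      N (flow t x) (0, A) \<le> C * exp (- c * t) * N x (0, A)"
begin

lemma rho_mem: "g \<in> G \<Longrightarrow> \<rho> g \<in> H"
  using rho_hom unfolding hom_def by auto

lemma rho_invertible: "g \<in> G \<Longrightarrow> invertible (\<rho> g)"
  using rho_mem matrix_subgroupD(3)[OF H] by blast

lemma rho_mult: "\<lbrakk>g \<in> G; h \<in> G\<rbrakk> \<Longrightarrow> \<rho> (g \<otimes> h) = \<rho> g ** \<rho> h"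
  using rho_hom unfolding hom_def by auto

lemma rho_one: "\<rho> \<one> = mat 1"
proof -
  have "\<rho> \<one> ** \<rho> \<one> = \<rho> \<one>" using rho_mult[of \<one> \<one>] by simp
  then have "matrix_inv (\<rho> \<one>) ** (\<rho> \<one> ** \<rho> \<one>) = mat 1" using matrix_inv_mult(2)[OF rho_invertible] by simp
  then show ?thesis unfolding matrix_mul_assoc using matrix_inv_mult(2)[OF rho_invertible] by simp
qed

lemma rho_inv: "g \<in> G \<Longrightarrow> \<rho> (inv g) = matrix_inv (\<rho> g)"
proof -
  assume g: "g \<in> G"
  have "\<rho> g ** \<rho> (inv g) = mat 1" using rho_mult[of g "inv g"] g rho_one by simp
  then show ?thesis using matrix_inv_unique(2) by metis
qed

lemma rho_inv_vec [simp]: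
  assumes "g \<in> G"
  shows "\<rho> (inv g) *v (\<rho> g *v v) = v" "\<rho> g *v (\<rho> (inv g) *v v) = v"
  using matrix_inv_mult(3,4)[OF rho_invertible[OF assms]] rho_inv[OF assms] by auto

lemma xi_equiv: "\<lbrakk>g \<in> G; p \<in> bdry\<rbrakk> \<Longrightarrow> \<xi> (bact g p) = translate (\<rho> g) (\<xi> p)"
  using xi unfolding equivariant_boundary_map_def by blast

lemma eta_equiv: "\<lbrakk>g \<in> G; p \<in> bdry\<rbrakk> \<Longrightarrow> \<eta> (bact g p) = translate (\<rho> g) (\<eta> p)"
  using eta unfolding equivariant_boundary_map_def by blast

lemmas xi_coset = boundary_map_coset[OF xi, unfolded topspace_boundary] and eta_coset = boundary_map_coset[OF eta, unfolded topspace_boundary]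

lemmas xi_lift = boundary_map_lift[OF H P xi, unfolded topspace_boundary] and eta_lift = boundary_map_lift[OF H Q eta, unfolded topspace_boundary]

lemma zero_lie [simp]: "0 \<in> lie_algebra H"
  using zero_lie_algebra matrix_subgroupD(1)[OF H] .

lemma N_form:
  assumes "x \<in> X" obtains B where "bilinear B"
    "\<And>v. v \<in> lie_algebra H \<times> lie_algebra H \<Longrightarrow> 0 \<le> B v v \<and> N x v = sqrt (B v v) \<and>
      (B v v = 0 \<longleftrightarrow> v \<in> isotropy_algebra H (\<xi> (fst x)) \<times> isotropy_algebra H (\<eta> (fst (snd x))))"
  using N_norm[of "fst x" "fst (snd x)" "snd (snd x)"] assms unfolding euclidean_norm_mod_def by force

lemma N_positive: "\<lbrakk>x \<in> X; A \<in> lie_algebra H; A \<notin> isotropy_algebra H (\<eta> (fst (snd x)))\<rbrakk> \<Longrightarrow> 0 < N x (0, A)"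
proof -
  assume x: "x \<in> X" and A: "A \<in> lie_algebra H" "A \<notin> isotropy_algebra H (\<eta> (fst (snd x)))"
  obtain B where B: "\<And>v. v \<in> lie_algebra H \<times> lie_algebra H \<Longrightarrow> 0 \<le> B v v \<and> N x v = sqrt (B v v) \<and>
      (B v v = 0 \<longleftrightarrow> v \<in> isotropy_algebra H (\<xi> (fst x)) \<times> isotropy_algebra H (\<eta> (fst (snd x))))"
    using N_form[OF x] by metis
  have "B (0, A) (0, A) \<noteq> 0" using B[of "(0, A)"] A by auto
  then show "0 < N x (0, A)" using B[of "(0, A)"] A by auto
qed

lemma N_scale:
  assumes x: "x \<in> X" and A: "A \<in> lie_algebra H" "s *\<^sub>R A \<in> lie_algebra H"
  shows "N x (0, s *\<^sub>R A) = \<bar>s\<bar> * N x (0, A)"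
proof -
  obtain B where B: "bilinear B" "\<And>v. v \<in> lie_algebra H \<times> lie_algebra H \<Longrightarrow> 0 \<le> B v v \<and> N x v = sqrt (B v v) \<and>
      (B v v = 0 \<longleftrightarrow> v \<in> isotropy_algebra H (\<xi> (fst x)) \<times> isotropy_algebra H (\<eta> (fst (snd x))))"
    using N_form[OF x] by metis
  have eq: "(0, s *\<^sub>R A) = s *\<^sub>R (0 :: 'k matrix, A)" by simp
  have "B (0, s *\<^sub>R A) (0, s *\<^sub>R A) = s\<^sup>2 * B (0, A) (0, A)"
    unfolding eq bilinear_lmul[OF B(1)] bilinear_rmul[OF B(1)] by (simp add: power2_eq_square)
  then show ?thesis using B(2)[of "(0, A)"] B(2)[of "(0, s *\<^sub>R A)"] A by (simp add: real_sqrt_mult)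
qed

lemma N_flim:
  assumes x: "\<And>k. x k \<in> X" "flim x l" and A: "\<And>k. A k \<in> lie_algebra H" "A \<longlonglongrightarrow> B" "B \<in> lie_algebra H"
  shows "(\<lambda>k. N (x k) (0, A k)) \<longlonglongrightarrow> N l (0, B)"
proof -
  have "limitin (top_of_set (lie_algebra H \<times> lie_algebra H)) (\<lambda>k. (0, A k)) (0, B) sequentially"
    unfolding limitin_subtopology using A by (auto intro!: tendsto_Pair)
  then have "limitin (prod_topology flow_top (top_of_set (lie_algebra H \<times> lie_algebra H)))
      (\<lambda>k. (x k, (0, A k))) (l, (0, B)) sequentially"
    unfolding limitin_pairwise using x(2) unfolding flim_def by (simp add: comp_def)
  from continuous_map_limit[OF N_cont this] show ?thesis by (simp add: comp_def)
qed

lemma N_equiv_right: "\<lbrakk>g \<in> G; x \<in> X; A \<in> lie_algebra H\<rbrakk> \<Longrightarrow> N (act g x) (0, Ad (\<rho> g) A) = N x (0, A)"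
  using N_equiv[of g x 0 A] by simp

sublocale nv: averaging \<Gamma> S \<delta> act d "\<lambda>g. (*v) (\<rho> g)"
  by unfold_locales (auto simp: rho_mult rho_one matrix_vector_mul_assoc matrix_vector_right_distrib matrix_vector_mult_scaleR)

abbreviation "nrm \<equiv> nv.anorm"

lemma core_norm:
  obtains B where "B > 0" "\<And>y v. y \<in> core \<Longrightarrow> norm v \<le> B * nrm y v \<and> nrm y v \<le> B * norm v"
  using nv.anorm_core by blast

lemma core_rep:
  assumes "x \<in> X"
  obtains g y where "g \<in> G" "y \<in> core" "y \<in> X" "x = act g y" "\<And>v. nrm x v = nrm y (\<rho> (inv g) *v v)"
proof -
  obtain g where g: "g \<in> G" "act (inv g) x \<in> core" using to_core[OF assms] .
  have "nrm x v = nrm (act (inv g) x) (\<rho> (inv g) *v v)" for v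
    using nv.anorm_equivariant[of "inv g" x v] g assms by simp
  then show ?thesis using that[of g "act (inv g) x"] g assms core_mem by simp
qed

lemma nrm_pos: "x \<in> X \<Longrightarrow> v \<noteq> 0 \<Longrightarrow> 0 < nrm x v"
  using nv.anorm_zero_iff[of x v] nv.anorm_nonneg[of x v] by linarith

lemma nrm_zero [simp]: "nrm x 0 = 0"
  using nv.anorm_scale[of x 0 0] by simp

lemma nrm_minus [simp]: "nrm x (- v) = nrm x v"
  using nv.anorm_scale[of x "-1" v] by simp

text \<open>Otherwise normalised vectors would accumulate at a unit vector of norm zero over
  \<open>l\<close>.\<close>

lemma nrm_null:
  assumes x: "\<And>k. x k \<in> X" "flim x l" and z: "(\<lambda>k. nrm (x k) (z k)) \<longlonglongrightarrow> 0"
  shows "z \<longlonglongrightarrow> 0"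
proof (rule ccontr)
  assume "\<not> z \<longlonglongrightarrow> 0"
  then obtain e where e: "e > 0" "\<exists>\<^sub>F k in sequentially. e \<le> norm (z k)"
    unfolding tendsto_iff by (auto simp: frequently_def not_le)
  then have inf: "infinite {k. e \<le> norm (z k)}" unfolding cofinite_eq_sequentially[symmetric] frequently_cofinite by simp
  obtain r where r: "strict_mono (r :: nat \<Rightarrow> nat)" "\<And>k. e \<le> norm (z (r k))" using infinite_enumerate[OF inf] by blast
  define u where "u k = (1 / norm (z (r k))) *\<^sub>R z (r k)" for k
  have nz: "0 < norm (z (r k))" for k using r(2)[of k] e(1) by linarith
  have nu: "norm (u k) = 1" for k unfolding u_def using nz[of k] by auto
  obtain s m where s: "strict_mono (s :: nat \<Rightarrow> nat)" "(\<lambda>k. u (s k)) \<longlonglongrightarrow> m" "norm m = 1"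
    by (rule unit_subseq[of u, OF nu]) (rule that)
  have rs: "strict_mono (\<lambda>k. r (s k))" using strict_mono_o[OF r(1) s(1)] by (simp add: comp_def)
  have "(\<lambda>k. nrm (x (r (s k))) (u (s k))) \<longlonglongrightarrow> nrm l m" by (rule nv.anorm_flim[OF x(1) flim_subseq[OF x(2) rs] s(2)])
  moreover have "(\<lambda>k. nrm (x (r (s k))) (u (s k))) \<longlonglongrightarrow> 0"
  proof (rule lim_null_bound)
    show "(\<lambda>k. (1 / e) * nrm (x (r (s k))) (z (r (s k)))) \<longlonglongrightarrow> 0"
      using tendsto_mult_left[OF LIMSEQ_subseq_LIMSEQ[OF z rs], of "1/e"] by (simp add: comp_def)
    have "(1 / norm (z (r (s k)))) * nrm (x (r (s k))) (z (r (s k))) \<le> (1 / e) * nrm (x (r (s k))) (z (r (s k)))" for k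
      by (rule mult_right_mono) (use r(2) e(1) in \<open>simp_all add: frac_le\<close>)
    then show "norm (nrm (x (r (s k))) (u (s k))) \<le> (1 / e) * nrm (x (r (s k))) (z (r (s k)))" for k
      unfolding u_def by (simp add: nv.anorm_scale)
  qed
  ultimately have "nrm l m = 0" using LIMSEQ_unique by blast
  then show False using s(3) nv.anorm_zero_iff[OF flim_mem[OF x(2)]] by force
qed

text \<open>Turns decay of norms along diverging base points into convergence of the matrices of the
  elements that bring these points back.\<close>

lemma nrm_cocycle:
  assumes g: "\<And>k. g k \<in> G" and x: "\<And>k. x k \<in> X" and lim: "flim (\<lambda>k. act (g k) (x k)) l"
  shows "(\<lambda>k. nrm (x k) (v k)) \<longlonglongrightarrow> 0 \<longleftrightarrow> (\<lambda>k. \<rho> (g k) *v v k) \<longlonglongrightarrow> 0"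
proof -
  have eq: "nrm (act (g k) (x k)) (\<rho> (g k) *v v k) = nrm (x k) (v k)" for k
    using nv.anorm_equivariant[OF g x] by simp
  have X: "act (g k) (x k) \<in> X" for k using act_closed g x by simp
  show ?thesis
    using nrm_null[OF X lim, of "\<lambda>k. \<rho> (g k) *v v k"] nv.anorm_flim[OF X lim, of "\<lambda>k. \<rho> (g k) *v v k" 0] unfolding eq by auto
qed

end

section \<open>Anosov in SL implies proper\<close>

lemma outer_scale: "outer (a *\<^sub>R u) (b *\<^sub>R w) = (a * b) *\<^sub>R outer u w"
  unfolding outer_def by (simp add: vec_eq_iff)

lemma stabilizer_subspace_image: "u \<in> stabilizer_subspace H V \<Longrightarrow> (*v) u ` V = V"
  unfolding stabilizer_subspace_def stabilizer_matrix_group by auto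

lemma stabilizer_subspace_subset: "stabilizer_subspace H V \<subseteq> H"
  unfolding stabilizer_subspace_def stabilizer_matrix_group by auto

locale SL_anosov = anosov_rep \<Gamma> S \<delta> act d \<rho> SL "stabilizer_subspace SL V" "stabilizer_subspace SL V'" \<xi> \<eta> N C c
  for \<Gamma> :: "'g monoid" (structure) and S \<delta> act d and \<rho> :: "'g \<Rightarrow> ('n::finite + 'n) matrix" and V V' \<xi> \<eta> N C c +
  assumes VV': "complementary V V'" and dims: "dim V = CARD('n)" "dim V' = CARD('n)"
    and rho_isometry: "g \<in> G \<Longrightarrow> isometry (\<rho> g)"
begin

definition E :: "'g flow_point \<Rightarrow> (real^('n + 'n)) set" where "E x = orbit_sp (\<xi> (fst x)) V"
definition F :: "'g flow_point \<Rightarrow> (real^('n + 'n)) set" where "F x = orbit_sp (\<eta> (fst (snd x))) V'"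

lemma SL_inv: "g \<in> SL \<Longrightarrow> invertible g"
  using matrix_subgroupD(3)[OF matrix_subgroup_SL] .

lemma orbit_V: "orbit_sp (translate h (stabilizer_subspace SL V)) V = (*v) h ` V"
  by (rule orbit_sp_translate[OF matrix_subgroup_stabilizer_subspace[OF matrix_subgroup_SL] stabilizer_subspace_image])

lemma orbit_V': "orbit_sp (translate h (stabilizer_subspace SL V')) V' = (*v) h ` V'"
  by (rule orbit_sp_translate[OF matrix_subgroup_stabilizer_subspace[OF matrix_subgroup_SL] stabilizer_subspace_image])

lemma EF_frame:
  assumes "x \<in> X" obtains h where "h \<in> SL" "E x = (*v) h ` V" "F x = (*v) h ` V'"
proof -
  have "(\<xi> (fst x), \<eta> (fst (snd x))) \<in> transverse_pairs SL (stabilizer_subspace SL V) (stabilizer_subspace SL V')"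
    using transverse[of "fst x" "fst (snd x)" "snd (snd x)"] assms by simp
  then obtain h where "h \<in> SL" "\<xi> (fst x) = translate h (stabilizer_subspace SL V)"
    "\<eta> (fst (snd x)) = translate h (stabilizer_subspace SL V')" by (rule transverse_pairs_frame)
  then show ?thesis using that[of h] orbit_V orbit_V' unfolding E_def F_def by simp
qed

lemma EF: 
  assumes "x \<in> X" 
  shows "complementary (E x) (F x)" "dim (E x) = CARD('n)" "dim (F x) = CARD('n)"
proof -
  obtain h where h: "h \<in> SL" "E x = (*v) h ` V" "F x = (*v) h ` V'" using EF_frame[OF assms] .
  show "complementary (E x) (F x)" "dim (E x) = CARD('n)" "dim (F x) = CARD('n)"
    unfolding h using complementary_image[OF VV' SL_inv[OF h(1)]] dim_image_invertible[OF SL_inv[OF h(1)]] dims by auto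
qed

lemma EF_equivariant:
  assumes "g \<in> G" "x \<in> X"
  shows "E (act g x) = (*v) (\<rho> g) ` E x" "F (act g x) = (*v) (\<rho> g) ` F x"
  unfolding E_def F_def act_fst[OF assms] using xi_equiv[OF assms(1) mem_boundary(1)[OF assms(2)]] eta_equiv[OF assms(1) mem_boundary(2)[OF assms(2)]]
  by (simp_all add: orbit_sp_equivariant)

lemma EF_flow [simp]: "E (flow t x) = E x" "F (flow t x) = F x"
  unfolding E_def F_def by simp_all

definition proj where "proj x = projection (E x) (F x)"

lemma proj:
  assumes "x \<in> X"
  shows "proj x *v z \<in> E x" "z - proj x *v z \<in> F x" "z \<in> E x \<Longrightarrow> proj x *v z = z" "z \<in> F x \<Longrightarrow> proj x *v z = 0"
  unfolding proj_def using projection[OF EF(1)[OF assms]] EF(1)[OF assms] by auto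

lemma EF_subspace: "x \<in> X \<Longrightarrow> subspace (E x)" "x \<in> X \<Longrightarrow> subspace (F x)"
  using EF(1) unfolding complementary_def by auto

lemma proj_flim:
  assumes x: "\<And>k. x k \<in> X" "flim x l"
  shows "(\<lambda>k. proj (x k)) \<longlonglongrightarrow> proj l"
proof -
  have lX: "l \<in> X" using x flim_mem by blast
  obtain h where h: "h \<in> SL" "\<xi> (fst l) = translate h (stabilizer_subspace SL V)" using xi_coset[OF mem_boundary(1)[OF lX]] by blast
  obtain h' where h': "h' \<in> SL" "\<eta> (fst (snd l)) = translate h' (stabilizer_subspace SL V')" using eta_coset[OF mem_boundary(2)[OF lX]] by blast
  obtain g where g: "g \<longlonglongrightarrow> h" "\<And>k. g k \<in> SL" "\<And>k. \<xi> (fst (x k)) = translate (g k) (stabilizer_subspace SL V)"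
    by (rule xi_lift[OF mem_boundary(1)[OF x(1)] flim_boundary(1)[OF x] h]) (rule that)
  obtain g' where g': "g' \<longlonglongrightarrow> h'" "\<And>k. g' k \<in> SL" "\<And>k. \<eta> (fst (snd (x k))) = translate (g' k) (stabilizer_subspace SL V')"
    by (rule eta_lift[OF mem_boundary(2)[OF x(1)] flim_boundary(2)[OF x] h']) (rule that)
  have e: "E (x k) = (*v) (g k) ` V" "F (x k) = (*v) (g' k) ` V'" "E l = (*v) h ` V" "F l = (*v) h' ` V'" for k
    unfolding E_def F_def g g' h h' orbit_V orbit_V' by simp_all
  have "E (x k) \<inter> F (x k) = {0}" "E l \<inter> F l = {0}" for k using EF(1) x(1) lX unfolding complementary_def by auto
  then show ?thesis unfolding proj_def e by (intro tendsto_projection[OF VV' g(1) g'(1)] SL_inv g(2) g'(2) h(1) h'(1))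
qed

lemma EF_limit:
  assumes x: "\<And>k. x k \<in> X" "flim x l"
  shows "v \<longlonglongrightarrow> w \<Longrightarrow> (\<And>k. v k \<in> E (x k)) \<Longrightarrow> w \<in> E l"
    "z \<in> E l \<Longrightarrow> (\<lambda>k. proj (x k) *v z) \<longlonglongrightarrow> z" "z \<in> F l \<Longrightarrow> (\<lambda>k. z - proj (x k) *v z) \<longlonglongrightarrow> z"
proof -
  have lX: "l \<in> X" using x flim_mem by blast
  show "w \<in> E l" if "v \<longlonglongrightarrow> w" "\<And>k. v k \<in> E (x k)"
  proof -
    have "(\<lambda>k. proj (x k) *v v k) \<longlonglongrightarrow> proj l *v w" by (intro tendsto_intros proj_flim x that)
    then have "v \<longlonglongrightarrow> proj l *v w" using proj(3)[OF x(1) that(2)] by simp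
    then show ?thesis using that(1) LIMSEQ_unique proj(1)[OF lX] by metis
  qed
  have lim: "(\<lambda>k. proj (x k) *v z) \<longlonglongrightarrow> proj l *v z" by (intro tendsto_intros proj_flim x)
  show "z \<in> E l \<Longrightarrow> (\<lambda>k. proj (x k) *v z) \<longlonglongrightarrow> z" using lim proj(3)[OF lX] by simp
  show "(\<lambda>k. z - proj (x k) *v z) \<longlonglongrightarrow> z" if "z \<in> F l"
    using tendsto_diff[OF tendsto_const[of z] lim] proj(4)[OF lX that] by simp
qed

text \<open>The isotropy algebra at \<open>\<eta>\<close> preserves \<open>F x\<close>, while
  \<open>outer e b\<close> has its values on the line of \<open>e\<close> in \<open>E x\<close>. So
  \<open>b\<close> would vanish on \<open>F x\<close> as well as on \<open>E x\<close>.\<close>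

lemma outer_not_isotropy:
  assumes x: "x \<in> X" and e: "e \<in> E x" "e \<noteq> 0" and b: "b \<noteq> 0" "\<And>u. u \<in> E x \<Longrightarrow> b \<bullet> u = 0"
  shows "outer e b \<notin> isotropy_algebra SL (\<eta> (fst (snd x)))"
proof
  assume iso: "outer e b \<in> isotropy_algebra SL (\<eta> (fst (snd x)))"
  have c: "complementary (E x) (F x)" by (rule EF(1)[OF x])
  then have sF: "subspace (orbit_sp (\<eta> (fst (snd x))) V')" unfolding complementary_def F_def by blast
  have pres: "(b \<bullet> z) *\<^sub>R e \<in> F x" if "z \<in> F x" for z
    using isotropy_algebra_preserves[OF iso sF, of z] that unfolding F_def by simp
  have "b \<bullet> z = 0" if z: "z \<in> F x" for z
  proof (rule ccontr)
    assume ne: "b \<bullet> z \<noteq> 0"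
    have "inverse (b \<bullet> z) *\<^sub>R (b \<bullet> z) *\<^sub>R e \<in> F x"
      by (rule subspace_scale[OF _ pres[OF z]]) (use c in \<open>auto simp: complementary_def\<close>)
    then have "e \<in> E x \<inter> F x" using ne e by simp
    then show False using c e unfolding complementary_def by simp
  qed
  moreover have "b = proj x *v b + (b - proj x *v b)" by simp
  ultimately have "b \<bullet> b = 0"
    using proj(1,2)[OF x, of b] b(2) by (metis add_0 inner_add_right)
  then show False using b(1) by simp
qed

text \<open>The contragredient action, under which the pairing of functionals with vectors is
  invariant.\<close>

sublocale dual: averaging \<Gamma> S \<delta> act d "\<lambda>g. (*v) (transpose (\<rho> (inv g)))"
  by unfold_locales (auto simp: rho_mult rho_one inv_mult_group matrix_transpose_mul matrix_vector_right_distrib matrix_vector_mult_scaleR simp flip: matrix_vector_mul_assoc)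

lemma dual_inner: "g \<in> G \<Longrightarrow> (transpose (\<rho> (inv g)) *v b) \<bullet> (\<rho> g *v v) = b \<bullet> v"
  by (simp only: transpose_matrix_vector dot_lmul_matrix rho_inv_vec)

definition perp where "perp x b \<longleftrightarrow> (\<forall>u\<in>E x. b \<bullet> u = 0)"

text \<open>A functional killing \<open>E x\<close> is a functional on \<open>F x\<close>; thus
  \<open>outer e b\<close> is a rank one map from \<open>F x\<close> to \<open>E x\<close>, which is
  a tangent vector at the flag \<open>\<eta>\<close>.\<close>

lemma compare_N:
  "\<exists>K>0. \<forall>x\<in>X. \<forall>e b. e \<in> E x \<and> perp x b \<longrightarrow>
    nrm x e * dual.anorm x b \<le> K * N x (0, outer e b) \<and> N x (0, outer e b) \<le> K * (nrm x e * dual.anorm x b)"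
  unfolding nv.anorm_def dual.anorm_def
proof (rule invariant_pair_bound[OF nv.averaging_axioms dual.averaging_axioms])
  have lie: "outer e b \<in> lie_algebra SL" if "e \<in> E x \<and> perp x b" for x e b
    by (rule outer_lie_algebra_SL) (use that perp_def in auto)
  show "(\<rho> g *v e \<in> E (act g x) \<and> perp (act g x) (transpose (\<rho> (inv g)) *v b)) \<and>
      N (act g x) (0, outer (\<rho> g *v e) (transpose (\<rho> (inv g)) *v b)) = N x (0, outer e b)"
    if g: "g \<in> G" "x \<in> X" "e \<in> E x \<and> perp x b" for g x e b
    using N_equiv_right[OF g(1,2) lie[OF g(3)]] g dual_inner
    by (auto simp: EF_equivariant perp_def Ad_outer rho_invertible rho_inv simp del: transpose_matrix_vector)
  show "(a *\<^sub>R e \<in> E x \<and> perp x (r *\<^sub>R b)) \<and> N x (0, outer (a *\<^sub>R e) (r *\<^sub>R b)) = \<bar>a * r\<bar> * N x (0, outer e b)"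
    if x: "x \<in> X" "e \<in> E x \<and> perp x b" for x e b a r
  proof -
    have m: "a *\<^sub>R e \<in> E x \<and> perp x (r *\<^sub>R b)" using x EF_subspace(1)[OF x(1)] by (auto simp: perp_def subspace_scale)
    then show ?thesis using N_scale[OF x(1) lie[OF x(2)], of "a * r"] lie[OF m] unfolding outer_scale by simp
  qed
  show "(e' \<in> E l \<and> perp l b') \<and> (\<lambda>k. N (x k) (0, outer (e k) (b k))) \<longlonglongrightarrow> N l (0, outer e' b')"
    if x: "\<And>k. x k \<in> X" "flim x l" and m: "\<And>k. e k \<in> E (x k) \<and> perp (x k) (b k)" and lim: "e \<longlonglongrightarrow> e'" "b \<longlonglongrightarrow> b'" for x l e e' b b'
  proof -
    have "b' \<bullet> u = 0" if "u \<in> E l" for u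
    proof -
      have "(\<lambda>k. b k \<bullet> (proj (x k) *v u)) \<longlonglongrightarrow> b' \<bullet> u" by (intro tendsto_intros lim EF_limit(2)[OF x that])
      then show ?thesis using m proj(1)[OF x(1)] unfolding perp_def by (simp add: LIMSEQ_const_iff)
    qed
    then have l: "e' \<in> E l \<and> perp l b'" using EF_limit(1)[OF x lim(1)] m unfolding perp_def by blast
    then show ?thesis using N_flim[OF x lie[OF m] tendsto_outer[OF lim] lie[OF l]] by blast
  qed
  show "0 < N x (0, outer e b)" if "x \<in> X" "e \<in> E x \<and> perp x b" "e \<noteq> 0" "b \<noteq> 0" for x e b
    using N_positive[OF that(1) lie[OF that(2)]] outer_not_isotropy[OF that(1)] that unfolding perp_def by blast
qed

text \<open>Annihilators of \<open>E x\<close> norm the vectors of \<open>F x\<close> uniformly,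
  because the projections are bounded over \<open>core\<close>; the second bound is the
  Cauchy-Schwarz inequality carried over from \<open>core\<close>.\<close>

lemma dual_pairing:
  "\<exists>D>0. \<forall>x\<in>X. \<forall>f. f \<in> F x \<and> f \<noteq> 0 \<longrightarrow> (\<exists>b. perp x b \<and> b \<bullet> f \<noteq> 0 \<and> dual.anorm x b * nrm x f \<le> D * \<bar>b \<bullet> f\<bar>)"
  "\<exists>D>0. \<forall>x\<in>X. \<forall>b f. \<bar>b \<bullet> f\<bar> \<le> D * (dual.anorm x b * nrm x f)"
proof -
  obtain B where B: "B > 0" "\<And>y v. y \<in> core \<Longrightarrow> norm v \<le> B * nrm y v \<and> nrm y v \<le> B * norm v" by (rule core_norm) (rule that)
  obtain B' where B': "B' > 0" "\<And>y v. y \<in> core \<Longrightarrow> norm v \<le> B' * dual.anorm y v \<and> dual.anorm y v \<le> B' * norm v" using dual.anorm_core by blast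
  have dual: "dual.anorm (act g y) (transpose (\<rho> (inv g)) *v b) = dual.anorm y b" if "g \<in> G" "y \<in> X" for g y b
    using dual.anorm_equivariant that by blast
  obtain L where L: "0 < L" "\<And>(A :: ('n + 'n) matrix) v. norm (A *v v) \<le> L * norm A * norm v"
    by (rule matrix_vector_norm_bound) (rule that)
  have "\<exists>K>0. \<forall>x\<in>core. \<forall>v\<in>{0::real}. True \<longrightarrow> norm (transpose (mat 1 - proj x)) \<le> K"
    by (rule core_bound) (auto intro!: tendsto_intros proj_flim)
  then obtain K where K: "K > 0" "\<And>x. x \<in> core \<Longrightarrow> norm (transpose (mat 1 - proj x)) \<le> K" by auto
  show "\<exists>D>0. \<forall>x\<in>X. \<forall>f. f \<in> F x \<and> f \<noteq> 0 \<longrightarrow> (\<exists>b. perp x b \<and> b \<bullet> f \<noteq> 0 \<and> dual.anorm x b * nrm x f \<le> D * \<bar>b \<bullet> f\<bar>)"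
  proof (rule exI[of _ "B' * (L * K) * B"], rule conjI, use B B' L K in simp, intro ballI allI impI)
    fix x f assume x: "x \<in> X" and f: "f \<in> F x \<and> f \<noteq> 0"
    obtain g y where g: "g \<in> G" "y \<in> core" "y \<in> X" "x = act g y" "\<And>v. nrm x v = nrm y (\<rho> (inv g) *v v)"
      by (rule core_rep[OF x]) (rule that)
    obtain u where u: "u \<in> F y" "f = \<rho> g *v u" using f unfolding g(4) EF_equivariant[OF g(1,3)] by blast
    \<comment> \<open>The functional pairing \<open>u\<close> with the component along
      \<open>F y\<close>: it kills \<open>E y\<close> and takes the value
      \<open>norm u * norm u\<close> at \<open>u\<close>.\<close>
    define a where "a = transpose (mat 1 - proj y) *v u"
    have a: "a \<bullet> z = u \<bullet> (z - proj y *v z)" for z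
      unfolding a_def by (simp only: transpose_matrix_vector dot_lmul_matrix) (simp add: matrix_vector_mult_diff_rdistrib)
    have au: "a \<bullet> u = norm u * norm u" unfolding a using proj(4)[OF g(3) u(1)] by (simp add: power2_norm_eq_inner flip: power2_eq_square)
    have "dual.anorm y a * nrm y u \<le> (B' * (L * K * norm u)) * (B * norm u)"
    proof (rule mult_mono)
      have "norm a \<le> L * norm (transpose (mat 1 - proj y)) * norm u" unfolding a_def by (rule L(2))
      also have "\<dots> \<le> L * K * norm u" using K(2)[OF g(2)] L(1) by (intro mult_right_mono mult_left_mono) auto
      finally show "dual.anorm y a \<le> B' * (L * K * norm u)" using B'(2)[OF g(2), of a] B'(1) by (meson mult_left_mono order_less_imp_le order_trans)
    qed (use B B' L K g(2) in auto)
    then have le: "dual.anorm y a * nrm y u \<le> B' * (L * K) * B * (norm u * norm u)" by (simp add: mult_ac)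
    have "perp x (transpose (\<rho> (inv g)) *v a)"
      unfolding perp_def g(4) EF_equivariant[OF g(1,3)] using proj(3)[OF g(3)] by (auto simp: dual_inner g(1) a simp del: transpose_matrix_vector)
    moreover have "u \<noteq> 0" using f u by auto
    ultimately show "\<exists>b. perp x b \<and> b \<bullet> f \<noteq> 0 \<and> dual.anorm x b * nrm x f \<le> B' * (L * K) * B * \<bar>b \<bullet> f\<bar>"
      using le unfolding u(2) by (intro exI[of _ "transpose (\<rho> (inv g)) *v a"]) (simp add: dual_inner g au dual nv.anorm_equivariant del: transpose_matrix_vector)
  qed
  show "\<exists>D>0. \<forall>x\<in>X. \<forall>b f. \<bar>b \<bullet> f\<bar> \<le> D * (dual.anorm x b * nrm x f)"
  proof (rule exI[of _ "B' * B"], rule conjI, use B B' in simp, intro ballI allI)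
    fix x b f assume x: "x \<in> X"
    obtain g where g: "g \<in> G" "act (inv g) x \<in> core" using to_core[OF x] .
    define b' f' where "b' = transpose (\<rho> g) *v b" and "f' = \<rho> (inv g) *v f"
    have "\<bar>b \<bullet> f\<bar> = \<bar>b' \<bullet> f'\<bar>" unfolding b'_def f'_def using dual_inner[of "inv g" b f] g(1) by simp
    also have "\<dots> \<le> norm b' * norm f'" by (rule Cauchy_Schwarz_ineq2)
    also have "\<dots> \<le> (B' * dual.anorm (act (inv g) x) b') * (B * nrm (act (inv g) x) f')" using B B' g(2) by (intro mult_mono) auto
    also have "\<dots> = B' * B * (dual.anorm x b * nrm x f)"
      unfolding b'_def f'_def using dual[of "inv g" x b] nv.anorm_equivariant[of "inv g" x f] g(1) x by simp
    finally show "\<bar>b \<bullet> f\<bar> \<le> B' * B * (dual.anorm x b * nrm x f)" .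
  qed
qed

text \<open>Contraction of \<open>outer e b\<close> is an estimate for \<open>e\<close> times
  \<open>b\<close>. Taking \<open>b\<close> to norm \<open>f\<close> at \<open>x\<close>, and
  bounding its value at \<open>f\<close> by the norms at time \<open>t\<close>, exchanges
  \<open>b\<close> for \<open>f\<close>.\<close>

lemma domination:
  obtains K where "0 < K" "\<And>x e f t. \<lbrakk>x \<in> X; e \<in> E x; f \<in> F x; 0 \<le> t\<rbrakk> \<Longrightarrow>
    nrm (flow t x) e * nrm x f \<le> K * exp (- c * t) * (nrm x e * nrm (flow t x) f)"
proof -
  obtain K where K: "K > 0" "\<And>x e b. x \<in> X \<Longrightarrow> e \<in> E x \<and> perp x b \<Longrightarrow>
    nrm x e * dual.anorm x b \<le> K * N x (0, outer e b) \<and> N x (0, outer e b) \<le> K * (nrm x e * dual.anorm x b)" using compare_N by blast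
  obtain D where D: "D > 0" "\<And>x f. x \<in> X \<Longrightarrow> f \<in> F x \<and> f \<noteq> 0 \<Longrightarrow> \<exists>b. perp x b \<and> b \<bullet> f \<noteq> 0 \<and> dual.anorm x b * nrm x f \<le> D * \<bar>b \<bullet> f\<bar>"
    using dual_pairing(1) by blast
  obtain D' where D': "D' > 0" "\<And>x b f. x \<in> X \<Longrightarrow> \<bar>b \<bullet> f\<bar> \<le> D' * (dual.anorm x b * nrm x f)" using dual_pairing(2) by blast
  show ?thesis
  proof (rule that[of "K * C * K * D * D'"])
    show "0 < K * C * K * D * D'" using K D D' Cc by simp
    fix x e f and t :: real assume x: "x \<in> X" and e: "e \<in> E x" and f: "f \<in> F x" and t: "0 \<le> t"
    let ?y = "flow t x" let ?E = "exp (- c * t)"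
    show "nrm ?y e * nrm x f \<le> K * C * K * D * D' * ?E * (nrm x e * nrm ?y f)"
    proof (cases "f = 0")
      case False
      then obtain b where b: "perp x b" "b \<bullet> f \<noteq> 0" "dual.anorm x b * nrm x f \<le> D * \<bar>b \<bullet> f\<bar>" using D(2)[OF x] f by blast
      have lie: "outer e b \<in> lie_algebra SL" by (rule outer_lie_algebra_SL) (use b e perp_def in auto)
      have "perp ?y b" using b(1) unfolding perp_def by simp
      then have "nrm ?y e * dual.anorm ?y b \<le> K * N ?y (0, outer e b)" using K(2)[of ?y e b] x e by simp
      also have "\<dots> \<le> K * (C * ?E * N x (0, outer e b))" using N_contract[OF x t lie] K(1) by (intro mult_left_mono) auto
      also have "\<dots> \<le> K * (C * ?E * (K * (nrm x e * dual.anorm x b)))" using K(2)[OF x] K(1) Cc(1) e b(1) by (intro mult_left_mono) auto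
      finally have 1: "nrm ?y e * dual.anorm ?y b \<le> K * C * K * ?E * (nrm x e * dual.anorm x b)" by (simp add: mult_ac)
      have "(nrm ?y e * nrm x f) * \<bar>b \<bullet> f\<bar> \<le> (nrm ?y e * nrm x f) * (D' * (dual.anorm ?y b * nrm ?y f))"
        using D'(2)[of ?y b f] x by (intro mult_left_mono) auto
      also have "\<dots> = D' * nrm x f * nrm ?y f * (nrm ?y e * dual.anorm ?y b)" by simp
      also have "\<dots> \<le> D' * nrm x f * nrm ?y f * (K * C * K * ?E * (nrm x e * dual.anorm x b))" using 1 D'(1) by (intro mult_left_mono) auto
      also have "\<dots> = K * C * K * D' * ?E * nrm x e * nrm ?y f * (dual.anorm x b * nrm x f)" by simp
      also have "\<dots> \<le> K * C * K * D' * ?E * nrm x e * nrm ?y f * (D * \<bar>b \<bullet> f\<bar>)" using b(3) K(1) D'(1) Cc(1) by (intro mult_left_mono) auto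
      also have "\<dots> = (K * C * K * D * D' * ?E * (nrm x e * nrm ?y f)) * \<bar>b \<bullet> f\<bar>" by simp
      finally show ?thesis using b(2) by (simp del: mult.assoc)
    qed simp
  qed
qed

text \<open>A pairing preserved by all \<open>A k\<close> tends to 0 if one vector is contracted to
  0 and the image of the other converges. Hence \<open>U\<close> is isotropic and \<open>v\<close>
  is orthogonal to it, so \<open>v\<close> lies in \<open>U\<close>.\<close>

lemma isotropic_limit:
  fixes A :: "nat \<Rightarrow> ('n + 'n) matrix"
  assumes A: "\<And>k. isometry (A k)" and U: "\<And>z. z \<in> U \<Longrightarrow> \<exists>e. e \<longlonglongrightarrow> z \<and> (\<lambda>k. A k *v e k) \<longlonglongrightarrow> 0"
    and dim: "subspace U" "dim U = CARD('n)" and w: "w \<longlonglongrightarrow> v" "(\<lambda>k. A k *v w k) \<longlonglongrightarrow> v'"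
  shows "hf v v = 0"
proof -
  have iso: "hf (A k *v a) (A k *v b) = hf a b" for k a b using A unfolding isometry_def by blast
  have zero: "hf a z = 0" if "z \<in> U" "e' \<longlonglongrightarrow> a" "(\<lambda>k. A k *v e' k) \<longlonglongrightarrow> a'" for z e' a a'
  proof -
    obtain e where e: "e \<longlonglongrightarrow> z" "(\<lambda>k. A k *v e k) \<longlonglongrightarrow> 0" using U[OF \<open>z \<in> U\<close>] by blast
    have "(\<lambda>k. hf (A k *v e' k) (A k *v e k)) \<longlonglongrightarrow> hf a' 0" by (intro tendsto_intros that e)
    then have "(\<lambda>k. hf (e' k) (e k)) \<longlonglongrightarrow> 0" by (simp add: iso hf_simps)
    moreover have "(\<lambda>k. hf (e' k) (e k)) \<longlonglongrightarrow> hf a z" by (intro tendsto_intros that e)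
    ultimately show ?thesis using LIMSEQ_unique by blast
  qed
  have U0: "hf a z = 0" if a: "a \<in> U" and z: "z \<in> U" for a z using U[OF a] zero[OF z] by blast
  have "v \<in> U" by (rule lagrangian_orthogonal[OF dim U0 zero[OF _ w]])
  then show ?thesis using U0 by blast
qed

text \<open>Domination only compares the two bundles. If along a subsequence some vector of
  \<open>F\<close> grows by a bounded factor, \<open>E\<close> is contracted forwards; otherwise
  \<open>F\<close> is expanded without bound and so contracted by the inverses. Either way one of
  the limits \<open>v\<close>, \<open>v'\<close> would be isotropic.\<close>

lemma no_recurrence:
  assumes x: "\<And>k. x k \<in> X" "flim x l" and g: "\<And>k. g k \<in> G" and y: "flim (\<lambda>k. act (g k) (flow (t k) (x k))) m"
    and t: "filterlim t at_top sequentially" and w: "w \<longlonglongrightarrow> v" "(\<lambda>k. \<rho> (g k) *v w k) \<longlonglongrightarrow> v'" and v: "hf v v = -1" "hf v' v' = -1"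
  shows False
proof -
  define y' where "y' k = flow (t k) (x k)" for k
  have X: "l \<in> X" "m \<in> X" "y' k \<in> X" "act (g k) (y' k) \<in> X" for k unfolding y'_def using x y flim_mem act_closed g by auto
  obtain K where K: "0 < K" "\<And>x e f t. \<lbrakk>x \<in> X; e \<in> E x; f \<in> F x; 0 \<le> t\<rbrakk> \<Longrightarrow>
    nrm (flow t x) e * nrm x f \<le> K * exp (- c * t) * (nrm x e * nrm (flow t x) f)" by (rule domination) (rule that)
  have y: "flim (\<lambda>k. act (g k) (y' k)) m" using y unfolding y'_def .
  show False
  proof (cases "\<exists>M. \<exists>\<^sub>F k in sequentially. \<exists>f\<in>F (x k). f \<noteq> 0 \<and> nrm (y' k) f \<le> M * nrm (x k) f")
    case True
    then obtain M where "infinite {k. \<exists>f\<in>F (x k). f \<noteq> 0 \<and> nrm (y' k) f \<le> M * nrm (x k) f}"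
      unfolding cofinite_eq_sequentially[symmetric] frequently_cofinite by blast
    from infinite_enumerate[OF this] obtain r where r: "strict_mono (r :: nat \<Rightarrow> nat)" "\<And>k. \<exists>f\<in>F (x (r k)). f \<noteq> 0 \<and> nrm (y' (r k)) f \<le> M * nrm (x (r k)) f" by blast
    have tr: "filterlim (\<lambda>k. t (r k)) at_top sequentially" by (rule filterlim_compose[OF t filterlim_subseq[OF r(1)]])
    have "hf v v = 0"
    proof (rule isotropic_limit[of "\<lambda>k. \<rho> (g (r k))" "E l"])
      show "(\<lambda>k. w (r k)) \<longlonglongrightarrow> v" "(\<lambda>k. \<rho> (g (r k)) *v w (r k)) \<longlonglongrightarrow> v'"
        using LIMSEQ_subseq_LIMSEQ[OF w(1) r(1)] LIMSEQ_subseq_LIMSEQ[OF w(2) r(1)] by (simp_all add: comp_def)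
      fix z assume z: "z \<in> E l"
      define e where "e k = proj (x (r k)) *v z" for k
      have e: "e \<longlonglongrightarrow> z" "\<And>k. e k \<in> E (x (r k))"
        unfolding e_def using EF_limit(2)[OF x(1) flim_subseq[OF x(2) r(1)] z] proj(1)[OF x(1)] by auto
      have "(\<lambda>k. nrm (y' (r k)) (e k)) \<longlonglongrightarrow> 0"
      proof (rule Lim_null_comparison)
        have "(\<lambda>k. K * exp (- c * t (r k)) * (M * nrm (x (r k)) (e k))) \<longlonglongrightarrow> K * 0 * (M * nrm l z)"
          by (intro tendsto_intros exp_at_top[OF Cc(2) tr] nv.anorm_flim[OF x(1) flim_subseq[OF x(2) r(1)] e(1)])
        then show "(\<lambda>k. K * exp (- c * t (r k)) * (M * nrm (x (r k)) (e k))) \<longlonglongrightarrow> 0" by simp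
        have "\<forall>\<^sub>F k in sequentially. 0 \<le> t (r k)" using tr by (simp add: filterlim_at_top)
        then show "\<forall>\<^sub>F k in sequentially. norm (nrm (y' (r k)) (e k)) \<le> K * exp (- c * t (r k)) * (M * nrm (x (r k)) (e k))"
        proof eventually_elim
          case (elim k)
          obtain f where f: "f \<in> F (x (r k))" "f \<noteq> 0" "nrm (y' (r k)) f \<le> M * nrm (x (r k)) f" using r(2) by blast
          have "nrm (y' (r k)) (e k) * nrm (x (r k)) f \<le> K * exp (- c * t (r k)) * (nrm (x (r k)) (e k) * nrm (y' (r k)) f)"
            unfolding y'_def by (rule K(2)[OF x(1) e(2) f(1) elim])
          also have "\<dots> \<le> K * exp (- c * t (r k)) * (nrm (x (r k)) (e k) * (M * nrm (x (r k)) f))" using f(3) K(1) by (intro mult_left_mono) auto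
          finally have "nrm (y' (r k)) (e k) * nrm (x (r k)) f \<le> (K * exp (- c * t (r k)) * (M * nrm (x (r k)) (e k))) * nrm (x (r k)) f" by (simp add: mult_ac)
          then show ?case using nrm_pos[OF x(1) f(2)] by simp
        qed
      qed
      then show "\<exists>e. e \<longlonglongrightarrow> z \<and> (\<lambda>k. \<rho> (g (r k)) *v e k) \<longlonglongrightarrow> 0"
        using nrm_cocycle[of "\<lambda>k. g (r k)", OF g X(3) flim_subseq[OF y r(1)]] e(1) by blast
    qed (use rho_isometry g EF_subspace EF X in auto)
    then show False using v by simp
  next
    case False
    have "hf v' v' = 0"
    proof (rule isotropic_limit[of "\<lambda>k. \<rho> (inv (g k))" "F m"])
      show "(\<lambda>k. \<rho> (g k) *v w k) \<longlonglongrightarrow> v'" "(\<lambda>k. \<rho> (inv (g k)) *v (\<rho> (g k) *v w k)) \<longlonglongrightarrow> v" using w g by auto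
      fix z assume z: "z \<in> F m"
      define e where "e k = z - proj (act (g k) (y' k)) *v z" for k
      have e: "e \<longlonglongrightarrow> z" "\<And>k. e k \<in> F (act (g k) (y' k))"
        unfolding e_def using EF_limit(3)[OF X(4) y z] proj(2)[OF X(4)] by auto
      define f where "f k = \<rho> (inv (g k)) *v e k" for k
      have f: "f k \<in> F (x k)" "nrm (y' k) (f k) = nrm (act (g k) (y' k)) (e k)" for k
        using e(2)[of k] nv.anorm_equivariant[of "g k" "y' k" "f k"] X(3)[of k] g[of k] unfolding f_def y'_def by (auto simp: EF_equivariant)
      have "(\<lambda>k. nrm (x k) (f k)) \<longlonglongrightarrow> 0"
      proof (rule tendstoI)
        fix eps :: real assume ep: "eps > 0"
        have lim: "(\<lambda>k. nrm (y' k) (f k)) \<longlonglongrightarrow> nrm m z" unfolding f(2) by (rule nv.anorm_flim[OF X(4) y e(1)])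
        \<comment> \<open>With this \<open>M\<close>, a vector of \<open>F (x k)\<close> of norm at
          least \<open>eps\<close> would be expanded to norm above
          \<open>nrm m z + 1\<close>.\<close>
        define M where "M = (nrm m z + 1) / eps"
        have "\<forall>\<^sub>F k in sequentially. nrm (y' k) (f k) < nrm m z + 1" by (rule order_tendstoD(2)[OF lim]) simp
        moreover have "\<forall>\<^sub>F k in sequentially. \<forall>f\<in>F (x k). f \<noteq> 0 \<longrightarrow> M * nrm (x k) f < nrm (y' k) f"
          using False by (simp add: frequently_def not_le imp_conv_disj)
        ultimately show "\<forall>\<^sub>F k in sequentially. dist (nrm (x k) (f k)) 0 < eps"
        proof eventually_elim
          case (elim k)
          show ?case
          proof (cases "f k = 0")
            case nz: False
            then have "M * nrm (x k) (f k) < nrm m z + 1" using elim f(1) by force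
            then have "(nrm m z + 1) * nrm (x k) (f k) < (nrm m z + 1) * eps" unfolding M_def using ep by (simp add: field_simps)
            then show ?thesis using nv.anorm_nonneg[of m z] by (simp add: mult_less_cancel_left_pos)
          qed (use ep in simp)
        qed
      qed
      from nrm_null[OF x this] show "\<exists>e. e \<longlonglongrightarrow> z \<and> (\<lambda>k. \<rho> (inv (g k)) *v e k) \<longlonglongrightarrow> 0" using e(1) unfolding f_def by blast
    qed (use rho_isometry g EF_subspace EF X in auto)
    then show False using v by simp
  qed
qed

lemma finite_recurrence:
  assumes inj: "inj_on \<rho> G" and K: "compact K" "\<And>z. z \<in> K \<Longrightarrow> hf z z = -1"
  shows "finite {A \<in> \<rho> ` G. (*v) A ` K \<inter> K \<noteq> {}}"
proof (rule ccontr)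
  assume "infinite {A \<in> \<rho> ` G. (*v) A ` K \<inter> K \<noteq> {}}"
  then obtain f :: "nat \<Rightarrow> ('n + 'n) matrix" where f: "inj f" "range f \<subseteq> {A \<in> \<rho> ` G. (*v) A ` K \<inter> K \<noteq> {}}"
    using infinite_countable_subset by blast
  then have "\<forall>k. \<exists>h. h \<in> G \<and> f k = \<rho> h" by blast
  then obtain h where h: "\<And>k. h k \<in> G" "\<And>k. f k = \<rho> (h k)" by metis
  have "\<forall>k. \<exists>u. u \<in> K \<and> \<rho> (h k) *v u \<in> K" using f(2) unfolding h(2)[symmetric] by blast
  then obtain u where u: "\<And>k. u k \<in> K" "\<And>k. \<rho> (h k) *v u k \<in> K" by metis
  have injh: "inj h" using f(1) h(2) by (metis injD injI)
  have inf: "infinite G" using range_inj_infinite[OF injh] h(1) by (meson finite_subset image_subsetI)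
  obtain p q c c' and r :: "nat \<Rightarrow> nat" where sp: "p \<in> bdry" "q \<in> bdry" "c \<in> bdry" "c' \<in> bdry"
    "c \<noteq> q" "c' \<noteq> p" "strict_mono r"
    "blim (\<lambda>k. bact (h (r k)) p) c"
    "blim (\<lambda>k. bact (inv (h (r k))) q) c'"
    by (rule separated_pair[OF inf h(1) injh]) (rule that)
  have "\<forall>\<^sub>F k in sequentially. bact (h (r k)) p \<in> bdry - {q}"
    using sp(8) openin_boundary_minus_point[OF sp(2)] sp(3,5) unfolding limitin_def by blast
  \<comment> \<open>From index \<open>M\<close> on, \<open>bact (h (r k)) p\<close> and
    \<open>q\<close> are distinct and thus the ends of a flow line.\<close>
  then obtain M where M: "\<And>k. k \<ge> M \<Longrightarrow> bact (h (r k)) p \<noteq> q" unfolding eventually_sequentially by blast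
  obtain m r' where m: "m \<in> K \<times> K" "strict_mono (r' :: nat \<Rightarrow> nat)" "((\<lambda>k. (u (r (k + M)), \<rho> (h (r (k + M))) *v u (r (k + M)))) \<circ> r') \<longlonglongrightarrow> m"
    by (rule seq_compactE[OF compact_imp_seq_compact[OF compact_Times[OF K(1) K(1)]], of "\<lambda>k. (u (r (k + M)), \<rho> (h (r (k + M))) *v u (r (k + M)))"]) (use u in auto)
  define s where "s k = r (r' k + M)" for k
  have sr: "strict_mono (\<lambda>k. r' k + M)" using m(2) by (simp add: strict_mono_def)
  have s: "strict_mono s" unfolding s_def using strict_mono_o[OF sp(7) sr] by (simp add: comp_def)
  define g w where "g k = h (s k)" and "w k = u (s k)" for k
  have g: "g k \<in> G" "inv (g k) \<in> G" "\<rho> (inv (g k)) *v (\<rho> (g k) *v w k) = w k" for k unfolding g_def using h by simp_all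
  have injg: "inj g" unfolding g_def using inj_compose[OF injh strict_mono_imp_inj_on[OF s]] by (simp add: comp_def)
  have w: "w \<longlonglongrightarrow> fst m" "(\<lambda>k. \<rho> (g k) *v w k) \<longlonglongrightarrow> snd m"
    using tendsto_fst[OF m(3)] tendsto_snd[OF m(3)] unfolding w_def g_def s_def comp_def by simp_all
  have hm: "hf (fst m) (fst m) = -1" "hf (snd m) (snd m) = -1" using m(1) K(2) by auto
  \<comment> \<open>By the choice of \<open>p\<close> and \<open>q\<close> both sequences converge
    in the flow space, and \<open>inv (g k)\<close> maps the flow line of \<open>x k\<close> to that
    of \<open>y k\<close>.\<close>
  define x y where "x k = (bact (g k) p, q, 0::real)" and "y k = (p, bact (inv (g k)) q, 0::real)" for k
  have x: "x k \<in> X" for k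
    unfolding x_def mem_X using boundary_act_closed[OF g(1) sp(1)] sp(2) M[of "r' k + M"] by (simp add: g_def s_def)
  have "\<forall>k. \<exists>a. act (inv (g k)) (flow a (x k)) = y k"
    using flow_normalize[OF g(2) x[unfolded x_def]] boundary_act_inv[OF g(1) sp(1)] unfolding x_def y_def by metis
  then obtain a where a: "\<And>k. act (inv (g k)) (flow (a k) (x k)) = y k" by metis
  have y: "y k \<in> X" for k unfolding a[symmetric] using g x act_closed by simp
  have b: "act (g k) (flow (- a k) (y k)) = x k" for k
  proof -
    have "flow (- a k) (y k) = act (inv (g k)) (flow (- a k) (flow (a k) (x k)))"
      unfolding a[symmetric] using act_flow[OF g(2), of "flow (a k) (x k)" k "- a k"] x by simp
    then show ?thesis using g(1) x by simp
  qed
  have fx: "flim x (c, q, 0)"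
    unfolding flim_iff[of x, OF x, of c q 0, unfolded mem_X, OF conjI[OF sp(3) conjI[OF sp(2) sp(5)]]]
    using limitin_subsequence[OF sr sp(8)] sp(2) by (simp add: x_def g_def s_def comp_def limitin_const_iff)
  have fy: "flim y (p, c', 0)"
    unfolding flim_iff[of y, OF y, of p c' 0, unfolded mem_X, OF conjI[OF sp(1) conjI[OF sp(4) sp(6)[symmetric]]]]
    using limitin_subsequence[OF sr sp(9)] sp(1) by (simp add: y_def g_def s_def comp_def limitin_const_iff)
  show False
  proof (rule real_subseq_cases[of a])
    fix r :: "nat \<Rightarrow> nat" and l assume r: "strict_mono r" "(\<lambda>k. a (r k)) \<longlonglongrightarrow> l"
    \<comment> \<open>Convergent times would contradict properness on the flow space, since the
      \<open>g k\<close> are distinct.\<close>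
    have "finite (range (\<lambda>k. inv (g (r k))))"
      by (rule proper_seq[OF g(2) _ flim_flow[OF x flim_subseq[OF fx r(1)] r(2)]]) (use x flim_subseq[OF fy r(1)] in \<open>simp_all add: a\<close>)
    then have "finite (m_inv \<Gamma> ` range (\<lambda>k. inv (g (r k))))" by (rule finite_imageI)
    then have "finite (range (\<lambda>k. g (r k)))" using g(1) by (simp add: image_image)
    moreover have "inj (\<lambda>k. g (r k))" using inj_compose[OF injg strict_mono_imp_inj_on[OF r(1)]] by (simp add: comp_def)
    ultimately show False using range_inj_infinite by blast
  next
    fix r :: "nat \<Rightarrow> nat" assume r: "strict_mono r" "filterlim (\<lambda>k. a (r k)) at_top sequentially"
    show False
      by (rule no_recurrence[of "\<lambda>k. x (r k)" _ "\<lambda>k. inv (g (r k))", OF x flim_subseq[OF fx r(1)] g(2) flim_subseq[OF fy r(1), folded a] r(2)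
        LIMSEQ_subseq_LIMSEQ[OF w(2) r(1), unfolded comp_def] _ hm(2,1)]) (use LIMSEQ_subseq_LIMSEQ[OF w(1) r(1)] in \<open>simp add: g comp_def\<close>)
  next
    fix r :: "nat \<Rightarrow> nat" assume r: "strict_mono r" "filterlim (\<lambda>k. a (r k)) at_bot sequentially"
    have at: "filterlim (\<lambda>k. - a (r k)) at_top sequentially" using r(2) by (simp add: filterlim_uminus_at_top)
    show False
      by (rule no_recurrence[of "\<lambda>k. y (r k)" _ "\<lambda>k. g (r k)", OF y flim_subseq[OF fy r(1)] g(1) flim_subseq[OF fx r(1), folded b] at
        LIMSEQ_subseq_LIMSEQ[OF w(1) r(1), unfolded comp_def] LIMSEQ_subseq_LIMSEQ[OF w(2) r(1), unfolded comp_def] hm])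
  qed
qed

end

lemma pseudo_hyperbolic_norm: "z \<in> pseudo_hyperbolic \<Longrightarrow> hf z z = -1"
proof -
  assume "z \<in> pseudo_hyperbolic"
  then obtain g :: "'a nmat" where g: "g \<in> SO0_nn" "z = g *v axis (Inr None) 1"
    unfolding pseudo_hyperbolic_def by auto
  have "hf z z = hf (axis (Inr None) 1 :: 'a nvec) (axis (Inr None) 1)"
    using SO0_isometry[OF g(1)] unfolding isometry_def g(2) by simp
  also have "\<dots> = -1" unfolding hf_option by (simp add: axis_def)
  finally show ?thesis .
qed

lemma proper_action_pseudo_hyperbolic:
  "proper_action A (top_of_set pseudo_hyperbolic) (*v) \<longleftrightarrow>
     (\<forall>K. compact K \<and> K \<subseteq> pseudo_hyperbolic \<longrightarrow> finite {g \<in> A. (*v) g ` K \<inter> K \<noteq> {}})"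
  unfolding proper_action_def compactin_subtopology compactin_euclidean_iff by blast

section \<open>Domination for Anosov representations into SO(n,n)\<close>

locale SO_anosov = anosov_rep \<Gamma> S \<delta> act d \<rho> SO0_nn P_plus P_minus \<xi> \<eta> N C c
  for \<Gamma> :: "'g monoid" (structure) and S \<delta> act d and \<rho> :: "'g \<Rightarrow> 'm::finite nmat" and \<xi> \<eta> N C c
begin

lemma rho_SO0: "g \<in> G \<Longrightarrow> \<rho> g \<in> SO0_nn"
  by (rule rho_mem)

lemma rho_hf [simp]: "g \<in> G \<Longrightarrow> hf (\<rho> g *v v) (\<rho> g *v w) = hf v w"
  using SO0_isometry[OF rho_SO0] unfolding isometry_def by blast

definition "W (x :: 'g flow_point) = W_plus (\<xi> (fst x))"
definition "Wm (x :: 'g flow_point) = W_minus (\<eta> (fst (snd x)))"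
definition "Vs eps (x :: 'g flow_point) = V_plus eps (\<xi> (fst x))"
definition "Ls eps (x :: 'g flow_point) = null_line eps (\<xi> (fst x)) (\<eta> (fst (snd x)))"

text \<open>A common frame for both cosets identifies the whole fibre, null lines included, with the
  model.\<close>

definition framing :: "'g flow_point \<Rightarrow> 'm nmat \<Rightarrow> bool" where
  "framing x h \<longleftrightarrow> h \<in> SO0_nn \<and> \<xi> (fst x) = translate h P_plus \<and> \<eta> (fst (snd x)) = translate h P_minus"

lemma framing_exists: assumes "x \<in> X" obtains h where "framing x h"
  using transverse[of "fst x" "fst (snd x)" "snd (snd x)"] assms that
  unfolding framing_def by (auto elim: transverse_pairs_frame)

lemma framingD:
  assumes "framing x h"
  shows "h \<in> SO0_nn" "hf (h *v v) (h *v w) = hf v w" "W x = (*v) h ` W_model 1" "Wm x = (*v) h ` W_model (-1)"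
    "eps \<in> {1, -1} \<Longrightarrow> Vs eps x = (*v) h ` V_model eps" "eps \<in> {1, -1} \<Longrightarrow> Ls eps x = range (\<lambda>c. c *\<^sub>R (h *v null_vec eps))"
    "\<xi> (fst x) = translate h P_plus" "\<eta> (fst (snd x)) = translate h P_minus"
  using assms SO0_isometry[of h] frame_null_line[of h eps]
  unfolding framing_def isometry_def W_def Wm_def Vs_def Ls_def by (auto simp: frame_W_plus frame_W_minus frame_V_plus)

lemma act_sets:
  assumes g: "g \<in> G" and x: "x \<in> X"
  shows "\<rho> g *v v \<in> W (act g x) \<longleftrightarrow> v \<in> W x" "\<rho> g *v v \<in> Wm (act g x) \<longleftrightarrow> v \<in> Wm x"
    "\<rho> g *v v \<in> Vs eps (act g x) \<longleftrightarrow> v \<in> Vs eps x" "\<rho> g *v v \<in> Ls eps (act g x) \<longleftrightarrow> v \<in> Ls eps x"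
proof -
  have inj: "\<rho> g *v v \<in> (*v) (\<rho> g) ` U \<longleftrightarrow> v \<in> U" for v U
    using rho_inv_vec(1)[OF g] by (metis (no_types, lifting) imageE imageI)
  show "\<rho> g *v v \<in> W (act g x) \<longleftrightarrow> v \<in> W x" "\<rho> g *v v \<in> Vs eps (act g x) \<longleftrightarrow> v \<in> Vs eps x"
    "\<rho> g *v v \<in> Wm (act g x) \<longleftrightarrow> v \<in> Wm x"
    unfolding W_def Vs_def Wm_def act_fst[OF assms] xi_equiv[OF g mem_boundary(1)[OF x]] eta_equiv[OF g mem_boundary(2)[OF x]] orbit_sp_equivariant by (rule inj)+
  show "\<rho> g *v v \<in> Ls eps (act g x) \<longleftrightarrow> v \<in> Ls eps x"
    unfolding Ls_def null_line_def act_fst[OF assms] xi_equiv[OF g mem_boundary(1)[OF x]] eta_equiv[OF g mem_boundary(2)[OF x]] orbit_sp_equivariant using g by (auto simp: inj)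
qed

lemma flow_sets [simp]: "W (flow t x) = W x" "Wm (flow t x) = Wm x" "Vs eps (flow t x) = Vs eps x" "Ls eps (flow t x) = Ls eps x"
  unfolding W_def Wm_def Vs_def Ls_def by simp_all

lemma orbit_closed_xi:
  assumes p: "\<And>k. p k \<in> bdry" "blim p l" "l \<in> bdry"
    and U: "subspace U" "\<And>u. u \<in> P_plus \<Longrightarrow> (*v) u ` U = U" and v: "v \<longlonglongrightarrow> w" "\<And>k. v k \<in> orbit_sp (\<xi> (p k)) U"
  shows "w \<in> orbit_sp (\<xi> l) U"
proof -
  obtain h where h: "h \<in> SO0_nn" "\<xi> l = translate h P_plus" using xi_coset[OF p(3)] by blast
  obtain g where g: "g \<longlonglongrightarrow> h" "\<And>k. g k \<in> SO0_nn" "\<And>k. \<xi> (p k) = translate (g k) P_plus"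
    by (rule xi_lift[OF p(1,2) h]) (rule that)
  show ?thesis unfolding h(2)
    by (rule orbit_sp_closed[OF matrix_subgroup_P_plus U(2) U(1) g(1) _ _ v(1), of "\<lambda>k. \<xi> (p k)"])
      (use g h v in \<open>auto simp: SO0_invertible\<close>)
qed

lemma orbit_closed_eta:
  assumes p: "\<And>k. p k \<in> bdry" "blim p l" "l \<in> bdry"
    and v: "v \<longlonglongrightarrow> w" "\<And>k. v k \<in> W_minus (\<eta> (p k))"
  shows "w \<in> W_minus (\<eta> l)"
proof -
  obtain h where h: "h \<in> SO0_nn" "\<eta> l = translate h P_minus" using eta_coset[OF p(3)] by blast
  obtain g where g: "g \<longlonglongrightarrow> h" "\<And>k. g k \<in> SO0_nn" "\<And>k. \<eta> (p k) = translate (g k) P_minus"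
    by (rule eta_lift[OF p(1,2) h]) (rule that)
  show ?thesis unfolding h(2)
    by (rule orbit_sp_closed[OF matrix_subgroup_P_minus P_minus_W subspace_W_model g(1) _ _ v(1), of "\<lambda>k. \<eta> (p k)"])
      (use g h v in \<open>auto simp: SO0_invertible\<close>)
qed

lemma orbit_approx_eta:
  assumes p: "\<And>k. p k \<in> bdry" "blim p l" "l \<in> bdry"
    and w: "w \<in> W_minus (\<eta> l)"
  obtains v where "v \<longlonglongrightarrow> w" "\<And>k. v k \<in> W_minus (\<eta> (p k))"
proof -
  obtain h where h: "h \<in> SO0_nn" "\<eta> l = translate h P_minus" using eta_coset[OF p(3)] by blast
  obtain g where g: "g \<longlonglongrightarrow> h" "\<And>k. g k \<in> SO0_nn" "\<And>k. \<eta> (p k) = translate (g k) P_minus"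
    by (rule eta_lift[OF p(1,2) h]) (rule that)
  obtain u where u: "u \<in> W_model (-1)" "w = h *v u" using w unfolding h(2) frame_W_minus by blast
  show ?thesis
  proof (rule that[of "\<lambda>k. g k *v u"])
    show "(\<lambda>k. g k *v u) \<longlonglongrightarrow> w" unfolding u(2) by (intro tendsto_intros g(1))
    show "g k *v u \<in> W_minus (\<eta> (p k))" for k unfolding g(3) frame_W_minus using u(1) by blast
  qed
qed

lemma closed_sets:
  assumes x: "\<And>k. x k \<in> X" "flim x l" and v: "v \<longlonglongrightarrow> w"
  shows "(\<And>k. v k \<in> W (x k)) \<Longrightarrow> w \<in> W l" "(\<And>k. v k \<in> Wm (x k)) \<Longrightarrow> w \<in> Wm l"
    "eps \<in> {1, -1} \<Longrightarrow> (\<And>k. v k \<in> Vs eps (x k)) \<Longrightarrow> w \<in> Vs eps l"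
    "eps \<in> {1, -1} \<Longrightarrow> (\<And>k. v k \<in> Ls eps (x k)) \<Longrightarrow> w \<in> Ls eps l"
proof -
  have lX: "l \<in> X" using flim_mem x by blast
  note b = mem_boundary(1)[OF x(1)] flim_boundary(1)[OF x] mem_boundary(1)[OF lX]
  note b' = mem_boundary(2)[OF x(1)] flim_boundary(2)[OF x] mem_boundary(2)[OF lX]
  show "w \<in> W l" if "\<And>k. v k \<in> W (x k)"
    using orbit_closed_xi[OF b subspace_W_model P_plus_W v] that unfolding W_def by blast
  show "w \<in> Wm l" if "\<And>k. v k \<in> Wm (x k)"
    using orbit_closed_eta[OF b' v] that unfolding Wm_def by blast
  show V: "w \<in> Vs eps l" if "eps \<in> {1, -1}" "\<And>k. v k \<in> Vs eps (x k)"
  proof -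
    have e: "eps = 1 \<or> eps = -1" using that(1) by auto
    show ?thesis using orbit_closed_xi[OF b subspace_V_model P_plus_V[OF _ e] v] that(2) unfolding Vs_def by blast
  qed
  show "w \<in> Ls eps l" if e: "eps \<in> {1, -1}" and vL: "\<And>k. v k \<in> Ls eps (x k)"
  proof -
    have "w \<in> Vs eps l" by (rule V[OF e]) (use vL in \<open>auto simp: Ls_def null_line_def Vs_def\<close>)
    moreover have "hf w z = 0" if z: "z \<in> W_minus (\<eta> (fst (snd l)))" for z
    proof -
      obtain y where y: "y \<longlonglongrightarrow> z" "\<And>k. y k \<in> W_minus (\<eta> (fst (snd (x k))))"
        by (rule orbit_approx_eta[OF b' z]) (rule that)
      have "hf (v k) (y k) = 0" for k using vL[of k] y(2)[of k] unfolding Ls_def null_line_def by blast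
      moreover have "(\<lambda>k. hf (v k) (y k)) \<longlonglongrightarrow> hf w z" by (intro tendsto_intros v y)
      ultimately show ?thesis by (simp add: LIMSEQ_const_iff)
    qed
    ultimately show ?thesis unfolding Ls_def null_line_def Vs_def by blast
  qed
qed

lemma nrm_flow_continuous:
  assumes "x \<in> X" shows "continuous_on UNIV (\<lambda>t. nrm (flow t x) v)"
  unfolding continuous_on_sequentially
proof (intro allI ballI impI)
  fix s and t :: real assume "(\<forall>n. s n \<in> UNIV) \<and> s \<longlonglongrightarrow> t"
  then have "flim (\<lambda>k. flow (s k) x) (flow t x)" using flim_flow[OF assms flim_const[OF assms]] by blast
  then show "((\<lambda>t. nrm (flow t x) v) \<circ> s) \<longlonglongrightarrow> nrm (flow t x) v"
    using nv.anorm_flim[of "\<lambda>k. flow (s k) x" _ "\<lambda>k. v"] assms by (simp add: comp_def)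
qed

lemma subspaces:
  assumes "x \<in> X" "eps \<in> {1, -1}"
  shows "subspace (W x)" "subspace (Wm x)" "subspace (Vs eps x)" "subspace (Ls eps x)"
proof -
  obtain h where h: "framing x h" using framing_exists[OF assms(1)] .
  show "subspace (W x)" "subspace (Wm x)" "subspace (Vs eps x)"
    unfolding framingD(3,4)[OF h] framingD(5)[OF h assms(2)]
    by (intro linear_subspace_image matrix_vector_mul_linear subspace_W_model subspace_V_model)+
  show "subspace (Ls eps x)" unfolding framingD(6)[OF h assms(2)] by (simp flip: span_singleton)
qed

lemma null_line_nonzero:
  assumes "x \<in> X" "eps \<in> {1, -1}" obtains a where "a \<in> Ls eps x" "a \<noteq> 0"
proof -
  obtain h where h: "framing x h" using framing_exists[OF assms(1)] .
  have "null_vec eps \<noteq> (0 :: 'm nvec)" using null_vec_nth(1)[of eps] by (metis zero_index zero_neq_one)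
  then have "h *v null_vec eps \<noteq> 0" using SO0_invertible[OF framingD(1)[OF h]] by (metis invertible_def matrix_left_invertible_ker)
  moreover have "h *v null_vec eps \<in> Ls eps x" unfolding framingD(6)[OF h assms(2)] by (metis rangeI scaleR_one)
  ultimately show ?thesis using that by blast
qed

lemma null_line_multiple:
  assumes "x \<in> X" "eps \<in> {1, -1}" "a \<in> Ls eps x" "a \<noteq> 0" "b \<in> Ls eps x" shows "\<exists>s. b = s *\<^sub>R a"
proof -
  obtain h where h: "framing x h" using framing_exists[OF assms(1)] .
  obtain s t where st: "a = s *\<^sub>R (h *v null_vec eps)" "b = t *\<^sub>R (h *v null_vec eps)"
    using assms(3,5) unfolding framingD(6)[OF h assms(2)] by blast
  then have "s \<noteq> 0" using assms(4) by auto
  then have "b = (t / s) *\<^sub>R a" unfolding st by simp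
  then show ?thesis by blast
qed

lemma Vs_decomp:
  assumes "x \<in> X" "eps \<in> {1, -1}" shows "v \<in> Vs eps x \<longleftrightarrow> (\<exists>w\<in>W x. \<exists>a\<in>Ls eps x. v = w + a)"
proof -
  obtain h where h: "framing x h" using framing_exists[OF assms(1)] .
  have eq: "h *v w + c *\<^sub>R (h *v null_vec eps) = h *v (w + c *\<^sub>R null_vec eps)" for w c
    by (simp add: matrix_vector_right_distrib matrix_vector_mult_scaleR)
  have "v \<in> Vs eps x \<longleftrightarrow> (\<exists>z. z \<in> V_model eps \<and> v = h *v z)" unfolding framingD(5)[OF h assms(2)] by blast
  also have "\<dots> \<longleftrightarrow> (\<exists>w\<in>W_model 1. \<exists>c. v = h *v w + c *\<^sub>R (h *v null_vec eps))" unfolding V_model_decomp eq by blast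
  also have "\<dots> \<longleftrightarrow> (\<exists>w\<in>W x. \<exists>a\<in>Ls eps x. v = w + a)" unfolding framingD(3)[OF h] framingD(6)[OF h assms(2)] by blast
  finally show ?thesis .
qed

lemma frame_hf:
  assumes x: "x \<in> X" and e: "eps \<in> {1, -1}" and w: "w \<in> W x" and a: "a \<in> Ls eps x"
  shows "w' \<in> W x \<Longrightarrow> hf w w' = 0" "a' \<in> Ls eps x \<Longrightarrow> hf a a' = 0" "hf w a = 0" "hf a w = 0" "z \<in> Wm x \<Longrightarrow> hf a z = 0"
proof -
  obtain h where h: "framing x h" using framing_exists[OF x] .
  obtain u b where u: "u \<in> W_model 1" "w = h *v u" "a = b *\<^sub>R (h *v null_vec eps)"
    using w a unfolding framingD(3)[OF h] framingD(6)[OF h e] by blast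
  show "hf w w' = 0" if "w' \<in> W x" using that u(1) hf_W_W unfolding framingD(3)[OF h] u by (auto simp: framingD(2)[OF h])
  show "hf a a' = 0" if "a' \<in> Ls eps x"
    using that e unfolding framingD(6)[OF h e] u by (auto simp: hf_simps framingD(2)[OF h] hf_null_vec null_vec_nth)
  show "hf w a = 0" unfolding u by (simp add: hf_simps framingD(2)[OF h] hf_null_vec) (use u(1) in \<open>simp add: W_model_def\<close>)
  then show "hf a w = 0" using hf_sym by metis
  show "hf a z = 0" if "z \<in> Wm x" using a that unfolding Ls_def null_line_def Wm_def by blast
qed

text \<open>\<open>I_nn\<close> exchanges the two model subspaces, and
  \<open>hf (I_nn *v u) u\<close> is the squared length of \<open>u\<close>. The constant comes from
  the frame at \<open>x\<close>.\<close>

lemma dual_W: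
  assumes x: "x \<in> X"
  shows "\<exists>D>0. \<forall>w'\<in>Wm x. w' \<noteq> 0 \<longrightarrow> (\<exists>w\<in>W x. w \<noteq> 0 \<and> norm w * norm w' \<le> D * \<bar>hf w w'\<bar>)"
proof -
  obtain h where h: "framing x h" using framing_exists[OF x] .
  obtain D where D: "D > 0" "\<And>u. norm (h *v u) \<le> norm u * D" using bounded_linear.pos_bounded[OF matrix_vector_mul_bounded_linear] by metis
  show ?thesis
  proof (rule exI[of _ "D * D"], rule conjI, use D(1) in simp, intro ballI impI)
    fix w' assume w': "w' \<in> Wm x" "w' \<noteq> 0"
    obtain u where u: "u \<in> W_model (-1)" "w' = h *v u" using w'(1) unfolding framingD(4)[OF h] by blast
    define w where "w = h *v (I_nn *v u)"
    have m: "w \<in> W x" using u(1) unfolding w_def framingD(3)[OF h] W_model_def I_nn_vec by simp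
    have hw: "hf w w' = norm u * norm u"
      unfolding w_def u(2) framingD(2)[OF h] hf_sym[of "I_nn *v u"] by (simp add: power2_norm_eq_inner flip: power2_eq_square)
    have "u \<noteq> 0" using u w' by auto
    then have "w \<noteq> 0" using hw by (auto simp: hf_simps)
    moreover have "norm w * norm w' \<le> (norm u * D) * (norm u * D)"
      using D(2)[of "I_nn *v u"] D(2)[of u] D(1) unfolding w_def u(2) norm_I_nn by (intro mult_mono) auto
    ultimately show "\<exists>w\<in>W x. w \<noteq> 0 \<and> norm w * norm w' \<le> D * D * \<bar>hf w w'\<bar>" using m by (intro bexI[of _ w]) (auto simp: hw mult_ac)
  qed
qed

lemma skew_lie: "\<lbrakk>x \<in> X; eps \<in> {1, -1}; w \<in> W x; a \<in> Ls eps x\<rbrakk> \<Longrightarrow> skew w a \<in> lie_algebra SO0_nn"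
  by (intro skew_lie_algebra) (auto intro: frame_hf)

text \<open>Some vector of \<open>Wm x\<close> pairs nontrivially with \<open>w\<close>, and
  \<open>skew w a\<close> sends it to a nonzero multiple of \<open>a\<close>, which lies outside
  \<open>Wm x\<close>.\<close>

lemma skew_not_isotropy:
  assumes x: "x \<in> X" and e: "eps \<in> {1, -1}" and w: "w \<in> W x" "w \<noteq> 0" and a: "a \<in> Ls eps x" "a \<noteq> 0"
  shows "skew w a \<notin> isotropy_algebra SO0_nn (\<eta> (fst (snd x)))"
proof
  assume iso: "skew w a \<in> isotropy_algebra SO0_nn (\<eta> (fst (snd x)))"
  obtain h where h: "framing x h" using framing_exists[OF x] .
  obtain u b where u: "u \<in> W_model 1" "w = h *v u" "a = b *\<^sub>R (h *v null_vec eps)"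
    using w a unfolding framingD(3)[OF h] framingD(6)[OF h e] by blast
  have sub: "subspace (Wm x)" using subspaces(2)[OF x e] .
  define z where "z = h *v (I_nn *v u)"
  have z: "z \<in> Wm x" using u(1) unfolding z_def framingD(4)[OF h] W_model_def I_nn_vec by simp
  have "skew w a *v z = - (u \<bullet> u) *\<^sub>R a" unfolding skew_vec frame_hf(5)[OF x e w(1) a(1) z] unfolding u(2) z_def framingD(2)[OF h] by simp
  moreover have "skew w a *v z \<in> Wm x" using isotropy_algebra_preserves[OF iso, of "W_model (-1)"] sub z unfolding Wm_def by blast
  ultimately have "(- inverse (u \<bullet> u)) *\<^sub>R (- (u \<bullet> u)) *\<^sub>R a \<in> Wm x" by (metis subspace_scale[OF sub])
  moreover have "u \<noteq> 0" using u w by auto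
  ultimately have "a \<in> Wm x" by simp
  then obtain u' where u': "u' \<in> W_model (-1)" "h *v (b *\<^sub>R null_vec eps) = h *v u'"
    unfolding framingD(4)[OF h] u(3) by (auto simp: matrix_vector_mult_scaleR)
  then have "b *\<^sub>R null_vec eps = u'" using matrix_inv_mult(4)[OF SO0_invertible[OF framingD(1)[OF h]]] by metis
  then have "b = u' $ Inl None" using null_vec_nth(1) by (metis mult.right_neutral real_scaleR_def vector_scaleR_component)
  then show False using u'(1) a u(3) unfolding W_model_def by simp
qed

lemma compare_N:
  assumes e: "eps \<in> {1, -1}"
  shows "\<exists>K>0. \<forall>x\<in>X. \<forall>w a. w \<in> W x \<and> a \<in> Ls eps x \<longrightarrow>
    nrm x w * nrm x a \<le> K * N x (0, skew w a) \<and> N x (0, skew w a) \<le> K * (nrm x w * nrm x a)"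
  unfolding nv.anorm_def
proof (rule invariant_pair_bound[OF nv.averaging_axioms nv.averaging_axioms])
  note lie = skew_lie[OF _ e]
  show "(\<rho> g *v w \<in> W (act g x) \<and> \<rho> g *v a \<in> Ls eps (act g x)) \<and> N (act g x) (0, skew (\<rho> g *v w) (\<rho> g *v a)) = N x (0, skew w a)"
    if g: "g \<in> G" "x \<in> X" "w \<in> W x \<and> a \<in> Ls eps x" for g x w a
    using N_equiv_right[OF g(1,2) lie] g by (simp add: act_sets Ad_skew[OF SO0_isometry[OF rho_SO0]])
  show "(b *\<^sub>R w \<in> W x \<and> r *\<^sub>R a \<in> Ls eps x) \<and> N x (0, skew (b *\<^sub>R w) (r *\<^sub>R a)) = \<bar>b * r\<bar> * N x (0, skew w a)"
    if x: "x \<in> X" "w \<in> W x \<and> a \<in> Ls eps x" for x w a b r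
  proof -
    have m: "b *\<^sub>R w \<in> W x" "r *\<^sub>R a \<in> Ls eps x" using x subspaces[OF x(1) e] by (auto intro: subspace_scale)
    have "skew (b *\<^sub>R w) (r *\<^sub>R a) = (b * r) *\<^sub>R skew w a"
      by (simp add: bounded_bilinear.scaleR_left[OF bounded_bilinear_skew] bounded_bilinear.scaleR_right[OF bounded_bilinear_skew])
    then show ?thesis using N_scale[OF x(1) lie[OF x(1) conjunct1[OF x(2)] conjunct2[OF x(2)]], of "b * r"] lie[OF x(1) m] x m by simp
  qed
  show "(w' \<in> W l \<and> a' \<in> Ls eps l) \<and> (\<lambda>k. N (x k) (0, skew (w k) (a k))) \<longlonglongrightarrow> N l (0, skew w' a')"
    if x: "\<And>k. x k \<in> X" "flim x l" and m: "\<And>k. w k \<in> W (x k) \<and> a k \<in> Ls eps (x k)" and lim: "w \<longlonglongrightarrow> w'" "a \<longlonglongrightarrow> a'" for x l w w' a a'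
  proof -
    have l: "w' \<in> W l" "a' \<in> Ls eps l" using closed_sets(1)[OF x lim(1)] closed_sets(4)[OF x lim(2) e] m by blast+
    then show ?thesis using N_flim[OF x lie[OF x(1) conjunct1[OF m] conjunct2[OF m]] tendsto_skew[OF lim] lie[OF flim_mem[OF x(2)] l]] by blast
  qed
  show "0 < N x (0, skew w a)" if "x \<in> X" "w \<in> W x \<and> a \<in> Ls eps x" "w \<noteq> 0" "a \<noteq> 0" for x w a
    using that N_positive[OF that(1) lie skew_not_isotropy[OF that(1) e]] by blast
qed

lemma domination:
  assumes e: "eps \<in> {1, -1}"
  obtains K where "K > 0" "\<And>x w a t. \<lbrakk>x \<in> X; w \<in> W x; a \<in> Ls eps x; 0 \<le> t\<rbrakk> \<Longrightarrow>
    nrm (flow t x) w * nrm (flow t x) a \<le> K * exp (- c * t) * (nrm x w * nrm x a)"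
proof -
  obtain K where K: "K > 0" "\<And>x w a. \<lbrakk>x \<in> X; w \<in> W x; a \<in> Ls eps x\<rbrakk> \<Longrightarrow> nrm x w * nrm x a \<le> K * N x (0, skew w a) \<and> N x (0, skew w a) \<le> K * (nrm x w * nrm x a)"
    using compare_N[OF e] by blast
  show ?thesis
  proof (rule that[of "K * C * K"])
    show "0 < K * C * K" using K(1) Cc(1) by simp
    fix x w a and t :: real assume x: "x \<in> X" and w: "w \<in> W x" and a: "a \<in> Ls eps x" and t: "0 \<le> t"
    have "nrm (flow t x) w * nrm (flow t x) a \<le> K * N (flow t x) (0, skew w a)" using K(2)[of "flow t x" w a] x w a by simp
    also have "\<dots> \<le> K * (C * exp (- c * t) * N x (0, skew w a))"
      using N_contract[OF x t skew_lie[OF x e w a]] K(1) by (intro mult_left_mono) auto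
    also have "\<dots> \<le> K * (C * exp (- c * t) * (K * (nrm x w * nrm x a)))"
      using K(2)[OF x w a] K(1) Cc(1) by (intro mult_left_mono) auto
    finally show "nrm (flow t x) w * nrm (flow t x) a \<le> K * C * K * exp (- c * t) * (nrm x w * nrm x a)" by (simp add: mult_ac)
  qed
qed

lemma null_pair_nonzero:
  assumes "x \<in> X" "eps \<in> {1, -1}" "a \<in> Ls eps x" "b \<in> Ls (- eps) x" "a \<noteq> 0" "b \<noteq> 0" shows "hf a b \<noteq> 0"
proof -
  obtain h where h: "framing x h" using framing_exists[OF assms(1)] .
  have e: "- eps \<in> {1, -1}" using assms(2) by auto
  obtain s t where st: "a = s *\<^sub>R (h *v null_vec eps)" "b = t *\<^sub>R (h *v null_vec (- eps))"
    using assms(3,4) unfolding framingD(6)[OF h assms(2)] framingD(6)[OF h e] by blast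
  then show ?thesis using assms by (auto simp: hf_simps framingD(2)[OF h] hf_null_vec null_vec_nth)
qed

lemma null_pair_bound:
  obtains D where "D > 0" "\<And>x eps a b. \<lbrakk>x \<in> X; eps \<in> {1, -1}; a \<in> Ls eps x; b \<in> Ls (- eps) x\<rbrakk> \<Longrightarrow> nrm x a * nrm x b \<le> D * \<bar>hf a b\<bar>"
proof -
  have "\<exists>K>0. \<forall>x\<in>X. \<forall>a b. a \<in> Ls 1 x \<and> b \<in> Ls (-1) x \<longrightarrow>
    nrm x a * nrm x b \<le> K * \<bar>hf a b\<bar> \<and> \<bar>hf a b\<bar> \<le> K * (nrm x a * nrm x b)"
    unfolding nv.anorm_def
  proof (rule invariant_pair_bound[OF nv.averaging_axioms nv.averaging_axioms])
    show "(a' \<in> Ls 1 l \<and> b' \<in> Ls (-1) l) \<and> (\<lambda>k. \<bar>hf (a k) (b k)\<bar>) \<longlonglongrightarrow> \<bar>hf a' b'\<bar>"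
      if "\<And>k. x k \<in> X" "flim x l" "\<And>k. a k \<in> Ls 1 (x k) \<and> b k \<in> Ls (-1) (x k)" "a \<longlonglongrightarrow> a'" "b \<longlonglongrightarrow> b'" for x l a a' b b'
      using closed_sets(4)[OF that(1,2,4), of 1] closed_sets(4)[OF that(1,2,5), of "-1"] that(3-5) by (auto intro!: tendsto_intros)
  qed (use null_pair_nonzero[of _ 1] subspaces(4) in \<open>auto simp: act_sets hf_simps abs_mult intro: subspace_scale\<close>)
  then obtain D where D: "D > 0" "\<And>x a b. \<lbrakk>x \<in> X; a \<in> Ls 1 x; b \<in> Ls (-1) x\<rbrakk> \<Longrightarrow> nrm x a * nrm x b \<le> D * \<bar>hf a b\<bar>" by blast
  show ?thesis
  proof (rule that[OF D(1)])
    fix x and eps :: real and a b assume "x \<in> X" "eps \<in> {1, -1}" "a \<in> Ls eps x" "b \<in> Ls (-eps) x"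
    then show "nrm x a * nrm x b \<le> D * \<bar>hf a b\<bar>"
      using D(2)[of x a b] D(2)[of x b a] by (auto simp: hf_sym[of b a] mult.commute)
  qed
qed

lemma hf_bound:
  obtains D where "D > 0" "\<And>x v w. x \<in> X \<Longrightarrow> \<bar>hf v w\<bar> \<le> D * (nrm x v * nrm x w)"
proof -
  obtain B where B: "B > 0" "\<And>y v. y \<in> core \<Longrightarrow> norm v \<le> B * nrm y v \<and> nrm y v \<le> B * norm v" by (rule core_norm) (rule that)
  show ?thesis
  proof (rule that[of "B * B"])
    show "0 < B * B" using B by simp
    fix x v w assume x: "x \<in> X"
    obtain g y where g: "g \<in> G" "y \<in> core" "y \<in> X" "x = act g y" "\<And>v. nrm x v = nrm y (\<rho> (inv g) *v v)"
      by (rule core_rep[OF x]) (rule that)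
    have "\<bar>hf v w\<bar> = \<bar>hf (\<rho> (inv g) *v v) (\<rho> (inv g) *v w)\<bar>" using g by simp
    also have "\<dots> \<le> norm (\<rho> (inv g) *v v) * norm (\<rho> (inv g) *v w)" by (rule hf_norm_le)
    also have "\<dots> \<le> (B * nrm x v) * (B * nrm x w)" unfolding g(5) using B(2)[OF g(2)] B(1) by (intro mult_mono) auto
    finally show "\<bar>hf v w\<bar> \<le> B * B * (nrm x v * nrm x w)" by (simp add: mult_ac)
  qed
qed

text \<open>The value \<open>hf a b\<close> does not involve the base point: it is comparable to the
  product of norms at \<open>x\<close> and bounded by the product at \<open>y\<close>. The vector
  \<open>v\<close> may differ from \<open>a\<close> by anything orthogonal to
  \<open>b\<close>.\<close>

lemma null_pair_flow:
  obtains M where "M > 0" "\<And>x y v eps a b. \<lbrakk>x \<in> X; y \<in> X; eps \<in> {1, -1}; a \<in> Ls eps x; b \<in> Ls (- eps) x; hf v b = hf a b\<rbrakk> \<Longrightarrow>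
    nrm x a * nrm x b \<le> M * (nrm y v * nrm y b)"
proof -
  obtain D where D: "D > 0" "\<And>x eps a b. \<lbrakk>x \<in> X; eps \<in> {1, -1}; a \<in> Ls eps x; b \<in> Ls (- eps) x\<rbrakk> \<Longrightarrow> nrm x a * nrm x b \<le> D * \<bar>hf a b\<bar>"
    by (rule null_pair_bound) (rule that)
  obtain D' where D': "D' > 0" "\<And>x v w. x \<in> X \<Longrightarrow> \<bar>hf v w\<bar> \<le> D' * (nrm x v * nrm x w)" by (rule hf_bound) (rule that)
  have "nrm x a * nrm x b \<le> D * D' * (nrm y v * nrm y b)"
    if "x \<in> X" "y \<in> X" "eps \<in> {1, -1}" "a \<in> Ls eps x" "b \<in> Ls (- eps) x" "hf v b = hf a b" for x y v eps a b
  proof -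
    have "nrm x a * nrm x b \<le> D * \<bar>hf v b\<bar>" using D(2)[OF that(1,3-5)] that(6) by simp
    also have "\<dots> \<le> D * (D' * (nrm y v * nrm y b))" using D'(2)[OF that(2)] D(1) by (intro mult_left_mono) auto
    finally show ?thesis by (simp add: mult.assoc)
  qed
  then show ?thesis using that[of "D * D'"] D(1) D'(1) by simp
qed

text \<open>Pairing with the opposite null line recovers \<open>a\<close> from \<open>w + a\<close>,
  because that line is orthogonal to \<open>W x\<close>.\<close>

lemma sum_bound:
  "\<exists>D>0. \<forall>x\<in>X. \<forall>eps\<in>{1,-1}. \<forall>w\<in>W x. \<forall>a\<in>Ls eps x. nrm x w \<le> D * nrm x (w + a) \<and> nrm x a \<le> D * nrm x (w + a)"
proof -
  obtain M where M: "M > 0" "\<And>x y v eps a b. \<lbrakk>x \<in> X; y \<in> X; eps \<in> {1, -1}; a \<in> Ls eps x; b \<in> Ls (- eps) x; hf v b = hf a b\<rbrakk> \<Longrightarrow>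
    nrm x a * nrm x b \<le> M * (nrm y v * nrm y b)" by (rule null_pair_flow) (rule that)
  show ?thesis
  proof (intro exI[of _ "1 + M"] conjI ballI)
    show "0 < 1 + M" using M(1) by simp
    fix x eps w a assume x: "x \<in> X" and e: "eps \<in> {1, -1}" and w: "w \<in> W x" and a: "a \<in> Ls eps x"
    have e': "- eps \<in> {1, -1}" using e by auto
    obtain b where b: "b \<in> Ls (-eps) x" "b \<noteq> 0" using null_line_nonzero[OF x e'] .
    have "nrm x a * nrm x b \<le> M * nrm x (w + a) * nrm x b"
      using M(2)[OF x x e a b(1), of "w + a"] frame_hf(3)[OF x e' w b(1)] by (simp add: hf_simps mult.assoc)
    then have *: "nrm x a \<le> M * nrm x (w + a)" using nrm_pos[OF x b(2)] by simp
    then show "nrm x a \<le> (1 + M) * nrm x (w + a)" using nv.anorm_nonneg[of x "w + a"] by (simp only: distrib_right)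
    show "nrm x w \<le> (1 + M) * nrm x (w + a)" using nv.anorm_triangle[of x "w + a" "- a"] * by (simp add: algebra_simps)
  qed
qed

text \<open>Multiplying the dominations for the two null lines produces the squared norm of
  \<open>w\<close>. The product of the norms of a null pair cannot shrink along the flow by more
  than a constant, so it cancels.\<close>

lemma W_contract:
  obtains K where "K > 0" "\<And>x w t. \<lbrakk>x \<in> X; w \<in> W x; 0 \<le> t\<rbrakk> \<Longrightarrow> nrm (flow t x) w \<le> K * exp (- c * t) * nrm x w"
proof -
  obtain M where M: "M > 0" "\<And>x y v eps a b. \<lbrakk>x \<in> X; y \<in> X; eps \<in> {1, -1}; a \<in> Ls eps x; b \<in> Ls (- eps) x; hf v b = hf a b\<rbrakk> \<Longrightarrow>
    nrm x a * nrm x b \<le> M * (nrm y v * nrm y b)" by (rule null_pair_flow) (rule that)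
  obtain K1 where K1: "K1 > 0" "\<And>x w a t. \<lbrakk>x \<in> X; w \<in> W x; a \<in> Ls 1 x; 0 \<le> t\<rbrakk> \<Longrightarrow> nrm (flow t x) w * nrm (flow t x) a \<le> K1 * exp (- c * t) * (nrm x w * nrm x a)"
    by (rule domination[of 1], simp) (rule that)
  obtain K2 where K2: "K2 > 0" "\<And>x w a t. \<lbrakk>x \<in> X; w \<in> W x; a \<in> Ls (-1) x; 0 \<le> t\<rbrakk> \<Longrightarrow> nrm (flow t x) w * nrm (flow t x) a \<le> K2 * exp (- c * t) * (nrm x w * nrm x a)"
    by (rule domination[of "-1"], simp) (rule that)
  define K where "K = sqrt (K1 * K2 * M)"
  have K: "K * K = K1 * K2 * M" "K > 0" unfolding K_def using K1(1) K2(1) M(1) by simp_all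
  show ?thesis
  proof (rule that[OF K(2)])
    fix x w and t :: real assume x: "x \<in> X" and w: "w \<in> W x" and t: "0 \<le> t"
    obtain a where a: "a \<in> Ls 1 x" "a \<noteq> 0" using null_line_nonzero[OF x, of 1] by auto
    obtain b where b: "b \<in> Ls (-1) x" "b \<noteq> 0" using null_line_nonzero[OF x, of "-1"] by auto
    let ?y = "flow t x" let ?E = "exp (- c * t)"
    have p: "0 < nrm ?y a * nrm ?y b" using nrm_pos[of ?y] x a b by simp
    have "(nrm ?y w * nrm ?y w) * (nrm ?y a * nrm ?y b) = (nrm ?y w * nrm ?y a) * (nrm ?y w * nrm ?y b)" by simp
    also have "\<dots> \<le> (K1 * ?E * (nrm x w * nrm x a)) * (K2 * ?E * (nrm x w * nrm x b))"
      by (rule mult_mono[OF K1(2)[OF x w a(1) t] K2(2)[OF x w b(1) t]]) (use K1(1) in auto)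
    also have "\<dots> = (K1 * K2 * ?E * ?E * nrm x w * nrm x w) * (nrm x a * nrm x b)" by simp
    also have "\<dots> \<le> (K1 * K2 * ?E * ?E * nrm x w * nrm x w) * (M * (nrm ?y a * nrm ?y b))"
      using M(2)[of x ?y 1 a b a] x a b K1(1) K2(1) by (intro mult_left_mono) auto
    also have "\<dots> = ((K * ?E * nrm x w) * (K * ?E * nrm x w)) * (nrm ?y a * nrm ?y b)" using K(1) by (simp add: algebra_simps)
    finally have "nrm ?y w * nrm ?y w \<le> (K * ?E * nrm x w) * (K * ?E * nrm x w)" by (rule mult_right_le_imp_le[OF _ p])
    then have "(nrm ?y w)\<^sup>2 \<le> (K * ?E * nrm x w)\<^sup>2" by (simp add: power2_eq_square)
    then show "nrm ?y w \<le> K * ?E * nrm x w" by (rule power2_le_imp_le) (use K(2) in simp)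
  qed
qed

end

section \<open>Properness and the contracted null line\<close>

lemma pseudo_hyperbolic_translate: "g \<in> SO0_nn \<Longrightarrow> v \<in> pseudo_hyperbolic \<Longrightarrow> g *v v \<in> pseudo_hyperbolic"
  unfolding pseudo_hyperbolic_def using matrix_subgroupD(2)[OF matrix_subgroup_SO0, of g]
  by (auto simp: matrix_vector_mul_assoc)

lemma hf_base_point: "hf v (axis (Inr None) 1) = - v $ Inr None"
  by (simp add: hf_option axis_def)

text \<open>The limit has norm -1 and pairs negatively with nearby members of the orbit, so
  \<open>SO0_transitive\<close> reaches it from one of them.\<close>

lemma closed_pseudo_hyperbolic: "closed (pseudo_hyperbolic :: 'm::finite nvec set)"
  unfolding closed_sequential_limits
proof (intro allI impI)
  fix w and l :: "'m nvec" assume "(\<forall>n. w n \<in> pseudo_hyperbolic) \<and> w \<longlonglongrightarrow> l"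
  then have w: "\<And>n. w n \<in> pseudo_hyperbolic" "w \<longlonglongrightarrow> l" by auto
  have "(\<lambda>n. hf (w n) (w n)) \<longlonglongrightarrow> hf l l" by (intro tendsto_intros w)
  then have l: "hf l l = -1" using pseudo_hyperbolic_norm[OF w(1)] by (simp add: LIMSEQ_const_iff)
  have "(\<lambda>n. hf (w n) l) \<longlonglongrightarrow> hf l l" by (intro tendsto_intros w)
  then have "\<forall>\<^sub>F n in sequentially. hf (w n) l < 0" by (rule order_tendstoD(2)) (simp add: l)
  then obtain n where "hf (w n) l < 0" by (auto simp: eventually_sequentially)
  then obtain g where "g \<in> SO0_nn" "g *v w n = l" by (rule SO0_transitive[OF pseudo_hyperbolic_norm[OF w(1)] l])
  then show "l \<in> pseudo_hyperbolic" using pseudo_hyperbolic_translate[OF _ w(1)] by blast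
qed

text \<open>The two null vectors pair to 2, so the product -1/4 gives norm -1. With \<open>a\<close>
  positive and \<open>b\<close> negative the pairing with the base vector is negative, as
  \<open>SO0_transitive\<close> requires.\<close>

lemma pseudo_hyperbolic_null_sum:
  fixes a b :: real
  assumes ab: "a * b = -1/4" and a: "0 < a"
  shows "a *\<^sub>R null_vec 1 + b *\<^sub>R null_vec (-1) \<in> (pseudo_hyperbolic :: 'm::finite nvec set)"
proof -
  define z :: "'m nvec" where "z = a *\<^sub>R null_vec 1 + b *\<^sub>R null_vec (-1)"
  define e :: "'m nvec" where "e = axis (Inr None) 1"
  have z: "hf z z = -1" unfolding z_def using ab by (simp add: hf_option null_vec_nth algebra_simps)
  have "b < 0" using ab a by (metis mult_nonneg_nonneg not_le less_eq_real_def divide_less_0_iff neg_less_0_iff_less zero_less_numeral zero_less_one)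
  then have neg: "hf e z < 0" unfolding hf_sym[of e] unfolding e_def hf_base_point z_def using a by (simp add: null_vec_nth)
  have "hf e e = -1" unfolding e_def hf_base_point by (simp add: axis_def)
  then obtain g where "g \<in> SO0_nn" "g *v e = z" using SO0_transitive[OF _ z neg] by blast
  then show ?thesis unfolding z_def[symmetric] pseudo_hyperbolic_def e_def by blast
qed

locale SO_proper = SO_anosov \<Gamma> S \<delta> act d \<rho> \<xi> \<eta> N C c
  for \<Gamma> :: "'g monoid" (structure) and S \<delta> act d and \<rho> :: "'g \<Rightarrow> 'm::finite nmat" and \<xi> \<eta> N C c +
  assumes rho_inj: "inj_on \<rho> G"
    and proper: "compact K \<Longrightarrow> K \<subseteq> pseudo_hyperbolic \<Longrightarrow> finite {g \<in> \<rho> ` G. (*v) g ` K \<inter> K \<noteq> {}}"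
begin

text \<open>In a frame the coefficients have product -1/4; one of the two signs makes the first
  coefficient positive.\<close>

lemma null_pair_pseudo_hyperbolic:
  assumes x: "x \<in> X" and a: "a \<in> Ls 1 x" and b: "b \<in> Ls (-1) x" and ab: "hf a b = -1/2"
  shows "a + b \<in> pseudo_hyperbolic \<or> - (a + b) \<in> pseudo_hyperbolic"
proof -
  obtain h where h: "framing x h" using framing_exists[OF x] .
  obtain s t where st: "a = s *\<^sub>R (h *v null_vec 1)" "b = t *\<^sub>R (h *v null_vec (-1))"
    using a b framingD(6)[OF h, of 1] framingD(6)[OF h, of "-1"] by auto
  have "hf a b = 2 * (s * t)" unfolding st by (simp add: hf_simps framingD(2)[OF h] hf_null_vec null_vec_nth)
  then have "s * t = -1/4" using ab by simp
  moreover have eq: "h *v (s *\<^sub>R null_vec 1 + t *\<^sub>R null_vec (-1)) = a + b"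
    if "a = s *\<^sub>R (h *v null_vec 1)" "b = t *\<^sub>R (h *v null_vec (-1))" for a b s t
    unfolding that by (simp add: matrix_vector_right_distrib matrix_vector_mult_scaleR)
  ultimately consider "0 < s" | "0 < - s" by (metis divide_eq_0_iff less_linear mult_zero_left neg_0_less_iff_less neg_equal_0_iff_equal zero_neq_numeral zero_neq_one)
  then show ?thesis
  proof cases
    case 1
    then have "h *v (s *\<^sub>R null_vec 1 + t *\<^sub>R null_vec (-1)) \<in> pseudo_hyperbolic"
      by (intro pseudo_hyperbolic_translate framingD(1)[OF h] pseudo_hyperbolic_null_sum) (use \<open>s * t = -1/4\<close> in auto)
    then show ?thesis unfolding eq[OF st] by blast
  next
    case 2
    then have "h *v ((-s) *\<^sub>R null_vec 1 + (-t) *\<^sub>R null_vec (-1)) \<in> pseudo_hyperbolic"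
      by (intro pseudo_hyperbolic_translate framingD(1)[OF h] pseudo_hyperbolic_null_sum) (use \<open>s * t = -1/4\<close> in auto)
    moreover have "- a = (-s) *\<^sub>R (h *v null_vec 1)" "- b = (-t) *\<^sub>R (h *v null_vec (-1))" unfolding st by auto
    ultimately have "- a + - b \<in> pseudo_hyperbolic" using eq by metis
    then show ?thesis by simp
  qed
qed

text \<open>Bringing both ends of a flow segment back to \<open>core\<close> turns a vector bounded
  at both ends into a return to a compact part of the orbit. By properness and injectivity one group
  element would serve arbitrarily long segments, although it changes times over \<open>core\<close>
  by a bounded amount.\<close>

lemma pseudo_hyperbolic_escape:
  "\<exists>T. \<forall>x\<in>X. \<forall>t\<ge>T. \<forall>v\<in>pseudo_hyperbolic. R < nrm x v \<or> R < nrm (flow t x) v"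
proof (rule ccontr)
  assume neg: "\<not> ?thesis"
  have "\<forall>k::nat. \<exists>x t v. x \<in> X \<and> real k \<le> t \<and> v \<in> pseudo_hyperbolic \<and> nrm x v \<le> R \<and> nrm (flow t x) v \<le> R"
    using neg by (meson not_le)
  then obtain x t v where xtv: "\<And>k::nat. x k \<in> X" "\<And>k. real k \<le> t k" "\<And>k. v k \<in> pseudo_hyperbolic"
    "\<And>k. nrm (x k) (v k) \<le> R" "\<And>k. nrm (flow (t k) (x k)) (v k) \<le> R" by metis
  have "\<forall>k. \<exists>g. g \<in> G \<and> act (inv g) (x k) \<in> core" using to_core[OF xtv(1)] by metis
  then obtain g where g: "\<And>k. g k \<in> G" "\<And>k. act (inv (g k)) (x k) \<in> core" by metis
  have "\<forall>k. \<exists>g. g \<in> G \<and> act (inv g) (flow (t k) (x k)) \<in> core" using to_core xtv(1) by (metis flow_mem)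
  then obtain h where h: "\<And>k. h k \<in> G" "\<And>k. act (inv (h k)) (flow (t k) (x k)) \<in> core" by metis
  obtain B where B: "B > 0" "\<And>y v. y \<in> core \<Longrightarrow> norm v \<le> B * nrm y v \<and> nrm y v \<le> B * norm v" by (rule core_norm) (rule that)
  define K where "K = pseudo_hyperbolic \<inter> (cball 0 (B * R) :: 'm nvec set)"
  have cK: "compact K" unfolding K_def by (rule closed_Int_compact[OF closed_pseudo_hyperbolic compact_cball])
  have mem: "\<rho> (inv u) *v w \<in> K" if "u \<in> G" "y \<in> X" "act (inv u) y \<in> core" "w \<in> pseudo_hyperbolic" "nrm y w \<le> R" for u y w
  proof -
    have "norm (\<rho> (inv u) *v w) \<le> B * nrm (act (inv u) y) (\<rho> (inv u) *v w)" using B(2)[OF that(3)] by blast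
    also have "\<dots> = B * nrm y w" using nv.anorm_equivariant[of "inv u" y w] that by simp
    also have "\<dots> \<le> B * R" using that B(1) by simp
    finally show ?thesis unfolding K_def using pseudo_hyperbolic_translate[OF rho_SO0, of "inv u" w] that by simp
  qed
  define q where "q k = inv (h k) \<otimes> g k" for k
  have q: "q k \<in> G" for k unfolding q_def using g h by simp
  have "\<rho> (q k) \<in> {A \<in> \<rho> ` G. (*v) A ` K \<inter> K \<noteq> {}}" for k
  proof -
    have "\<rho> (q k) *v (\<rho> (inv (g k)) *v v k) = \<rho> (inv (h k)) *v v k"
      unfolding q_def using g h by (simp add: rho_mult flip: matrix_vector_mul_assoc)
    moreover have "\<rho> (inv (g k)) *v v k \<in> K" "\<rho> (inv (h k)) *v v k \<in> K"
      using mem[OF g(1) xtv(1) g(2) xtv(3,4)] mem[OF h(1) _ h(2) xtv(3,5)] xtv(1) by auto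
    ultimately have "\<rho> (inv (h k)) *v v k \<in> (*v) (\<rho> (q k)) ` K \<inter> K" by (metis IntI imageI)
    then show ?thesis using q by blast
  qed
  then have "range (\<lambda>k. \<rho> (q k)) \<subseteq> {A \<in> \<rho> ` G. (*v) A ` K \<inter> K \<noteq> {}}" by blast
  then have "finite (\<rho> ` range q)" using finite_subset[OF _ proper[OF cK]] unfolding K_def by (simp add: image_image)
  then have "finite (range q)" by (rule finite_imageD) (use rho_inj q in \<open>auto simp: inj_on_def\<close>)
  then obtain q0 where q0: "infinite {k. q k = q0}" using pigeonhole_infinite[of "UNIV :: nat set" q] by auto
  \<comment> \<open>The time coordinate: it is bounded on each translate of the compact set
    \<open>core\<close>.\<close>
  define T where "T u = snd (snd u)" for u :: "'g flow_point"
  have "\<exists>K>0. \<forall>z\<in>core. \<forall>v\<in>{0::real}. True \<longrightarrow> \<bar>T (act u z)\<bar> \<le> K" if u: "u \<in> G" for u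
  proof (rule core_bound)
    fix z l assume z: "\<And>k. z k \<in> X" "flim z l"
    then have "(\<lambda>k. T (act u (z k))) \<longlonglongrightarrow> T (act u l)"
      using flim_iff[of "\<lambda>k. act u (z k)" "fst (act u l)" "fst (snd (act u l))" "snd (snd (act u l))"] flim_act[OF z u] flim_mem[OF z(2)] act_closed[OF u]
      unfolding T_def by simp
    then show "(\<lambda>k. \<bar>T (act u (z k))\<bar>) \<longlonglongrightarrow> \<bar>T (act u l)\<bar>" by (rule tendsto_rabs)
  qed simp
  then have bound: "\<exists>K. \<forall>z\<in>core. \<bar>T (act u z)\<bar> \<le> K" if "u \<in> G" for u using that by auto
  have q0G: "q0 \<in> G" using infinite_imp_nonempty[OF q0] q by auto
  obtain K1 K2 where K12: "\<And>z. z \<in> core \<Longrightarrow> \<bar>T (act (inv q0) z)\<bar> \<le> K1" "\<And>z. z \<in> core \<Longrightarrow> \<bar>T (act \<one> z)\<bar> \<le> K2"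
    using bound[of "inv q0"] bound[of \<one>] q0G by auto
  obtain k where k: "nat \<lceil>K1 + K2\<rceil> < k" "q k = q0" using q0 unfolding infinite_nat_iff_unbounded by blast
  define y z where "y = act (inv (g k)) (x k)" and "z = act (inv (h k)) (flow (t k) (x k))"
  have yz: "y \<in> core" "z \<in> core" "y \<in> X" unfolding y_def z_def using g h core_mem by auto
  have "act q0 (flow (t k) y) = act (q k) (act (inv (g k)) (flow (t k) (x k)))"
    unfolding y_def using act_flow[of "inv (g k)"] g xtv(1) k(2) by simp
  also have "\<dots> = z" unfolding q_def z_def using g h xtv(1) act_mult[of "inv (h k)" "g k"] act_closed by simp
  finally have "flow (t k) y = act (inv q0) z" using act_inv(1)[OF q0G] yz(3) by (metis flow_mem)
  moreover have "T (flow (t k) y) = T y + t k" unfolding T_def by (cases y) simp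
  ultimately show False using K12(1)[OF yz(2)] K12(2)[OF yz(1)] act_one[OF yz(3)] xtv(2)[of k] k(1) by simp linarith
qed

text \<open>Normalise \<open>a\<close> at \<open>x\<close> and complete it to a null pair of pairing
  -1/2. If its norm changed by a factor of at most \<open>M\<close>, both members would be bounded
  at both ends of the segment, and so would their sum, against
  \<open>pseudo_hyperbolic_escape\<close>.\<close>

lemma ratio_escape:
  assumes M: "1 \<le> M"
  shows "\<exists>T. \<forall>x\<in>X. \<forall>eps\<in>{1, -1}. \<forall>a\<in>Ls eps x. \<forall>t\<ge>T. a \<noteq> 0 \<longrightarrow> M * nrm (flow t x) a < nrm x a \<or> M * nrm x a < nrm (flow t x) a"
proof -
  obtain D where D: "D > 0" "\<And>x eps a b. \<lbrakk>x \<in> X; eps \<in> {1,-1}; a \<in> Ls eps x; b \<in> Ls (-eps) x\<rbrakk> \<Longrightarrow> nrm x a * nrm x b \<le> D * \<bar>hf a b\<bar>"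
    by (rule null_pair_bound) (rule that)
  \<comment> \<open>\<open>M\<close> bounds the normalised vector. Its norm is also at least
    \<open>1 / M\<close>, which bounds the partner by \<open>D * M\<close>.\<close>
  define R where "R = M + D * M"
  obtain T where T: "\<And>x t v. \<lbrakk>x \<in> X; T \<le> t; v \<in> pseudo_hyperbolic\<rbrakk> \<Longrightarrow> R < nrm x v \<or> R < nrm (flow t x) v"
    using pseudo_hyperbolic_escape by blast
  show ?thesis
  proof (intro exI[of _ T] ballI allI impI)
    fix x and eps :: real and a and t :: real assume x: "x \<in> X" and e: "eps \<in> {1, -1}" and a: "a \<in> Ls eps x" "a \<noteq> 0" and t: "T \<le> t"
    show "M * nrm (flow t x) a < nrm x a \<or> M * nrm x a < nrm (flow t x) a"
    proof (rule ccontr)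
      assume "\<not> ?thesis"
      then have neg: "nrm x a \<le> M * nrm (flow t x) a" "nrm (flow t x) a \<le> M * nrm x a" by auto
      have p: "0 < nrm x a" using nrm_pos[OF x a(2)] .
      define a' where "a' = (1 / nrm x a) *\<^sub>R a"
      have a': "a' \<in> Ls eps x" unfolding a'_def using a(1) subspaces(4)[OF x e] by (rule subspace_scale[rotated])
      have na': "nrm y a' = nrm y a / nrm x a" for y unfolding a'_def using p by (simp add: nv.anorm_scale)
      have e': "-eps \<in> {1, -1}" using e by auto
      obtain b0 where b0: "b0 \<in> Ls (-eps) x" "b0 \<noteq> 0" using null_line_nonzero[OF x e'] .
      have "a' \<noteq> 0" unfolding a'_def using a p by auto
      then have nz: "hf a' b0 \<noteq> 0" using null_pair_nonzero[OF x e a' b0(1) _ b0(2)] by blast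
      define b where "b = (-1 / (2 * hf a' b0)) *\<^sub>R b0"
      have b: "b \<in> Ls (-eps) x" unfolding b_def using b0(1) subspaces(4)[OF x e'] by (rule subspace_scale[rotated])
      have ab: "hf a' b = -1/2" unfolding b_def using nz by (simp add: hf_simps)
      have nb: "nrm y b \<le> D * M" and nay: "nrm y a' \<le> M" if y: "y = x \<or> y = flow t x" for y
      proof -
        have yX: "y \<in> X" using y x by auto
        have m: "a' \<in> Ls eps y" "b \<in> Ls (-eps) y" using y a' b by (auto simp: flow_sets)
        have "1 \<le> M * nrm y a'" using y neg(1) M p unfolding na' by (auto simp: field_simps)
        then have "1 * nrm y b \<le> M * nrm y a' * nrm y b" by (rule mult_right_mono) simp
        also have "\<dots> \<le> M * (D * (1/2))" using D(2)[OF yX e m] M ab by simp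
        also have "\<dots> \<le> D * M" using M D(1) by simp
        finally show "nrm y b \<le> D * M" by simp
        show "nrm y a' \<le> M" using y neg(2) M p unfolding na' by (auto simp: field_simps)
      qed
      have le: "nrm y (a' + b) \<le> R" if "y = x \<or> y = flow t x" for y
        using nv.anorm_triangle[of y a' b] nb[OF that] nay[OF that] unfolding R_def by linarith
      have "a' + b \<in> pseudo_hyperbolic \<or> - (a' + b) \<in> pseudo_hyperbolic"
        using null_pair_pseudo_hyperbolic[OF x, of a' b] null_pair_pseudo_hyperbolic[OF x, of b a'] e a' b ab
        by (auto simp: hf_sym[of b] add.commute)
      then show False using T[OF x t] le by (metis not_le nrm_minus)
    qed
  qed
qed

definition contracted :: "real \<Rightarrow> 'g flow_point \<Rightarrow> bool" where
  "contracted eps x \<longleftrightarrow> (\<forall>a\<in>Ls eps x. ((\<lambda>t. nrm (flow t x) a) \<longlongrightarrow> 0) at_top)"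

text \<open>By the intermediate value theorem contraction cannot turn into expansion at a later
  time; this makes the choice of line independent of \<open>t\<close>.\<close>

lemma one_sided:
  fixes f :: "real \<Rightarrow> real"
  assumes f: "continuous_on UNIV f" and m: "m \<le> M" and gap: "\<And>t. T \<le> t \<Longrightarrow> f t < m \<or> M < f t"
  shows "(\<forall>t\<ge>T. f t < m) \<or> (\<forall>t\<ge>T. M < f t)"
proof (rule ccontr)
  assume "\<not> ?thesis"
  then obtain s t where st: "T \<le> s" "T \<le> t" "M < f s" "f t < m" using gap by blast
  have c: "continuous_on A f" for A using f continuous_on_subset by blast
  have "\<exists>u\<ge>T. f u = m"
  proof (cases "s \<le> t")
    case True
    then obtain u where "s \<le> u" "f u = m" using IVT2'[of f t m s] st m c by auto
    then show ?thesis using st(1) order_trans by blast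
  next
    case False
    then obtain u where "t \<le> u" "f u = m" using IVT'[of f t m s] st m c by auto
    then show ?thesis using st(2) order_trans by blast
  qed
  then show False using gap m by (metis less_irrefl not_le)
qed

text \<open>The product of the norms of a null pair varies by a bounded factor along the flow, so
  strong contraction of one line means expansion of the other.\<close>

lemma sign_dichotomy:
  "\<exists>T. \<forall>x\<in>X. \<exists>eps\<in>{1, -1}. \<forall>t\<ge>T. (\<forall>a\<in>Ls eps x. 2 * nrm (flow t x) a \<le> nrm x a) \<and> (\<forall>b\<in>Ls (-eps) x. 2 * nrm x b \<le> nrm (flow t x) b)"
proof -
  obtain D where D: "D > 0" "\<And>x y v eps a b. \<lbrakk>x \<in> X; y \<in> X; eps \<in> {1, -1}; a \<in> Ls eps x; b \<in> Ls (- eps) x; hf v b = hf a b\<rbrakk> \<Longrightarrow>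
    nrm x a * nrm x b \<le> D * (nrm y v * nrm y b)" by (rule null_pair_flow) (rule that)
  \<comment> \<open>Contraction by \<open>2 * D\<close> on one line forces twofold expansion of the
    other; the summand 2 makes the contraction itself at least twofold.\<close>
  define M where "M = 2 * D + 2"
  have M: "1 \<le> M" "2 \<le> M" "2 * D \<le> M" unfolding M_def using D(1) by auto
  obtain T where T: "\<And>x eps a t. \<lbrakk>x \<in> X; eps \<in> {1, -1}; a \<in> Ls eps x; T \<le> t; a \<noteq> 0\<rbrakk> \<Longrightarrow> M * nrm (flow t x) a < nrm x a \<or> M * nrm x a < nrm (flow t x) a"
    using ratio_escape[OF M(1)] by blast
  show ?thesis
  proof (intro exI[of _ T] ballI)
    fix x assume x: "x \<in> X"
    obtain a where a: "a \<in> Ls 1 x" "a \<noteq> 0" using null_line_nonzero[OF x, of 1] by auto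
    obtain b where b: "b \<in> Ls (-1) x" "b \<noteq> 0" using null_line_nonzero[OF x, of "-1"] by auto
    have p: "0 < nrm (flow t x) a" "0 < nrm (flow t x) b" for t using nrm_pos[of "flow t x"] x a b by auto
    have p0: "0 < nrm x a" "0 < nrm x b" using p[of 0] by auto
    have le: "nrm (flow t x) a * nrm (flow t x) b \<le> D * (nrm (flow s x) a * nrm (flow s x) b)" for s t
      using D(2)[of "flow t x" "flow s x" 1 a b a] x a b by simp
    have small: "2 * nrm (flow t x) v \<le> nrm (flow s x) v" if "M * nrm (flow t x) v \<le> nrm (flow s x) v" for s t v
      using that M(2) mult_right_mono[OF M(2) nv.anorm_nonneg[of "flow t x" v]] by linarith
    have other: "2 * nrm (flow s x) w \<le> nrm (flow t x) w"
      if v: "M * nrm (flow t x) v \<le> nrm (flow s x) v" and vw: "{v, w} = {a, b}" for s t v w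
    proof -
      have pw: "0 < nrm (flow t x) v" "0 < nrm (flow t x) w" "0 < nrm (flow s x) w" using vw p by (auto simp: doubleton_eq_iff)
      have "nrm (flow s x) v * nrm (flow s x) w \<le> D * (nrm (flow t x) v * nrm (flow t x) w)"
        using vw le[of s t] by (auto simp: doubleton_eq_iff mult.commute)
      moreover have "(M * nrm (flow t x) v) * nrm (flow s x) w \<le> nrm (flow s x) v * nrm (flow s x) w"
        using v pw by (intro mult_right_mono) auto
      ultimately have "nrm (flow t x) v * (M * nrm (flow s x) w) \<le> nrm (flow t x) v * (D * nrm (flow t x) w)" by (simp add: mult_ac)
      then have "M * nrm (flow s x) w \<le> D * nrm (flow t x) w" using pw(1) by simp
      moreover have "2 * D * nrm (flow s x) w \<le> M * nrm (flow s x) w" using M(3) pw by (intro mult_right_mono) auto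
      ultimately have "D * (2 * nrm (flow s x) w) \<le> D * nrm (flow t x) w" by simp
      then show ?thesis using D(1) by simp
    qed
    have ext: "\<forall>v\<in>Ls eps x. 2 * nrm y v \<le> nrm z v" if u: "u \<in> Ls eps x" "u \<noteq> 0" "eps \<in> {1,-1}" "2 * nrm y u \<le> nrm z u" for u eps y z
    proof
      fix v assume "v \<in> Ls eps x"
      then obtain r where "v = r *\<^sub>R u" using null_line_multiple[OF x u(3,1,2)] by blast
      then show "2 * nrm y v \<le> nrm z v" using mult_left_mono[OF u(4), of "\<bar>r\<bar>"] by (simp add: nv.anorm_scale mult_ac)
    qed
    have "(\<forall>t\<ge>T. nrm (flow t x) a < nrm x a / M) \<or> (\<forall>t\<ge>T. M * nrm x a < nrm (flow t x) a)"
    proof (rule one_sided[OF nrm_flow_continuous[OF x]])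
      have "1 \<le> M * M" using mult_mono[OF M(1) M(1)] M(1) by simp
      then have "nrm x a \<le> M * M * nrm x a" using p0(1) by simp
      then show "nrm x a / M \<le> M * nrm x a" using M(1) by (simp add: field_simps)
      show "nrm (flow t x) a < nrm x a / M \<or> M * nrm x a < nrm (flow t x) a" if "T \<le> t" for t
        using T[OF x _ a(1) that a(2)] M(1) by (auto simp: field_simps)
    qed
    then show "\<exists>eps\<in>{1, -1}. \<forall>t\<ge>T. (\<forall>a\<in>Ls eps x. 2 * nrm (flow t x) a \<le> nrm x a) \<and> (\<forall>b\<in>Ls (-eps) x. 2 * nrm x b \<le> nrm (flow t x) b)"
    proof
      assume L: "\<forall>t\<ge>T. nrm (flow t x) a < nrm x a / M"
      show ?thesis
      proof (intro bexI[of _ 1] allI impI conjI)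
        fix t assume "T \<le> t"
        then have l: "M * nrm (flow t x) a \<le> nrm (flow 0 x) a" using L M(1) by (auto simp: field_simps less_imp_le)
        show "\<forall>a\<in>Ls 1 x. 2 * nrm (flow t x) a \<le> nrm x a" using ext[OF a] small[OF l] by simp
        show "\<forall>b\<in>Ls (-1) x. 2 * nrm x b \<le> nrm (flow t x) b" using ext[OF b] other[OF l refl] by simp
      qed simp
    next
      assume L: "\<forall>t\<ge>T. M * nrm x a < nrm (flow t x) a"
      show ?thesis
      proof (intro bexI[of _ "-1"] allI impI conjI)
        fix t assume "T \<le> t"
        then have l: "M * nrm (flow 0 x) a \<le> nrm (flow t x) a" using L by (auto simp: less_imp_le)
        show "\<forall>a\<in>Ls (-1) x. 2 * nrm (flow t x) a \<le> nrm x a" using ext[OF b] other[OF l refl] by simp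
        show "\<forall>b\<in>Ls (-(-1)) x. 2 * nrm x b \<le> nrm (flow t x) b" using ext[OF a] small[OF l] by simp
      qed simp
    qed
  qed
qed

text \<open>For every factor, \<open>ratio_escape\<close> eventually leaves only norms much smaller
  or much larger than the initial one, and halving excludes the latter.\<close>

lemma contracted_tendsto:
  assumes x: "x \<in> X" and e: "eps \<in> {1, -1}" and half: "\<And>t a. T \<le> t \<Longrightarrow> a \<in> Ls eps x \<Longrightarrow> 2 * nrm (flow t x) a \<le> nrm x a"
  shows "contracted eps x"
  unfolding contracted_def
proof
  fix a assume a: "a \<in> Ls eps x"
  show "((\<lambda>t. nrm (flow t x) a) \<longlongrightarrow> 0) at_top"
  proof (cases "a = 0")
    case True then show ?thesis by simp
  next
    case False
    have p: "0 < nrm x a" using nrm_pos[OF x False] .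
    show ?thesis
    proof (rule tendstoI)
      fix r :: real assume r: "0 < r"
      define M where "M = max 1 (nrm x a / r)"
      have M: "1 \<le> M" "nrm x a \<le> M * r" unfolding M_def using r by (auto simp: max_def field_simps)
      obtain T' where T': "\<And>t. T' \<le> t \<Longrightarrow> M * nrm (flow t x) a < nrm x a \<or> M * nrm x a < nrm (flow t x) a"
        using ratio_escape[OF M(1)] x e a False by blast
      have "nrm (flow t x) a < r" if "max T T' \<le> t" for t
      proof -
        have "2 * nrm (flow t x) a \<le> nrm x a" using half a that by simp
        moreover have "nrm x a \<le> M * nrm x a" using M(1) p by simp
        moreover have "M * nrm (flow t x) a < nrm x a \<or> M * nrm x a < nrm (flow t x) a" using T' that by simp
        ultimately have "M * nrm (flow t x) a < nrm x a" using p by linarith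
        then have "M * nrm (flow t x) a < M * r" using M(2) by linarith
        then show ?thesis using M(1) by simp
      qed
      then show "\<forall>\<^sub>F t in at_top. dist (nrm (flow t x) a) 0 < r"
        unfolding eventually_at_top_linorder by (intro exI[of _ "max T T'"]) simp
    qed
  qed
qed

text \<open>The sign of the contracted line; the default -1 is correct because exactly one line is
  contracted, by \<open>contracted_half\<close>.\<close>

definition sg :: "'g flow_point \<Rightarrow> real" where "sg x = (if contracted 1 x then 1 else -1)"

lemma sg_cases [simp]: "sg x \<in> {1, -1}" "- sg x \<in> {1, -1}"
  unfolding sg_def by auto

lemma contracted_half:
  "\<exists>T. \<forall>x\<in>X. contracted (sg x) x \<and> \<not> contracted (- sg x) x \<and>
    (\<forall>t\<ge>T. (\<forall>a\<in>Ls (sg x) x. 2 * nrm (flow t x) a \<le> nrm x a) \<and> (\<forall>b\<in>Ls (- sg x) x. 2 * nrm x b \<le> nrm (flow t x) b))"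
proof -
  obtain T where T: "\<And>x. x \<in> X \<Longrightarrow> \<exists>eps\<in>{1, -1}. \<forall>t\<ge>T. (\<forall>a\<in>Ls eps x. 2 * nrm (flow t x) a \<le> nrm x a) \<and> (\<forall>b\<in>Ls (-eps) x. 2 * nrm x b \<le> nrm (flow t x) b)"
    using sign_dichotomy by blast
  show ?thesis
  proof (intro exI[of _ T] ballI)
    fix x assume x: "x \<in> X"
    obtain eps where e: "eps \<in> {1, -1}" "\<And>t a. T \<le> t \<Longrightarrow> a \<in> Ls eps x \<Longrightarrow> 2 * nrm (flow t x) a \<le> nrm x a"
      "\<And>t b. T \<le> t \<Longrightarrow> b \<in> Ls (-eps) x \<Longrightarrow> 2 * nrm x b \<le> nrm (flow t x) b" using T[OF x] by blast
    have c: "contracted eps x" by (rule contracted_tendsto[OF x e(1,2)])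
    have nc: "\<not> contracted (-eps) x"
    proof
      assume "contracted (-eps) x"
      have "- eps \<in> {1, -1}" using e(1) by auto
      then obtain b where b: "b \<in> Ls (-eps) x" "b \<noteq> 0" using null_line_nonzero[OF x] by metis
      have p: "0 < nrm x b" using nrm_pos[OF x b(2)] .
      have "((\<lambda>t. nrm (flow t x) b) \<longlongrightarrow> 0) at_top" using \<open>contracted (-eps) x\<close> b(1) unfolding contracted_def by blast
      then have "\<forall>\<^sub>F t in at_top. nrm (flow t x) b < nrm x b" using p by (rule order_tendstoD(2))
      then obtain T' where "\<And>t. T' \<le> t \<Longrightarrow> nrm (flow t x) b < nrm x b" unfolding eventually_at_top_linorder by blast
      from this[of "max T T'"] e(3)[of "max T T'", OF _ b(1)] p show False by simp
    qed
    have "sg x = eps" unfolding sg_def using c nc e(1) by auto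
    then show "contracted (sg x) x \<and> \<not> contracted (- sg x) x \<and>
      (\<forall>t\<ge>T. (\<forall>a\<in>Ls (sg x) x. 2 * nrm (flow t x) a \<le> nrm x a) \<and> (\<forall>b\<in>Ls (- sg x) x. 2 * nrm x b \<le> nrm (flow t x) b))"
      using c nc e(2,3) by blast
  qed
qed

lemma sg_flow: "sg (flow s x) = sg x"
proof -
  have sh: "((\<lambda>t. f (t + u)) \<longlongrightarrow> 0) at_top" if "(f \<longlongrightarrow> 0) at_top" for f :: "real \<Rightarrow> real" and u
    using filterlim_compose[OF that filterlim_tendsto_add_at_top[OF tendsto_const[of u] filterlim_ident]] by (simp add: add.commute)
  have "((\<lambda>t. nrm (flow (t + s) x) a) \<longlongrightarrow> 0) at_top \<longleftrightarrow> ((\<lambda>t. nrm (flow t x) a) \<longlongrightarrow> 0) at_top" for a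
    using sh[of "\<lambda>t. nrm (flow t x) a" s] sh[of "\<lambda>t. nrm (flow (t + s) x) a" "-s"] by auto
  then show ?thesis unfolding sg_def contracted_def by simp
qed

lemma sg_act: assumes "g \<in> G" "x \<in> X" shows "sg (act g x) = sg x"
proof -
  have eq: "nrm (flow t (act g x)) (\<rho> g *v a) = nrm (flow t x) a" for t a
    using nv.anorm_equivariant[of g "flow t x" a] assms act_flow[of g x t] by simp
  have "contracted 1 (act g x) \<longleftrightarrow> contracted 1 x" unfolding contracted_def
  proof (intro iffI ballI)
    fix a assume "\<forall>a\<in>Ls 1 (act g x). ((\<lambda>t. nrm (flow t (act g x)) a) \<longlongrightarrow> 0) at_top" "a \<in> Ls 1 x"
    then show "((\<lambda>t. nrm (flow t x) a) \<longlongrightarrow> 0) at_top" using act_sets(4)[OF assms, of a 1] by (auto simp: eq dest: bspec[of _ _ "\<rho> g *v a"])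
  next
    fix a assume h: "\<forall>a\<in>Ls 1 x. ((\<lambda>t. nrm (flow t x) a) \<longlongrightarrow> 0) at_top" "a \<in> Ls 1 (act g x)"
    have a: "a = \<rho> g *v (\<rho> (inv g) *v a)" using assms by simp
    then have "\<rho> (inv g) *v a \<in> Ls 1 x" using h(2) act_sets(4)[OF assms, of "\<rho> (inv g) *v a" 1] by simp
    then have "((\<lambda>t. nrm (flow t (act g x)) (\<rho> g *v (\<rho> (inv g) *v a))) \<longlongrightarrow> 0) at_top" unfolding eq using h(1) by blast
    then show "((\<lambda>t. nrm (flow t (act g x)) a) \<longlongrightarrow> 0) at_top" using a by simp
  qed
  then show ?thesis unfolding sg_def by simp
qed

end

section \<open>Dynamics of returning group elements on the boundary\<close>

context SO_anosov
begin

text \<open>The tested vectors span the orthogonal space of \<open>Wm x\<close>, whose own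
  orthogonal space is \<open>Wm x\<close>.\<close>

lemma Wm_orthogonal:
  assumes x: "x \<in> X" and u: "\<And>z. z \<in> Wm x \<union> Ls 1 x \<union> Ls (-1) x \<Longrightarrow> hf u z = 0"
  shows "u \<in> Wm x"
proof -
  obtain h where h: "framing x h" using framing_exists[OF x] .
  define p where "p = matrix_inv h *v u"
  have p: "u = h *v p" unfolding p_def using matrix_inv_mult(3)[OF SO0_invertible[OF framingD(1)[OF h]]] by simp
  have hf: "hf p z = hf u (h *v z)" for z unfolding p framingD(2)[OF h] ..
  have "hf p (isotropic_basis (-1) j) = 0" for j
    unfolding hf by (rule u) (use isotropic_basis_W in \<open>auto simp: framingD(4)[OF h]\<close>)
  moreover have "hf p (null_vec eps) = 0" if "eps \<in> {1, -1}" for eps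
  proof -
    have "h *v null_vec eps \<in> Ls eps x" unfolding framingD(6)[OF h that] by (metis rangeI scaleR_one)
    then show ?thesis unfolding hf using u that by auto
  qed
  from this[of 1] this[of "-1"] have "p $ Inl None = 0" "p $ Inr None = 0" by (auto simp: hf_null_vec)
  ultimately have "p \<in> W_model (-1)" unfolding W_model_def hf_isotropic_basis by (auto simp: add_eq_0_iff)
  then show ?thesis unfolding framingD(4)[OF h] p by blast
qed

text \<open>Unit vectors of the lines accumulate at a unit vector of the limit line, which spans it;
  hence the passage to a subsequence.\<close>

lemma Ls_approx:
  assumes x: "\<And>k. x k \<in> X" "flim x l" and e: "eps \<in> {1, -1}" and z: "z \<in> Ls eps l"
  obtains r Z where "strict_mono (r :: nat \<Rightarrow> nat)" "Z \<longlonglongrightarrow> z" "\<And>k. Z k \<in> Ls eps (x (r k))"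
proof -
  have "\<exists>a. a \<in> Ls eps (x k) \<and> norm a = 1" for k
  proof -
    obtain a where a: "a \<in> Ls eps (x k)" "a \<noteq> 0" using null_line_nonzero[OF x(1) e] .
    then show ?thesis using subspaces(4)[OF x(1) e, of k] by (intro exI[of _ "(1 / norm a) *\<^sub>R a"]) (auto intro: subspace_scale)
  qed
  then obtain a where a: "\<And>k. a k \<in> Ls eps (x k)" "\<And>k. norm (a k) = 1" by metis
  obtain r m where r: "strict_mono (r :: nat \<Rightarrow> nat)" "(\<lambda>k. a (r k)) \<longlonglongrightarrow> m" "norm m = 1"
    by (rule unit_subseq[of a, OF a(2)]) (rule that)
  have "m \<in> Ls eps l" by (rule closed_sets(4)[OF x(1) flim_subseq[OF x(2) r(1)] r(2) e a(1)])
  moreover have "m \<noteq> 0" using r(3) by auto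
  ultimately obtain s where s: "z = s *\<^sub>R m" using null_line_multiple[OF flim_mem[OF x(2)] e _ _ z] by blast
  show ?thesis
  proof (rule that[OF r(1)])
    show "(\<lambda>k. s *\<^sub>R a (r k)) \<longlonglongrightarrow> z" unfolding s by (intro tendsto_intros r)
    show "s *\<^sub>R a (r k) \<in> Ls eps (x (r k))" for k by (rule subspace_scale[OF subspaces(4)[OF x(1) e] a(1)])
  qed
qed

lemma nrm_equivalent:
  assumes x: "x \<in> X" obtains B where "B > 0" "\<And>v. norm v \<le> B * nrm x v \<and> nrm x v \<le> B * norm v"
proof -
  obtain B where B: "B > 0" "\<And>y v. y \<in> core \<Longrightarrow> norm v \<le> B * nrm y v \<and> nrm y v \<le> B * norm v" by (rule core_norm) (rule that)
  obtain g y where g: "g \<in> G" "y \<in> core" "y \<in> X" "x = act g y" "\<And>v. nrm x v = nrm y (\<rho> (inv g) *v v)"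
    by (rule core_rep[OF x]) (rule that)
  obtain K where K: "K > 0" "\<And>v. norm (\<rho> g *v v) \<le> norm v * K"
    using bounded_linear.pos_bounded[OF matrix_vector_mul_bounded_linear] by metis
  obtain K' where K': "K' > 0" "\<And>v. norm (\<rho> (inv g) *v v) \<le> norm v * K'"
    using bounded_linear.pos_bounded[OF matrix_vector_mul_bounded_linear] by metis
  show ?thesis
  proof (rule that[of "B * (K + K')"])
    fix v
    have "norm v \<le> norm (\<rho> (inv g) *v v) * K" using K(2)[of "\<rho> (inv g) *v v"] g(1) by simp
    also have "\<dots> \<le> (B * nrm x v) * (K + K')" using B(2)[OF g(2)] K K' B(1) unfolding g(5) by (intro mult_mono) auto
    finally have 1: "norm v \<le> B * (K + K') * nrm x v" by (simp add: mult_ac)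
    have "nrm x v \<le> B * norm (\<rho> (inv g) *v v)" unfolding g(5) using B(2)[OF g(2)] by blast
    also have "\<dots> \<le> B * (norm v * (K + K'))"
      using B(1) K(1) order_trans[OF K'(2) mult_left_mono[of K' "K + K'" "norm v"]] by (intro mult_left_mono) auto
    finally show "norm v \<le> B * (K + K') * nrm x v \<and> nrm x v \<le> B * (K + K') * norm v" using 1 by (simp add: mult_ac)
  qed (use B K K' in simp)
qed

text \<open>A pairing bounded below at \<open>x\<close> stays bounded by the norms at \<open>flow t x\<close>; hence a vector which pairs with a direction
  contracted by the flow is expanded at the same rate.\<close>

lemma transverse_expansion:
  assumes x: "x \<in> X" and x': "x' \<in> X" "fst x' = fst x"
  obtains K where "K > 0" "\<And>v z t. \<lbrakk>v \<in> Wm x'; z \<in> Wm x \<union> Ls 1 x \<union> Ls (-1) x; 0 \<le> t\<rbrakk> \<Longrightarrow>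
    nrm x v * nrm x z \<le> K * exp (- c * t) * (nrm (flow t x) v * nrm (flow t x) z)"
proof -
  obtain B where B: "B > 0" "\<And>v. norm v \<le> B * nrm x v \<and> nrm x v \<le> B * norm v" by (rule nrm_equivalent[OF x]) (rule that)
  obtain D' where D': "D' > 0" "\<And>x v w. x \<in> X \<Longrightarrow> \<bar>hf v w\<bar> \<le> D' * (nrm x v * nrm x w)" by (rule hf_bound) (rule that)
  have dual: "\<exists>D>0. \<forall>v\<in>Wm y. v \<noteq> 0 \<longrightarrow> (\<exists>w\<in>W x. w \<noteq> 0 \<and> (\<forall>t. nrm x v * nrm x w \<le> D * (nrm (flow t x) v * nrm (flow t x) w)))"
    if y: "y \<in> X" "fst y = fst x" for y
  proof -
    obtain D where D: "D > 0" "\<And>v. v \<in> Wm y \<Longrightarrow> v \<noteq> 0 \<Longrightarrow> \<exists>w\<in>W x. w \<noteq> 0 \<and> norm w * norm v \<le> D * \<bar>hf w v\<bar>"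
      using dual_W[OF y(1)] unfolding W_def y(2) by blast
    have "nrm x v * nrm x w \<le> B * B * D * D' * (nrm (flow t x) v * nrm (flow t x) w)" if w: "norm w * norm v \<le> D * \<bar>hf w v\<bar>" for v w t
    proof -
      have "nrm x v * nrm x w \<le> (B * norm v) * (B * norm w)" using B by (intro mult_mono) auto
      also have "\<dots> = B * B * (norm w * norm v)" by simp
      also have "\<dots> \<le> B * B * (D * (D' * (nrm (flow t x) w * nrm (flow t x) v)))"
        using order_trans[OF w mult_left_mono[OF D'(2)[of "flow t x" w v]]] D(1) B(1) x by (intro mult_left_mono) auto
      finally show ?thesis by (simp add: mult_ac)
    qed
    then show ?thesis using D B(1) D'(1) by (intro exI[of _ "B * B * D * D'"]) (simp, blast)
  qed
  obtain D1 where D1: "D1 > 0" "\<And>v. v \<in> Wm x' \<Longrightarrow> v \<noteq> 0 \<Longrightarrow> \<exists>w\<in>W x. w \<noteq> 0 \<and> (\<forall>t. nrm x v * nrm x w \<le> D1 * (nrm (flow t x) v * nrm (flow t x) w))"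
    using dual[OF x'] by blast
  obtain D2 where D2: "D2 > 0" "\<And>v. v \<in> Wm x \<Longrightarrow> v \<noteq> 0 \<Longrightarrow> \<exists>w\<in>W x. w \<noteq> 0 \<and> (\<forall>t. nrm x v * nrm x w \<le> D2 * (nrm (flow t x) v * nrm (flow t x) w))"
    using dual[OF x refl] by blast
  obtain M where M: "M > 0" "\<And>x y v eps a b. \<lbrakk>x \<in> X; y \<in> X; eps \<in> {1, -1}; a \<in> Ls eps x; b \<in> Ls (- eps) x; hf v b = hf a b\<rbrakk> \<Longrightarrow>
    nrm x a * nrm x b \<le> M * (nrm y v * nrm y b)" by (rule null_pair_flow) (rule that)
  obtain K1 where K1: "K1 > 0" "\<And>x w a t. \<lbrakk>x \<in> X; w \<in> W x; a \<in> Ls 1 x; 0 \<le> t\<rbrakk> \<Longrightarrow> nrm (flow t x) w * nrm (flow t x) a \<le> K1 * exp (- c * t) * (nrm x w * nrm x a)"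
    by (rule domination[of 1], simp) (rule that)
  obtain K2 where K2: "K2 > 0" "\<And>x w a t. \<lbrakk>x \<in> X; w \<in> W x; a \<in> Ls (-1) x; 0 \<le> t\<rbrakk> \<Longrightarrow> nrm (flow t x) w * nrm (flow t x) a \<le> K2 * exp (- c * t) * (nrm x w * nrm x a)"
    by (rule domination[of "-1"], simp) (rule that)
  obtain K3 where K3: "K3 > 0" "\<And>x w t. \<lbrakk>x \<in> X; w \<in> W x; 0 \<le> t\<rbrakk> \<Longrightarrow> nrm (flow t x) w \<le> K3 * exp (- c * t) * nrm x w"
    by (rule W_contract) (rule that)
  define L R where "L = D2 + M" and "R = K1 + K2 + K3 * K3"
  have LR: "0 < L" "0 < R" "D2 \<le> L" "M \<le> L" "K1 \<le> R" "K2 \<le> R" "K3 * K3 \<le> R" unfolding L_def R_def using D2 M K1 K2 K3 by (auto simp: add_pos_pos)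
  show ?thesis
  proof (rule that[of "D1 * L * R"])
    show "0 < D1 * L * R" using D1(1) LR by simp
    fix v z and t :: real assume v: "v \<in> Wm x'" and z: "z \<in> Wm x \<union> Ls 1 x \<union> Ls (-1) x" and t: "0 \<le> t"
    let ?y = "flow t x" let ?E = "exp (- c * t)"
    show "nrm x v * nrm x z \<le> D1 * L * R * ?E * (nrm ?y v * nrm ?y z)"
    proof (cases "v = 0 \<or> z = 0")
      case False
      obtain w where w: "w \<in> W x" "w \<noteq> 0" "nrm x v * nrm x w \<le> D1 * (nrm ?y v * nrm ?y w)" using D1(2)[OF v] False by blast
      \<comment> \<open>The partner \<open>a\<close> of \<open>z\<close> lies in \<open>W x\<close>
        if \<open>z\<close> is in \<open>Wm x\<close>, and in the opposite null line if
        \<open>z\<close> is null. It pairs with \<open>z\<close>, and its product with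
        \<open>w\<close> is contracted by \<open>W_contract\<close> or by domination.\<close>
      have "\<exists>a. a \<noteq> 0 \<and> nrm x z * nrm x a \<le> L * (nrm ?y z * nrm ?y a) \<and> nrm ?y w * nrm ?y a \<le> R * ?E * (nrm x w * nrm x a)"
      proof -
        have wk: "nrm x z * nrm x a \<le> L * (nrm ?y z * nrm ?y a) \<and> nrm ?y w * nrm ?y a \<le> R * ?E * (nrm x w * nrm x a)"
          if "nrm x z * nrm x a \<le> l * (nrm ?y z * nrm ?y a)" "l \<le> L" "nrm ?y w * nrm ?y a \<le> r * ?E * (nrm x w * nrm x a)" "r \<le> R" for a l r
          using that order_trans[OF that(1) mult_right_mono[OF that(2)]] order_trans[OF that(3) mult_right_mono[OF mult_right_mono[OF that(4)]]] by simp
        consider "z \<in> Wm x" | "z \<in> Ls 1 x" | "z \<in> Ls (-1) x" using z by blast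
        then show ?thesis
        proof cases
          case 1
          obtain a where a: "a \<in> W x" "a \<noteq> 0" "nrm x z * nrm x a \<le> D2 * (nrm ?y z * nrm ?y a)" using D2(2)[OF 1] False by blast
          have "nrm ?y w * nrm ?y a \<le> (K3 * ?E * nrm x w) * (K3 * 1 * nrm x a)"
            using K3(2)[OF x w(1) t] K3(1) t Cc(2) by (intro mult_mono order_trans[OF K3(2)[OF x a(1) t]] mult_right_mono mult_left_mono) auto
          also have "\<dots> = K3 * K3 * ?E * (nrm x w * nrm x a)" by simp
          finally show ?thesis using wk[OF a(3) LR(3) _ LR(7)] a(2) by blast
        next
          case 2
          obtain a where a: "a \<in> Ls (-1) x" "a \<noteq> 0" using null_line_nonzero[OF x, of "-1"] by auto
          have "nrm x z * nrm x a \<le> M * (nrm ?y z * nrm ?y a)" using M(2)[of x ?y 1 z a z] x 2 a by simp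
          then show ?thesis using wk[OF _ LR(4) K2(2)[OF x w(1) a(1) t] LR(6)] a(2) by blast
        next
          case 3
          obtain a where a: "a \<in> Ls 1 x" "a \<noteq> 0" using null_line_nonzero[OF x, of 1] by auto
          have "nrm x z * nrm x a \<le> M * (nrm ?y z * nrm ?y a)" using M(2)[of x ?y "-1" z a z] x 3 a by simp
          then show ?thesis using wk[OF _ LR(4) K1(2)[OF x w(1) a(1) t] LR(5)] a(2) by blast
        qed
      qed
      then obtain a where a: "a \<noteq> 0" "nrm x z * nrm x a \<le> L * (nrm ?y z * nrm ?y a)" "nrm ?y w * nrm ?y a \<le> R * ?E * (nrm x w * nrm x a)" by blast
      have "(nrm x v * nrm x w) * (nrm x z * nrm x a) \<le> (D1 * (nrm ?y v * nrm ?y w)) * (L * (nrm ?y z * nrm ?y a))"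
        by (rule mult_mono[OF w(3) a(2)]) (use D1(1) in auto)
      also have "\<dots> = D1 * L * (nrm ?y v * nrm ?y z) * (nrm ?y w * nrm ?y a)" by simp
      also have "\<dots> \<le> D1 * L * (nrm ?y v * nrm ?y z) * (R * ?E * (nrm x w * nrm x a))" using a(3) D1(1) LR(1) by (intro mult_left_mono) auto
      finally have "(nrm x v * nrm x z) * (nrm x w * nrm x a) \<le> (D1 * L * R * ?E * (nrm ?y v * nrm ?y z)) * (nrm x w * nrm x a)" by (simp add: mult_ac)
      then show ?thesis using nrm_pos[OF x w(2)] nrm_pos[OF x a(1)] by (simp del: mult.assoc)
    qed auto
  qed
qed

text \<open>North-south dynamics: a boundary point other than the forward end is attracted to the
  backward end of the limit. By \<open>transverse_expansion\<close> the moved copies of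
  \<open>W_minus\<close> become orthogonal to \<open>Wm\<close> and to both null lines, so their
  limit is \<open>Wm l\<close>; orientation and injectivity of \<open>\<eta>\<close> then identify
  the point.\<close>

lemma dynamics:
  assumes x: "x \<in> X" and r: "r \<in> bdry" "r \<noteq> fst x" and g: "\<And>k. g k \<in> G"
    and t: "filterlim t at_top sequentially" and lim: "flim (\<lambda>k. act (g k) (flow (t k) x)) l"
    and e: "blim (\<lambda>k. bact (g k) r) e" "e \<in> bdry"
  shows "e = fst (snd l)"
proof -
  define y where "y k = act (g k) (flow (t k) x)" for k
  define x' where "x' = (fst x, r, 0 :: real)"
  have x': "x' \<in> X" "fst x' = fst x" "fst (snd x') = r" using mem_boundary(1)[OF x] r unfolding x'_def mem_X by auto
  have yX: "y k \<in> X" for k unfolding y_def using act_closed g x by simp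
  have lX: "l \<in> X" using flim_mem lim .
  have limy: "flim y l" using lim unfolding y_def .
  have gr: "bact (g k) r \<in> bdry" for k using boundary_act_closed g r by blast
  obtain K where K: "K > 0" "\<And>v z t. \<lbrakk>v \<in> Wm x'; z \<in> Wm x \<union> Ls 1 x \<union> Ls (-1) x; 0 \<le> t\<rbrakk> \<Longrightarrow>
    nrm x v * nrm x z \<le> K * exp (- c * t) * (nrm (flow t x) v * nrm (flow t x) z)"
    by (rule transverse_expansion[OF x x'(1,2)]) (rule that)
  obtain D where D: "D > 0" "\<And>x v w. x \<in> X \<Longrightarrow> \<bar>hf v w\<bar> \<le> D * (nrm x v * nrm x w)" by (rule hf_bound) (rule that)
  have sub: "u \<in> Wm l" if u: "u \<in> W_minus (\<eta> e)" for u
  proof (rule Wm_orthogonal[OF lX])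
    fix z assume z: "z \<in> Wm l \<union> Ls 1 l \<union> Ls (-1) l"
    obtain U where U: "U \<longlonglongrightarrow> u" "\<And>k. U k \<in> W_minus (\<eta> (bact (g k) r))"
      by (rule orbit_approx_eta[OF gr e u]) (rule that)
    have "\<exists>s Z. strict_mono (s :: nat \<Rightarrow> nat) \<and> Z \<longlonglongrightarrow> z \<and> (\<forall>k. Z k \<in> Wm (y (s k)) \<union> Ls 1 (y (s k)) \<union> Ls (-1) (y (s k)))"
    proof (cases "z \<in> Wm l")
      case True
      then obtain Z where "Z \<longlonglongrightarrow> z" "\<And>k. Z k \<in> W_minus (\<eta> (fst (snd (y k))))"
        unfolding Wm_def using orbit_approx_eta[OF mem_boundary(2)[OF yX] flim_boundary(2)[OF yX limy] mem_boundary(2)[OF lX]] by blast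
      then show ?thesis unfolding Wm_def by (intro exI[of _ id]) (auto simp: strict_mono_def)
    next
      case False
      then obtain eps where "eps \<in> {1, -1}" "z \<in> Ls eps l" using z by auto
      then show ?thesis using Ls_approx[OF yX limy, of eps z] by (metis UnI1 UnI2 insertE singletonD)
    qed
    then obtain s Z where s: "strict_mono (s :: nat \<Rightarrow> nat)" "Z \<longlonglongrightarrow> z"
      "\<And>k. Z k \<in> Wm (y (s k)) \<union> Ls 1 (y (s k)) \<union> Ls (-1) (y (s k))" by blast
    have lU: "(\<lambda>k. U (s k)) \<longlonglongrightarrow> u" using LIMSEQ_subseq_LIMSEQ[OF U(1) s(1)] by (simp add: comp_def)
    have ts: "filterlim (\<lambda>k. t (s k)) at_top sequentially" by (rule filterlim_compose[OF t filterlim_subseq[OF s(1)]])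
    have "(\<lambda>k. hf (U (s k)) (Z k)) \<longlonglongrightarrow> 0"
    proof (rule Lim_null_comparison)
      have "(\<lambda>k. D * (K * exp (- c * t (s k)) * (nrm (y (s k)) (U (s k)) * nrm (y (s k)) (Z k)))) \<longlonglongrightarrow> D * (K * 0 * (nrm l u * nrm l z))"
        by (intro tendsto_intros exp_at_top[OF Cc(2) ts] nv.anorm_flim[OF yX flim_subseq[OF limy s(1)]] lU s(2))
      then show "(\<lambda>k. D * (K * exp (- c * t (s k)) * (nrm (y (s k)) (U (s k)) * nrm (y (s k)) (Z k)))) \<longlonglongrightarrow> 0" by simp
      have "\<forall>\<^sub>F k in sequentially. 0 \<le> t (s k)" using ts by (simp add: filterlim_at_top)
      then show "\<forall>\<^sub>F k in sequentially. norm (hf (U (s k)) (Z k)) \<le> D * (K * exp (- c * t (s k)) * (nrm (y (s k)) (U (s k)) * nrm (y (s k)) (Z k)))"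
      proof eventually_elim
        case (elim k)
        let ?g = "g (s k)" and ?f = "flow (t (s k)) x"
        define v w where "v = \<rho> (inv ?g) *v U (s k)" and "w = \<rho> (inv ?g) *v Z k"
        have vw: "U (s k) = \<rho> ?g *v v" "Z k = \<rho> ?g *v w" unfolding v_def w_def using g by auto
        have n: "nrm (y (s k)) (\<rho> ?g *v u) = nrm ?f u" for u
          unfolding y_def using nv.anorm_equivariant[of ?g ?f u] g x by simp
        have "U (s k) \<in> Wm (act ?g x')" using U(2) unfolding Wm_def act_fst[OF g x'(1)] x'(3) .
        then have v: "v \<in> Wm x'" unfolding vw act_sets[OF g x'(1)] .
        have "?f \<in> X" using x by simp
        then have w: "w \<in> Wm x \<union> Ls 1 x \<union> Ls (-1) x" using s(3)[of k] unfolding y_def vw by (simp add: act_sets g)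
        have "\<bar>hf (U (s k)) (Z k)\<bar> = \<bar>hf v w\<bar>" unfolding vw using g by simp
        also have "\<dots> \<le> D * (K * exp (- c * t (s k)) * (nrm ?f v * nrm ?f w))"
          using order_trans[OF D(2)[OF x] mult_left_mono[OF K(2)[OF v w elim]]] D(1) by simp
        finally show ?case unfolding vw n by simp
      qed
    qed
    moreover have "(\<lambda>k. hf (U (s k)) (Z k)) \<longlonglongrightarrow> hf u z" by (intro tendsto_intros lU s)
    ultimately show "hf u z = 0" using LIMSEQ_unique by blast
  qed
  obtain h where h: "framing l h" using framing_exists[OF lX] .
  obtain h' where h': "h' \<in> SO0_nn" "\<eta> e = translate h' P_minus" using eta_coset[OF e(2)] by blast
  have inc: "(*v) h' ` W_model (-1) \<subseteq> (*v) h ` W_model (-1)"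
    using sub unfolding h'(2) frame_W_minus framingD(4)[OF h] by blast
  have Weq: "(*v) h' ` W_model (-1) = (*v) h ` W_model (-1)"
    by (rule subspace_dim_equal[OF _ _ inc])
      (auto simp: dim_image_invertible SO0_invertible framingD(1)[OF h] h' intro: linear_subspace_image subspace_W_model)
  obtain J where J: "J \<longlonglongrightarrow> h" "\<And>k. J k \<in> SO0_nn" "\<And>k. \<xi> (fst (y k)) = translate (J k) P_plus"
    by (rule xi_lift[OF mem_boundary(1)[OF yX] flim_boundary(1)[OF yX limy] framingD(1,7)[OF h]]) (rule that)
  obtain G' where G': "G' \<longlonglongrightarrow> h'" "\<And>k. G' k \<in> SO0_nn" "\<And>k. \<eta> (bact (g k) r) = translate (G' k) P_minus"
    by (rule eta_lift[OF gr e(1) h']) (rule that)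
  \<comment> \<open>Equality of subspaces does not yet give equality of cosets. The moved point
    stays transverse to the forward end, which fixes the relative orientation along the
    sequence.\<close>
  have pos: "0 \<le> det (gram (J k) (G' k))" for k
  proof -
    have X: "act (g k) x' \<in> X" "flow (t k) x \<in> X" using act_closed[OF g x'(1)] x by auto
    have "(\<xi> (fst (act (g k) x')), \<eta> (fst (snd (act (g k) x')))) \<in> transverse_pairs SO0_nn P_plus P_minus"
      using transverse[of "fst (act (g k) x')" "fst (snd (act (g k) x'))" "snd (snd (act (g k) x'))"] X by simp
    then have "(translate (J k) P_plus, translate (G' k) P_minus) \<in> transverse_pairs SO0_nn P_plus P_minus"
      unfolding act_fst[OF g x'(1)] x' G'(3) J(3)[symmetric] y_def act_fst[OF g X(2)] flow_fst .
    then show ?thesis using gram_positive[OF J(2) G'(2)] by (simp add: less_imp_le)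
  qed
  have "(\<lambda>k. det (gram (J k) (G' k))) \<longlonglongrightarrow> det (gram h h')"
    by (intro tendsto_det continuous_gram J G')
  then have "0 \<le> det (gram h h')" using pos by (auto intro: LIMSEQ_le_const)
  moreover have "(translate h P_plus, translate h P_minus) \<in> transverse_pairs SO0_nn P_plus P_minus"
    unfolding transverse_pairs_def using framingD(1)[OF h] by blast
  ultimately have "translate h' P_minus = translate h P_minus"
    using gram_determines_orientation[OF framingD(1)[OF h] framingD(1)[OF h] h'(1) _ Weq] by blast
  then have "\<eta> e = \<eta> (fst (snd l))" using framingD(8)[OF h] h' by simp
  moreover have "inj_on \<eta> bdry" using eta unfolding equivariant_boundary_map_def by blast
  ultimately show ?thesis using e(2) mem_boundary(2)[OF lX] by (meson inj_onD)
qed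

end

context hyp_group
begin

lemma boundary_infinite_carrier:
  assumes "p \<in> bdry" shows "infinite G"
proof
  assume fin: "finite G"
  obtain a where a: "a \<in> seqs" using boundary_rep[OF assms] by blast
  have c: "a i \<in> G" for i using gromov_seqs_closed[OF a] by blast
  define M where "M = Max ((\<lambda>(x, y). gp x y) ` (G \<times> G))"
  have "gp (a i) (a j) \<le> M" for i j unfolding M_def using fin c by (intro Max_ge) auto
  moreover obtain n where "\<forall>i\<ge>n. \<forall>j\<ge>n. M + 1 \<le> gp (a i) (a j)" using gromov_seqsD[OF a] by blast
  ultimately show False by (metis add_le_same_cancel1 not_one_le_zero order_refl order_trans)
qed

lemma boundary_other_point:
  assumes "p \<in> bdry" obtains q where "q \<in> bdry" "q \<noteq> p"
proof -
  obtain g where "loxodromic g" by (rule loxodromic_exists[OF boundary_infinite_carrier[OF assms]])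
  then show ?thesis using loxodromic_boundary(2-4)[of g] that by metis
qed

end

text \<open>Write \<open>t\<close> as \<open>n * T\<close> plus a rest of at most \<open>T\<close>:
  halving contributes \<open>(1/2) ^ n\<close>, the rest costs \<open>B\<close>, and the factor 2 in
  \<open>K\<close> pays for replacing \<open>n\<close> by \<open>t / T\<close>.\<close>

lemma exponential_decay:
  fixes T B :: real
  assumes T: "0 < T"
  obtains \<kappa> K where "0 < \<kappa>" "0 < K"
    "\<And>f t. \<lbrakk>\<forall>s\<ge>0. \<forall>t\<ge>T. 2 * f (s + t) \<le> f s; \<forall>s\<ge>0. \<forall>t. 0 \<le> t \<and> t \<le> T \<longrightarrow> f (s + t) \<le> B * f s;
      \<forall>s\<ge>0. 0 \<le> f s; 0 \<le> t\<rbrakk> \<Longrightarrow> f t \<le> K * exp (- \<kappa> * t) * f (0::real)"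
proof (rule that[of "ln 2 / T" "2 * (\<bar>B\<bar> + 1)"])
  show "0 < ln 2 / T" "0 < 2 * (\<bar>B\<bar> + 1)" using T by auto
  fix f and t :: real assume h: "\<forall>s\<ge>0. \<forall>t\<ge>T. 2 * f (s + t) \<le> f s" and B: "\<forall>s\<ge>0. \<forall>t. 0 \<le> t \<and> t \<le> T \<longrightarrow> f (s + t) \<le> B * f s"
    and p: "\<forall>s\<ge>0. 0 \<le> f s" and t: "0 \<le> t"
  have it: "f (real n * T) \<le> (1/2) ^ n * f 0" for n
  proof (induction n)
    case (Suc n)
    have "2 * f (real n * T + T) \<le> f (real n * T)" using h T by simp
    then show ?case using Suc by (simp add: algebra_simps)
  qed simp
  define n where "n = nat \<lfloor>t / T\<rfloor>"
  have n0: "real n = of_int \<lfloor>t / T\<rfloor>" unfolding n_def using t T by simp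
  have n1: "real n \<le> t / T" "t / T < real n + 1" unfolding n0 by linarith+
  have n: "real n * T \<le> t" "t - real n * T \<le> T" using n1 T by (auto simp: field_simps)
  have "f t \<le> B * f (real n * T)" using B[rule_format, of "real n * T" "t - real n * T"] n T by simp
  also have "\<dots> \<le> (\<bar>B\<bar> + 1) * f (real n * T)" using p T by (intro mult_right_mono) auto
  also have "\<dots> \<le> (\<bar>B\<bar> + 1) * ((1/2) ^ n * f 0)" using it by (intro mult_left_mono) auto
  also have "\<dots> \<le> (\<bar>B\<bar> + 1) * ((2 * exp (- (ln 2 / T) * t)) * f 0)"
  proof -
    have "(1/2 :: real) ^ n = exp (- ln 2) ^ n" by (simp add: exp_minus field_simps)
    also have "\<dots> = exp (- ln 2 * real n)" by (metis exp_of_nat_mult mult.commute)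
    also have "\<dots> \<le> exp (ln 2 + - (ln 2 / T) * t)"
    proof -
      have "ln 2 * (t / T) \<le> ln 2 * (real n + 1)" using n1(2) by (intro mult_left_mono) auto
      then show ?thesis by (simp add: algebra_simps)
    qed
    finally have "(1/2 :: real) ^ n \<le> 2 * exp (- (ln 2 / T) * t)" unfolding exp_add by simp
    then show ?thesis using p by (intro mult_left_mono mult_right_mono) auto
  qed
  finally show "f t \<le> 2 * (\<bar>B\<bar> + 1) * exp (- (ln 2 / T) * t) * f 0"
    by (simp only: mult_ac)
qed

context SO_anosov
begin

lemma flow_growth:
  "\<exists>B>0. \<forall>x\<in>X. \<forall>t v. 0 \<le> t \<and> t \<le> T \<longrightarrow> nrm (flow t x) v \<le> B * nrm x v"
proof -
  have "\<exists>K>0. \<forall>x\<in>core. \<forall>z\<in>{0..T} \<times> sphere 0 1. True \<longrightarrow> nrm (flow (fst z) x) (snd z) \<le> K"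
    by (rule core_bound) (auto intro!: compact_Times nv.anorm_flim flim_flow tendsto_fst tendsto_snd)
  then obtain K where K: "K > 0" "\<And>x t v. x \<in> core \<Longrightarrow> 0 \<le> t \<Longrightarrow> t \<le> T \<Longrightarrow> norm v = 1 \<Longrightarrow> nrm (flow t x) v \<le> K"
    by fastforce
  obtain B where B: "B > 0" "\<And>y v. y \<in> core \<Longrightarrow> norm v \<le> B * nrm y v \<and> nrm y v \<le> B * norm v" by (rule core_norm) (rule that)
  show ?thesis
  proof (intro exI[of _ "K * B"] conjI ballI allI impI)
    show "0 < K * B" using K B by simp
    fix x v and t :: real assume x: "x \<in> X" and t: "0 \<le> t \<and> t \<le> T"
    obtain g where g: "g \<in> G" "act (inv g) x \<in> core" using to_core[OF x] .
    define y u where "y = act (inv g) x" and "u = \<rho> (inv g) *v v"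
    have eq: "nrm (flow s y) u = nrm (flow s x) v" for s
      unfolding y_def u_def using nv.anorm_equivariant[of "inv g" "flow s x" v] act_flow[of "inv g" x s] g x by simp
    show "nrm (flow t x) v \<le> K * B * nrm x v"
    proof (cases "u = 0")
      case True
      then show ?thesis using eq[of t] eq[of 0] by simp
    next
      case False
      have "nrm (flow t y) ((1 / norm u) *\<^sub>R u) \<le> K" using K(2)[of y t "(1 / norm u) *\<^sub>R u"] t g(2) False unfolding y_def by simp
      then have "nrm (flow t y) u \<le> K * norm u" using False by (simp add: nv.anorm_scale field_simps)
      also have "\<dots> \<le> K * (B * nrm y u)" using B(2)[of y u] g(2) K(1) unfolding y_def by (intro mult_left_mono) auto
      finally show ?thesis using eq[of t] eq[of 0] by simp
    qed
  qed
qed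

lemma W_nonzero:
  assumes x: "x \<in> X" obtains w where "w \<in> W x" "w \<noteq> 0"
proof -
  obtain h where h: "framing x h" using framing_exists[OF x] .
  define i :: 'm where "i = undefined"
  have "isotropic_basis 1 i \<noteq> 0" using isotropic_basis_nth(3)[of 1 i i] by (metis zero_index zero_neq_one)
  then have "h *v isotropic_basis 1 i \<noteq> 0" using SO0_invertible[OF framingD(1)[OF h]] by (metis invertible_def matrix_left_invertible_ker)
  moreover have "h *v isotropic_basis 1 i \<in> W x" unfolding framingD(3)[OF h] using isotropic_basis_W by blast
  ultimately show ?thesis using that by blast
qed

text \<open>If \<open>t k\<close> stayed below \<open>s\<close>, contraction from time
  \<open>t k\<close> to \<open>s\<close> would bound the norm at \<open>t k\<close> from below. So
  an exponentially contracted vector detects divergence of times, and a common vector compares times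
  on different flow lines.\<close>

lemma flow_decay:
  assumes x: "x \<in> X" and v: "v \<noteq> 0" and K: "K > 0" "\<kappa> > 0"
    and decay: "\<And>s t. 0 \<le> t \<Longrightarrow> nrm (flow t (flow s x)) v \<le> K * exp (- \<kappa> * t) * nrm (flow s x) v"
  shows "(\<lambda>k. nrm (flow (t k) x) v) \<longlonglongrightarrow> 0 \<longleftrightarrow> filterlim t at_top sequentially"
proof
  assume t: "filterlim t at_top sequentially"
  show "(\<lambda>k. nrm (flow (t k) x) v) \<longlonglongrightarrow> 0"
  proof (rule Lim_null_comparison)
    have "\<forall>\<^sub>F k in sequentially. 0 \<le> t k" using t by (simp add: filterlim_at_top)
    then show "\<forall>\<^sub>F k in sequentially. norm (nrm (flow (t k) x) v) \<le> K * exp (- \<kappa> * t k) * nrm x v"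
      by eventually_elim (use decay[of _ 0] in simp)
    show "(\<lambda>k. K * exp (- \<kappa> * t k) * nrm x v) \<longlonglongrightarrow> 0"
      using tendsto_mult_left[OF tendsto_mult_right[OF exp_at_top[OF K(2) t], of "nrm x v"], of K] by (simp add: mult.assoc)
  qed
next
  assume lim: "(\<lambda>k. nrm (flow (t k) x) v) \<longlonglongrightarrow> 0"
  show "filterlim t at_top sequentially"
    unfolding filterlim_at_top
  proof
    fix s
    have "0 < nrm (flow s x) v" using nrm_pos[of "flow s x" v] x v by simp
    then have "\<forall>\<^sub>F k in sequentially. nrm (flow (t k) x) v < nrm (flow s x) v / K" using K(1) by (intro order_tendstoD(2)[OF lim]) simp
    then show "\<forall>\<^sub>F k in sequentially. s \<le> t k"
    proof eventually_elim
      case (elim k)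
      show ?case
      proof (rule ccontr)
        assume n: "\<not> s \<le> t k"
        have "nrm (flow (s - t k) (flow (t k) x)) v \<le> K * exp (- \<kappa> * (s - t k)) * nrm (flow (t k) x) v"
          by (rule decay) (use n in simp)
        also have "\<dots> \<le> K * 1 * nrm (flow (t k) x) v" using n K by (intro mult_mono) (auto simp: mult_nonneg_nonneg)
        finally have "nrm (flow s x) v \<le> K * nrm (flow (t k) x) v" by simp
        then show False using elim K(1) by (simp add: field_simps)
      qed
    qed
  qed
qed

lemma W_decay:
  assumes x: "x \<in> X" and w: "w \<in> W x" "w \<noteq> 0"
  shows "(\<lambda>k. nrm (flow (t k) x) w) \<longlonglongrightarrow> 0 \<longleftrightarrow> filterlim t at_top sequentially"
proof -
  obtain K where K: "K > 0" "\<And>x w t. \<lbrakk>x \<in> X; w \<in> W x; 0 \<le> t\<rbrakk> \<Longrightarrow> nrm (flow t x) w \<le> K * exp (- c * t) * nrm x w" by (rule W_contract) (rule that)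
  show ?thesis by (rule flow_decay[OF x w(2) K(1) Cc(2) K(2)]) (use x w in auto)
qed

lemma flow_cocycle:
  assumes g: "\<And>k. g k \<in> G" and x: "x \<in> X" and lim: "flim (\<lambda>k. act (g k) (flow (t k) x)) l"
  shows "(\<lambda>k. nrm (flow (t k) x) v) \<longlonglongrightarrow> 0 \<longleftrightarrow> (\<lambda>k. \<rho> (g k) *v v) \<longlonglongrightarrow> 0"
  by (rule nrm_cocycle[OF g _ lim]) (use x in simp)

lemma forward_recurrence:
  assumes x: "x \<in> X"
  obtains g t l where "\<And>k. g k \<in> G" "filterlim t at_top sequentially" "flim (\<lambda>k. act (g k) (flow (t k) x)) l"
proof -
  obtain g l r where g: "\<And>k. g k \<in> G" "strict_mono (r :: nat \<Rightarrow> nat)" "l \<in> core"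
    "flim (\<lambda>k. act (inv (g (r k))) (flow (real (r k)) x)) l"
    by (rule cocompact_subseq[of "\<lambda>k. flow (real k) x"], use x in simp) (rule that)
  then show ?thesis using filterlim_compose[OF filterlim_real_sequentially filterlim_subseq[OF g(2)]]
    by (intro that[of "\<lambda>k. inv (g (r k))" "\<lambda>k. real (r k)" l]) auto
qed

text \<open>Moving the backward end to \<open>r\<close> keeps the forward end and therefore
  \<open>W\<close>. A vector of \<open>W x\<close> is contracted by the group elements, which shows
  that the times on the new line diverge too; \<open>dynamics\<close> gives the limit of its
  backward end.\<close>

lemma third_point:
  assumes x: "x \<in> X" and r: "r \<in> bdry" "r \<noteq> fst x" and g: "\<And>k. g k \<in> G"
    and t: "filterlim t at_top sequentially" and lim: "flim (\<lambda>k. act (g k) (flow (t k) x)) l"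
  obtains u s where "strict_mono (u :: nat \<Rightarrow> nat)" "filterlim s at_top sequentially"
    "flim (\<lambda>k. act (g (u k)) (flow (s k) (fst x, r, 0))) (fst l, fst (snd l), 0)"
    "blim (\<lambda>k. bact (g (u k)) r) (fst (snd l))"
proof -
  have gr: "bact (g k) r \<in> bdry" for k using boundary_act_closed g r by blast
  obtain e u where u: "e \<in> bdry" "strict_mono (u :: nat \<Rightarrow> nat)"
    "\<And>N::nat. \<exists>k0. \<forall>k\<ge>k0. ereal N \<le> bprod e (bact (g (u k)) r)"
    by (rule boundary_seq_compact[of "\<lambda>k. bact (g k) r", OF gr]) (rule that)
  have le: "blim (\<lambda>k. bact (g (u k)) r) e"
    by (rule limitin_boundary[OF u(1) gr u(3)])
  have tu: "filterlim (\<lambda>k. t (u k)) at_top sequentially"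
    using filterlim_compose[OF t filterlim_subseq[OF u(2)]] by simp
  note limu = flim_subseq[OF lim u(2)]
  have e: "e = fst (snd l)" by (rule dynamics[OF x r g tu limu le u(1)])
  define x' where "x' = (fst x, r, 0 :: real)"
  have x': "x' \<in> X" "fst x' = fst x" "fst (snd x') = r" using mem_boundary(1)[OF x] r unfolding x'_def mem_X by auto
  have "\<exists>s. act (g (u k)) (flow s x') = (bact (g (u k)) (fst x), bact (g (u k)) r, 0)" for k
    using flow_normalize[OF g x'(1)[unfolded x'_def], of "u k"] unfolding x'_def by metis
  then obtain s where s: "\<And>k. act (g (u k)) (flow (s k) x') = (bact (g (u k)) (fst x), bact (g (u k)) r, 0)" by metis
  have X: "flow (t (u k)) x \<in> X" "act (g (u k)) (flow (t (u k)) x) \<in> X" "act (g (u k)) (flow (s k) x') \<in> X" for k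
    using act_closed g x x' by auto
  have lX: "(fst l, fst (snd l), 0) \<in> X" using flim_mem[OF lim] by (cases l) (simp add: mem_X)
  have limz: "flim (\<lambda>k. act (g (u k)) (flow (s k) x')) (fst l, fst (snd l), 0)"
    unfolding flim_iff[OF X(3) lX] using flim_boundary(1)[OF X(2) limu] le unfolding s e act_fst[OF g X(1)] by simp
  obtain w where w: "w \<in> W x" "w \<noteq> 0" using W_nonzero[OF x] .
  have wx': "w \<in> W x'" using w x'(2) unfolding W_def by simp
  have "filterlim s at_top sequentially"
    using W_decay[OF x w, of "\<lambda>k. t (u k)"] tu unfolding flow_cocycle[OF g x limu] W_decay[OF x'(1) wx' w(2), symmetric] flow_cocycle[OF g x'(1) limz] by blast
  then show ?thesis using that[OF u(2), of s] limz le unfolding x'_def e by blast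
qed

end

section \<open>Independence of the sign from the backward end, and transversality\<close>

context SO_proper
begin

text \<open>The null line decays by \<open>exponential_decay\<close> and \<open>W\<close> by
  \<open>W_contract\<close>; \<open>sum_bound\<close> allows the two estimates to be added.\<close>

lemma sg_contract:
  "\<exists>K>0. \<exists>\<kappa>>0. \<forall>x\<in>X. \<forall>v\<in>Vs (sg x) x. \<forall>t\<ge>0. nrm (flow t x) v \<le> K * exp (- \<kappa> * t) * nrm x v"
proof -
  obtain T0 where T0: "\<And>x t a. x \<in> X \<Longrightarrow> T0 \<le> t \<Longrightarrow> a \<in> Ls (sg x) x \<Longrightarrow> 2 * nrm (flow t x) a \<le> nrm x a"
    using contracted_half by blast
  define T where "T = max T0 1"
  have T: "0 < T" "T0 \<le> T" unfolding T_def by auto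
  obtain B where B: "B > 0" "\<And>x t v. x \<in> X \<Longrightarrow> 0 \<le> t \<and> t \<le> T \<Longrightarrow> nrm (flow t x) v \<le> B * nrm x v" using flow_growth by blast
  obtain \<kappa> K where K: "\<kappa> > 0" "K > 0" "\<And>f t. \<lbrakk>\<forall>s\<ge>0. \<forall>t\<ge>T. 2 * f (s + t) \<le> f s; \<forall>s\<ge>0. \<forall>t. 0 \<le> t \<and> t \<le> T \<longrightarrow> f (s + t) \<le> B * f s;
     \<forall>s\<ge>0. 0 \<le> f s; 0 \<le> t\<rbrakk> \<Longrightarrow> f t \<le> K * exp (- \<kappa> * t) * f 0"
    by (rule exponential_decay[OF T(1), of B]) (rule that)
  obtain K3 where K3: "K3 > 0" "\<And>x w t. \<lbrakk>x \<in> X; w \<in> W x; 0 \<le> t\<rbrakk> \<Longrightarrow> nrm (flow t x) w \<le> K3 * exp (- c * t) * nrm x w"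
    by (rule W_contract) (rule that)
  obtain D where D: "D > 0" "\<And>x eps w a. \<lbrakk>x \<in> X; eps \<in> {1,-1}; w \<in> W x; a \<in> Ls eps x\<rbrakk> \<Longrightarrow> nrm x w \<le> D * nrm x (w + a) \<and> nrm x a \<le> D * nrm x (w + a)"
    using sum_bound by blast
  define \<mu> where "\<mu> = min \<kappa> c"
  have mu: "0 < \<mu>" "\<mu> \<le> \<kappa>" "\<mu> \<le> c" unfolding \<mu>_def using K(1) Cc(2) by auto
  show ?thesis
  proof (rule exI[of _ "(K + K3) * D"], rule conjI[rotated], rule exI[of _ \<mu>], intro conjI ballI allI impI mu(1))
    show "0 < (K + K3) * D" using K(2) K3(1) D(1) by simp
    fix x v and t :: real assume x: "x \<in> X" and v: "v \<in> Vs (sg x) x" and t: "0 \<le> t"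
    obtain w a where wa: "w \<in> W x" "a \<in> Ls (sg x) x" "v = w + a" using v unfolding Vs_decomp[OF x sg_cases(1)] by blast
    have "nrm (flow t x) a \<le> K * exp (- \<kappa> * t) * nrm (flow 0 x) a"
    proof (rule K(3)[OF _ _ _ t])
      show "\<forall>s\<ge>0. \<forall>t\<ge>T. 2 * nrm (flow (s + t) x) a \<le> nrm (flow s x) a"
      proof (intro allI impI)
        fix s t assume "T \<le> t"
        then show "2 * nrm (flow (s + t) x) a \<le> nrm (flow s x) a"
          using T0[of "flow s x" t a] x wa(2) T(2) by (simp add: flow_sets sg_flow add.commute)
      qed
      show "\<forall>s\<ge>0. \<forall>t. 0 \<le> t \<and> t \<le> T \<longrightarrow> nrm (flow (s + t) x) a \<le> B * nrm (flow s x) a"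
      proof (intro allI impI)
        fix s t assume "0 \<le> t \<and> t \<le> T"
        then show "nrm (flow (s + t) x) a \<le> B * nrm (flow s x) a"
          using B(2)[of "flow s x" t a] x by (simp add: add.commute)
      qed
    qed simp
    also have "\<dots> \<le> K * exp (- \<mu> * t) * (D * nrm x v)"
      using D(2)[OF x sg_cases(1) wa(1,2)] mu t K(2) unfolding wa(3) by (intro mult_mono) (auto simp: mult_right_mono)
    finally have a: "nrm (flow t x) a \<le> K * exp (- \<mu> * t) * (D * nrm x v)" .
    have "nrm (flow t x) w \<le> K3 * exp (- c * t) * nrm x w" by (rule K3(2)[OF x wa(1) t])
    also have "\<dots> \<le> K3 * exp (- \<mu> * t) * (D * nrm x v)"
      using D(2)[OF x sg_cases(1) wa(1,2)] mu t K3(1) unfolding wa(3) by (intro mult_mono) (auto simp: mult_right_mono)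
    finally have "nrm (flow t x) v \<le> K * exp (- \<mu> * t) * (D * nrm x v) + K3 * exp (- \<mu> * t) * (D * nrm x v)"
      using a nv.anorm_triangle[of "flow t x" w a] unfolding wa(3) by linarith
    then show "nrm (flow t x) v \<le> (K + K3) * D * exp (- \<mu> * t) * nrm x v" by (simp add: algebra_simps)
  qed
qed

lemma E_decay:
  assumes x: "x \<in> X" and v: "v \<in> Vs (sg x) x" "v \<noteq> 0"
  shows "(\<lambda>k. nrm (flow (t k) x) v) \<longlonglongrightarrow> 0 \<longleftrightarrow> filterlim t at_top sequentially"
proof -
  obtain K \<kappa> where K: "K > 0" "\<kappa> > 0" "\<And>y v t. y \<in> X \<Longrightarrow> v \<in> Vs (sg y) y \<Longrightarrow> 0 \<le> t \<Longrightarrow> nrm (flow t y) v \<le> K * exp (- \<kappa> * t) * nrm y v"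
    using sg_contract by blast
  show ?thesis by (rule flow_decay[OF x v(2) K]) (use x v in \<open>auto simp: sg_flow\<close>)
qed

text \<open>With different signs the same group elements would contract both maximal isotropic
  subspaces over the common forward end, hence a null pair, whose nonzero pairing they
  preserve.\<close>

lemma sg_independent:
  assumes x: "x \<in> X" and y: "y \<in> X" and eq: "fst x = fst y"
  shows "sg x = sg y"
proof (rule ccontr)
  assume ne: "sg x \<noteq> sg y"
  define z where "z = (fst y, fst (snd y), 0 :: real)"
  have yz: "z = flow (- snd (snd y)) y" unfolding z_def by (cases y) simp
  have z: "z \<in> X" "sg z = sg y" "fst z = fst x"
    using y by (simp add: yz) (simp only: yz sg_flow, simp add: z_def eq)
  obtain g t l where g: "\<And>k. g k \<in> G" "filterlim t at_top sequentially" "flim (\<lambda>k. act (g k) (flow (t k) x)) l"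
    by (rule forward_recurrence[OF x]) (rule that)
  have ry: "fst (snd y) \<in> bdry" "fst (snd y) \<noteq> fst x" unfolding eq using mem_boundary[OF y] by auto
  obtain u s where us: "strict_mono (u :: nat \<Rightarrow> nat)" "filterlim s at_top sequentially"
    "flim (\<lambda>k. act (g (u k)) (flow (s k) (fst x, fst (snd y), 0))) (fst l, fst (snd l), 0)"
    by (rule third_point[OF x ry g]) (rule that)
  have us3: "flim (\<lambda>k. act (g (u k)) (flow (s k) z)) (fst l, fst (snd l), 0)" using us(3) unfolding z_def eq .
  have tu: "filterlim (\<lambda>k. t (u k)) at_top sequentially" by (rule filterlim_compose[OF g(2) filterlim_subseq[OF us(1)]])
  have c1: "(\<lambda>k. \<rho> (g (u k)) *v v) \<longlonglongrightarrow> 0" if "v \<in> Vs (sg x) x" for v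
    using flow_cocycle[OF g(1) x flim_subseq[OF g(3) us(1)], of v] E_decay[OF x that, of "\<lambda>k. t (u k)"] tu by (cases "v = 0") auto
  have c2: "(\<lambda>k. \<rho> (g (u k)) *v v) \<longlonglongrightarrow> 0" if "v \<in> Vs (sg y) x" for v
  proof -
    have "v \<in> Vs (sg z) z" using that unfolding z(2) Vs_def z(3) .
    then show ?thesis using flow_cocycle[OF g(1) z(1) us3, of v] E_decay[OF z(1), of v s] us(2) by (cases "v = 0") auto
  qed
  have c3: "(\<lambda>k. \<rho> (g (u k)) *v v) \<longlonglongrightarrow> 0" if "v \<in> Vs eps x" "eps \<in> {1, -1}" for v eps
    using c1[of v] c2[of v] ne sg_cases(1)[of x] sg_cases(1)[of y] that by auto
  obtain a where a: "a \<in> Ls 1 x" "a \<noteq> 0" using null_line_nonzero[OF x, of 1] by auto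
  obtain b where b: "b \<in> Ls (-1) x" "b \<noteq> 0" using null_line_nonzero[OF x, of "-1"] by auto
  have ab: "a \<in> Vs 1 x" "b \<in> Vs (-1) x" using a b unfolding Ls_def null_line_def Vs_def by auto
  have "(\<lambda>k. hf (\<rho> (g (u k)) *v a) (\<rho> (g (u k)) *v b)) \<longlonglongrightarrow> hf (0 :: 'm nvec) 0"
    by (rule bounded_bilinear.tendsto[OF bounded_bilinear_hf]) (use c3 ab in auto)
  then have "hf a b = 0" using g by (simp add: hf_simps LIMSEQ_const_iff)
  then show False using null_pair_nonzero[OF x, of 1] a b by auto
qed

text \<open>The same \<open>g k\<close> act on both flow lines, so \<open>E_decay\<close> for a
  common nonzero vector transfers divergence to +infinity from \<open>t\<close> to
  \<open>s\<close>.\<close>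

lemma E_transverse_dynamics:
  assumes x: "x \<in> X" and y: "y \<in> X" and g: "\<And>k. g k \<in> G"
    and t: "filterlim t at_top sequentially" "flim (\<lambda>k. act (g k) (flow (t k) x)) l"
    and s: "filterlim s at_bot sequentially" "flim (\<lambda>k. act (g k) (flow (s k) y)) l'"
  shows "Vs (sg x) x \<inter> Vs (sg y) y \<subseteq> {0}"
proof
  fix v assume v: "v \<in> Vs (sg x) x \<inter> Vs (sg y) y"
  show "v \<in> {0}"
  proof (rule ccontr)
    assume "v \<notin> {0}"
    then have "filterlim s at_top sequentially"
      using E_decay[OF x, of v t] E_decay[OF y, of v s] v t(1) unfolding flow_cocycle[OF g x t(2)] flow_cocycle[OF g y s(2)] by simp
    then have "\<forall>\<^sub>F k in sequentially. 1 \<le> s k" "\<forall>\<^sub>F k in sequentially. s k \<le> 0" using s(1) by (simp_all add: filterlim_at_top filterlim_at_bot)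
    then have "\<forall>\<^sub>F k :: nat in sequentially. False" by eventually_elim simp
    then show False by simp
  qed
qed

text \<open>Elements recurrent on \<open>x\<close> act on the reversed line \<open>y\<close> with
  times \<open>s k\<close>. Convergent times are impossible since a vector of \<open>W x\<close> is
  contracted; times tending to +infinity are impossible since \<open>dynamics\<close> would send
  \<open>r\<close> to both ends of the limit. Times tending to -infinity give
  transversality.\<close>

lemma E_transverse_third:
  assumes pq: "(p, q, 0) \<in> X" and r: "r \<in> bdry" "r \<noteq> p" "r \<noteq> q"
  shows "Vs (sg (p, q, 0)) (p, q, 0) \<inter> Vs (sg (q, p, 0)) (q, p, 0) \<subseteq> {0}"
proof -
  define x y where "x = (p, q, 0 :: real)" and "y = (q, p, 0 :: real)"
  have X: "x \<in> X" "y \<in> X" using pq unfolding x_def y_def mem_X by auto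
  obtain g t0 l where g: "\<And>k. g k \<in> G" "filterlim t0 at_top sequentially" "flim (\<lambda>k. act (g k) (flow (t0 k) x)) l"
    by (rule forward_recurrence[OF X(1)]) (rule that)
  have rx: "r \<noteq> fst x" using r(2) unfolding x_def by simp
  obtain u s0 where u: "strict_mono (u :: nat \<Rightarrow> nat)" "filterlim s0 at_top sequentially"
    "flim (\<lambda>k. act (g (u k)) (flow (s0 k) (fst x, r, 0))) (fst l, fst (snd l), 0)"
    "blim (\<lambda>k. bact (g (u k)) r) (fst (snd l))"
    by (rule third_point[OF X(1) r(1) rx g]) (rule that)
  define J t where "J k = g (u k)" and "t k = t0 (u k)" for k
  have J: "J k \<in> G" for k unfolding J_def by (rule g)
  have t: "filterlim t at_top sequentially" unfolding t_def by (rule filterlim_compose[OF g(2) filterlim_subseq[OF u(1)]])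
  have limx: "flim (\<lambda>k. act (J k) (flow (t k) x)) l" unfolding J_def t_def by (rule flim_subseq[OF g(3) u(1)])
  have lX: "l \<in> X" using flim_mem limx .
  have "\<exists>s. act (J k) (flow s y) = (bact (J k) q, bact (J k) p, 0)" for k
    using flow_normalize[OF J X(2)[unfolded y_def], of k] unfolding y_def by metis
  then obtain s where s: "\<And>k. act (J k) (flow (s k) y) = (bact (J k) q, bact (J k) p, 0)" by metis
  have zX: "flow (t k) x \<in> X" "act (J k) (flow (t k) x) \<in> X" "act (J k) (flow (s k) y) \<in> X" for k using act_closed J X by auto
  have lX': "(fst (snd l), fst l, 0) \<in> X" using lX by (cases l) (auto simp: mem_X)
  have limz: "flim (\<lambda>k. act (J k) (flow (s k) y)) (fst (snd l), fst l, 0)"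
    unfolding flim_iff[OF zX(3) lX'] using flim_boundary[OF zX(2) limx] unfolding s act_fst[OF J zX(1)] by (simp add: x_def)
  show ?thesis
  proof (cases rule: real_subseq_cases[of s])
    case (1 v m)
    have y1: "flim (\<lambda>k. flow (s (v k)) y) (flow m y)" using flim_flow[OF X(2) flim_const[OF X(2)] 1(2)] .
    obtain w where w: "w \<in> W x" "w \<noteq> 0" using W_nonzero[OF X(1)] .
    have "(\<lambda>k. nrm (flow (s k) y) w) \<longlonglongrightarrow> 0" using W_decay[OF X(1) w, of t] t unfolding flow_cocycle[OF J X(1) limx] flow_cocycle[OF J X(2) limz] by blast
    then have "(\<lambda>k. nrm (flow (s (v k)) y) w) \<longlonglongrightarrow> 0" using LIMSEQ_subseq_LIMSEQ[OF _ 1(1)] by (auto simp: comp_def)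
    moreover have "(\<lambda>k. nrm (flow (s (v k)) y) w) \<longlonglongrightarrow> nrm (flow m y) w"
      by (rule nv.anorm_flim[OF _ y1 tendsto_const]) (use X in simp)
    ultimately have "nrm (flow m y) w = 0" using LIMSEQ_unique by blast
    then show ?thesis using nrm_pos[of "flow m y" w] X w by simp
  next
    case (2 v)
    have ry: "r \<noteq> fst y" using r(3) unfolding y_def by simp
    have l2: "blim (\<lambda>k. bact (J (v k)) r) (fst (snd l))"
      using limitin_subsequence[OF 2(1) u(4)] by (simp add: J_def comp_def)
    have "fst (snd l) = fst (snd (fst (snd l), fst l, 0 :: real))"
      by (rule dynamics[OF X(2) r(1) ry J 2(2) flim_subseq[OF limz 2(1)] l2 mem_boundary(2)[OF lX]])
    then show ?thesis using mem_boundary(3)[OF lX] by simp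
  next
    case (3 v)
    have "filterlim (\<lambda>k. t (v k)) at_top sequentially" using filterlim_compose[OF t filterlim_subseq[OF 3(1)]] by simp
    then show ?thesis unfolding x_def[symmetric] y_def[symmetric]
      by (rule E_transverse_dynamics[OF X J _ flim_subseq[OF limx 3(1)] 3(2) flim_subseq[OF limz 3(1)]])
  qed
qed

text \<open>By periodicity the powers of \<open>inv g\<close> bring \<open>x\<close> back from time
  \<open>k * l\<close> and the reversed line back from time \<open>- k * l'\<close>.\<close>

lemma E_transverse_loxodromic:
  assumes g: "loxodromic g" and pq: "p = att g" "q = rep g"
  shows "Vs (sg (p, q, 0)) (p, q, 0) \<inter> Vs (sg (q, p, 0)) (q, p, 0) \<subseteq> {0}"
proof -
  define x y where "x = (p, q, 0 :: real)" and "y = (q, p, 0 :: real)"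
  have X: "x \<in> X" "y \<in> X" using loxodromic_boundary(2-4)[OF g] unfolding x_def y_def mem_X pq by auto
  have gc: "g \<in> G" using g unfolding loxodromic_def by blast
  have per: "\<exists>l>0. \<forall>t. act h (flow t z) = flow (t + l) z"
    if "loxodromic h" "z = (att h, rep h, 0)" for h z
    using period[of h] loxodromic_boundary(1)[OF that(1)] that(1) unfolding loxodromic_def that(2) by (auto simp: add.commute)
  obtain l where l: "l > 0" "\<And>t. act g (flow t x) = flow (t + l) x" using per[OF g, of x] unfolding x_def pq by blast
  have gi: "loxodromic (inv g)" by (rule loxodromic_inv[OF g])
  have "rep (inv g) = p" "att (inv g) = q" unfolding pq repelling_point_def using gc by simp_all
  then obtain l' where l': "l' > 0" "\<And>t. act (inv g) (flow t y) = flow (t + l') y" using per[OF gi, of y] unfolding y_def by metis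
  have ix: "act (inv g) (flow t x) = flow (t - l) x" for t
  proof -
    have "act (inv g) (act g (flow (t - l) x)) = flow (t - l) x" by (rule act_inv(1)) (use gc X in auto)
    then show ?thesis unfolding l(2) by simp
  qed
  define J where "J k = inv g [^] (k::nat)" for k
  have J: "J k \<in> G" for k unfolding J_def using gc by simp
  have pow: "act (J k) (flow t z) = flow (t + real k * m) z" if z: "z \<in> X" "\<And>t. act (inv g) (flow t z) = flow (t + m) z" for k t m z
  proof (induction k arbitrary: t)
    case 0 then show ?case unfolding J_def using act_one z by simp
  next
    case (Suc k) then show ?case
      unfolding J_def using z gc act_mult[of "inv g [^] k" "inv g" "flow t z"] by (simp add: algebra_simps)
  qed
  have Gx: "act (J k) (flow t x) = flow (t - real k * l) x" for k t using pow[of x "- l" k t] ix X by simp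
  note Gy = pow[of y l', OF X(2) l'(2)]
  have t: "filterlim (\<lambda>k. real k * l) at_top sequentially" "filterlim (\<lambda>k. real k * l') at_top sequentially"
    using l(1) l'(1) filterlim_real_sequentially by (auto intro: filterlim_at_top_mult_tendsto_pos[OF tendsto_const])
  have s: "filterlim (\<lambda>k. - (real k * l')) at_bot sequentially"
    using filterlim_compose[OF filterlim_uminus_at_bot_at_top t(2)] by simp
  have fl: "flim (\<lambda>k. act (J k) (flow (real k * l) x)) x" "flim (\<lambda>k. act (J k) (flow (- (real k * l')) y)) y"
    unfolding Gx Gy using flim_const X by simp_all
  show ?thesis unfolding x_def[symmetric] y_def[symmetric]
    by (rule E_transverse_dynamics[of x y J, OF X J t(1) fl(1) s fl(2)])
qed

lemma E_transverse:
  assumes pq: "(p, q, 0) \<in> X"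
  shows "Vs (sg (p, q, 0)) (p, q, 0) \<inter> Vs (sg (q, p, 0)) (q, p, 0) = {0}"
proof -
  have b: "p \<in> bdry" "q \<in> bdry" "p \<noteq> q" using pq unfolding mem_X by auto
  have qp: "(q, p, 0) \<in> X" using b unfolding mem_X by auto
  have "Vs (sg (p, q, 0)) (p, q, 0) \<inter> Vs (sg (q, p, 0)) (q, p, 0) \<subseteq> {0}"
  proof (cases "\<exists>r\<in>bdry. r \<noteq> p \<and> r \<noteq> q")
    case True
    then show ?thesis using E_transverse_third[OF pq] by blast
  next
    case False
    \<comment> \<open>The boundary consists of \<open>p\<close> and \<open>q\<close> only, so they
      are the fixed points of any loxodromic element.\<close>
    obtain g where g: "loxodromic g" by (rule loxodromic_exists[OF boundary_infinite_carrier[OF b(1)]])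
    have "att g \<in> {p, q}" "rep g \<in> {p, q}" "att g \<noteq> rep g"
      using loxodromic_boundary(2-4)[OF g] False by auto
    then consider "p = att g" "q = rep g" | "q = att g" "p = rep g" by blast
    then show ?thesis
    proof cases
      case 1 then show ?thesis by (rule E_transverse_loxodromic[OF g])
    next
      case 2 then show ?thesis using E_transverse_loxodromic[OF g] by blast
    qed
  qed
  moreover have "0 \<in> Vs (sg (p, q, 0)) (p, q, 0)" "0 \<in> Vs (sg (q, p, 0)) (q, p, 0)"
    using subspaces(3)[OF pq sg_cases(1)] subspaces(3)[OF qp sg_cases(1)] by (auto intro: subspace_0)
  ultimately show ?thesis by blast
qed

end

section \<open>The invariant Lagrangian subspaces\<close>

lemma dim_V_model:
  assumes e: "eps \<in> {1, -1}"
  shows "dim (V_model eps :: 'm::finite nvec set) = CARD('m option)"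
proof -
  define f :: "real^('m option) \<Rightarrow> 'm nvec"
    where "f v = (\<chi> i. case i of Inl j \<Rightarrow> v $ j | Inr j \<Rightarrow> (case j of None \<Rightarrow> eps * v $ j | Some _ \<Rightarrow> v $ j))" for v
  have lin: "linear f"
    by (rule linearI) (auto simp: f_def vec_eq_iff algebra_simps split: sum.split option.split)
  have nth: "f v $ Inl j = v $ j" for v j unfolding f_def by simp
  have "inj f" by (rule injI) (metis nth vec_eq_iff)
  have "range f = V_model eps"
  proof (intro antisym subsetI)
    fix z :: "'m nvec" assume z: "z \<in> V_model eps"
    have "z = f (\<chi> j. z $ Inl j)" using z unfolding vec_eq_option V_model_def f_def by simp
    then show "z \<in> range f" by blast
  qed (auto simp: V_model_def f_def)
  then show ?thesis using dim_image_eq[OF lin, of UNIV] \<open>inj f\<close> by simp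
qed

context SO_proper
begin

text \<open>An auxiliary backward end for reading off the sign at \<open>p\<close>; by
  \<open>sg_independent\<close> the choice is immaterial.\<close>

definition other :: "'g boundary_point \<Rightarrow> 'g boundary_point" where
  "other p = (SOME q. q \<in> bdry \<and> q \<noteq> p)"

lemma other: assumes "p \<in> bdry" shows "other p \<in> bdry" "other p \<noteq> p"
proof -
  have "\<exists>q. q \<in> bdry \<and> q \<noteq> p" by (rule boundary_other_point[OF assms]) blast
  from someI_ex[OF this] show "other p \<in> bdry" "other p \<noteq> p" unfolding other_def by auto
qed

lemma other_mem: "p \<in> bdry \<Longrightarrow> (p, other p, 0) \<in> X"
  unfolding mem_X using other[of p] by metis

definition bsg :: "'g boundary_point \<Rightarrow> real" where "bsg p = sg (p, other p, 0)"
definition E :: "'g boundary_point \<Rightarrow> 'm nvec set" where "E p = V_plus (bsg p) (\<xi> p)"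

lemma bsg_cases [simp]: "bsg p \<in> {1, -1}" "- bsg p \<in> {1, -1}"
  unfolding bsg_def by (rule sg_cases)+

lemma bsg_eq: "x \<in> X \<Longrightarrow> bsg (fst x) = sg x"
  unfolding bsg_def by (rule sg_independent) (auto simp: other_mem mem_boundary(1))

lemma Vs_E: "x \<in> X \<Longrightarrow> Vs (sg x) x = E (fst x)"
  unfolding E_def Vs_def by (simp add: bsg_eq)

lemma E_frame:
  assumes "h \<in> SO0_nn" "\<xi> p = translate h P_plus" shows "E p = (*v) h ` V_model (bsg p)"
  unfolding E_def assms(2) by (rule frame_V_plus) (use bsg_cases(1)[of p] in auto)

lemma E_properties:
  assumes p: "p \<in> bdry"
  shows "subspace (E p)" "dim (E p) = CARD('m option)" "\<And>e e'. e \<in> E p \<Longrightarrow> e' \<in> E p \<Longrightarrow> hf e e' = 0"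
proof -
  obtain h where h: "h \<in> SO0_nn" "\<xi> p = translate h P_plus" using xi_coset[OF p] by blast
  note Ep = E_frame[OF h]
  show "subspace (E p)" unfolding Ep by (intro linear_subspace_image matrix_vector_mul_linear subspace_V_model)
  show "dim (E p) = CARD('m option)" unfolding Ep dim_image_invertible[OF SO0_invertible[OF h(1)]] by (rule dim_V_model[OF bsg_cases(1)])
  fix e e' assume "e \<in> E p" "e' \<in> E p"
  then obtain u u' where "e = h *v u" "e' = h *v u'" "u \<in> V_model (bsg p)" "u' \<in> V_model (bsg p)" unfolding Ep by blast
  then show "hf e e' = 0" using hf_V_V[of "bsg p" u u'] SO0_isometry[OF h(1)] bsg_cases(1)[of p] unfolding isometry_def by auto
qed

lemma E_complementary:
  assumes "p \<in> bdry" "q \<in> bdry" "p \<noteq> q" shows "complementary (E p) (E q)"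
proof -
  have X: "(p, q, 0) \<in> X" "(q, p, 0) \<in> X" using assms unfolding mem_X by auto
  have "E p \<inter> E q = {0}" using E_transverse[OF X(1)] Vs_E[OF X(1)] Vs_E[OF X(2)] by simp
  then show ?thesis unfolding complementary_def using E_properties assms by (simp add: card_sum)
qed

lemma complementary_E: "x \<in> X \<Longrightarrow> complementary (E (fst x)) (E (fst (snd x)))"
  using E_complementary mem_boundary by metis

lemma E_equivariant:
  assumes g: "g \<in> G" and p: "p \<in> bdry"
  shows "E (bact g p) = (*v) (\<rho> g) ` E p"
proof -
  have x: "(p, other p, 0) \<in> X" by (rule other_mem[OF p])
  have "bsg (bact g p) = sg (act g (p, other p, 0))"
    using bsg_eq[OF act_closed[OF g x]] act_fst(1)[OF g x] by simp
  then have "bsg (bact g p) = bsg p" unfolding sg_act[OF g x] bsg_def .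
  then show ?thesis unfolding E_def xi_equiv[OF g p] orbit_sp_equivariant by simp
qed

lemma E_contract:
  "\<exists>K>0. \<exists>\<kappa>>0. \<forall>x\<in>X. \<forall>v\<in>E (fst x). \<forall>t\<ge>0. nrm (flow t x) v \<le> K * exp (- \<kappa> * t) * nrm x v"
  using sg_contract by (metis Vs_E)

text \<open>The time \<open>T\<close> is uniform. If the signs differed along a subsequence, the
  line of sign \<open>- sg l\<close> would be halved there at time \<open>T\<close> but doubled over
  \<open>l\<close>, against continuity of the norms.\<close>

lemma sg_limit:
  assumes x: "\<And>k. x k \<in> X" "flim x l" shows "\<forall>\<^sub>F k in sequentially. sg (x k) = sg l"
proof (rule ccontr)
  assume "\<not> ?thesis"
  then have "\<exists>\<^sub>F k in sequentially. sg (x k) \<noteq> sg l" by (simp add: frequently_def)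
  then have inf: "infinite {k. sg (x k) \<noteq> sg l}" unfolding cofinite_eq_sequentially[symmetric] frequently_cofinite by simp
  obtain r where r: "strict_mono (r :: nat \<Rightarrow> nat)" "\<And>k. sg (x (r k)) \<noteq> sg l" using infinite_enumerate[OF inf] by blast
  have lX: "l \<in> X" using flim_mem x(2) .
  obtain T where T: "\<And>x t. x \<in> X \<Longrightarrow> t \<ge> T \<Longrightarrow> (\<forall>a\<in>Ls (sg x) x. 2 * nrm (flow t x) a \<le> nrm x a) \<and> (\<forall>b\<in>Ls (- sg x) x. 2 * nrm x b \<le> nrm (flow t x) b)"
    using contracted_half by blast
  obtain z where z: "z \<in> Ls (- sg l) l" "z \<noteq> 0" using null_line_nonzero[OF lX sg_cases(2)] .
  have xr: "x (r k) \<in> X" for k by (rule x(1))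
  obtain s Z where s: "strict_mono (s :: nat \<Rightarrow> nat)" "Z \<longlonglongrightarrow> z" "\<And>k. Z k \<in> Ls (- sg l) (x (r (s k)))"
    by (rule Ls_approx[OF xr flim_subseq[OF x(2) r(1)] sg_cases(2) z(1)]) (rule that)
  have lim: "flim (\<lambda>k. x (r (s k))) l" using flim_subseq[OF flim_subseq[OF x(2) r(1)] s(1)] .
  have l1: "(\<lambda>k. nrm (x (r (s k))) (Z k)) \<longlonglongrightarrow> nrm l z" by (rule nv.anorm_flim[OF x(1) lim s(2)])
  have fX: "flow T (x (r (s k))) \<in> X" for k using x(1) by simp
  have l2: "(\<lambda>k. 2 * nrm (flow T (x (r (s k)))) (Z k)) \<longlonglongrightarrow> 2 * nrm (flow T l) z"
    by (intro tendsto_mult_left nv.anorm_flim[OF fX flim_flow[OF x(1) lim tendsto_const] s(2)])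
  have "sg (x (r k)) = - sg l" for k using r(2)[of k] sg_cases(1)[of l] sg_cases(1)[of "x (r k)"] by auto
  then have "2 * nrm (flow T (x (r (s k)))) (Z k) \<le> nrm (x (r (s k))) (Z k)" for k
    using T[OF x(1) order_refl, of "r (s k)"] s(3)[of k] by auto
  then have "2 * nrm (flow T l) z \<le> nrm l z" using LIMSEQ_le[OF l2 l1] by blast
  moreover have "2 * nrm l z \<le> nrm (flow T l) z" using T[OF lX order_refl] z by blast
  moreover have "0 < nrm l z" using nrm_pos[OF lX z(2)] .
  ultimately show False by linarith
qed

text \<open>All signs are read with the fixed backward end \<open>other l\<close>; the finitely many
  \<open>p k\<close> equal to it are replaced by \<open>l\<close>.\<close>

lemma bsg_limit:
  assumes p: "\<And>k. p k \<in> bdry" "blim p l" "l \<in> bdry"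
  shows "\<forall>\<^sub>F k in sequentially. bsg (p k) = bsg l"
proof -
  define q where "q = other l"
  have q: "q \<in> bdry" "q \<noteq> l" unfolding q_def using other[OF p(3)] by auto
  have "\<forall>\<^sub>F k in sequentially. p k \<in> bdry - {q}"
    using p(2) openin_boundary_minus_point[OF q(1)] p(3) q(2) unfolding limitin_def by blast
  then have ev: "\<forall>\<^sub>F k in sequentially. p k \<noteq> q" by eventually_elim blast
  define p' where "p' k = (if p k = q then l else p k)" for k
  have p': "p' k \<in> bdry" "p' k \<noteq> q" for k unfolding p'_def using p q by auto
  have evp: "\<forall>\<^sub>F k in sequentially. p k = p' k" using ev by eventually_elim (simp add: p'_def)
  have lim: "blim p' l" by (rule limitin_transform_eventually[OF evp p(2)])
  have X: "(p' k, q, 0) \<in> X" for k using p' q(1) unfolding mem_X by blast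
  have lX: "(l, q, 0) \<in> X" using p(3) q unfolding mem_X by auto
  have "flim (\<lambda>k. (p' k, q, 0)) (l, q, 0)" unfolding flim_iff[OF X lX] using lim q(1) by (simp add: limitin_const_iff)
  then have "\<forall>\<^sub>F k in sequentially. sg (p' k, q, 0) = sg (l, q, 0)" by (rule sg_limit[OF X])
  then show ?thesis using evp
  proof eventually_elim
    case (elim k)
    then show ?case using bsg_eq[OF X, of k] bsg_eq[OF lX] by simp
  qed
qed

end

locale SO_proper_target = SO_proper \<Gamma> S \<delta> act d \<rho> \<xi> \<eta> N C c
  for \<Gamma> :: "'g monoid" (structure) and S \<delta> act d and \<rho> :: "'g \<Rightarrow> 'm::finite nmat" and \<xi> \<eta> N C c +
  fixes V V' :: "'m nvec set"
  assumes VV': "complementary V V'" and dims: "dim V = CARD('m option)" "dim V' = CARD('m option)"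
begin

lemma SL_invertible: "g \<in> SL \<Longrightarrow> invertible g"
  using matrix_subgroupD(3)[OF matrix_subgroup_SL] .

lemma E_pair_image:
  assumes "p \<in> bdry" "q \<in> bdry" "p \<noteq> q"
  obtains h where "h \<in> SL" "(*v) h ` V = E p" "(*v) h ` V' = E q"
proof -
  have "dim (E p) = dim V" using E_properties(2)[OF assms(1)] dims(1) by simp
  then show ?thesis using complementary_SL[OF VV' E_complementary[OF assms]] that by metis
qed

lemma E_image:
  assumes "p \<in> bdry" and U: "U = V \<or> U = V'"
  obtains h where "h \<in> SL" "(*v) h ` U = E p"
  using U
proof
  assume "U = V"
  then show ?thesis using E_pair_image[OF assms(1) other(1)[OF assms(1)] other(2)[OF assms(1), symmetric]] that by metis
next
  assume "U = V'"
  then show ?thesis using E_pair_image[OF other(1)[OF assms(1)] assms(1) other(2)[OF assms(1)]] that by metis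
qed

text \<open>Where the sign agrees with that at \<open>l\<close>, a convergent lift of
  \<open>\<xi>\<close> carries \<open>E l\<close> to \<open>E (p k)\<close>. The finitely many other
  indices take an arbitrary frame.\<close>

lemma E_lift:
  assumes p: "\<And>k. p k \<in> bdry" "blim p l" "l \<in> bdry"
    and U: "U = V \<or> U = V'" and h: "h \<in> SL" "(*v) h ` U = E l"
  obtains g where "g \<longlonglongrightarrow> h" "\<And>k. g k \<in> SL" "\<And>k. (*v) (g k) ` U = E (p k)"
proof -
  obtain a where a: "a \<in> SO0_nn" "\<xi> l = translate a P_plus" using xi_coset[OF p(3)] by blast
  obtain b where b: "b \<longlonglongrightarrow> a" "\<And>k. b k \<in> SO0_nn" "\<And>k. \<xi> (p k) = translate (b k) P_plus"
    by (rule xi_lift[OF p(1,2) a]) (rule that)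
  have SL: "u \<in> SL" if "u \<in> SO0_nn" for u :: "'m nmat" using SO0_subset_SL that by blast
  have "\<forall>k. \<exists>u. u \<in> SL \<and> (*v) u ` U = E (p k)" using E_image[OF p(1) U] by metis
  then obtain f where f: "\<And>k. f k \<in> SL" "\<And>k. (*v) (f k) ` U = E (p k)" by metis
  define m where "m k = b k ** (matrix_inv a ** h)" for k
  have "m \<longlonglongrightarrow> a ** (matrix_inv a ** h)" unfolding m_def by (intro tendsto_intros b)
  then have mh: "m \<longlonglongrightarrow> h" using matrix_inv_mult(1)[OF SO0_invertible[OF a(1)]] by (simp add: matrix_mul_assoc)
  define g where "g k = (if bsg (p k) = bsg l then m k else f k)" for k
  have ev: "\<forall>\<^sub>F k in sequentially. m k = g k" using bsg_limit[OF p] by eventually_elim (simp add: g_def)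
  have mSL: "m k \<in> SL" for k unfolding m_def
    using matrix_subgroupD(2)[OF matrix_subgroup_SL] matrix_subgroupD(4)[OF matrix_subgroup_SL] SL b(2) a(1) h(1) by metis
  have mE: "(*v) (m k) ` U = E (p k)" if "bsg (p k) = bsg l" for k
  proof -
    have "(*v) (m k) ` U = (*v) (b k) ` ((*v) (matrix_inv a) ` ((*v) h ` U))"
      unfolding m_def by (simp add: image_image matrix_vector_mul_assoc)
    also have "\<dots> = (*v) (b k) ` ((*v) (matrix_inv a) ` ((*v) a ` V_model (bsg l)))" unfolding h(2) E_frame[OF a] ..
    also have "\<dots> = (*v) (b k) ` V_model (bsg l)"
      using matrix_inv_mult(4)[OF SO0_invertible[OF a(1)]] by (simp add: image_image)
    finally show ?thesis unfolding E_frame[OF b(2,3)] that .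
  qed
  show ?thesis
  proof (rule that[of g])
    show "g \<longlonglongrightarrow> h" by (rule Lim_transform_eventually[OF mh ev])
    show "g k \<in> SL" "(*v) (g k) ` U = E (p k)" for k unfolding g_def using mSL mE f by auto
  qed
qed

definition proj :: "'g flow_point \<Rightarrow> 'm nmat" where
  "proj x = projection (E (fst x)) (E (fst (snd x)))"
definition coproj :: "'g flow_point \<Rightarrow> 'm nmat" where
  "coproj x = projection (E (fst (snd x))) (E (fst x))"

lemma proj_simps:
  assumes x: "x \<in> X"
  shows "proj x *v v \<in> E (fst x)" "coproj x *v v \<in> E (fst (snd x))" "proj x + coproj x = mat 1"
    "e \<in> E (fst x) \<Longrightarrow> proj x *v e = e" "e \<in> E (fst x) \<Longrightarrow> coproj x *v e = 0"
    "f \<in> E (fst (snd x)) \<Longrightarrow> coproj x *v f = f" "f \<in> E (fst (snd x)) \<Longrightarrow> proj x *v f = 0"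
  unfolding proj_def coproj_def
  using projection[OF complementary_E[OF x]] projection(1)[OF complementary_sym[OF complementary_E[OF x]]]
    projection_sum[OF complementary_E[OF x]] complementary_E[OF x] complementary_sym[OF complementary_E[OF x]] by auto

lemma flow_proj [simp]: "proj (flow t x) = proj x" "coproj (flow t x) = coproj x"
  unfolding proj_def coproj_def by simp_all

lemma act_proj:
  assumes g: "g \<in> G" and x: "x \<in> X"
  shows "proj (act g x) = \<rho> g ** proj x ** matrix_inv (\<rho> g)" "coproj (act g x) = \<rho> g ** coproj x ** matrix_inv (\<rho> g)"
  unfolding proj_def coproj_def act_fst[OF g x] E_equivariant[OF g mem_boundary(1)[OF x]] E_equivariant[OF g mem_boundary(2)[OF x]]
  by (rule projection_image[OF _ rho_invertible[OF g]]; rule complementary_E[OF x] complementary_sym[OF complementary_E[OF x]])+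

lemma proj_flim:
  assumes x: "\<And>k. x k \<in> X" "flim x l" shows "(\<lambda>k. proj (x k)) \<longlonglongrightarrow> proj l" "(\<lambda>k. coproj (x k)) \<longlonglongrightarrow> coproj l"
proof -
  have lX: "l \<in> X" using flim_mem x(2) .
  obtain h where h: "h \<in> SL" "(*v) h ` V = E (fst l)" "(*v) h ` V' = E (fst (snd l))"
    by (rule E_pair_image[OF mem_boundary(1,2)[OF lX] mem_boundary(3)[OF lX, symmetric]])
  obtain g where g: "g \<longlonglongrightarrow> h" "\<And>k. g k \<in> SL" "\<And>k. (*v) (g k) ` V = E (fst (x k))"
    by (rule E_lift[OF mem_boundary(1)[OF x(1)] flim_boundary(1)[OF x] mem_boundary(1)[OF lX] disjI1[OF refl] h(1,2)]) (rule that)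
  obtain g' where g': "g' \<longlonglongrightarrow> h" "\<And>k. g' k \<in> SL" "\<And>k. (*v) (g' k) ` V' = E (fst (snd (x k)))"
    by (rule E_lift[OF mem_boundary(2)[OF x(1)] flim_boundary(2)[OF x] mem_boundary(2)[OF lX] disjI2[OF refl] h(1,3)]) (rule that)
  have "(\<lambda>k. projection ((*v) (g k) ` V) ((*v) (g' k) ` V')) \<longlonglongrightarrow> projection ((*v) h ` V) ((*v) h ` V')"
  proof (rule tendsto_projection[OF VV' g(1) g'(1)])
    show "invertible (g k)" "invertible (g' k)" "invertible h" "invertible h" for k using SL_invertible g(2) g'(2) h(1) by blast+
    show "(*v) (g k) ` V \<inter> (*v) (g' k) ` V' = {0}" for k
      unfolding g(3) g'(3) using complementary_E[OF x(1)] unfolding complementary_def by blast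
    show "(*v) h ` V \<inter> (*v) h ` V' = {0}"
      unfolding h(2,3) using complementary_E[OF lX] unfolding complementary_def by blast
  qed
  then show 1: "(\<lambda>k. proj (x k)) \<longlonglongrightarrow> proj l" unfolding g g' h proj_def .
  have "coproj y = mat 1 - proj y" if "y \<in> X" for y using proj_simps(3)[OF that] by (simp add: eq_diff_eq add.commute)
  then show "(\<lambda>k. coproj (x k)) \<longlonglongrightarrow> coproj l" using x(1) lX by (simp add: tendsto_diff 1)
qed

end

lemma continuous_map_sequential:
  fixes f :: "'a \<Rightarrow> real"
  assumes T: "metrizable_space T"
    and f: "\<And>s l. \<lbrakk>\<And>k. s k \<in> topspace T; limitin T s l sequentially\<rbrakk> \<Longrightarrow> (\<lambda>k::nat. f (s k)) \<longlonglongrightarrow> f l"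
  shows "continuous_map T euclideanreal f"
proof -
  obtain M d where d: "Metric_space M d" "T = Metric_space.mtopology M d" using T unfolding metrizable_space_def by blast
  interpret Metric_space M d by (rule d(1))
  have "closedin T {x \<in> topspace T. f x \<in> A}" if A: "closed A" for A
    unfolding d(2) metric_closedin_iff_sequentially_closed
  proof (intro conjI allI impI)
    fix s l assume h: "range s \<subseteq> {x \<in> topspace mtopology. f x \<in> A} \<and> limitin mtopology s l sequentially"
    then have s: "\<And>k. s k \<in> topspace T" "\<And>k. f (s k) \<in> A" "limitin T s l sequentially" unfolding d(2) by auto
    have "f l \<in> A" using closed_sequentially[OF A, of "\<lambda>k. f (s k)"] f[OF s(1,3)] s(2) by blast
    then show "l \<in> {x \<in> topspace mtopology. f x \<in> A}" using limitin_topspace h by fastforce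
  qed auto
  then show ?thesis by (simp add: continuous_map_closedin)
qed

lemma matrix_norm_le:
  fixes A :: "'k::finite matrix"
  assumes b: "\<And>v. norm (A *v v) \<le> b * norm v"
  shows "norm A \<le> real (CARD('k) * CARD('k)) * b"
proof -
  have e: "\<bar>A $ i $ j\<bar> \<le> b" for i j
  proof -
    have "A $ i $ j = (A *v axis j 1) $ i" by (simp add: matrix_vector_mult_basis column_def)
    then have "\<bar>A $ i $ j\<bar> \<le> norm (A *v axis j 1)" using component_le_norm_cart by metis
    then show ?thesis using b[of "axis j 1"] by simp
  qed
  have "norm (A $ i) \<le> real CARD('k) * b" for i
    using norm_le_l1_cart[of "A $ i"] sum_bounded_above[of UNIV "\<lambda>j. \<bar>A $ i $ j\<bar>" b] e by force
  then have "(\<Sum>i\<in>UNIV. norm (A $ i)) \<le> real CARD('k) * (real CARD('k) * b)"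
    using sum_bounded_above[of UNIV "\<lambda>i. norm (A $ i)"] by force
  moreover have "norm A \<le> (\<Sum>i\<in>UNIV. norm (A $ i))" unfolding norm_vec_def by (intro L2_set_le_sum) simp
  ultimately show ?thesis by (simp add: mult.assoc)
qed

section \<open>Operator norms and contraction of the off-diagonal blocks\<close>

context SO_proper_target
begin

lemma linear_sandwich: "linear (\<lambda>A. P ** A ** Q :: 'k::finite matrix)"
  by (rule bounded_linear.linear) (intro bounded_linear_compose[OF bounded_bilinear.bounded_linear_left[OF bounded_bilinear_matrix_matrix] bounded_bilinear.bounded_linear_right[OF bounded_bilinear_matrix_matrix]])

lemma linear_Ad: "linear (Ad g)"
  using linear_sandwich unfolding Ad_def .

sublocale nm: averaging \<Gamma> S \<delta> act d "\<lambda>g. Ad (\<rho> g)"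
  by unfold_locales (simp_all add: linear_add[OF linear_Ad] linear_scale[OF linear_Ad] rho_mult Ad_mult rho_invertible rho_one)

abbreviation "mnrm \<equiv> nm.anorm"

lemma core_matrix:
  assumes x: "x \<in> X"
  obtains g y where "g \<in> G" "y \<in> core" "y \<in> X" "\<And>v. nrm x v = nrm y (\<rho> (inv g) *v v)"
    "\<And>A. mnrm x A = mnrm y (Ad (\<rho> (inv g)) A)" "\<And>A v. Ad (\<rho> (inv g)) A *v (\<rho> (inv g) *v v) = \<rho> (inv g) *v (A *v v)"
proof -
  obtain g y where g: "g \<in> G" "y \<in> core" "y \<in> X" "x = act g y" "\<And>v. nrm x v = nrm y (\<rho> (inv g) *v v)"
    by (rule core_rep[OF x]) (rule that)
  have m: "mnrm x A = mnrm y (Ad (\<rho> (inv g)) A)" for A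
    using nm.anorm_equivariant[of "inv g" x A] g(1,3) x unfolding g(4) by simp
  have "Ad (\<rho> (inv g)) A *v (\<rho> (inv g) *v v) = \<rho> (inv g) *v (A *v v)" for A v
    unfolding Ad_def using matrix_inv_mult(4)[OF rho_invertible[of "inv g"]] g(1) by (simp flip: matrix_vector_mul_assoc)
  then show ?thesis using that[OF g(1-3,5) m] by blast
qed

text \<open>Over \<open>core\<close> all norms are comparable to the standard ones; conjugation by
  the representation carries the bound to \<open>X\<close>.\<close>

lemma operator_bound: "\<exists>K>0. \<forall>x\<in>X. \<forall>A v. nrm x (A *v v) \<le> K * mnrm x A * nrm x v"
proof -
  obtain B where B: "B > 0" "\<And>y v. y \<in> core \<Longrightarrow> norm v \<le> B * nrm y v \<and> nrm y v \<le> B * norm v" by (rule core_norm) (rule that)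
  obtain D where D: "D > 0" "\<And>y v. y \<in> core \<Longrightarrow> norm v \<le> D * mnrm y v \<and> mnrm y v \<le> D * norm v" using nm.anorm_core by blast
  obtain L where L: "0 < L" "\<And>(A :: 'm nmat) v. norm (A *v v) \<le> L * norm A * norm v"
    by (rule matrix_vector_norm_bound) (rule that)
  show ?thesis
  proof (intro exI[of _ "B * (L * D * B)"] conjI ballI allI)
    show "0 < B * (L * D * B)" using B D L by simp
    fix x A v assume x: "x \<in> X"
    obtain g y where g: "g \<in> G" "y \<in> core" "y \<in> X" "\<And>v. nrm x v = nrm y (\<rho> (inv g) *v v)"
      "\<And>A. mnrm x A = mnrm y (Ad (\<rho> (inv g)) A)" "\<And>A v. Ad (\<rho> (inv g)) A *v (\<rho> (inv g) *v v) = \<rho> (inv g) *v (A *v v)"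
      by (rule core_matrix[OF x]) (rule that)
    define A' v' where "A' = Ad (\<rho> (inv g)) A" and "v' = \<rho> (inv g) *v v"
    have "nrm y (A' *v v') \<le> B * (L * norm A' * norm v')"
      using B(2)[OF g(2), of "A' *v v'"] mult_left_mono[OF L(2)[of A' v'] less_imp_le[OF B(1)]] by linarith
    also have "\<dots> \<le> B * (L * (D * mnrm y A') * (B * nrm y v'))"
      using B(2)[OF g(2)] D(2)[OF g(2)] B(1) L(1) D(1) by (intro mult_left_mono mult_mono) auto
    finally show "nrm x (A *v v) \<le> B * (L * D * B) * mnrm x A * nrm x v"
      unfolding g(4,5) A'_def v'_def g(6) by (simp add: mult_ac)
  qed
qed

lemma operator_bound_converse:
  "\<exists>K>0. \<forall>x\<in>X. \<forall>A b. 0 \<le> b \<longrightarrow> (\<forall>v. nrm x (A *v v) \<le> b * nrm x v) \<longrightarrow> mnrm x A \<le> K * b"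
proof -
  obtain B where B: "B > 0" "\<And>y v. y \<in> core \<Longrightarrow> norm v \<le> B * nrm y v \<and> nrm y v \<le> B * norm v" by (rule core_norm) (rule that)
  obtain D where D: "D > 0" "\<And>y v. y \<in> core \<Longrightarrow> norm v \<le> D * mnrm y v \<and> mnrm y v \<le> D * norm v" using nm.anorm_core by blast
  define n where "n = real (CARD('m option + 'm option) * CARD('m option + 'm option))"
  have n: "0 < n" unfolding n_def by (simp only: of_nat_0_less_iff nat_0_less_mult_iff zero_less_card_finite simp_thms)
  show ?thesis
  proof (intro exI[of _ "D * (n * (B * B))"] conjI ballI allI impI)
    show "0 < D * (n * (B * B))" using B D n by simp
    fix x and A :: "'m nmat" and b assume x: "x \<in> X" and b: "0 \<le> b" "\<forall>v. nrm x (A *v v) \<le> b * nrm x v"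
    obtain g y where g: "g \<in> G" "y \<in> core" "y \<in> X" "\<And>v. nrm x v = nrm y (\<rho> (inv g) *v v)"
      "\<And>A. mnrm x A = mnrm y (Ad (\<rho> (inv g)) A)" "\<And>A v. Ad (\<rho> (inv g)) A *v (\<rho> (inv g) *v v) = \<rho> (inv g) *v (A *v v)"
      by (rule core_matrix[OF x]) (rule that)
    define A' where "A' = Ad (\<rho> (inv g)) A"
    have le: "norm (A' *v v) \<le> B * B * b * norm v" for v
    proof -
      have v: "v = \<rho> (inv g) *v (\<rho> g *v v)" using g(1) by simp
      have "A' *v v = \<rho> (inv g) *v (A *v (\<rho> g *v v))" unfolding A'_def by (subst v) (rule g(6))
      then have "nrm y (A' *v v) \<le> b * nrm y v" using b(2)[rule_format, of "\<rho> g *v v"] unfolding g(4) v[symmetric] by simp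
      also have "\<dots> \<le> b * (B * norm v)" using B(2)[OF g(2)] b(1) by (intro mult_left_mono) auto
      finally have "B * nrm y (A' *v v) \<le> B * (b * (B * norm v))" using B(1) by simp
      then show ?thesis using B(2)[OF g(2), of "A' *v v"] by (simp add: mult_ac)
    qed
    have "norm A' \<le> n * (B * B * b)" unfolding n_def by (rule matrix_norm_le[OF le])
    then have "D * norm A' \<le> D * (n * (B * B * b))" using D(1) by simp
    then show "mnrm x A \<le> D * (n * (B * B)) * b"
      using D(2)[OF g(2), of A'] unfolding g(5) A'_def by (simp add: mult_ac)
  qed
qed

lemma act_proj_Ad:
  assumes "g \<in> G" "x \<in> X" shows "proj (act g x) = Ad (\<rho> g) (proj x)" "coproj (act g x) = Ad (\<rho> g) (coproj x)"
  unfolding act_proj[OF assms] Ad_def by simp_all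

lemma proj_bound:
  "\<exists>K>0. \<forall>x\<in>X. \<forall>v. nrm x (proj x *v v) \<le> K * nrm x v \<and> nrm x (coproj x *v v) \<le> K * nrm x v"
proof -
  have "\<exists>K>0. \<forall>x\<in>core. \<forall>v\<in>{0::real}. True \<longrightarrow> mnrm x (proj x) + mnrm x (coproj x) \<le> K"
    by (rule core_bound) (auto intro!: tendsto_intros nm.anorm_flim proj_flim)
  then obtain M where M: "M > 0" "\<And>x. x \<in> core \<Longrightarrow> mnrm x (proj x) + mnrm x (coproj x) \<le> M" by auto
  have le: "mnrm x (proj x) \<le> M \<and> mnrm x (coproj x) \<le> M" if x: "x \<in> X" for x
  proof -
    obtain g where g: "g \<in> G" "act (inv g) x \<in> core" using to_core[OF x] .
    have "mnrm x (proj x) + mnrm x (coproj x) \<le> M"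
      using M(2)[OF g(2)] act_proj_Ad[of "inv g" x] nm.anorm_equivariant[of "inv g" x] g(1) x by simp
    then show ?thesis using nm.anorm_nonneg[of x "proj x"] nm.anorm_nonneg[of x "coproj x"] by linarith
  qed
  obtain U where U: "U > 0" "\<And>x A v. x \<in> X \<Longrightarrow> nrm x (A *v v) \<le> U * mnrm x A * nrm x v" using operator_bound by blast
  have "nrm x (A *v v) \<le> U * M * nrm x v" if "x \<in> X" "mnrm x A \<le> M" for x A v
    using order_trans[OF U(2)[OF that(1)] mult_right_mono[OF mult_left_mono[OF that(2)]]] U(1) by simp
  then show ?thesis using le U(1) M(1) by (intro exI[of _ "U * M"]) simp
qed

text \<open>The form puts complementary Lagrangians in duality: as it vanishes on the second, the
  component of \<open>I_nn *v u\<close> in the first pairs with \<open>u\<close> exactly as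
  \<open>I_nn *v u\<close> does.\<close>

lemma E_dual:
  "\<exists>D>0. \<forall>x\<in>X. \<forall>f\<in>E (fst (snd x)). f \<noteq> 0 \<longrightarrow> (\<exists>e\<in>E (fst x). e \<noteq> 0 \<and> nrm x e * nrm x f \<le> D * \<bar>hf e f\<bar>)"
proof -
  obtain K where K: "K > 0" "\<And>x v. x \<in> X \<Longrightarrow> nrm x (proj x *v v) \<le> K * nrm x v" using proj_bound by blast
  obtain B where B: "B > 0" "\<And>y v. y \<in> core \<Longrightarrow> norm v \<le> B * nrm y v \<and> nrm y v \<le> B * norm v" by (rule core_norm) (rule that)
  show ?thesis
  proof (intro exI[of _ "K * B * B"] conjI ballI impI)
    show "0 < K * B * B" using K B by simp
    fix x f assume x: "x \<in> X" and f: "f \<in> E (fst (snd x))" "f \<noteq> 0"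
    obtain g y where g: "g \<in> G" "y \<in> core" "y \<in> X" "x = act g y" "\<And>v. nrm x v = nrm y (\<rho> (inv g) *v v)"
      by (rule core_rep[OF x]) (rule that)
    have Ex: "E (fst x) = (*v) (\<rho> g) ` E (fst y)" "E (fst (snd x)) = (*v) (\<rho> g) ` E (fst (snd y))"
      unfolding g(4) act_fst[OF g(1,3)] using E_equivariant[OF g(1)] mem_boundary[OF g(3)] by auto
    obtain u where u: "u \<in> E (fst (snd y))" "f = \<rho> g *v u" using f(1) unfolding Ex by blast
    have u0: "u \<noteq> 0" using f(2) u(2) by auto
    define e where "e = proj y *v (I_nn *v u)"
    have eE: "e \<in> E (fst y)" unfolding e_def by (rule proj_simps(1)[OF g(3)])
    have "I_nn *v u = (proj y + coproj y) *v (I_nn *v u)" unfolding proj_simps(3)[OF g(3)] by simp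
    then have "I_nn *v u = e + coproj y *v (I_nn *v u)" unfolding e_def by (simp add: matrix_vector_mult_add_rdistrib)
    moreover have "hf (coproj y *v (I_nn *v u)) u = 0"
      by (rule E_properties(3)[OF mem_boundary(2)[OF g(3)] proj_simps(2)[OF g(3)] u(1)])
    ultimately have "hf e u = hf (I_nn *v u) u" by (metis add.right_neutral bounded_bilinear.add_left[OF bounded_bilinear_hf])
    then have hu: "hf e u = norm u * norm u" unfolding hf_sym[of "I_nn *v u"] by (simp add: power2_norm_eq_inner flip: power2_eq_square)
    have "nrm y e \<le> K * (B * norm u)"
      unfolding e_def using K(2)[OF g(3), of "I_nn *v u"] B(2)[OF g(2), of "I_nn *v u"] K(1) unfolding norm_I_nn by (meson mult_left_mono order_less_imp_le order_trans)
    then have "nrm y e * nrm y u \<le> (K * (B * norm u)) * (B * norm u)"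
      using B(2)[OF g(2), of u] K(1) B(1) by (intro mult_mono) auto
    then have le: "nrm y e * nrm y u \<le> K * B * B * \<bar>hf e u\<bar>" unfolding hu by (simp add: mult_ac)
    have "e \<noteq> 0" using hu u0 by (auto simp: hf_simps)
    then have "\<rho> g *v e \<noteq> 0" using rho_inv_vec(1)[OF g(1), of e] by auto
    moreover have "nrm x (\<rho> g *v e) * nrm x f \<le> K * B * B * \<bar>hf (\<rho> g *v e) f\<bar>"
      unfolding g(5) u(2) using le g(1) by simp
    ultimately show "\<exists>e\<in>E (fst x). e \<noteq> 0 \<and> nrm x e * nrm x f \<le> K * B * B * \<bar>hf e f\<bar>" using eE unfolding Ex by blast
  qed
qed

text \<open>Expansion of the second bundle follows from contraction of the first, since the pairing
  between them is constant along the flow.\<close>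

lemma E_rates:
  obtains K \<kappa> where "0 < K" "0 < \<kappa>"
    "\<And>x e t. \<lbrakk>x \<in> X; e \<in> E (fst x); 0 \<le> t\<rbrakk> \<Longrightarrow> nrm (flow t x) e \<le> K * exp (- \<kappa> * t) * nrm x e"
    "\<And>x f t. \<lbrakk>x \<in> X; f \<in> E (fst (snd x)); 0 \<le> t\<rbrakk> \<Longrightarrow> nrm x f \<le> K * exp (- \<kappa> * t) * nrm (flow t x) f"
proof -
  obtain K \<kappa> where K: "K > 0" "\<kappa> > 0" "\<And>x v t. x \<in> X \<Longrightarrow> v \<in> E (fst x) \<Longrightarrow> 0 \<le> t \<Longrightarrow> nrm (flow t x) v \<le> K * exp (- \<kappa> * t) * nrm x v"
    using E_contract by blast
  obtain D where D: "D > 0" "\<And>x f. x \<in> X \<Longrightarrow> f \<in> E (fst (snd x)) \<Longrightarrow> f \<noteq> 0 \<Longrightarrow> \<exists>e\<in>E (fst x). e \<noteq> 0 \<and> nrm x e * nrm x f \<le> D * \<bar>hf e f\<bar>"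
    using E_dual by blast
  obtain D' where D': "D' > 0" "\<And>x v w. x \<in> X \<Longrightarrow> \<bar>hf v w\<bar> \<le> D' * (nrm x v * nrm x w)" by (rule hf_bound) (rule that)
  define M where "M = K + D * D' * K"
  have DK: "0 < D * D' * K" using K(1) D(1) D'(1) by simp
  have M: "0 < M" "K \<le> M" "D * D' * K \<le> M" unfolding M_def using K(1) DK by linarith+
  have lift: "k * exp (- \<kappa> * t) * r \<le> M * exp (- \<kappa> * t) * r" if "k \<le> M" "0 \<le> r" for k r t
    using that by (intro mult_right_mono) auto
  show ?thesis
  proof (rule that[OF M(1) K(2)])
    fix x e and t :: real assume "x \<in> X" "e \<in> E (fst x)" "0 \<le> t"
    then show "nrm (flow t x) e \<le> M * exp (- \<kappa> * t) * nrm x e"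
      using K(3) lift[OF M(2) nv.anorm_nonneg[of x e], of t] order_trans by blast
  next
    fix x f and t :: real assume x: "x \<in> X" and f: "f \<in> E (fst (snd x))" and t: "0 \<le> t"
    show "nrm x f \<le> M * exp (- \<kappa> * t) * nrm (flow t x) f"
    proof (cases "f = 0")
      case True
      then show ?thesis by simp
    next
      case False
      obtain e where e: "e \<in> E (fst x)" "e \<noteq> 0" "nrm x e * nrm x f \<le> D * \<bar>hf e f\<bar>" using D(2)[OF x f False] by blast
      have "\<bar>hf e f\<bar> \<le> D' * (nrm (flow t x) e * nrm (flow t x) f)" using D'(2)[of "flow t x"] x by simp
      also have "\<dots> \<le> D' * ((K * exp (- \<kappa> * t) * nrm x e) * nrm (flow t x) f)"
        using K(3)[OF x e(1) t] D'(1) by (intro mult_left_mono mult_right_mono) auto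
      finally have "D * \<bar>hf e f\<bar> \<le> D * (D' * ((K * exp (- \<kappa> * t) * nrm x e) * nrm (flow t x) f))" using D(1) by (intro mult_left_mono) auto
      then have "nrm x e * nrm x f \<le> nrm x e * (D * D' * K * exp (- \<kappa> * t) * nrm (flow t x) f)" using e(3) by (simp add: mult_ac)
      then have "nrm x f \<le> D * D' * K * exp (- \<kappa> * t) * nrm (flow t x) f" using nrm_pos[OF x e(2)] by simp
      then show ?thesis using lift[OF M(3) nv.anorm_nonneg[of "flow t x" f], of t] by linarith
    qed
  qed
qed

text \<open>In the given direction of time each block has its values in a contracted bundle and
  factors through the projection onto an expanded one. The rate comes from the values; the factor
  from the arguments is bounded by 1.\<close>

lemma matrix_contract:
  obtains K \<kappa> where "0 < K" "0 < \<kappa>"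
    "\<And>x A t. \<lbrakk>x \<in> X; 0 \<le> t\<rbrakk> \<Longrightarrow> mnrm (flow (- t) x) (coproj x ** A ** proj x) \<le> K * exp (- \<kappa> * t) * mnrm x (coproj x ** A ** proj x)"
    "\<And>x A t. \<lbrakk>x \<in> X; 0 \<le> t\<rbrakk> \<Longrightarrow> mnrm (flow t x) (proj x ** A ** coproj x) \<le> K * exp (- \<kappa> * t) * mnrm x (proj x ** A ** coproj x)"
proof -
  obtain K \<kappa> where K: "0 < K" "0 < \<kappa>"
    "\<And>x e t. \<lbrakk>x \<in> X; e \<in> E (fst x); 0 \<le> t\<rbrakk> \<Longrightarrow> nrm (flow t x) e \<le> K * exp (- \<kappa> * t) * nrm x e"
    "\<And>x f t. \<lbrakk>x \<in> X; f \<in> E (fst (snd x)); 0 \<le> t\<rbrakk> \<Longrightarrow> nrm x f \<le> K * exp (- \<kappa> * t) * nrm (flow t x) f"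
    by (rule E_rates) (rule that)
  obtain P where P: "P > 0" "\<And>x v. x \<in> X \<Longrightarrow> nrm x (proj x *v v) \<le> P * nrm x v \<and> nrm x (coproj x *v v) \<le> P * nrm x v" using proj_bound by blast
  obtain U where U: "U > 0" "\<And>x A v. x \<in> X \<Longrightarrow> nrm x (A *v v) \<le> U * mnrm x A * nrm x v" using operator_bound by blast
  obtain L where L: "L > 0" "\<And>x A b. \<lbrakk>x \<in> X; 0 \<le> b; \<forall>v. nrm x (A *v v) \<le> b * nrm x v\<rbrakk> \<Longrightarrow> mnrm x A \<le> L * b" using operator_bound_converse by blast
  have E1: "exp (- \<kappa> * t) \<le> 1" if "0 \<le> t" for t using that K(2) by simp
  have key: "mnrm y M \<le> L * (K * U * K * P) * exp (- \<kappa> * t) * mnrm x M"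
    if xy: "x \<in> X" "y \<in> X" and t: "0 \<le> t"
      and c1: "\<And>v. nrm y (M *v v) \<le> K * exp (- \<kappa> * t) * nrm x (M *v v)"
      and p: "\<And>v. M *v v = M *v (p *v v)" "\<And>v. nrm x (p *v v) \<le> K * exp (- \<kappa> * t) * nrm y (p *v v)" "\<And>v. nrm y (p *v v) \<le> P * nrm y v"
    for x y M p t
  proof -
    have p2: "nrm x (p *v v) \<le> K * (P * nrm y v)" for v
    proof -
      have "nrm x (p *v v) \<le> K * 1 * nrm y (p *v v)"
        using p(2)[of v] mult_right_mono[OF mult_left_mono[OF E1[OF t] less_imp_le[OF K(1)]] nv.anorm_nonneg[of y "p *v v"]] by linarith
      also have "\<dots> \<le> K * 1 * (P * nrm y v)" using p(3) K(1) by (intro mult_left_mono) auto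
      finally show ?thesis by simp
    qed
    have "nrm y (M *v v) \<le> (K * exp (- \<kappa> * t) * (U * mnrm x M * (K * P))) * nrm y v" for v
    proof -
      have "nrm x (M *v v) \<le> U * mnrm x M * nrm x (p *v v)" using U(2)[OF xy(1), of M "p *v v"] p(1)[of v] by simp
      also have "\<dots> \<le> U * mnrm x M * (K * (P * nrm y v))" using p2 U(1) by (intro mult_left_mono) auto
      finally have "K * exp (- \<kappa> * t) * nrm x (M *v v) \<le> K * exp (- \<kappa> * t) * (U * mnrm x M * (K * (P * nrm y v)))"
        using K(1) by (intro mult_left_mono) auto
      then show ?thesis using c1[of v] by (simp add: mult_ac)
    qed
    then have "mnrm y M \<le> L * (K * exp (- \<kappa> * t) * (U * mnrm x M * (K * P)))"
      using K(1) U(1) P(1) by (intro L(2)[OF xy(2)]) auto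
    then show ?thesis by (simp add: mult_ac)
  qed
  show ?thesis
  proof (rule that)
    show "0 < L * (K * U * K * P)" "0 < \<kappa>" using K(1,2) U(1) P(1) L(1) by auto
    fix x A and t :: real assume x: "x \<in> X" and t: "0 \<le> t"
    have idem: "proj x *v (proj x *v v) = proj x *v v" "coproj x *v (coproj x *v v) = coproj x *v v" for v
      using proj_simps[OF x] by auto
    let ?y = "flow (- t) x"
    show "mnrm ?y (coproj x ** A ** proj x) \<le> L * (K * U * K * P) * exp (- \<kappa> * t) * mnrm x (coproj x ** A ** proj x)"
    proof (rule key[of _ _ _ _ "proj x"])
      show "nrm ?y ((coproj x ** A ** proj x) *v v) \<le> K * exp (- \<kappa> * t) * nrm x ((coproj x ** A ** proj x) *v v)" for v
        using K(4)[of ?y "(coproj x ** A ** proj x) *v v" t] x t proj_simps(2)[OF x] by (simp flip: matrix_vector_mul_assoc)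
      show "nrm x (proj x *v v) \<le> K * exp (- \<kappa> * t) * nrm ?y (proj x *v v)" for v
        using K(3)[of ?y "proj x *v v" t] x t proj_simps(1)[OF x] by simp
      show "nrm ?y (proj x *v v) \<le> P * nrm ?y v" for v using P(2)[of ?y v] x by simp
    qed (use x t idem in \<open>simp_all flip: matrix_vector_mul_assoc\<close>)
    let ?z = "flow t x"
    show "mnrm ?z (proj x ** A ** coproj x) \<le> L * (K * U * K * P) * exp (- \<kappa> * t) * mnrm x (proj x ** A ** coproj x)"
    proof (rule key[of _ _ _ _ "coproj x"])
      show "nrm ?z ((proj x ** A ** coproj x) *v v) \<le> K * exp (- \<kappa> * t) * nrm x ((proj x ** A ** coproj x) *v v)" for v
        using K(3)[OF x _ t, of "(proj x ** A ** coproj x) *v v"] proj_simps(1)[OF x] by (simp flip: matrix_vector_mul_assoc)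
      show "nrm x (coproj x *v v) \<le> K * exp (- \<kappa> * t) * nrm ?z (coproj x *v v)" for v
        using K(4)[OF x _ t, of "coproj x *v v"] proj_simps(2)[OF x] by simp
      show "nrm ?z (coproj x *v v) \<le> P * nrm ?z v" for v using P(2)[of ?z v] x by simp
    qed (use x t idem in \<open>simp_all flip: matrix_vector_mul_assoc\<close>)
  qed
qed

end

lemma lie_algebra_mono: "H \<subseteq> H' \<Longrightarrow> lie_algebra H \<subseteq> lie_algebra H'"
  unfolding lie_algebra_def by blast

lemma bilinear_linear_comp:
  assumes "bilinear B" "linear f" shows "bilinear (\<lambda>v w. B (f v) (f w))"
  using assms unfolding bilinear_def by (auto intro: linear_compose[unfolded comp_def])

lemma bilinear_add:
  assumes "bilinear B" "bilinear B'" shows "bilinear (\<lambda>v w. B v w + B' v w :: real)"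
  using assms unfolding bilinear_def by (auto intro: linear_compose_add)

section \<open>The boundary maps into flags of \<open>SL\<close> and the contracted norm\<close>

context SO_proper_target
begin

abbreviation (input) "stab \<equiv> stabilizer_subspace SL"

text \<open>Describes the coset without a representative. Both boundary maps arise from the same
  family \<open>E\<close>, with \<open>U = V\<close> for one and \<open>U = V'\<close> for the
  other.\<close>

definition coset_of :: "'m nvec set \<Rightarrow> 'g boundary_point \<Rightarrow> 'm nmat set" where
  "coset_of U p = {g \<in> SL. (*v) g ` U = E p}"

lemma coset_of_eq:
  assumes h: "h \<in> SL" "(*v) h ` U = E p"
  shows "coset_of U p = translate h (stab U)"
proof -
  note SL = matrix_subgroupD[OF matrix_subgroup_SL]
  have inv: "invertible h" by (rule SL_invertible[OF h(1)])
  have "g \<in> coset_of U p \<longleftrightarrow> matrix_inv h ** g \<in> stab U" for g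
  proof -
    have g: "h ** (matrix_inv h ** g) = g" by (simp add: matrix_mul_assoc matrix_inv_mult(1)[OF inv])
    have "g \<in> SL \<longleftrightarrow> matrix_inv h ** g \<in> SL" using SL(2)[OF SL(4)[OF h(1)], of g] SL(2)[OF h(1), of "matrix_inv h ** g"] g by auto
    moreover have "(*v) g ` U = (*v) h ` U \<longleftrightarrow> (*v) (matrix_inv h ** g) ` U = U"
    proof
      assume "(*v) g ` U = (*v) h ` U"
      then have "(*v) (matrix_inv h) ` ((*v) g ` U) = (*v) (matrix_inv h) ` ((*v) h ` U)" by simp
      then show "(*v) (matrix_inv h ** g) ` U = U" by (simp add: image_image matrix_vector_mul_assoc matrix_inv_mult(2)[OF inv])
    next
      assume "(*v) (matrix_inv h ** g) ` U = U"
      then have "(*v) h ` ((*v) (matrix_inv h ** g) ` U) = (*v) h ` U" by simp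
      then show "(*v) g ` U = (*v) h ` U" by (simp add: image_image matrix_vector_mul_assoc g)
    qed
    ultimately show ?thesis unfolding coset_of_def h(2)[symmetric] stabilizer_subspace_def stabilizer_matrix_group by auto
  qed
  then show ?thesis using mem_translate[OF inv] by blast
qed

lemma boundary_coset:
  assumes U: "U = V \<or> U = V'"
  shows "equivariant_boundary_map \<Gamma> S SL (stab U) \<rho> (coset_of U)"
  unfolding equivariant_boundary_map_def
proof (intro conjI ballI)
  let ?Q = "quotient_space_topology SL (stab U)"
  have coset: "coset_of U p \<in> lcosets\<^bsub>matrix_group SL\<^esub> (stab U)" if p: "p \<in> bdry" for p
  proof -
    obtain h where h: "h \<in> SL" "(*v) h ` U = E p" by (rule E_image[OF p U])
    show ?thesis unfolding coset_of_eq[OF h] lcosets_matrix_group using h(1) by blast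
  qed
  show "continuous_map bdry_top ?Q (coset_of U)"
    unfolding continuous_map_def
  proof (intro conjI allI impI)
    have "{h \<in> SL. translate h (stab U) \<in> lcosets\<^bsub>matrix_group SL\<^esub> (stab U)} = SL" unfolding lcosets_matrix_group by blast
    then have "openin ?Q (lcosets\<^bsub>matrix_group SL\<^esub> (stab U))" unfolding openin_quotient_space_topology by simp
    then have "lcosets\<^bsub>matrix_group SL\<^esub> (stab U) \<subseteq> topspace ?Q" by (rule openin_subset)
    then show "coset_of U \<in> topspace bdry_top \<rightarrow> topspace ?Q" using coset by auto
  next
    fix O' assume O': "openin ?Q O'"
    show "openin bdry_top {p \<in> topspace bdry_top. coset_of U p \<in> O'}"
      unfolding openin_boundary_topology
    proof (intro conjI ballI)
      fix p assume "p \<in> {p \<in> topspace bdry_top. coset_of U p \<in> O'}"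
      then have p: "p \<in> bdry" "coset_of U p \<in> O'" by auto
      show "\<exists>r::real. \<forall>q\<in>bdry. ereal r \<le> bprod p q \<longrightarrow> q \<in> {p \<in> topspace bdry_top. coset_of U p \<in> O'}"
      proof (rule ccontr)
        assume "\<not> ?thesis"
        then have "\<forall>n::nat. \<exists>q. q \<in> bdry \<and> ereal (real n) \<le> bprod p q \<and> coset_of U q \<notin> O'" by auto
        \<comment> \<open>A failure of openness at \<open>p\<close> gives a sequence converging to
          \<open>p\<close>; its representatives from \<open>E_lift\<close> converge to
          \<open>h\<close> and so enter the open set.\<close>
        then obtain q where q: "\<And>n::nat. q n \<in> bdry" "\<And>n. ereal (real n) \<le> bprod p (q n)" "\<And>n. coset_of U (q n) \<notin> O'" by metis
        have "\<exists>k0. \<forall>k\<ge>k0. ereal (real n) \<le> bprod p (q k)" for n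
          using q(2) by (intro exI[of _ n] allI impI) (meson ereal_less_eq(3) of_nat_le_iff order_trans)
        then have lim: "blim q p" by (rule limitin_boundary[OF p(1) q(1)])
        obtain h where h: "h \<in> SL" "(*v) h ` U = E p" by (rule E_image[OF p(1) U])
        obtain g where g: "g \<longlonglongrightarrow> h" "\<And>k. g k \<in> SL" "\<And>k. (*v) (g k) ` U = E (q k)"
          by (rule E_lift[OF q(1) lim p(1) U h]) (rule that)
        have "openin (top_of_set SL) {h \<in> SL. translate h (stab U) \<in> O'}"
          using O' unfolding openin_quotient_space_topology by blast
        then obtain J where J: "open J" "{h \<in> SL. translate h (stab U) \<in> O'} = SL \<inter> J" unfolding openin_open by blast
        have "h \<in> {h \<in> SL. translate h (stab U) \<in> O'}" using h(1) p(2) unfolding coset_of_eq[OF h] by blast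
        then have "h \<in> J" unfolding J(2) by blast
        then have "\<forall>\<^sub>F k in sequentially. g k \<in> J" using g(1) J(1) topological_tendstoD by blast
        then obtain k where "g k \<in> SL \<inter> J" using g(2) by (auto simp: eventually_sequentially)
        then have "translate (g k) (stab U) \<in> O'" unfolding J(2)[symmetric] by blast
        then show False using q(3)[of k] unfolding coset_of_eq[OF g(2,3)] by blast
      qed
    qed auto
  qed
  show "inj_on (coset_of U) bdry"
  proof (rule inj_onI)
    fix p q assume pq: "p \<in> bdry" "q \<in> bdry" "coset_of U p = coset_of U q"
    obtain h where h: "h \<in> SL" "(*v) h ` U = E p" by (rule E_image[OF pq(1) U])
    then have "h \<in> coset_of U q" using pq(3) unfolding coset_of_def by blast
    then have eq: "E q = E p" using h(2) unfolding coset_of_def by simp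
    show "p = q"
    proof (rule ccontr)
      assume "p \<noteq> q"
      then have "E p \<inter> E q = {0}" using E_complementary pq unfolding complementary_def by blast
      then have "E p = {0}" unfolding eq by simp
      then show False using E_properties(2)[OF pq(1)] by simp
    qed
  qed
  fix g p assume g: "g \<in> G" and p: "p \<in> bdry"
  obtain h where h: "h \<in> SL" "(*v) h ` U = E p" by (rule E_image[OF p U])
  have "\<rho> g ** h \<in> SL" using matrix_subgroupD(2)[OF matrix_subgroup_SL _ h(1)] rho_SO0[OF g] SO0_subset_SL by blast
  moreover have "(*v) (\<rho> g ** h) ` U = E (bact g p)"
    unfolding E_equivariant[OF g p] h(2)[symmetric] by (simp add: image_image matrix_vector_mul_assoc)
  ultimately show "coset_of U (bact g p) = translate (\<rho> g) (coset_of U p)"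
    unfolding coset_of_eq[OF h] by (simp add: coset_of_eq translate_mult)
qed

text \<open>The isotropy algebra consists of the operators preserving \<open>E p\<close>, which are
  those without a block from \<open>E p\<close> to \<open>E q\<close>;
  \<open>lie_algebra_preserving\<close> supplies the required curves.\<close>

lemma isotropy_coset:
  assumes pq: "p \<in> bdry" "q \<in> bdry" "p \<noteq> q" and U: "U = V \<or> U = V'" and A: "A \<in> lie_algebra SL"
  shows "A \<in> isotropy_algebra SL (coset_of U p) \<longleftrightarrow> projection (E q) (E p) ** A ** projection (E p) (E q) = 0"
proof
  have c: "complementary (E p) (E q)" by (rule E_complementary[OF pq])
  obtain h where h: "h \<in> SL" "(*v) h ` U = E p" by (rule E_image[OF pq(1) U])
  have orb: "orbit_sp (coset_of U p) U = E p"
    unfolding coset_of_eq[OF h] h(2)[symmetric]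
    by (rule orbit_sp_translate[OF matrix_subgroup_stabilizer_subspace[OF matrix_subgroup_SL] stabilizer_subspace_image])
  {
    assume iso: "A \<in> isotropy_algebra SL (coset_of U p)"
    have "A *v e \<in> E p" if "e \<in> E p" for e
      using isotropy_algebra_preserves[OF iso, of U e] that E_properties(1)[OF pq(1)] unfolding orb by blast
    then show "projection (E q) (E p) ** A ** projection (E p) (E q) = 0"
      unfolding matrix_eq using projection(1)[OF c] complementary_sym[OF c] by (simp flip: matrix_vector_mul_assoc)
  next
    assume z: "projection (E q) (E p) ** A ** projection (E p) (E q) = 0"
    have "A *v e \<in> E p" if e: "e \<in> E p" for e
    proof -
      have "projection (E q) (E p) *v (A *v e) = (projection (E q) (E p) ** A ** projection (E p) (E q)) *v e"
        using c e by (simp flip: matrix_vector_mul_assoc)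
      then have "projection (E q) (E p) *v (A *v e) = 0" unfolding z by simp
      then show ?thesis using projection(2)[OF complementary_sym[OF c], of "A *v e"] by simp
    qed
    then have "A \<in> lie_algebra {k \<in> SL. (*v) k ` E p = E p}" by (rule lie_algebra_preserving[OF c A])
    moreover have "{k \<in> SL. (*v) k ` E p = E p} \<subseteq> stabilizer (matrix_group SL) translate (coset_of U p)"
    proof
      fix k assume k: "k \<in> {k \<in> SL. (*v) k ` E p = E p}"
      then have "k ** h \<in> SL" using matrix_subgroupD(2)[OF matrix_subgroup_SL _ h(1)] by blast
      moreover have "(*v) (k ** h) ` U = E p" using k h(2) by (simp add: image_image flip: matrix_vector_mul_assoc) (metis image_image)
      ultimately have "coset_of U p = translate k (coset_of U p)"
        unfolding coset_of_eq[OF h] translate_mult[symmetric] using coset_of_eq coset_of_eq[OF h] by metis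
      then show "k \<in> stabilizer (matrix_group SL) translate (coset_of U p)" unfolding stabilizer_matrix_group using k by simp
    qed
    ultimately show "A \<in> isotropy_algebra SL (coset_of U p)" unfolding isotropy_algebra_def using lie_algebra_mono by blast
  }
qed

text \<open>The tangent space at a transverse pair is Hom(E p, E q) plus Hom(E q, E p), read off
  from the off-diagonal blocks.\<close>

definition "mixed x Z = (coproj x ** fst Z ** proj x, proj x ** snd Z ** coproj x)"

definition "N' x Z = sqrt ((mnrm x (fst (mixed x Z)))\<^sup>2 + (mnrm x (snd (mixed x Z)))\<^sup>2)"

lemma N'_norm:
  assumes x: "(p, q, t) \<in> X"
  shows "euclidean_norm_mod (lie_algebra SL \<times> lie_algebra SL)
    (isotropy_algebra SL (coset_of V p) \<times> isotropy_algebra SL (coset_of V' q)) (N' (p, q, t))"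
  unfolding euclidean_norm_mod_def
proof (intro exI conjI allI ballI)
  let ?x = "(p, q, t)"
  define B1 B2 where "B1 v w = average (\<lambda>g. Ad (\<rho> g)) ?x (fst (mixed ?x v)) (fst (mixed ?x w))"
    and "B2 v w = average (\<lambda>g. Ad (\<rho> g)) ?x (snd (mixed ?x v)) (snd (mixed ?x w))" for v w
  have sq: "average (\<lambda>g. Ad (\<rho> g)) ?x A A = (mnrm ?x A)\<^sup>2" for A unfolding nm.anorm_def by (simp add: average_nonneg)
  have l1: "linear (\<lambda>Z. fst (mixed ?x Z))" unfolding mixed_def fst_conv
    using linear_compose[OF linear_fst linear_sandwich, of "coproj ?x" "proj ?x"] by (simp add: comp_def)
  have l2: "linear (\<lambda>Z. snd (mixed ?x Z))" unfolding mixed_def snd_conv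
    using linear_compose[OF linear_snd linear_sandwich, of "proj ?x" "coproj ?x"] by (simp add: comp_def)
  show "bilinear (\<lambda>v w. B1 v w + B2 v w)"
    unfolding B1_def B2_def by (rule bilinear_add[OF bilinear_linear_comp[OF nm.bilinear_average l1] bilinear_linear_comp[OF nm.bilinear_average l2]])
  show "B1 v w + B2 v w = B1 w v + B2 w v" for v w
    unfolding B1_def B2_def by (simp only: average_sym[of _ _ "fst (mixed ?x v)"] average_sym[of _ _ "snd (mixed ?x v)"])
  fix Z :: "'m nmat \<times> 'm nmat" assume Z: "Z \<in> lie_algebra SL \<times> lie_algebra SL"
  have b: "p \<in> bdry" "q \<in> bdry" "p \<noteq> q" using x unfolding mem_X by auto
  show "0 \<le> B1 Z Z + B2 Z Z" unfolding B1_def B2_def by (simp add: sq)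
  show "N' ?x Z = sqrt (B1 Z Z + B2 Z Z)" unfolding B1_def B2_def N'_def by (simp add: sq)
  have "B1 Z Z + B2 Z Z = 0 \<longleftrightarrow> fst (mixed ?x Z) = 0 \<and> snd (mixed ?x Z) = 0"
    unfolding B1_def B2_def sq sum_power2_eq_zero_iff nm.anorm_zero_iff[OF x] ..
  also have "\<dots> \<longleftrightarrow> fst Z \<in> isotropy_algebra SL (coset_of V p) \<and> snd Z \<in> isotropy_algebra SL (coset_of V' q)"
    using Z isotropy_coset[OF b disjI1[OF refl], of "fst Z"] isotropy_coset[OF b(2,1) b(3)[symmetric] disjI2[OF refl], of "snd Z"]
    unfolding mixed_def proj_def coproj_def by auto
  finally show "B1 Z Z + B2 Z Z = 0 \<longleftrightarrow> Z \<in> isotropy_algebra SL (coset_of V p) \<times> isotropy_algebra SL (coset_of V' q)"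
    by (simp add: mem_Times_iff)
qed

lemma N'_flim:
  assumes x: "\<And>k. x k \<in> X" "flim x l" and Z: "Z \<longlonglongrightarrow> Z'"
  shows "(\<lambda>k. N' (x k) (Z k)) \<longlonglongrightarrow> N' l Z'"
  unfolding N'_def mixed_def fst_conv snd_conv
  by (intro tendsto_intros nm.anorm_flim[OF x] proj_flim[OF x] Z)

lemma N'_continuous:
  "continuous_map (prod_topology flow_top (top_of_set (lie_algebra SL \<times> lie_algebra SL))) euclideanreal (\<lambda>(x, v). N' x v)"
proof (rule continuous_map_sequential)
  have "metrizable_space flow_top" unfolding metric_topology[symmetric] by (rule M.metrizable_space_mtopology)
  moreover have "metrizable_space (top_of_set (lie_algebra SL \<times> lie_algebra SL))"
    by (intro metrizable_space_subtopology metrizable_space_euclidean)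
  ultimately show "metrizable_space (prod_topology flow_top (top_of_set (lie_algebra SL \<times> lie_algebra SL :: ('m nmat \<times> _) set)))"
    unfolding metrizable_space_prod_topology by blast
next
  fix s :: "nat \<Rightarrow> 'g flow_point \<times> 'm nmat \<times> 'm nmat" and l
  assume s: "\<And>k. s k \<in> topspace (prod_topology flow_top (top_of_set (lie_algebra SL \<times> lie_algebra SL)))"
    and lim: "limitin (prod_topology flow_top (top_of_set (lie_algebra SL \<times> lie_algebra SL))) s l sequentially"
  have "flim (\<lambda>k. fst (s k)) (fst l)" "(\<lambda>k. snd (s k)) \<longlonglongrightarrow> snd l"
    using lim unfolding flim_def limitin_pairwise limitin_subtopology by (auto simp: comp_def)
  moreover have "fst (s k) \<in> X" for k using s[of k] by (auto simp: mem_Times_iff)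
  ultimately show "(\<lambda>k. (\<lambda>(x, v). N' x v) (s k)) \<longlonglongrightarrow> (\<lambda>(x, v). N' x v) l"
    using N'_flim[of "\<lambda>k. fst (s k)"] by (simp add: case_prod_unfold)
qed

lemma N'_equivariant:
  assumes g: "g \<in> G" and x: "x \<in> X" shows "N' (act g x) (Ad (\<rho> g) A, Ad (\<rho> g) B) = N' x (A, B)"
proof -
  have inv: "invertible (\<rho> g)" by (rule rho_invertible[OF g])
  have Ad_times: "Ad (\<rho> g) P ** Ad (\<rho> g) Q = Ad (\<rho> g) (P ** Q)" for P Q
  proof -
    have "Ad (\<rho> g) P ** Ad (\<rho> g) Q = \<rho> g ** P ** (matrix_inv (\<rho> g) ** \<rho> g) ** Q ** matrix_inv (\<rho> g)"
      unfolding Ad_def by (simp only: matrix_mul_assoc)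
    then show ?thesis unfolding matrix_inv_mult(2)[OF inv] Ad_def by (simp add: matrix_mul_assoc)
  qed
  then show ?thesis unfolding N'_def mixed_def using nm.anorm_equivariant[OF g x] by (simp add: act_proj_Ad[OF g x] Ad_times)
qed

lemma target_anosov: "anosov \<Gamma> S act SL (stab V) (stab V') \<rho>"
proof -
  obtain K \<kappa> where K: "0 < K" "0 < \<kappa>"
    "\<And>x A t. \<lbrakk>x \<in> X; 0 \<le> t\<rbrakk> \<Longrightarrow> mnrm (flow (- t) x) (coproj x ** A ** proj x) \<le> K * exp (- \<kappa> * t) * mnrm x (coproj x ** A ** proj x)"
    "\<And>x A t. \<lbrakk>x \<in> X; 0 \<le> t\<rbrakk> \<Longrightarrow> mnrm (flow t x) (proj x ** A ** coproj x) \<le> K * exp (- \<kappa> * t) * mnrm x (proj x ** A ** coproj x)"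
    by (rule matrix_contract) (rule that)
  have m0: "mnrm x 0 = 0" for x using nm.anorm_scale[of x 0 0] by simp
  have z: "P ** 0 ** Q = (0 :: 'm nmat)" for P Q
    using linear_0[OF linear_sandwich, of P Q] by simp
  have hom: "\<rho> \<in> hom \<Gamma> (matrix_group SL)" using rho_hom SO0_subset_SL unfolding hom_def by auto
  have tr: "(coset_of V p, coset_of V' q) \<in> transverse_pairs SL (stab V) (stab V')"
    if x: "(p, q, t) \<in> X" for p q t
  proof -
    have b: "p \<in> bdry" "q \<in> bdry" "p \<noteq> q" using x unfolding mem_X by auto
    obtain h where h: "h \<in> SL" "(*v) h ` V = E p" "(*v) h ` V' = E q" by (rule E_pair_image[OF b])
    show ?thesis unfolding coset_of_eq[OF h(1,2)] coset_of_eq[OF h(1,3)] transverse_pairs_def using h(1) by blast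
  qed
  have N1: "N' (flow (- t) x) (A, 0) \<le> K * exp (- \<kappa> * t) * N' x (A, 0)" if "x \<in> X" "0 \<le> t" for x t A
    using K(3)[OF that, of A] unfolding N'_def mixed_def by (simp add: z m0)
  have N2: "N' (flow t x) (0, A) \<le> K * exp (- \<kappa> * t) * N' x (0, A)" if "x \<in> X" "0 \<le> t" for x t A
    using K(4)[OF that, of A] unfolding N'_def mixed_def by (simp add: z m0)
  show ?thesis
    unfolding anosov_def
    by (rule conjI[OF hom], rule exI, rule exI, intro conjI, rule boundary_coset[OF disjI1[OF refl]], rule boundary_coset[OF disjI2[OF refl]],
      use tr in blast, rule exI[of _ K], rule conjI[OF K(1)], rule exI[of _ \<kappa>], rule conjI[OF K(2)], rule exI[of _ N'])
      (use N'_norm N'_continuous N'_equivariant N1 N2 in blast)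
qed

end

lemma anosov_rep_exists:
  assumes flow: "cocompact_flow \<Gamma> S \<delta> act d" and groups: "matrix_subgroup H" "matrix_subgroup P" "P \<subseteq> H" "matrix_subgroup Q" "Q \<subseteq> H"
    and A: "anosov \<Gamma> S act H P Q \<rho>"
  obtains \<xi> \<eta> N C c where "anosov_rep \<Gamma> S \<delta> act d \<rho> H P Q \<xi> \<eta> N C c"
proof -
  interpret cocompact_flow \<Gamma> S \<delta> act d by (rule flow)
  show ?thesis
    using A unfolding anosov_def
  proof (elim conjE exE, goal_cases)
    case (1 \<xi> \<eta> C c N)
    show ?thesis
      by (rule that[of \<xi> \<eta> N C c], rule anosov_rep.intro[OF flow], rule anosov_rep_axioms.intro[OF groups]) (use 1 in blast)+
  qed
qed

theorem theorem1p1: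
  fixes \<Gamma> :: "'g monoid" and S :: "'g set"
    and act :: "'g \<Rightarrow> 'g flow_point \<Rightarrow> 'g flow_point"
    and d :: "'g flow_point \<Rightarrow> 'g flow_point \<Rightarrow> real"
    and \<rho> :: "'g \<Rightarrow> ('m::finite option + 'm option) matrix"
    and V V' :: "(real^('m option + 'm option)) set"
  assumes "word_hyperbolic \<Gamma> S"
    and "gromov_flow \<Gamma> S act d"
    and "\<rho> \<in> hom \<Gamma> (matrix_group SO0_nn)"
    and "inj_on \<rho> (carrier \<Gamma>)"
    and "anosov \<Gamma> S act SO0_nn P_plus P_minus \<rho>"
    and "subspace V" "dim V = CARD('m option)"
    and "subspace V'" "dim V' = CARD('m option)"
    and "V \<inter> V' = {0}"
  shows "proper_action (\<rho> ` carrier \<Gamma>) (top_of_set pseudo_hyperbolic) (*v)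
     \<longleftrightarrow> anosov \<Gamma> S act SL (stabilizer_subspace SL V) (stabilizer_subspace SL V') \<rho>"
proof -
  obtain \<delta> where "hyp_group \<Gamma> S \<delta>" using word_hyperbolic_hyp_group[OF assms(1)] .
  then have flow: "cocompact_flow \<Gamma> S \<delta> act d" using assms(2) by (rule cocompact_flow.intro)
  have c: "complementary V V'" unfolding complementary_def using assms(6-10) by (simp add: card_sum)
  obtain \<xi> \<eta> N C c where G: "anosov_rep \<Gamma> S \<delta> act d \<rho> SO0_nn P_plus P_minus \<xi> \<eta> N C c"
    by (rule anosov_rep_exists[OF flow matrix_subgroup_SO0 matrix_subgroup_P_plus P_plus_SO0 matrix_subgroup_P_minus P_minus_SO0 assms(5)])
  show ?thesis
  proof
    assume pr: "proper_action (\<rho> ` carrier \<Gamma>) (top_of_set pseudo_hyperbolic) (*v)"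
    interpret SO_proper_target \<Gamma> S \<delta> act d \<rho> \<xi> \<eta> N C c V V'
      by (intro SO_proper_target.intro SO_proper.intro SO_anosov.intro G SO_proper_axioms.intro SO_proper_target_axioms.intro assms(4,7,9) c)
        (use pr in \<open>auto simp: proper_action_pseudo_hyperbolic\<close>)
    show "anosov \<Gamma> S act SL (stabilizer_subspace SL V) (stabilizer_subspace SL V') \<rho>" by (rule target_anosov)
  next
    assume SL: "anosov \<Gamma> S act SL (stabilizer_subspace SL V) (stabilizer_subspace SL V') \<rho>"
    obtain \<xi>' \<eta>' N' C' c' where "anosov_rep \<Gamma> S \<delta> act d \<rho> SL (stabilizer_subspace SL V) (stabilizer_subspace SL V') \<xi>' \<eta>' N' C' c'"
      by (rule anosov_rep_exists[OF flow matrix_subgroup_SL matrix_subgroup_stabilizer_subspace[OF matrix_subgroup_SL] stabilizer_subspace_subset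
        matrix_subgroup_stabilizer_subspace[OF matrix_subgroup_SL] stabilizer_subspace_subset SL])
    moreover have "isometry (\<rho> g)" if "g \<in> carrier \<Gamma>" for g
      using assms(3) that by (intro SO0_isometry) (auto simp: hom_def)
    ultimately interpret SL_anosov \<Gamma> S \<delta> act d \<rho> V V' \<xi>' \<eta>' N' C' c'
      by (intro SL_anosov.intro SL_anosov_axioms.intro c assms(7,9))
    show "proper_action (\<rho> ` carrier \<Gamma>) (top_of_set pseudo_hyperbolic) (*v)"
      unfolding proper_action_pseudo_hyperbolic
      using finite_recurrence[OF assms(4)] pseudo_hyperbolic_norm by blast
  qed
qed

end
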